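(* Let $s,t,m$ be positive integers, $k_0=d=\min\{s,t\}$, $\delta=|s-t|$. Put $P=JW_{t}\otimes JW_{s}\in\mathrm{Hom}(+^{t+s},+^{t+s})$, and let $W_l=P\,(\mathrm{id}_{+^{t-l}}\otimes S_l\otimes\mathrm{id}_{+^{s-l}})\,P$ for $0\le l\le d$. Then the clasped parallel $m$-full twist satisfies, in $\mathrm{Hom}(+^{t+s},+^{t+s})$, $$P\,(T_{t,s})^m\,P=q^{-\frac m3 k_0(k_0+\delta)-mk_0}\sum_{k_0\ge k_1\ge\cdots\ge k_m\ge0}D(\underline k)\;W_{d-k_m},$$ where the sum is over $m$-tuples $\underline k=(k_1,\dots,k_m)$ of integers and $$D(\underline k)=q^{\sum_{i=1}^m\left(k_i(k_i+\delta)+k_i\right)}\,q^{\frac12(k_0-k_m)}\,\frac{(q)_{k_0+\delta}}{(q)_{k_m+\delta}}\binom{d}{k_1',k_2',\dots,k_m',k_m}_q,\qquad k_{i+1}'=k_i-k_{i+1}\ (0\le i\le m-1).$$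
   Context: The ground field is $\mathbb C(q^{1/6})$. Notation: $[n]=\frac{q^{n/2}-q^{-n/2}}{q^{1/2}-q^{-1/2}}$; $(q)_n=\prod_{i=1}^n(1-q^i)$, $(q)_0=1$; $\binom{n}{a_1,\dots,a_r}_q=\frac{(q)_n}{(q)_{a_1}\cdots(q)_{a_r}}$ when $a_1+\dots+a_r=n$, $a_i\ge 0$. $A_2$ webs. Let $D=[0,1]^2$. For words $\alpha,\beta$ over $\{+,-\}$, $\mathrm{Hom}(\alpha,\beta)$ is the vector space spanned by boundary-fixing isotopy classes of directed graphs immersed in $D$ (closed loops allowed) such that all vertices have valency 1 or 3, every trivalent vertex is a sink or a source, the only singularities are transverse double points of edges with over/under information, and the univalent vertices are $|\alpha|$ equally spaced points on the bottom edge and $|\beta|$ equally spaced points on the top edge, the edge at a point labelled $+$ being directed upward and at a point labelled $-$ downward; modulo the following local $A_2$ skein relations (also in rotated position): (i) a crossing of two upward strands whose over-strand runs from bottom-left to top-right equals $q^{1/3}\mathrm{id}_{++}-q^{-1/6}H$; (ii) a crossing of two upward strands whose over-strand runs from bottom-right to top-left equals $q^{-1/3}\mathrm{id}_{++}-q^{1/6}H$; (iii) a graph with a quadrilateral face equals the sum of the two graphs obtained by deleting the quadrilateral and joining its four legs by two disjoint arcs in the two planar ways; (iv) a bigon face inserted in an edge equals $[2]$ times the edge; (v) a circle bounding a disk, with either orientation, equals $[3]$. Here $H\in\mathrm{Hom}(++,++)$ is the web in which the two bottom edges merge into a sink, which is joined by a single (downward) edge to a source above it, from which two edges go up to the top.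 The composite $GF$ is $G$ stacked on top of $F$; $\otimes$ is juxtaposition from left to right; $\mathrm{id}_\alpha$ is the identity. Clasps: $JW_0$ is the empty diagram, $JW_1=\mathrm{id}_+$, and $JW_{m+1}=JW_m\otimes\mathrm{id}_+-\frac{[m]}{[m+1]}(JW_m\otimes\mathrm{id}_+)(\mathrm{id}_{+^{m-1}}\otimes H)(JW_m\otimes\mathrm{id}_+)\in\mathrm{Hom}(+^{m+1},+^{m+1})$. Twists: $c_{a,b}\in\mathrm{Hom}(+^{a+b},+^{a+b})$ is the diagram of $a+b$ upward strands in which the leftmost $a$ parallel strands move to the right passing over the other $b$ parallel strands, which move to the left ($ab$ crossings, none within a block). $T_{a,b}=c_{b,a}c_{a,b}$ is the full twist. Stair-step web: for $1\le i\le 2l-1$ let $H_i=\mathrm{id}_{+^{i-1}}\otimes H\otimes\mathrm{id}_{+^{2l-i-1}}\in\mathrm{Hom}(+^{2l},+^{2l})$, and for $1\le c\le l$ let $C_c=H_{l-c+1}H_{l-c+3}\cdots H_{l+c-1}$. Then $S_l=C_1C_2\cdots C_{l-1}C_lC_{l-1}\cdots C_1$ (the $l\times l$ grid of two crossing families of $l$ parallel strands with each of the $l^2$ crossings replaced by $H$); $S_0$ is the empty diagram. *)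

theory Defs
  imports
    "HOL-Analysis.Analysis"
    "HOL-Library.Poly_Mapping"
    "HOL-Computational_Algebra.Polynomial"
    "HOL-Computational_Algebra.Fraction_Field"
begin

section \<open>The ground field and q-numbers\<close>

type_synonym K = "complex poly fract"

text \<open>The ground field is the field of rational functions over the complex numbers in the
  variable \<open>q^(1/6)\<close>, and \<open>q6 n\<close> is \<open>q^(n/6)\<close>.\<close>

definition q6 :: "int \<Rightarrow> K" where
  "q6 n = (Fraction_Field.Fract [:0, 1:] 1) powi n"

definition qint :: "nat \<Rightarrow> K" where
  "qint n = (q6 (3 * int n) - q6 (- 3 * int n)) / (q6 3 - q6 (- 3))"

definition qpoch :: "nat \<Rightarrow> K" where
  "qpoch n = (\<Prod>i=1..n. 1 - q6 6 ^ i)"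

text \<open>Meant for lists \<open>as\<close> with \<open>sum_list as = n\<close>.\<close>

definition qmultinomial :: "nat \<Rightarrow> nat list \<Rightarrow> K" where
  "qmultinomial n as = qpoch n / prod_list (map qpoch as)"


section \<open>Diagrams in the square\<close>

text \<open>The plane is \<^typ>\<open>complex\<close>, with real part pointing to the right and imaginary part pointing up.
  A directed arc is \<open>(A, a, b)\<close>, where \<open>A\<close> is the point set of a simple path from \<open>a\<close> to \<open>b\<close>;
  since \<open>a \<noteq> b\<close>, these data determine the path up to reparametrisation.\<close>

type_synonym darc = "complex set \<times> complex \<times> complex"

abbreviation carrier_of :: "darc \<Rightarrow> complex set" where "carrier_of e \<equiv> fst e"
abbreviation src :: "darc \<Rightarrow> complex" where "src e \<equiv> fst (snd e)"
abbreviation tgt :: "darc \<Rightarrow> complex" where "tgt e \<equiv> snd (snd e)"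
abbreviation ends :: "darc \<Rightarrow> complex set" where "ends e \<equiv> {src e, tgt e}"

definition is_darc :: "darc \<Rightarrow> bool" where
  "is_darc e \<longleftrightarrow>
     (\<exists>g. arc g \<and> path_image g = carrier_of e \<and> pathstart g = src e \<and> pathfinish g = tgt e)"

definition square :: "complex set" where
  "square = {z. 0 \<le> Re z \<and> Re z \<le> 1 \<and> 0 \<le> Im z \<and> Im z \<le> 1}"

text \<open>\<open>Up\<close> is the label \<open>+\<close>, \<open>Down\<close> is the label \<open>-\<close>.\<close>

datatype orient = Up | Down

text \<open>An immersed directed graph is recorded by its bottom and top words, a finite set of directed
  arcs into which its edges and loops are cut, and its over-information: \<open>(p, e) \<in> over w\<close> says
  that \<open>e\<close> is the upper strand at the crossing \<open>p\<close>.  The cutting points are bivalent nodes; they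
  are no part of the graph and are removed by \<open>subdivision\<close> below.  (They are needed to describe
  closed loops and self-crossing edges by simple arcs.)\<close>

datatype web = Web (bottom: "orient list") (topw: "orient list")
  (edges: "darc set") (over: "(complex \<times> darc) set")

definition bpt :: "nat \<Rightarrow> nat \<Rightarrow> complex" where
  "bpt n i = Complex (real (i + 1) / real (n + 1)) 0"

definition tpt :: "nat \<Rightarrow> nat \<Rightarrow> complex" where
  "tpt n i = Complex (real (i + 1) / real (n + 1)) 1"

definition boundary_points :: "orient list \<Rightarrow> orient list \<Rightarrow> complex set" where
  "boundary_points \<alpha> \<beta> = bpt (length \<alpha>) ` {..<length \<alpha>} \<union> tpt (length \<beta>) ` {..<length \<beta>}"

definition valency :: "darc set \<Rightarrow> complex \<Rightarrow> nat \<times> nat" where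
  "valency E p = (card {e \<in> E. tgt e = p}, card {e \<in> E. src e = p})"

definition crossing :: "darc set \<Rightarrow> complex \<Rightarrow> darc \<Rightarrow> darc \<Rightarrow> bool" where
  "crossing E p e f \<longleftrightarrow> e \<in> E \<and> f \<in> E \<and> e \<noteq> f \<and> p \<in> carrier_of e - ends e \<and> p \<in> carrier_of f - ends f"

text \<open>Transversality in the topological category: in a local chart the two curves are the
  coordinate axes.\<close>

definition transverse_at :: "complex \<Rightarrow> complex set \<Rightarrow> complex set \<Rightarrow> bool" where
  "transverse_at p A B \<longleftrightarrow>
     (\<exists>U \<phi> \<psi>. open U \<and> p \<in> U \<and> homeomorphism U (ball 0 1) \<phi> \<psi> \<and> \<phi> p = 0 \<and>
        \<phi> ` (U \<inter> A) = {z \<in> ball 0 1. Im z = 0} \<and> \<phi> ` (U \<inter> B) = {z \<in> ball 0 1. Re z = 0})"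

text \<open>Away from the boundary points, \<open>(1, 1)\<close> is a cutting point, \<open>(3, 0)\<close> a sink and \<open>(0, 3)\<close> a
  source.\<close>

definition is_web :: "web \<Rightarrow> bool" where
  "is_web w \<longleftrightarrow>
     (let E = edges w; \<alpha> = bottom w; \<beta> = topw w in
      finite E \<and>
      (\<forall>e\<in>E. is_darc e \<and> carrier_of e \<subseteq> square \<and>
              carrier_of e \<inter> frontier square \<subseteq> boundary_points \<alpha> \<beta>) \<and>
      (\<forall>i<length \<alpha>. valency E (bpt (length \<alpha>) i) = (case \<alpha> ! i of Up \<Rightarrow> (0, 1) | Down \<Rightarrow> (1, 0))) \<and>
      (\<forall>i<length \<beta>. valency E (tpt (length \<beta>) i) = (case \<beta> ! i of Up \<Rightarrow> (1, 0) | Down \<Rightarrow> (0, 1))) \<and>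
      (\<forall>p \<in> (\<Union>e\<in>E. ends e) - boundary_points \<alpha> \<beta>. valency E p \<in> {(1, 1), (3, 0), (0, 3)}) \<and>
      (\<forall>e\<in>E. \<forall>f\<in>E. e \<noteq> f \<longrightarrow> finite (carrier_of e \<inter> carrier_of f) \<and>
         (\<forall>p \<in> carrier_of e \<inter> carrier_of f. p \<in> ends e \<inter> ends f \<or> crossing E p e f)) \<and>
      (\<forall>p e f. crossing E p e f \<longrightarrow>
         transverse_at p (carrier_of e) (carrier_of f) \<and>
         (\<forall>g\<in>E. p \<in> carrier_of g \<longrightarrow> g = e \<or> g = f) \<and>
         ((p, e) \<in> over w \<longleftrightarrow> (p, f) \<notin> over w)) \<and>
      over w \<subseteq> {(p, e). \<exists>f. crossing E p e f})"

definition webs :: "orient list \<Rightarrow> orient list \<Rightarrow> web set" where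
  "webs \<alpha> \<beta> = {w. is_web w \<and> bottom w = \<alpha> \<and> topw w = \<beta>}"

definition map_darc :: "(complex \<Rightarrow> complex) \<Rightarrow> darc \<Rightarrow> darc" where
  "map_darc h e = (h ` carrier_of e, h (src e), h (tgt e))"

definition map_edges :: "(complex \<Rightarrow> complex) \<Rightarrow> web \<Rightarrow> darc set" where
  "map_edges h w = map_darc h ` edges w"

definition map_over :: "(complex \<Rightarrow> complex) \<Rightarrow> web \<Rightarrow> (complex \<times> darc) set" where
  "map_over h w = (\<lambda>(p, e). (h p, map_darc h e)) ` over w"


section \<open>Isotopy\<close>

definition ambient_isotopy :: "complex set \<Rightarrow> (real \<Rightarrow> complex \<Rightarrow> complex) \<Rightarrow> bool" where
  "ambient_isotopy S k \<longleftrightarrow>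
     continuous_on ({0..1} \<times> S) (\<lambda>(t, z). k t z) \<and>
     (\<forall>t\<in>{0..1}. \<exists>g. homeomorphism S S (k t) g) \<and> (\<forall>z\<in>S. k 0 z = z)"

definition isotopic :: "web \<Rightarrow> web \<Rightarrow> bool" where
  "isotopic w w' \<longleftrightarrow>
     (\<exists>k. ambient_isotopy square k \<and> (\<forall>t\<in>{0..1}. \<forall>z\<in>frontier square. k t z = z) \<and>
        w' = Web (bottom w) (topw w) (map_edges (k 1) w) (map_over (k 1) w))"

definition subdivision :: "web \<Rightarrow> web \<Rightarrow> bool" where
  "subdivision w w' \<longleftrightarrow>
     (\<exists>A a b A1 A2 p.
        (A, a, b) \<in> edges w \<and> is_darc (A1, a, p) \<and> is_darc (A2, p, b) \<and>
        A = A1 \<union> A2 \<and> A1 \<inter> A2 = {p} \<and>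
        w' = Web (bottom w) (topw w)
          (edges w - {(A, a, b)} \<union> {(A1, a, p), (A2, p, b)})
          ({(x, e) \<in> over w. e \<noteq> (A, a, b)} \<union>
           {(x, (A1, a, p)) | x. (x, (A, a, b)) \<in> over w \<and> x \<in> A1} \<union>
           {(x, (A2, p, b)) | x. (x, (A, a, b)) \<in> over w \<and> x \<in> A2}))"


section \<open>Linear combinations and elementary webs\<close>

type_synonym lweb = "web \<Rightarrow>\<^sub>0 K"

definition smul :: "K \<Rightarrow> lweb \<Rightarrow> lweb" where
  "smul c x = Poly_Mapping.map ((*) c) x"

lemma lookup_smul: "Poly_Mapping.lookup (smul c x) w = c * Poly_Mapping.lookup x w"
  by (simp add: smul_def Poly_Mapping.map.rep_eq when_def)

interpretation lin: vector_space smul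
  by unfold_locales
    (auto intro!: poly_mapping_eqI simp: lookup_smul lookup_add algebra_simps)

definition lw :: "web \<Rightarrow> lweb" where
  "lw w = Poly_Mapping.single w 1"

definition seg :: "complex \<times> complex \<Rightarrow> darc" where
  "seg = (\<lambda>(a, b). (closed_segment a b, a, b))"

definition pt :: "real \<Rightarrow> real \<Rightarrow> complex" where "pt x y = Complex x y"

definition id_web :: "orient list \<Rightarrow> web" where
  "id_web \<alpha> = Web \<alpha> \<alpha>
     ((\<lambda>i. let n = length \<alpha> in
         case \<alpha> ! i of Up \<Rightarrow> seg (bpt n i, tpt n i) | Down \<Rightarrow> seg (tpt n i, bpt n i)) ` {..<length \<alpha>}) {}"

definition H_web :: web where
  "H_web = Web [Up, Up] [Up, Up]
     (seg ` {(pt (1/3) 0, pt (1/2) (1/3)), (pt (2/3) 0, pt (1/2) (1/3)),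
             (pt (1/2) (2/3), pt (1/2) (1/3)),
             (pt (1/2) (2/3), pt (1/3) 1), (pt (1/2) (2/3), pt (2/3) 1)}) {}"

text \<open>\<open>X_web True\<close> has its over-strand from bottom-left to top-right, \<open>X_web False\<close> has it from
  bottom-right to top-left.\<close>

definition X_web :: "bool \<Rightarrow> web" where
  "X_web b =
     (let e = seg (pt (1/3) 0, pt (2/3) 1); f = seg (pt (2/3) 0, pt (1/3) 1)
      in Web [Up, Up] [Up, Up] {e, f} {(pt (1/2) (1/2), if b then e else f)})"

text \<open>A quadrilateral with legs ending at the four boundary points; sinks at its lower left and
  upper right corner, sources at the other two.\<close>

definition square_web :: web where
  "square_web = Web [Up, Down] [Up, Down]
     (seg ` {(pt (1/3) 0, pt (1/3) (1/3)), (pt (2/3) (1/3), pt (2/3) 0),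
             (pt (2/3) 1, pt (2/3) (2/3)), (pt (1/3) (2/3), pt (1/3) 1),
             (pt (2/3) (1/3), pt (1/3) (1/3)), (pt (2/3) (1/3), pt (2/3) (2/3)),
             (pt (1/3) (2/3), pt (1/3) (1/3)), (pt (1/3) (2/3), pt (2/3) (2/3))}) {}"

definition turnback_web :: web where
  "turnback_web = Web [Up, Down] [Up, Down]
     (seg ` {(pt (1/3) 0, pt (1/2) (1/3)), (pt (1/2) (1/3), pt (2/3) 0),
             (pt (2/3) 1, pt (1/2) (2/3)), (pt (1/2) (2/3), pt (1/3) 1)}) {}"

definition bigon_web :: web where
  "bigon_web = Web [Up] [Up]
     (seg ` {(pt (1/2) 0, pt (1/2) (1/4)), (pt (1/2) (3/4), pt (1/2) 1),
             (pt (1/2) (3/4), pt (1/4) (1/2)), (pt (1/4) (1/2), pt (1/2) (1/4)),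
             (pt (1/2) (3/4), pt (3/4) (1/2)), (pt (3/4) (1/2), pt (1/2) (1/4))}) {}"

definition anticlockwise_circle :: web where
  "anticlockwise_circle = Web [] []
     (seg ` {(pt (1/3) (1/3), pt (2/3) (1/3)), (pt (2/3) (1/3), pt (1/2) (2/3)),
             (pt (1/2) (2/3), pt (1/3) (1/3))}) {}"

definition clockwise_circle :: web where
  "clockwise_circle = Web [] []
     (seg ` {(pt (2/3) (1/3), pt (1/3) (1/3)), (pt (1/2) (2/3), pt (2/3) (1/3)),
             (pt (1/3) (1/3), pt (1/2) (2/3))}) {}"


section \<open>The skein modules\<close>

text \<open>The local relations as linear combinations of diagrams in the square that are to vanish.\<close>

definition local_relations :: "lweb set" where
  "local_relations =
     {lw (X_web True) - (smul (q6 2) (lw (id_web [Up, Up])) - smul (q6 (- 1)) (lw H_web)),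
      lw (X_web False) - (smul (q6 (- 2)) (lw (id_web [Up, Up])) - smul (q6 1) (lw H_web)),
      lw square_web - (lw (id_web [Up, Down]) + lw turnback_web),
      lw bigon_web - smul (qint 2) (lw (id_web [Up])),
      lw anticlockwise_circle - smul (qint 3) (lw (id_web [])),
      lw clockwise_circle - smul (qint 3) (lw (id_web []))}"

text \<open>Orientation preserving embeddings of the square into itself: end points of isotopies of the
  plane.  Rotated positions are thereby included, reflected ones are not.\<close>

definition disc_embedding :: "(complex \<Rightarrow> complex) \<Rightarrow> bool" where
  "disc_embedding h \<longleftrightarrow> (\<exists>k. ambient_isotopy UNIV k \<and> h = k 1) \<and> h ` square \<subseteq> square"

text \<open>The diagram which inside the disc \<open>h ` square\<close> is the \<open>h\<close>-image of \<open>w\<close>, and which outside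
  consists of the arcs in \<open>E\<close>, with over-information \<open>R\<close>.\<close>

definition plug :: "orient list \<Rightarrow> orient list \<Rightarrow> darc set \<Rightarrow> (complex \<times> darc) set \<Rightarrow>
    (complex \<Rightarrow> complex) \<Rightarrow> web \<Rightarrow> web" where
  "plug \<alpha> \<beta> E R h w = Web \<alpha> \<beta> (E \<union> map_edges h w) (R \<union> map_over h w)"

definition skein_generators :: "orient list \<Rightarrow> orient list \<Rightarrow> lweb set" where
  "skein_generators \<alpha> \<beta> =
     {lw w - lw w' | w w'. w \<in> webs \<alpha> \<beta> \<and> w' \<in> webs \<alpha> \<beta> \<and> (isotopic w w' \<or> subdivision w w')} \<union>
     {(\<Sum>w\<in>Poly_Mapping.keys r. smul (Poly_Mapping.lookup r w) (lw (plug \<alpha> \<beta> E R h w))) | r E R h.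
        r \<in> local_relations \<and> disc_embedding h \<and>
        (\<forall>e\<in>E. carrier_of e \<inter> h ` square \<subseteq> h ` frontier square) \<and>
        R \<subseteq> UNIV \<times> E \<and>
        (\<forall>w\<in>Poly_Mapping.keys r. plug \<alpha> \<beta> E R h w \<in> webs \<alpha> \<beta>)}"

text \<open>\<open>Hom(\<alpha>, \<beta>)\<close> is the quotient of \<open>lin.span (lw ` webs \<alpha> \<beta>)\<close> by
  \<open>lin.span (skein_generators \<alpha> \<beta>)\<close>; \<open>eq_in_Hom \<alpha> \<beta> x y\<close> says that \<open>x\<close> and \<open>y\<close> represent elements
  of \<open>Hom(\<alpha>, \<beta>)\<close> and that these are equal.\<close>

definition eq_in_Hom :: "orient list \<Rightarrow> orient list \<Rightarrow> lweb \<Rightarrow> lweb \<Rightarrow> bool" where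
  "eq_in_Hom \<alpha> \<beta> x y \<longleftrightarrow>
     x \<in> lin.span (lw ` webs \<alpha> \<beta>) \<and> y \<in> lin.span (lw ` webs \<alpha> \<beta>) \<and>
     x - y \<in> lin.span (skein_generators \<alpha> \<beta>)"


section \<open>Composition and juxtaposition\<close>

definition stack_web :: "web \<Rightarrow> web \<Rightarrow> web" where
  "stack_web w v =
     (let lo = (\<lambda>z. Complex (Re z) (Im z / 2)); hi = (\<lambda>z. Complex (Re z) ((Im z + 1) / 2))
      in Web (bottom v) (topw w) (map_edges lo v \<union> map_edges hi w) (map_over lo v \<union> map_over hi w))"

text \<open>\<open>left_pos m n\<close> and \<open>right_pos m n\<close> map the unit interval piecewise linearly onto the part
  of it to the left, respectively right, of \<open>(m + 1/2) / (m + n + 1)\<close>, sending \<open>m\<close> equally spaced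
  points to the first \<open>m\<close>, respectively \<open>n\<close> equally spaced points to the last \<open>n\<close>, of \<open>m + n\<close>
  equally spaced points.  Juxtaposition interpolates linearly between the maps needed at the
  bottom and at the top.\<close>

definition left_pos :: "nat \<Rightarrow> nat \<Rightarrow> real \<Rightarrow> real" where
  "left_pos m n x = (let X = real (m + 1) * x in min X ((X + real m) / 2) / real (m + n + 1))"

definition right_pos :: "nat \<Rightarrow> nat \<Rightarrow> real \<Rightarrow> real" where
  "right_pos m n x = (let X = real (n + 1) * x in (real m + max X ((X + 1) / 2)) / real (m + n + 1))"

definition interpolate :: "(real \<Rightarrow> real) \<Rightarrow> (real \<Rightarrow> real) \<Rightarrow> complex \<Rightarrow> complex" where
  "interpolate f g z = Complex ((1 - Im z) * f (Re z) + Im z * g (Re z)) (Im z)"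

definition juxtapose_web :: "web \<Rightarrow> web \<Rightarrow> web" where
  "juxtapose_web v w =
     (let m = length (bottom v); n = length (bottom w); m' = length (topw v); n' = length (topw w);
          le = interpolate (left_pos m n) (left_pos m' n');
          ri = interpolate (right_pos m n) (right_pos m' n')
      in Web (bottom v @ bottom w) (topw v @ topw w)
           (map_edges le v \<union> map_edges ri w) (map_over le v \<union> map_over ri w))"

definition bilinear_ext :: "(web \<Rightarrow> web \<Rightarrow> web) \<Rightarrow> lweb \<Rightarrow> lweb \<Rightarrow> lweb" where
  "bilinear_ext f x y =
     (\<Sum>v\<in>Poly_Mapping.keys x. \<Sum>w\<in>Poly_Mapping.keys y.
        smul (Poly_Mapping.lookup x v * Poly_Mapping.lookup y w) (lw (f v w)))"

text \<open>Both operations are on representatives; \<open>x \<odot> y\<close> is \<open>x\<close> stacked on top of \<open>y\<close>.\<close>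

definition wcomp :: "lweb \<Rightarrow> lweb \<Rightarrow> lweb" (infixr \<open>\<odot>\<close> 70) where
  "x \<odot> y = bilinear_ext stack_web x y"

definition wtens :: "lweb \<Rightarrow> lweb \<Rightarrow> lweb" (infixr \<open>\<otimes>\<close> 75) where
  "x \<otimes> y = bilinear_ext juxtapose_web x y"

abbreviation ups :: "nat \<Rightarrow> orient list" where "ups n \<equiv> replicate n Up"

definition idu :: "nat \<Rightarrow> lweb" where
  "idu n = lw (id_web (ups n))"

text \<open>The leftmost factor of a product is on top.\<close>

definition comp_list :: "nat \<Rightarrow> lweb list \<Rightarrow> lweb" where
  "comp_list n xs = foldr (\<odot>) xs (idu n)"


section \<open>Clasps, twists and stair-step webs\<close>

fun JW :: "nat \<Rightarrow> lweb" where
  "JW 0 = idu 0"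
| "JW (Suc 0) = idu 1"
| "JW (Suc (Suc k)) =
     (let J = JW (Suc k) \<otimes> idu 1; m = Suc k
      in J - smul (qint m / qint (m + 1)) (J \<odot> (idu (m - 1) \<otimes> lw H_web) \<odot> J))"

text \<open>The grid of \<open>a b\<close> crossings, cut into elementary ones: the \<open>a\<close> strands are moved across
  the \<open>b\<close> strands one after the other, beginning with the rightmost one, and each of them crosses
  the \<open>b\<close> strands from left to right.\<close>

fun twist_one :: "nat \<Rightarrow> lweb" where
  "twist_one 0 = idu 1"
| "twist_one (Suc b) = (idu b \<otimes> lw (X_web True)) \<odot> (twist_one b \<otimes> idu 1)"

fun half_twist :: "nat \<Rightarrow> nat \<Rightarrow> lweb" where
  "half_twist 0 b = idu b"
| "half_twist (Suc a) b = (half_twist a b \<otimes> idu 1) \<odot> (idu a \<otimes> twist_one b)"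

definition full_twist :: "nat \<Rightarrow> nat \<Rightarrow> lweb" where
  "full_twist a b = half_twist b a \<odot> half_twist a b"

definition Hgen :: "nat \<Rightarrow> nat \<Rightarrow> lweb" where
  "Hgen n i = idu (i - 1) \<otimes> lw H_web \<otimes> idu (n - i - 1)"

definition stair_layer :: "nat \<Rightarrow> nat \<Rightarrow> lweb" where
  "stair_layer l c = comp_list (2 * l) (map (\<lambda>j. Hgen (2 * l) (l - c + 1 + 2 * j)) [0..<c])"

definition stair :: "nat \<Rightarrow> lweb" where
  "stair l = comp_list (2 * l) (map (stair_layer l) ([1..<l + 1] @ rev [1..<l]))"

definition clasp_pair :: "nat \<Rightarrow> nat \<Rightarrow> lweb" where
  "clasp_pair t s = JW t \<otimes> JW s"

definition clasped_stair :: "nat \<Rightarrow> nat \<Rightarrow> nat \<Rightarrow> lweb" where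
  "clasped_stair t s l =
     clasp_pair t s \<odot> (idu (t - l) \<otimes> stair l \<otimes> idu (s - l)) \<odot> clasp_pair t s"


section \<open>The coefficients\<close>

text \<open>A tuple \<open>(k_1, ..., k_m)\<close> is extended by \<open>k_0 = d\<close> to a list \<open>k\<close> of length \<open>m + 1\<close>.\<close>

definition tuples :: "nat \<Rightarrow> nat \<Rightarrow> nat list set" where
  "tuples d m = {k. length k = m + 1 \<and> k ! 0 = d \<and> (\<forall>i<m. k ! (i + 1) \<le> k ! i)}"

definition twist_coeff :: "nat \<Rightarrow> nat \<Rightarrow> nat \<Rightarrow> nat list \<Rightarrow> K" where
  "twist_coeff d \<delta> m k =
     q6 (6 * int (\<Sum>i=1..m. k ! i * (k ! i + \<delta>) + k ! i)) * q6 (3 * (int (k ! 0) - int (k ! m))) *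
     (qpoch (k ! 0 + \<delta>) / qpoch (k ! m + \<delta>)) *
     qmultinomial d (map (\<lambda>i. k ! i - k ! (i + 1)) [0..<m] @ [k ! m])"

end

theory Submission
  imports Defs
begin

text \<open>The webs \<open>H_i\<close> satisfy \<open>H_i H_i = [2] H_i\<close>, they commute if they are far apart, and
  \<open>H_i H_{i+1} H_i - H_i = H_{i+1} H_i H_{i+1} - H_{i+1}\<close>, since by the quadrilateral relation both sides
  are the web in which three strands merge and split again.  The isotopies needed for this move
  strands linearly in webs with straight edges that are cut at the same levels.

  Everything else is a computation in the Hecke algebra.  The full twist commutes with the clasps,
  and up to a power of \<open>q\<close> it is a product of Jucys-Murphy elements \<open>L_k\<close>.  These are moved through
  the stair-step web one at a time: the clasps turn \<open>L_k\<close> into a scalar and a term that enlarges the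
  stair-step web by one.  The resulting recursion has a closed form in terms of \<open>q\<close>-binomial
  coefficients, and iterating one twist \<open>m\<close> times produces the sum over the tuples.\<close>

subsection \<open>Quantum integers and clasps\<close>

text \<open>The relations are those of a Hecke algebra, not of a Temperley-Lieb algebra: the
  difference \<open>H_i H_{i+1} H_i - H_i\<close> is not set to zero, so turnbacks cannot be slid
  freely. What saves the planar calculus is the pair of clasps on the left. Two of any three
  neighbouring strands belong to the same block, so this difference is killed on the right module
  generated by the clasps, and there the Temperley-Lieb relations do hold. This is why the
  computations keep the clasps on the left and multiply from the right, and why cosets of the two
  blocks are studied.

  The full twist only yields \<open>L_{t+1} ... L_n\<close>. The clasps turn
  \<open>L_1 ... L_t\<close> into a scalar, so the product may be completed to
  \<open>L_1 ... L_n\<close> and cut behind the strands of the stair-step web instead. The first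
  part then acts by a scalar again, and only the last \<open>s - l\<close> factors can enlarge the
  web.

  For webs, stacking is associative only up to isotopy. The skein modules are therefore made into a
  ring, and the algebra is done in an abstract locale whose axioms, with the resolution of a
  crossing, are all that is asked of the topology.\<close>

lemma Fract_power: "Fraction_Field.Fract a 1 ^ k = Fraction_Field.Fract (a ^ k) (1 :: 'a :: idom)"
  by (induction k) (auto simp: One_fract_def)

lemma q6_base_neq_0: "Fraction_Field.Fract [:0, 1:] 1 \<noteq> (0 :: K)"
  by (simp add: Zero_fract_def eq_fract)

lemma q6_0 [simp]: "q6 0 = 1"
  by (simp add: q6_def)

lemma q6_add: "q6 (a + b) = q6 a * q6 b"
  using q6_base_neq_0 by (simp add: q6_def power_int_add)

lemma q6_neq_0 [simp]: "q6 a \<noteq> 0"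
  using q6_base_neq_0 by (simp add: q6_def)

lemma q6_power: "q6 a ^ k = q6 (int k * a)"
  by (induction k) (auto simp: q6_add algebra_simps)

text \<open>A positive power of the variable is a polynomial of positive degree, and a negative one
  is inverted first. Quantum integers and q-factorials are invertible by this fact.\<close>

lemma q6_eq_1_iff: "q6 a = 1 \<longleftrightarrow> a = 0"
proof -
  have nat: "q6 (int k) = 1 \<Longrightarrow> k = 0" for k
  proof -
    assume "q6 (int k) = 1"
    hence "[:0, 1 :: complex:] ^ k = 1"
      by (simp add: q6_def Fract_power One_fract_def eq_fract)
    hence "degree ([:0, 1 :: complex:] ^ k) = 0" by simp
    thus "k = 0" by (simp add: degree_power_eq)
  qed
  have "a = 0" if "q6 a = 1"
  proof (cases "a \<ge> 0")
    case True
    thus ?thesis using nat[of "nat a"] that by simp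
  next
    case False
    have "q6 (- a) * q6 a = 1" by (simp flip: q6_add)
    hence "q6 (- a) = 1" using that by simp
    thus ?thesis using nat[of "nat (- a)"] False by simp
  qed
  thus ?thesis by auto
qed

lemma q6_eq_iff: "q6 a = q6 b \<longleftrightarrow> a = b"
proof -
  have "q6 a = q6 (a - b) * q6 b" by (simp flip: q6_add)
  thus ?thesis using q6_eq_1_iff[of "a - b"] by auto
qed

lemma q6_minus_neq_0: "q6 3 - q6 (- 3) \<noteq> 0"
  by (simp add: q6_eq_iff)

lemma qint_neq_0: "n > 0 \<Longrightarrow> qint n \<noteq> 0"
  using q6_minus_neq_0 by (simp add: qint_def q6_eq_iff)

lemma qint_1 [simp]: "qint 1 = 1" "qint (Suc 0) = 1"
  using q6_minus_neq_0 by (simp_all add: qint_def)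

lemma qint_2: "qint 2 = q6 3 + q6 (- 3)"
proof -
  have "q6 6 = q6 3 * q6 3" "q6 (- 6) = q6 (- 3) * q6 (- 3)" by (simp_all flip: q6_add)
  thus ?thesis using q6_minus_neq_0 by (simp add: qint_def field_simps)
qed

text \<open>With \<open>u = q6 3\<close> and \<open>v = q6 (- 3)\<close> inverse to each other this
  is the Chebyshev recursion. It makes the coefficients of the clasps reproduce themselves.\<close>

lemma qint_rec: "qint 2 * qint (Suc k) - qint k = qint (Suc (Suc k))"
proof -
  define x where "x = q6 (3 * int k)"
  define y where "y = q6 (- 3 * int k)"
  define u where "u = q6 3"
  define v where "v = q6 (- 3)"
  have uv: "u * v = 1" by (simp add: u_def v_def flip: q6_add)
  have "q6 (3 * int (Suc k)) = u * x" "q6 (- 3 * int (Suc k)) = v * y"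
       "q6 (3 * int (Suc (Suc k))) = u * u * x" "q6 (- 3 * int (Suc (Suc k))) = v * v * y"
       "q6 (3 * int k) = x" "q6 (- (3 * int k)) = y"
    by (simp_all add: u_def v_def x_def y_def algebra_simps flip: q6_add)
  moreover have "(u + v) * (u * x - v * y) - (x - y) = u * u * x - v * v * y"
    using uv by algebra
  ultimately show ?thesis
    using q6_minus_neq_0 unfolding qint_2 unfolding qint_def
    by (simp add: u_def[symmetric] v_def[symmetric] flip: diff_divide_distrib)
qed

text \<open>The left factor is the coefficient in the next clasp, the bracket the scalar found in
  \<open>key\<close> of \<open>jw_props\<close>. That their product is 1 makes the next clasp
  annihilate its last generator.\<close>

lemma clasp_coefficient:
  "qint (Suc (Suc k)) / qint (Suc (Suc (Suc k))) * (qint 2 - qint (Suc k) / qint (Suc (Suc k))) = 1"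
  using qint_rec[of "Suc k"] qint_neq_0[of "Suc (Suc k)"] qint_neq_0[of "Suc (Suc (Suc k))"]
  by (simp add: field_simps)

section \<open>The abstract Hecke algebra and its clasps\<close>

text \<open>The generators are total in the index and vanish outside \<open>1, ..., n - 1\<close>,
  which keeps \<open>quad\<close> and \<open>far\<close> free of range conditions. The braid
  relation with a zero neighbour would force the other generator to vanish, so it keeps its
  conditions. Its linear terms come from the second resolution of the quadrilateral.\<close>

locale hecke =
  fixes scl :: "K \<Rightarrow> 'a :: ring_1 \<Rightarrow> 'a" (infixr "\<cdot>" 75)
    and h :: "nat \<Rightarrow> 'a" and n :: nat
  assumes scl_add_right: "c \<cdot> (x + y) = c \<cdot> x + c \<cdot> y"
    and scl_add_left: "(c + d) \<cdot> x = c \<cdot> x + d \<cdot> x"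
    and scl_scl [simp]: "c \<cdot> d \<cdot> x = (c * d) \<cdot> x"
    and scl_one [simp]: "1 \<cdot> x = x"
    and mult_scl_left [simp]: "(c \<cdot> x) * y = c \<cdot> (x * y)"
    and mult_scl_right [simp]: "x * (c \<cdot> y) = c \<cdot> (x * y)"
    and quad: "h i * h i = qint 2 \<cdot> h i"
    and far: "i + 1 < j \<Longrightarrow> h i * h j = h j * h i"
    and braid: "0 < i \<Longrightarrow> i + 1 < n \<Longrightarrow>
                  h i * h (i + 1) * h i - h i = h (i + 1) * h i * h (i + 1) - h (i + 1)"
    and h_outside: "i = 0 \<or> i \<ge> n \<Longrightarrow> h i = 0"
begin

lemma scl_zero_right [simp]: "c \<cdot> 0 = 0"
  using scl_add_right[of c 0 0] by simp

lemma scl_zero_left [simp]: "0 \<cdot> x = 0"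
  using scl_add_left[of 0 0 x] by simp

lemma scl_minus_right: "c \<cdot> (- x) = - (c \<cdot> x)"
  using scl_add_right[of c x "- x"] by (simp add: eq_neg_iff_add_eq_0 add.commute)

lemma scl_minus_left: "(- c) \<cdot> x = - (c \<cdot> x)"
  using scl_add_left[of c "- c" x] by (simp add: eq_neg_iff_add_eq_0 add.commute)

lemma scl_diff_right: "c \<cdot> (x - y) = c \<cdot> x - c \<cdot> y"
  using scl_add_right[of c x "- y"] by (simp add: scl_minus_right)

lemma scl_diff_left: "(c - d) \<cdot> x = c \<cdot> x - d \<cdot> x"
  using scl_add_left[of c "- d" x] by (simp add: scl_minus_left)

lemma scl_sum_right: "c \<cdot> sum f A = (\<Sum>x\<in>A. c \<cdot> f x)"
  by (induction A rule: infinite_finite_induct) (auto simp: scl_add_right)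

lemmas scl_distribs = scl_add_right scl_add_left scl_minus_right scl_minus_left scl_diff_right scl_diff_left

lemma scl_collect: "c \<cdot> x + d \<cdot> x = (c + d) \<cdot> x" "c \<cdot> x - d \<cdot> x = (c - d) \<cdot> x"
  by (simp_all add: scl_distribs)

lemma chain: "x * y = z \<Longrightarrow> x * (y * w) = z * w" for x y z w :: 'a
  by (simp add: mult.assoc[symmetric])

lemma far': "i + 1 < j \<or> j + 1 < i \<Longrightarrow> h i * h j = h j * h i"
  using far[of i j] far[of j i] by auto

text \<open>The clasp on the strands \<open>p + 1, ..., p + m\<close>; the generator
  \<open>h (p + Suc k)\<close> joins its last two strands \<open>p + k + 1\<close> and
  \<open>p + k + 2\<close> when \<open>m = k + 2\<close>.\<close>

fun jw :: "nat \<Rightarrow> nat \<Rightarrow> 'a" where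
  "jw p 0 = 1"
| "jw p (Suc 0) = 1"
| "jw p (Suc (Suc k)) = jw p (Suc k) -
     (qint (Suc k) / qint (Suc (Suc k))) \<cdot> (jw p (Suc k) * (h (p + Suc k) * jw p (Suc k)))"

lemma jw_commute:
  assumes "\<And>i. p < i \<Longrightarrow> i < p + m \<Longrightarrow> x * h i = h i * x"
  shows "x * jw p m = jw p m * x"
  using assms
proof (induction p m rule: jw.induct)
  case (3 p k)
  define J where "J = jw p (Suc k)"
  define e where "e = h (p + Suc k)"
  have J: "x * J = J * x" unfolding J_def by (rule 3) (auto intro: 3)
  have e: "x * e = e * x" unfolding e_def by (rule 3) auto
  have "x * (J * (e * J)) = J * (e * J) * x"
    by (metis J e mult.assoc)
  thus ?case
    by (simp add: J_def[symmetric] e_def[symmetric] algebra_simps J del: add_Suc_right)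
qed auto

text \<open>Annihilation, idempotence and absorption of the smaller clasp feed each other and are
  proved in one induction. The older generators are killed by the smaller clasp, and only the last
  one, \<open>e\<close>, needs a computation.\<close>

lemma jw_props:
  assumes "p + m \<le> n"
  shows "(\<forall>i. p < i \<longrightarrow> i < p + m \<longrightarrow> h i * jw p m = 0 \<and> jw p m * h i = 0) \<and> jw p m * jw p m = jw p m
     \<and> jw p (m - 1) * jw p m = jw p m \<and> jw p m * jw p (m - 1) = jw p m"
  using assms
proof (induction m rule: less_induct)
  case (less m)
  consider "m = 0" | "m = 1" | k where "m = Suc (Suc k)"
    by (metis One_nat_def not0_implies_Suc)
  thus ?case
  proof cases
    case (3 k)
    define J where "J = jw p (Suc k)"
    define e where "e = h (p + Suc k)"
    define c where "c = qint (Suc k) / qint (Suc (Suc k))"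
    have JJ: "jw p m = J - c \<cdot> (J * (e * J))"
      by (simp add: 3 J_def e_def c_def)
    have IH: "(\<forall>i. p < i \<longrightarrow> i < p + Suc k \<longrightarrow> h i * J = 0 \<and> J * h i = 0) \<and> J * J = J
       \<and> jw p k * J = J \<and> J * jw p k = J"
      using less.IH[of "Suc k"] less.prems 3 unfolding J_def by simp
    hence idem: "J * J = J" by blast
    have e2: "e * e = qint 2 \<cdot> e" by (simp add: e_def quad)
    \<comment> \<open>There is no Temperley-Lieb relation to collapse \<open>e J e\<close>.
      Expanding one \<open>J\<close> produces \<open>e f e\<close>, the braid relation turns this
      into \<open>f e f + e - f\<close>, and the outer \<open>J\<close> kills the two terms that
      have \<open>f\<close> next to it.\<close>
    have key: "e * J * e * J = (qint 2 - (if k = 0 then 0 else qint k / qint (Suc k))) \<cdot> (e * J) \<and>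
               J * e * J * e = (qint 2 - (if k = 0 then 0 else qint k / qint (Suc k))) \<cdot> (J * e)"
    proof (cases k)
      case 0
      thus ?thesis using e2 by (simp add: J_def)
    next
      case (Suc k')
      define J0 where "J0 = jw p k"
      define f where "f = h (p + k)"
      define d where "d = qint k / qint (Suc k)"
      have J: "J = J0 - d \<cdot> (J0 * (f * J0))"
        by (simp add: J_def J0_def f_def d_def Suc)
      have eJ0: "e * J0 = J0 * e"
        unfolding J0_def by (rule jw_commute) (auto simp: e_def intro!: far')
      have J0J: "J0 * J = J" "J * J0 = J" using IH by (auto simp: J0_def)
      have fJ: "f * J = 0" "J * f = 0" using IH by (auto simp: f_def Suc)
      have br: "e * (f * e) = f * (e * f) + e - f"
        using braid[of "p + k"] less.prems 3 Suc unfolding e_def f_def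
        by (simp add: algebra_simps)
      have "e * J * e * J = e * J0 * e * J - d \<cdot> (e * J0 * f * J0 * e * J)"
        unfolding J by (simp add: algebra_simps scl_distribs)
      also have "e * J0 * e * J = J0 * (e * e) * J"
        using eJ0 by (simp add: mult.assoc[symmetric])
      also have "\<dots> = qint 2 \<cdot> (e * J)"
        using e2 eJ0 J0J by (metis mult.assoc mult_scl_left mult_scl_right)
      also have "e * J0 * f * J0 * e * J = J0 * (e * (f * e)) * (J0 * J)"
        by (metis eJ0 mult.assoc)
      also have "\<dots> = J0 * (e * J)"
        unfolding br J0J(1) by (simp add: algebra_simps fJ)
      also have "\<dots> = e * J"
        by (metis eJ0 J0J(1) mult.assoc)
      finally have left: "e * J * e * J = (qint 2 - d) \<cdot> (e * J)"
        by (simp add: scl_distribs)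
      have "J * e * J * e = J * e * J0 * e - d \<cdot> (J * e * J0 * f * J0 * e)"
        unfolding J by (simp add: algebra_simps scl_distribs)
      also have "J * e * J0 * e = J * (e * e) * J0"
        by (metis eJ0 mult.assoc)
      also have "\<dots> = qint 2 \<cdot> (J * e)"
        using e2 eJ0 J0J by (metis mult.assoc mult_scl_left mult_scl_right)
      also have "J * e * J0 * f * J0 * e = (J * J0) * (e * (f * e)) * J0"
        by (metis eJ0 mult.assoc)
      also have "\<dots> = J * e * J0"
        unfolding br J0J(2) using fJ by (simp add: algebra_simps chain[OF fJ(2)])
      also have "\<dots> = J * e"
        by (metis eJ0 J0J(2) mult.assoc)
      finally have right: "J * e * J * e = (qint 2 - d) \<cdot> (J * e)"
        by (simp add: scl_distribs)
      show ?thesis using left right by (simp add: d_def Suc)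
    qed
    have cc: "c * (qint 2 - (if k = 0 then 0 else qint k / qint (Suc k))) = 1"
    proof (cases k)
      case 0
      thus ?thesis using qint_neq_0[of 2] by (simp add: c_def numeral_2_eq_2)
    next
      case (Suc k')
      thus ?thesis using clasp_coefficient[of k'] by (simp add: c_def)
    qed
    have "e * jw p m = e * J - c \<cdot> (e * J * e * J)" "jw p m * e = J * e - c \<cdot> (J * e * J * e)"
      unfolding JJ by (simp_all add: algebra_simps)
    hence e_kill: "e * jw p m = 0" "jw p m * e = 0"
      using cc by (simp_all only: key scl_scl scl_one diff_self)
    have kill: "h i * jw p m = 0 \<and> jw p m * h i = 0" if "p < i" "i < p + m" for i
    proof (cases "i = p + Suc k")
      case True
      thus ?thesis using e_kill by (simp add: e_def)
    next
      case False
      hence *: "h i * J = 0" "J * h i = 0" using IH that 3 by auto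
      show ?thesis unfolding JJ by (simp add: algebra_simps * chain[OF *(1)])
    qed
    have absorb: "J * jw p m = jw p m" "jw p m * J = jw p m"
      unfolding JJ using idem by (simp_all add: algebra_simps chain[OF idem])
    have "jw p m * jw p m = J * jw p m - c \<cdot> (J * (e * (J * jw p m)))"
      by (subst JJ) (simp add: algebra_simps)
    hence "jw p m * jw p m = jw p m" using absorb e_kill by simp
    thus ?thesis using kill absorb by (simp add: 3 J_def)
  qed auto
qed

lemma jw_kill: "p + m \<le> n \<Longrightarrow> p < i \<Longrightarrow> i < p + m \<Longrightarrow> h i * jw p m = 0"
  and kill_jw: "p + m \<le> n \<Longrightarrow> p < i \<Longrightarrow> i < p + m \<Longrightarrow> jw p m * h i = 0"
  using jw_props[of p m] by auto

end

section \<open>Crossings and permutation braids\<close>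

context hecke
begin

text \<open>The crossing with over-strand from bottom-left to top-right, resolved by the skein
  relation. It acts by \<open>q^(1/3)\<close> where \<open>h i\<close> vanishes and by
  \<open>-q^(-2/3)\<close> on \<open>h i\<close> itself; \<open>q6\<close> counts exponents in
  sixths.\<close>

definition sg :: "nat \<Rightarrow> 'a" where
  "sg i = q6 2 \<cdot> 1 - q6 (- 1) \<cdot> h i"

lemma comm_mult: "x * a = a * x \<Longrightarrow> x * b = b * x \<Longrightarrow> x * (a * b) = (a * b) * x" for x a b :: 'a
  by (metis mult.assoc)

lemma commute_sg: "x * h i = h i * x \<Longrightarrow> x * sg i = sg i * x"
  by (simp add: sg_def algebra_simps)

lemma sg_h_far: "i + 1 < j \<or> j + 1 < i \<Longrightarrow> sg i * h j = h j * sg i"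
  using commute_sg[of "h j" i] far'[of i j] by simp

lemma sg_h_same: "sg i * h i = (- q6 (- 4)) \<cdot> h i" and h_sg_same: "h i * sg i = (- q6 (- 4)) \<cdot> h i"
proof -
  have "q6 2 - q6 (- 1) * qint 2 = - q6 (- 4)"
    by (simp add: qint_2 algebra_simps flip: q6_add)
  thus "sg i * h i = (- q6 (- 4)) \<cdot> h i" "h i * sg i = (- q6 (- 4)) \<cdot> h i"
    by (simp_all add: sg_def left_diff_distrib right_diff_distrib quad scl_collect(2))
qed

lemma sg_absorb: "x * h i = 0 \<Longrightarrow> x * sg i = q6 2 \<cdot> x" "h i * x = 0 \<Longrightarrow> sg i * x = q6 2 \<cdot> x"
  by (simp_all add: sg_def algebra_simps)

text \<open>The third Reidemeister move with an \<open>h\<close> in place of one crossing. After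
  expansion the two sides differ by \<open>x * x - x * z * qint 2 + z * z\<close> times the
  difference of the generators, and this scalar vanishes by \<open>k\<close>.\<close>

lemma
  assumes "0 < i" "i + 1 < n"
  shows sg_sg_h_up: "sg i * (sg (i + 1) * h i) = h (i + 1) * (sg i * sg (i + 1))"
    and sg_sg_h_down: "sg (i + 1) * (sg i * h (i + 1)) = h i * (sg (i + 1) * sg i)"
proof -
  define a b where "a = h i" and "b = h (i + 1)"
  define x z where "x = q6 2" and "z = q6 (- 1)"
  have br: "a * (b * a) = b * (a * b) + a - b"
    using braid[OF assms] unfolding a_def b_def by (simp add: algebra_simps)
  have quads: "a * a = qint 2 \<cdot> a" "b * b = qint 2 \<cdot> b"
    by (simp_all add: a_def b_def quad)
  have k: "x * x = x * z * qint 2 - z * z"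
    by (simp add: x_def z_def qint_2 algebra_simps flip: q6_add)
  have sg: "sg i = x \<cdot> 1 - z \<cdot> a" "sg (i + 1) = x \<cdot> 1 - z \<cdot> b"
    by (simp_all add: sg_def a_def b_def x_def z_def)
  have "(x \<cdot> 1 - z \<cdot> a) * ((x \<cdot> 1 - z \<cdot> b) * a) = (x * x) \<cdot> a - (x * z * qint 2) \<cdot> a - (x * z) \<cdot> (b * a) + (z * z) \<cdot> (a * (b * a))"
    by (simp add: algebra_simps quads scl_distribs)
  also have "\<dots> = (x * x) \<cdot> b - (x * z * qint 2) \<cdot> b - (x * z) \<cdot> (b * a) + (z * z) \<cdot> (b * (a * b))"
    unfolding br k by (simp add: algebra_simps scl_distribs)
  also have "\<dots> = b * ((x \<cdot> 1 - z \<cdot> a) * (x \<cdot> 1 - z \<cdot> b))"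
    by (simp add: algebra_simps quads scl_distribs)
  finally show "sg i * (sg (i + 1) * h i) = h (i + 1) * (sg i * sg (i + 1))"
    by (simp only: sg) (simp only: a_def b_def)
  have "(x \<cdot> 1 - z \<cdot> b) * ((x \<cdot> 1 - z \<cdot> a) * b) = (x * x) \<cdot> b - (x * z * qint 2) \<cdot> b - (x * z) \<cdot> (a * b) + (z * z) \<cdot> (b * (a * b))"
    by (simp add: algebra_simps quads scl_distribs)
  also have "\<dots> = (x * x) \<cdot> a - (x * z * qint 2) \<cdot> a - (x * z) \<cdot> (a * b) + (z * z) \<cdot> (a * (b * a))"
    unfolding br k by (simp add: algebra_simps scl_distribs)
  also have "\<dots> = a * ((x \<cdot> 1 - z \<cdot> b) * (x \<cdot> 1 - z \<cdot> a))"
    by (simp add: algebra_simps quads scl_distribs)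
  finally show "sg (i + 1) * (sg i * h (i + 1)) = h i * (sg (i + 1) * sg i)"
    by (simp only: sg) (simp only: a_def b_def)
qed

text \<open>The rightmost crossing is expanded; the \<open>h\<close> it contributes slides through
  by \<open>sg_sg_h_up\<close> and recombines to a crossing at \<open>i + 1\<close>.\<close>

lemma sg_braid:
  assumes "0 < i" "i + 1 < n"
  shows "sg i * (sg (i + 1) * sg i) = sg (i + 1) * (sg i * sg (i + 1))"
proof -
  have "sg i * (sg (i + 1) * sg i) = q6 2 \<cdot> (sg i * sg (i + 1)) - q6 (- 1) \<cdot> (sg i * (sg (i + 1) * h i))"
    by (subst (3) sg_def) (simp add: algebra_simps)
  also have "\<dots> = sg (i + 1) * (sg i * sg (i + 1))"
    unfolding sg_sg_h_up[OF assms] by (subst (4) sg_def) (simp add: algebra_simps)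
  finally show ?thesis .
qed

text \<open>The strand in position \<open>p + 1\<close> at the bottom runs over the next
  \<open>a\<close> strands and arrives in position \<open>p + a + 1\<close>; the leftmost factor is
  on top.\<close>

fun tau :: "nat \<Rightarrow> nat \<Rightarrow> 'a" where
  "tau p 0 = 1"
| "tau p (Suc a) = sg (p + a + 1) * tau p a"

lemma tau_Suc_right: "tau p (Suc a) = tau (Suc p) a * sg (Suc p)"
  by (induction a) (simp_all add: mult.assoc)

lemma commute_tau:
  assumes "\<And>i. p < i \<Longrightarrow> i \<le> p + a \<Longrightarrow> x * h i = h i * x"
  shows "x * tau p a = tau p a * x"
  using assms
proof (induction a)
  case (Suc a)
  have "x * sg (p + a + 1) = sg (p + a + 1) * x" by (rule commute_sg, rule Suc.prems) auto
  moreover have "x * tau p a = tau p a * x" by (rule Suc.IH, rule Suc.prems) auto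
  ultimately show ?case using comm_mult by simp
qed auto

lemma tau_far: "j < p \<or> p + a + 1 < j \<Longrightarrow> h j * tau p a = tau p a * h j"
  by (rule commute_tau, rule far') auto

text \<open>What lies under the passing strand is shifted by one position to the left.\<close>

lemma tau_h:
  assumes "p + a < n" "p < i" "i < p + a"
  shows "tau p a * h (Suc i) = h i * tau p a"
  using assms
proof (induction a)
  case (Suc a)
  show ?case
  proof (cases "i < p + a")
    case True
    hence "tau p a * h (Suc i) = h i * tau p a" using Suc by simp
    moreover have "sg (p + a + 1) * h i = h i * sg (p + a + 1)"
      using True by (intro sg_h_far) auto
    ultimately show ?thesis by (simp add: mult.assoc) (simp flip: mult.assoc)
  next
    case False
    with Suc.prems obtain a' where a: "a = Suc a'" "i = p + a" by (cases a) auto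
    have "tau p a' * h (Suc i) = h (Suc i) * tau p a'" using tau_far[of "Suc i" p a'] a by simp
    hence "tau p (Suc a) * h (Suc i) = sg (i + 1) * (sg i * h (i + 1)) * tau p a'"
      by (simp add: a mult.assoc)
    also have "\<dots> = h i * tau p (Suc a)"
      by (subst sg_sg_h_down) (use Suc.prems a in \<open>auto simp: mult.assoc\<close>)
    finally show ?thesis .
  qed
qed auto

text \<open>Two neighbouring strands run over the same \<open>c\<close> strands and carry the
  \<open>h\<close> between them along.\<close>

lemma tau_tau_h:
  assumes "p + c + 1 < n"
  shows "tau p c * (tau (Suc p) c * h (Suc p)) = h (p + c + 1) * (tau p c * tau (Suc p) c)"
  using assms
proof (induction c arbitrary: p)
  case (Suc c)
  have comm: "sg (Suc p) * tau (Suc (Suc p)) c = tau (Suc (Suc p)) c * sg (Suc p)"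
    by (rule commute_tau, rule sg_h_far) auto
  have "tau p (Suc c) * (tau (Suc p) (Suc c) * h (Suc p))
      = tau (Suc p) c * (sg (Suc p) * tau (Suc (Suc p)) c) * (sg (Suc (Suc p)) * h (Suc p))"
    unfolding tau_Suc_right by (simp add: mult.assoc)
  also have "\<dots> = tau (Suc p) c * (tau (Suc (Suc p)) c * (sg (Suc p) * (sg (Suc p + 1) * h (Suc p))))"
    unfolding comm by (simp add: mult.assoc)
  also have "sg (Suc p) * (sg (Suc p + 1) * h (Suc p)) = h (Suc p + 1) * (sg (Suc p) * sg (Suc p + 1))"
    by (rule sg_sg_h_up) (use Suc.prems in auto)
  also have "tau (Suc p) c * (tau (Suc (Suc p)) c * (h (Suc p + 1) * (sg (Suc p) * sg (Suc p + 1))))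
     = tau (Suc p) c * (tau (Suc (Suc p)) c * h (Suc (Suc p))) * (sg (Suc p) * sg (Suc (Suc p)))"
    by (simp add: mult.assoc)
  also have "\<dots> = h (p + Suc c + 1) * (tau (Suc p) c * (tau (Suc (Suc p)) c * sg (Suc p)) * sg (Suc (Suc p)))"
    by (subst Suc.IH) (use Suc.prems in \<open>auto simp: mult.assoc\<close>)
  also have "\<dots> = h (p + Suc c + 1) * (tau p (Suc c) * tau (Suc p) (Suc c))"
    unfolding comm[symmetric] tau_Suc_right by (simp add: mult.assoc)
  finally show ?case .
qed auto

text \<open>Words in two letters (\<^term>\<open>True\<close> for strands of the left block) index the cosets of the
  parabolic subalgebra; \<open>br p w\<close> is the positive permutation braid of the coset of \<open>w\<close>.\<close>

definition cnt :: "bool list \<Rightarrow> nat" where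
  "cnt w = length (filter id w)"

lemma cnt_simps [simp]: "cnt [] = 0" "cnt (x # w) = (if x then Suc (cnt w) else cnt w)"
  "cnt (u @ w) = cnt u + cnt w"
  by (auto simp: cnt_def)

lemma cnt_le [simp]: "cnt w \<le> length w"
  by (simp add: cnt_def)

fun br :: "nat \<Rightarrow> bool list \<Rightarrow> 'a" where
  "br p [] = 1"
| "br p (x # w) = (if x then br (Suc p) w else tau p (cnt w) * br (Suc p) w)"

lemma br_far: "j < p \<Longrightarrow> h j * br p w = br p w * h j"
proof (induction w arbitrary: p)
  case (Cons x w)
  have "h j * br (Suc p) w = br (Suc p) w * h j" by (rule Cons.IH) (use Cons.prems in auto)
  moreover have "h j * tau p (cnt w) = tau p (cnt w) * h j" by (rule tau_far) (use Cons.prems in auto)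
  ultimately show ?case using comm_mult by simp
qed auto

definition kills :: "nat \<Rightarrow> nat \<Rightarrow> nat \<Rightarrow> 'a \<Rightarrow> bool" where
  "kills p a b Q \<longleftrightarrow> (\<forall>i. p < i \<longrightarrow> i < p + a + b \<longrightarrow> i \<noteq> p + a \<longrightarrow> Q * h i = 0)"

text \<open>This strips off a leading \<open>False\<close> strand: at the top it joins the front of
  the second block, and below it the remaining \<open>a + b\<close> strands again see two blocks
  that are killed.\<close>

lemma kills_tau:
  assumes "kills p a (Suc b) Q" "p + a + Suc b \<le> n"
  shows "kills (Suc p) a b (Q * tau p a)"
  unfolding kills_def
proof (intro allI impI)
  fix i assume i: "Suc p < i" "i < Suc p + a + b" "i \<noteq> Suc p + a"
  show "Q * tau p a * h i = 0"
  proof (cases "i \<le> p + a")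
    case True
    then obtain j where j: "i = Suc j" "p < j" "j < p + a" using i by (cases i) auto
    have "Q * tau p a * h i = Q * h j * tau p a"
      using tau_h[of p a j] j assms(2) by (simp add: mult.assoc)
    thus ?thesis using assms(1) j by (auto simp: kills_def)
  next
    case False
    hence "h i * tau p a = tau p a * h i" using i by (intro tau_far) auto
    hence "Q * tau p a * h i = Q * h i * tau p a" by (simp add: mult.assoc)
    thus ?thesis using assms(1) i False by (auto simp: kills_def)
  qed
qed

text \<open>If the letters are equal, the \<open>h\<close> slides up the braid into one of the
  blocks, where \<open>Q\<close> kills it. For \<open>True\<close> followed by \<open>False\<close>
  the crossing lengthens the representative to that of the exchanged word. The induction strips the
  letters of \<open>u\<close> and passes their strands into \<open>Q\<close>, which is why
  \<open>p\<close> and \<open>Q\<close> are arbitrary.\<close>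

lemma br_rel:
  assumes "kills p (cnt (u @ x # y # v)) (length (u @ x # y # v) - cnt (u @ x # y # v)) Q"
    and "p + length (u @ x # y # v) \<le> n"
  shows "(x = y \<longrightarrow> Q * br p (u @ x # y # v) * h (p + length u + 1) = 0) \<and>
         (x \<longrightarrow> \<not> y \<longrightarrow> Q * br p (u @ x # y # v) * sg (p + length u + 1) = Q * br p (u @ y # x # v))"
  using assms
proof (induction u arbitrary: p Q)
  case Nil
  have comm: "br (Suc (Suc p)) v * h (Suc p) = h (Suc p) * br (Suc (Suc p)) v"
    by (rule br_far[symmetric]) auto
  hence comm': "br (Suc (Suc p)) v * sg (Suc p) = sg (Suc p) * br (Suc (Suc p)) v"
    by (rule commute_sg)
  consider "x" "y" | "x" "\<not> y" | "\<not> x" "y" | "\<not> x" "\<not> y" by blast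
  thus ?case
  proof cases
    case 1
    have "Q * h (Suc p) = 0" using Nil 1 by (simp add: kills_def)
    thus ?thesis using 1 by (simp add: mult.assoc comm) (simp flip: mult.assoc)
  next
    case 2
    have "Q * (tau (Suc p) (cnt v) * (br (Suc (Suc p)) v * sg (Suc p))) = Q * (tau p (Suc (cnt v)) * br (Suc (Suc p)) v)"
      unfolding comm' tau_Suc_right by (simp add: mult.assoc)
    thus ?thesis using 2 by (simp add: mult.assoc)
  next
    case 4
    have "p + cnt v + 1 < p + cnt v + (2 + length v - cnt v)" using cnt_le[of v] by linarith
    hence kill: "Q * h (p + cnt v + 1) = 0" using Nil(1) 4 by (simp add: kills_def)
    have kill': "Q * (h (Suc (p + cnt v)) * y) = 0" for y
      using chain[OF kill] by simp
    \<comment> \<open>Both \<open>False\<close> strands run over the \<open>cnt v\<close> strands of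
      the first block, so the \<open>h\<close> between them arrives at the front of the second
      block.\<close>
    have "tau p (cnt v) * (tau (Suc p) (cnt v) * h (Suc p)) = h (p + cnt v + 1) * (tau p (cnt v) * tau (Suc p) (cnt v))"
      by (rule tau_tau_h) (use Nil(2) cnt_le[of v] in \<open>simp del: cnt_le\<close>)
    hence "Q * (tau p (cnt v) * (tau (Suc p) (cnt v) * (h (Suc p) * br (Suc (Suc p)) v)))
      = Q * h (p + cnt v + 1) * (tau p (cnt v) * tau (Suc p) (cnt v) * br (Suc (Suc p)) v)"
      by (simp add: mult.assoc[symmetric])
    thus ?thesis using 4 by (simp add: mult.assoc comm kill')
  qed auto
next
  case (Cons z u)
  let ?w = "u @ x # y # v"
  show ?case
  proof (cases z)
    case True
    have "kills (Suc p) (cnt ?w) (length ?w - cnt ?w) Q"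
      using Cons.prems(1) True by (auto simp: kills_def)
    from Cons.IH[OF this] show ?thesis using True Cons.prems(2) by simp
  next
    case False
    have "kills p (cnt ?w) (Suc (length ?w - cnt ?w)) Q"
      using Cons.prems(1) False cnt_le[of ?w] by (simp add: Suc_diff_le del: cnt_le)
    hence "kills (Suc p) (cnt ?w) (length ?w - cnt ?w) (Q * tau p (cnt ?w))"
      using Cons.prems(2) False cnt_le[of ?w] by (intro kills_tau) (auto simp del: cnt_le)
    from Cons.IH[OF this] show ?thesis using False Cons.prems(2) by (auto simp: mult.assoc)
  qed
qed

section \<open>Jucys-Murphy elements\<close>

text \<open>A loop of strand \<open>k\<close> around the strands \<open>1, ..., k - 1\<close>. The
  clause for 1 is separate because \<open>sg 0\<close> is the scalar \<open>q6 2\<close> and not 1;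
  the value at 0 is a default.\<close>

fun L :: "nat \<Rightarrow> 'a" where
  "L 0 = 1"
| "L (Suc 0) = 1"
| "L (Suc (Suc k)) = sg (Suc k) * (L (Suc k) * sg (Suc k))"

lemma commute_L:
  assumes "\<And>i. 0 < i \<Longrightarrow> i < k \<Longrightarrow> x * h i = h i * x"
  shows "x * L k = L k * x"
  using assms
proof (induction k rule: L.induct)
  case (3 k)
  have "x * L (Suc k) = L (Suc k) * x" by (rule 3) (auto intro: 3)
  moreover have "x * sg (Suc k) = sg (Suc k) * x" by (rule commute_sg, rule 3) auto
  ultimately show ?case using comm_mult by simp
qed auto

lemma L_far: "k < j \<Longrightarrow> h j * L k = L k * h j"
  by (rule commute_L, rule far') auto

lemma L_sg_far: "k < j \<Longrightarrow> sg j * L k = L k * sg j"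
  by (rule commute_L, rule sg_h_far) auto

text \<open>A generator between two encircled strands slides through the loop. The recursion handles
  all positions but the last, where \<open>j + 2\<close> is the index of the loop: there the
  \<open>h\<close> passes the crossings on one side by \<open>sg_sg_h_down\<close>, commutes with
  the inner loop as a distant generator, and returns by \<open>sg_sg_h_up\<close>.\<close>

lemma L_near:
  assumes "0 < j" "j + 1 < k" "k \<le> n"
  shows "h j * L k = L k * h j"
  using assms
proof (induction k rule: L.induct)
  case (3 k)
  show ?case
  proof (cases "j + 1 < Suc k")
    case True
    hence "h j * L (Suc k) = L (Suc k) * h j" using 3 by auto
    moreover have "h j * sg (Suc k) = sg (Suc k) * h j" by (rule sg_h_far[symmetric]) (use True in auto)
    ultimately show ?thesis using comm_mult by simp
  next
    case False
    with 3 have k: "k = j" and "k > 0" by auto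
    then obtain i where i: "k = Suc i" by (cases k) auto
    have comm: "h (Suc k) * L k = L k * h (Suc k)" by (rule L_far) auto
    have up: "sg k * (sg (Suc k) * h k) = h (Suc k) * (sg k * sg (Suc k))"
      and down: "h k * (sg (Suc k) * sg k) = sg (Suc k) * (sg k * h (Suc k))"
      using sg_sg_h_up[of k] sg_sg_h_down[of k] 3 k \<open>k > 0\<close> by auto
    have "h j * L (Suc (Suc k)) = h k * (sg (Suc k) * sg k) * (L k * (sg k * sg (Suc k)))"
      by (simp only: k[symmetric]) (simp add: i mult.assoc)
    also have "\<dots> = sg (Suc k) * (sg k * ((h (Suc k) * L k) * (sg k * sg (Suc k))))"
      unfolding down by (simp add: mult.assoc)
    also have "\<dots> = sg (Suc k) * (sg k * (L k * (h (Suc k) * (sg k * sg (Suc k)))))"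
      unfolding comm by (simp add: mult.assoc)
    also have "\<dots> = L (Suc (Suc k)) * h j"
      unfolding up[symmetric] by (simp only: k[symmetric]) (simp add: i mult.assoc)
    finally show ?thesis .
  qed
qed auto

lemma L_comm: "j \<le> n \<Longrightarrow> k \<le> n \<Longrightarrow> L j * L k = L k * L j"
proof (induction j k rule: linorder_wlog)
  case (le j k)
  show ?case
  proof (cases "j = k")
    case False
    have "L k * L j = L j * L k"
      by (rule commute_L, rule L_near[symmetric]) (use le False in auto)
    thus ?thesis by simp
  qed auto
qed auto

text \<open>Two neighbouring loops are the pair of loops one position further left, with a strand
  moved past both on either side. Twice a braid relation is used. This allows an induction on the
  position of a pair.\<close>

lemma L_pair_rec:
  assumes "0 < i" "i + 1 < n"
  shows "L (i + 1) * L (i + 2) = sg i * (sg (i + 1) * (L i * (L (i + 1) * (sg (i + 1) * sg i))))"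
proof -
  obtain k where k: "i = Suc k" using assms by (cases i) auto
  have L1: "L (i + 1) = sg i * (L i * sg i)" by (simp add: k)
  have L2: "L (i + 2) = sg (i + 1) * (sg i * (L i * (sg i * sg (i + 1))))" by (simp add: k mult.assoc)
  have comm: "sg (i + 1) * L i = L i * sg (i + 1)" by (rule L_sg_far) auto
  have "L (i + 1) * L (i + 2) = sg i * (L i * ((sg i * (sg (i + 1) * sg i)) * (L i * (sg i * sg (i + 1)))))"
    unfolding L2 unfolding L1 by (simp only: mult.assoc)
  also have "\<dots> = sg i * ((L i * sg (i + 1)) * (sg i * ((sg (i + 1) * L i) * (sg i * sg (i + 1)))))"
    unfolding sg_braid[OF assms] by (simp add: mult.assoc)
  also have "\<dots> = sg i * (sg (i + 1) * (L i * (sg i * (L i * (sg (i + 1) * (sg i * sg (i + 1)))))))"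
    unfolding comm by (simp only: mult.assoc chain[OF comm[symmetric]])
  also have "\<dots> = sg i * (sg (i + 1) * (L i * (sg i * (L i * (sg i * (sg (i + 1) * sg i))))))"
    unfolding sg_braid[OF assms] by (simp add: mult.assoc)
  also have "\<dots> = sg i * (sg (i + 1) * (L i * (L (i + 1) * (sg (i + 1) * sg i))))"
    unfolding L1 by (simp add: mult.assoc)
  finally show ?thesis .
qed

lemma sg_sq: "sg i * sg i = q6 4 \<cdot> 1 - (q6 1 - q6 (- 5)) \<cdot> h i"
proof -
  have "q6 2 * q6 2 = q6 4" and k: "q6 2 * q6 (- 1) = q6 1" "q6 (- 1) * q6 2 = q6 1" "q6 (- 1) * q6 (- 1) = q6 (- 2)"
    by (simp_all flip: q6_add)
  moreover have "q6 (- 1) * (q6 (- 1) * qint 2) = q6 1 + q6 1 - (q6 1 - q6 (- 5))"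
    by (simp add: qint_2 algebra_simps flip: q6_add)
  hence "(q6 (- 1) * (q6 (- 1) * qint 2)) \<cdot> h i = q6 1 \<cdot> h i + q6 1 \<cdot> h i - (q6 1 - q6 (- 5)) \<cdot> h i"
    by (simp only: scl_collect)
  ultimately show ?thesis
    by (simp add: sg_def left_diff_distrib right_diff_distrib scl_diff_right quad)
qed

text \<open>Behind the clasp on \<open>a\<close> strands the loop of the next strand has only two
  components. In the induction the smaller clasp is inserted next to the inner loop, the hypothesis
  is conjugated by the new crossing, and every term in which \<open>h a\<close> meets the larger
  clasp dies; the braid relation leaves \<open>h (a + 1)\<close> alone.\<close>

lemma jw_L:
  assumes "a < n"
  shows "jw 0 a * L (Suc a) =
    q6 (4 * int a) \<cdot> jw 0 a + (q6 (- 3 - 2 * int a) * (1 - q6 (6 * int a))) \<cdot> (jw 0 a * (h a * jw 0 a))"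
  using assms
proof (induction a)
  case 0
  show ?case by simp
next
  case (Suc a)
  define J J0 where "J = jw 0 (Suc a)" and "J0 = jw 0 a"
  define \<alpha> \<beta> where "\<alpha> = q6 (4 * int a)" and "\<beta> = q6 (- 3 - 2 * int a) * (1 - q6 (6 * int a))"
  define s where "s = sg (Suc a)"
  have JJ: "J * J = J" "J0 * J = J" "J * J0 = J"
    using jw_props[of 0 "Suc a"] Suc.prems by (simp_all add: J_def J0_def)
  have Ja: "J * h a = 0" "h a * J = 0"
    using Suc.prems by (cases "a = 0"; simp add: J_def h_outside jw_kill kill_jw)+
  have sJ0: "s * J0 = J0 * s"
    unfolding s_def J0_def by (rule jw_commute, rule sg_h_far) auto
  have IH: "J0 * L (Suc a) = \<alpha> \<cdot> J0 + \<beta> \<cdot> (J0 * (h a * J0))"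
    using Suc unfolding J0_def \<alpha>_def \<beta>_def by simp
  have "L (Suc (Suc a)) * J = J * L (Suc (Suc a))"
    unfolding J_def by (rule jw_commute, rule L_near[symmetric]) (use Suc.prems in auto)
  hence "J * L (Suc (Suc a)) = J * (L (Suc (Suc a)) * J)"
    by (metis JJ(1) mult.assoc)
  also have "\<dots> = J * (s * (L (Suc a) * (s * J)))"
    by (simp add: s_def mult.assoc)
  also have "\<dots> = J * (s * (J0 * L (Suc a)) * (s * J))"
    by (metis JJ(3) sJ0 mult.assoc)
  also have "\<dots> = \<alpha> \<cdot> (J * (s * (J0 * (s * J)))) + \<beta> \<cdot> (J * (s * (J0 * (h a * (J0 * (s * J))))))"
    unfolding IH by (simp add: algebra_simps)
  also have "J * (s * (J0 * (s * J))) = J * (s * s) * J"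
    by (metis JJ(3) sJ0 mult.assoc)
  also have "\<dots> = q6 4 \<cdot> J - (q6 1 - q6 (- 5)) \<cdot> (J * (h (Suc a) * J))"
    unfolding s_def sg_sq by (simp add: algebra_simps JJ)
  also have "J * (s * (J0 * (h a * (J0 * (s * J))))) = J * s * h a * s * J"
    by (metis JJ(2,3) sJ0 mult.assoc)
  also have "\<dots> = q6 (- 2) \<cdot> (J * (h (Suc a) * (h a * (h (Suc a) * J))))"
    unfolding s_def sg_def
    by (simp add: algebra_simps Ja chain[OF Ja(1)] scl_minus_right flip: q6_add)
  also have "\<beta> \<cdot> (q6 (- 2) \<cdot> (J * (h (Suc a) * (h a * (h (Suc a) * J))))) = (\<beta> * q6 (- 2)) \<cdot> (J * (h (Suc a) * J))"
  proof (cases "a = 0")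
    case False
    have hb: "h (Suc a) * (h a * h (Suc a)) = h a * (h (Suc a) * h a) - h a + h (Suc a)"
      using braid[of a] False Suc.prems by (simp add: algebra_simps)
    have "J * (h (Suc a) * (h a * h (Suc a))) * J = J * (h (Suc a) * J)"
      unfolding hb by (simp add: algebra_simps Ja chain[OF Ja(1)])
    thus ?thesis by (simp add: mult.assoc)
  qed (simp add: \<beta>_def)
  also have "\<alpha> \<cdot> (q6 4 \<cdot> J - (q6 1 - q6 (- 5)) \<cdot> (J * (h (Suc a) * J))) + (\<beta> * q6 (- 2)) \<cdot> (J * (h (Suc a) * J))
    = (\<alpha> * q6 4) \<cdot> J + (\<beta> * q6 (- 2) - \<alpha> * (q6 1 - q6 (- 5))) \<cdot> (J * (h (Suc a) * J))"
    by (simp add: scl_distribs algebra_simps)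
  also have "\<alpha> * q6 4 = q6 (4 * int (Suc a))"
    by (simp add: \<alpha>_def algebra_simps flip: q6_add)
  also have "\<beta> * q6 (- 2) - \<alpha> * (q6 1 - q6 (- 5)) = q6 (- 3 - 2 * int (Suc a)) * (1 - q6 (6 * int (Suc a)))"
    by (simp add: \<alpha>_def \<beta>_def algebra_simps flip: q6_add)
  finally show ?case by (simp add: J_def)
qed

end

section \<open>Gaussian binomial coefficients and falling q-factorials\<close>

lemma qpoch_Suc: "qpoch (Suc k) = qpoch k * (1 - q6 (6 * int (Suc k)))"
  by (simp add: qpoch_def q6_power algebra_simps)

lemma qpoch_0 [simp]: "qpoch 0 = 1"
  by (simp add: qpoch_def)

lemma qpoch_neq_0 [simp]: "qpoch k \<noteq> 0"
proof (induction k)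
  case (Suc k)
  have "1 - q6 (6 * int (Suc k)) \<noteq> 0" using q6_eq_1_iff[of "6 * int (Suc k)"] by auto
  with Suc show ?case by (simp only: qpoch_Suc) simp
qed simp

text \<open>The Gaussian binomial coefficient in \<open>q = q6 6\<close>, given by the q-Pascal rule
  because the recursion for the loops takes this form.\<close>

fun qbin :: "nat \<Rightarrow> nat \<Rightarrow> K" where
  "qbin r 0 = 1"
| "qbin 0 (Suc i) = 0"
| "qbin (Suc r) (Suc i) = qbin r i + q6 (6 * int (Suc i)) * qbin r (Suc i)"

lemma qbin_eq_0: "r < i \<Longrightarrow> qbin r i = 0"
  by (induction r i rule: qbin.induct) auto

lemma qbin_same: "qbin r r = 1"
  by (induction r) (auto simp: qbin_eq_0)

lemma qbin_qpoch: "i \<le> r \<Longrightarrow> qbin r i * (qpoch i * qpoch (r - i)) = qpoch r"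
proof (induction r i rule: qbin.induct)
  case (3 r i)
  show ?case
  proof (cases "i = r")
    case False
    with 3 have i: "i < r" by simp
    define j where "j = r - Suc i"
    have r: "r = Suc (i + j)" using i by (simp add: j_def)
    have IH: "qbin r i * (qpoch i * qpoch (Suc j)) = qpoch r" "qbin r (Suc i) * (qpoch (Suc i) * qpoch j) = qpoch r"
      using 3 i by (simp_all add: r)
    define x y where "x = q6 (6 * int (Suc i))" and "y = q6 (6 * int (Suc j))"
    have xy: "q6 (6 * int (Suc r)) = x * y"
      by (simp add: x_def y_def r algebra_simps flip: q6_add)
    have "qbin (Suc r) (Suc i) * (qpoch (Suc i) * qpoch (Suc j)) =
       qbin r i * (qpoch i * qpoch (Suc j)) * (1 - x) + x * (qbin r (Suc i) * (qpoch (Suc i) * qpoch j)) * (1 - y)"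
      by (simp add: qpoch_Suc x_def y_def algebra_simps del: of_nat_Suc)
    also have "\<dots> = qpoch r * (1 - x * y)" unfolding IH by (simp add: algebra_simps)
    also have "\<dots> = qpoch (Suc r)" by (simp only: qpoch_Suc xy)
    finally show ?thesis by (simp add: r)
  qed (simp add: qbin_same qbin_eq_0)
qed auto

lemma qbin_eq: "i \<le> r \<Longrightarrow> qbin r i = qpoch r / (qpoch i * qpoch (r - i))"
  by (simp add: nonzero_eq_divide_eq qbin_qpoch)

text \<open>The product of \<open>i\<close> factors \<open>1 - q^a\<close>,
  \<open>1 - q^(a - 1)\<close>, and so on. For \<open>i > a\<close> it contains
  \<open>1 - q^0\<close>, and this zero later truncates a sum.\<close>

fun qfall :: "nat \<Rightarrow> nat \<Rightarrow> K" where
  "qfall a 0 = 1"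
| "qfall a (Suc i) = (1 - q6 (6 * int a)) * qfall (a - 1) i"

lemma qfall_eq: "i \<le> a \<Longrightarrow> qfall a i = qpoch a / qpoch (a - i)"
proof (induction a i rule: qfall.induct)
  case (2 a i)
  then obtain b where b: "a = Suc b" by (cases a) auto
  show ?case using 2 unfolding b by (simp add: qpoch_Suc del: of_nat_Suc)
qed auto

lemma qfall_eq_0: "a < i \<Longrightarrow> qfall a i = 0"
proof (induction a i rule: qfall.induct)
  case (2 a i)
  thus ?case by (cases "a = 0") auto
qed auto

section \<open>The two clasps and the right module they generate\<close>

locale hecke_pair = hecke +
  fixes t s :: nat
  assumes n_eq: "n = t + s"
begin

definition P :: 'a where "P = jw 0 t * jw t s"

lemma jw_jw_commute: "jw 0 t * jw t s = jw t s * jw 0 t"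
  by (rule jw_commute, rule jw_commute[symmetric], rule far') auto

lemma P_kill: "i \<noteq> t \<Longrightarrow> h i * P = 0" and kill_P: "i \<noteq> t \<Longrightarrow> P * h i = 0"
proof -
  assume i: "i \<noteq> t"
  consider "i = 0 \<or> i \<ge> n" | "0 < i" "i < t" | "t < i" "i < t + s"
    using i n_eq by linarith
  hence "h i * P = 0 \<and> P * h i = 0"
  proof cases
    case 2
    hence *: "h i * jw 0 t = 0" "jw 0 t * h i = 0" by (auto intro!: jw_kill kill_jw simp: n_eq)
    hence "h i * P = 0" by (simp add: P_def mult.assoc[symmetric])
    moreover have "P * h i = 0" unfolding P_def jw_jw_commute by (simp add: mult.assoc *)
    ultimately show ?thesis by simp
  next
    case 3
    hence *: "h i * jw t s = 0" "jw t s * h i = 0" by (auto intro!: jw_kill kill_jw simp: n_eq)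
    hence "P * h i = 0" by (simp add: P_def mult.assoc)
    moreover have "h i * P = 0" unfolding P_def jw_jw_commute by (simp add: mult.assoc[symmetric] *)
    ultimately show ?thesis by simp
  qed (simp add: h_outside)
  thus "h i * P = 0" "P * h i = 0" by auto
qed

lemma absorb_jw: "(\<And>i. p < i \<Longrightarrow> i < p + m \<Longrightarrow> x * h i = 0) \<Longrightarrow> x * jw p m = x"
proof (induction p m rule: jw.induct)
  case (3 p k)
  have "x * jw p (Suc k) = x" by (rule 3) (auto intro: 3)
  moreover have "x * h (p + Suc k) = 0" by (rule 3) auto
  ultimately show ?case by (simp add: right_diff_distrib chain)
qed auto

lemma jw_absorb: "(\<And>i. p < i \<Longrightarrow> i < p + m \<Longrightarrow> h i * x = 0) \<Longrightarrow> jw p m * x = x"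
proof (induction p m rule: jw.induct)
  case (3 p k)
  have "jw p (Suc k) * x = x" by (rule 3) (auto intro: 3)
  moreover have "h (p + Suc k) * x = 0" by (rule 3) auto
  ultimately show ?case by (simp add: left_diff_distrib mult.assoc)
qed auto

text \<open>The right module generated by \<open>P\<close>, spanned by \<open>P\<close> times the
  coset representatives; closure under the generators is \<open>V_h\<close>. Statements linear in
  the vector need a proof only for the spanning elements, by rule induction.\<close>

inductive_set V :: "'a set" where
  V_base: "length w = n \<Longrightarrow> cnt w = t \<Longrightarrow> P * br 0 w \<in> V"
| V_add: "v \<in> V \<Longrightarrow> w \<in> V \<Longrightarrow> v + w \<in> V"
| V_scl: "v \<in> V \<Longrightarrow> c \<cdot> v \<in> V"

lemma P_in_V: "P \<in> V"
proof -
  have F: "cnt (replicate s False) = 0 \<and> br p (replicate s False) = 1" for p s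
    by (induction s arbitrary: p) auto
  have "br p (replicate t True @ replicate s False) = 1" for p
    by (induction t arbitrary: p) (auto simp: F)
  moreover have "cnt (replicate t True @ replicate s False) = t" using F by (auto simp: cnt_def)
  ultimately show ?thesis
    using V_base[of "replicate t True @ replicate s False"] by (simp add: n_eq)
qed

lemma V_diff: "v \<in> V \<Longrightarrow> w \<in> V \<Longrightarrow> v - w \<in> V"
  using V_add[of v "(- 1) \<cdot> w"] V_scl[of w "- 1"] by (simp add: scl_minus_left)

lemma split_word:
  assumes "0 < i" "i < n" "length w = n"
  obtains u x y v where "w = u @ x # y # v" "length u + 1 = i"
proof -
  have "w = take (i - 1) w @ w ! (i - 1) # w ! i # drop (i + 1) w"
    using assms by (metis Cons_nth_drop_Suc One_nat_def Suc_eq_plus1 Suc_lessD Suc_pred append_take_drop_id)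
  thus ?thesis using that[of "take (i - 1) w"] assms by auto
qed

lemma P_br:
  assumes "length (u @ x # y # v) = n" "cnt (u @ x # y # v) = t"
  shows "x = y \<Longrightarrow> P * br 0 (u @ x # y # v) * h (length u + 1) = 0"
    and "x \<Longrightarrow> \<not> y \<Longrightarrow> P * br 0 (u @ x # y # v) * sg (length u + 1) = P * br 0 (u @ y # x # v)"
proof -
  have "kills 0 t s P" by (auto simp: kills_def kill_P)
  hence "kills 0 (cnt (u @ x # y # v)) (length (u @ x # y # v) - cnt (u @ x # y # v)) P"
    unfolding assms by (simp add: n_eq)
  from br_rel[OF this] assms
  show "x = y \<Longrightarrow> P * br 0 (u @ x # y # v) * h (length u + 1) = 0"
    and "x \<Longrightarrow> \<not> y \<Longrightarrow> P * br 0 (u @ x # y # v) * sg (length u + 1) = P * br 0 (u @ y # x # v)"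
    by simp_all
qed

lemma h_via_sg: "h i = q6 3 \<cdot> 1 - q6 1 \<cdot> sg i"
  by (simp add: sg_def scl_diff_right flip: q6_add)

lemma V_h: "v \<in> V \<Longrightarrow> v * h i \<in> V"
proof (induction v rule: V.induct)
  case (V_base w)
  have zero: "0 \<in> V" using V_scl[OF P_in_V, of 0] by simp
  show ?case
  proof (cases "0 < i \<and> i < n")
    case False
    thus ?thesis using zero by (auto simp: h_outside not_less)
  next
    case True
    then obtain u x y v where w: "w = u @ x # y # v" and i: "length u + 1 = i"
      using split_word V_base by metis
    \<comment> \<open>\<open>True\<close> before \<open>False\<close> is the basic case: the
      crossing leads to another representative, and \<open>h i\<close> is a combination of 1 and the
      crossing. The opposite order is such a vector times a crossing, which \<open>h i\<close>
      absorbs up to a scalar.\<close>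
    have TF: "P * br 0 w * h i \<in> V"
      if w: "w = u @ True # False # v" and "length w = n" "cnt w = t" for w
    proof -
      have "P * br 0 w * sg i = P * br 0 (u @ False # True # v)"
        using P_br(2)[of u True False v] that i by simp
      moreover have "P * br 0 (u @ False # True # v) \<in> V"
        by (rule V.V_base) (use that in auto)
      moreover have "P * br 0 w * h i = q6 3 \<cdot> (P * br 0 w) - q6 1 \<cdot> (P * br 0 w * sg i)"
        by (subst h_via_sg) (simp only: right_diff_distrib mult_scl_right mult_1_right)
      ultimately show ?thesis
        using V.V_base[OF that(2,3)] by (simp only: V_diff V_scl)
    qed
    consider "x = y" | "x" "\<not> y" | "\<not> x" "y" by blast
    thus ?thesis
    proof cases
      case 1
      thus ?thesis using P_br(1)[of u x y v] V_base w i zero by simp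
    next
      case 2
      thus ?thesis using TF V_base w by simp
    next
      case 3
      let ?w = "u @ True # False # v"
      have eq: "P * br 0 w = P * br 0 ?w * sg i"
        using P_br(2)[of u True False v] V_base w i 3 by simp
      have "P * br 0 w * h i = (- q6 (- 4)) \<cdot> (P * br 0 ?w * h i)"
        unfolding eq mult.assoc[of _ "sg i" "h i"] sg_h_same by (rule mult_scl_right)
      thus ?thesis using TF[of ?w] V_base w 3 by (simp add: V_scl)
    qed
  qed
qed (auto simp: algebra_simps intro: V.intros)

lemma V_sg: "v \<in> V \<Longrightarrow> v * sg i \<in> V"
  unfolding sg_def by (simp add: right_diff_distrib V_diff V_scl V_h)

lemma V_prod: "v \<in> V \<Longrightarrow> (\<And>x. x \<in> set xs \<Longrightarrow> \<exists>i. x = h i) \<Longrightarrow> v * prod_list xs \<in> V"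
proof (induction xs arbitrary: v)
  case (Cons x xs)
  then obtain i where "x = h i" by auto
  hence "v * x \<in> V" using Cons V_h by simp
  from Cons.IH[OF this] Cons.prems show ?case by (simp add: mult.assoc)
qed auto

text \<open>Two of any three adjacent strands belong to the same block.\<close>

lemma V_relation:
  assumes "v \<in> V" "0 < i" "i + 1 < n"
  shows "v * (h i * h (i + 1) * h i - h i) = 0"
  using assms(1)
proof (induction v rule: V.induct)
  case (V_base w)
  define E where "E = h i * h (i + 1) * h i - h i"
  have E': "E = h (i + 1) * h i * h (i + 1) - h (i + 1)"
    unfolding E_def using braid assms by blast
  \<comment> \<open>Both expressions for \<open>E\<close> are used, one for each crossing: on the
    left of \<open>E\<close> either crossing becomes the scalar \<open>-q^(-2/3)\<close>.\<close>
  have sgE: "sg i * E = (- q6 (- 4)) \<cdot> E"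
    unfolding E_def by (simp add: right_diff_distrib chain[OF sg_h_same] sg_h_same mult.assoc scl_distribs)
  have sgE': "sg (i + 1) * E = (- q6 (- 4)) \<cdot> E"
    unfolding E' right_diff_distrib by (simp add: chain[OF sg_h_same] sg_h_same mult.assoc scl_distribs)
  have killE: "x * E = 0" if "x * h i = 0 \<or> x * h (i + 1) = 0" for x
    using that
  proof
    assume "x * h i = 0"
    thus ?thesis unfolding E_def by (simp add: right_diff_distrib mult.assoc[symmetric])
  next
    assume "x * h (i + 1) = 0"
    thus ?thesis unfolding E' by (simp add: right_diff_distrib mult.assoc[symmetric])
  qed
  obtain u x y v' where w: "w = u @ x # y # v'" and u: "length u + 1 = i"
    using split_word[of i w] assms V_base by (metis Suc_eq_plus1 Suc_lessD)
  have "length v' > 0" using V_base w u assms by auto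
  then obtain z v where v': "v' = z # v" by (cases v') auto
  have B1: "P * br 0 (u @ a # a # c # v) * E = 0"
    if "length (u @ a # a # c # v) = n" "cnt (u @ a # a # c # v) = t" for a c
    using killE P_br(1)[of u a a "c # v"] that u by simp
  have B2: "P * br 0 (u @ c # a # a # v) * E = 0"
    if "length (u @ c # a # a # v) = n" "cnt (u @ c # a # a # v) = t" for a c
    using killE P_br(1)[of "u @ [c]" a a v] that u by simp
  have "P * br 0 w * E = 0"
  proof (cases "x = y \<or> y = z")
    case True
    thus ?thesis using B1[of x z] B2[of x y] V_base w v' by auto
  next
    case False
    \<comment> \<open>An alternating word arises by one crossing from a word with two equal
      neighbours, and \<open>E\<close> absorbs this crossing.\<close>
    consider "x" "\<not> y" "z" | "\<not> x" "y" "\<not> z" using False by blast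
    thus ?thesis
    proof cases
      case 1
      have eq: "P * br 0 w = P * br 0 (u @ True # True # False # v) * sg (i + 1)"
        using P_br(2)[of "u @ [True]" True False v] V_base w v' u 1 by simp
      have "P * br 0 w * E = (- q6 (- 4)) \<cdot> (P * br 0 (u @ True # True # False # v) * E)"
        unfolding eq mult.assoc[of _ "sg (i + 1)" E] sgE' by (rule mult_scl_right)
      thus ?thesis using B1[of True False] V_base w v' 1 by simp
    next
      case 2
      have eq: "P * br 0 w = P * br 0 (u @ True # False # False # v) * sg i"
        using P_br(2)[of u True False "False # v"] V_base w v' u 2 by simp
      have "P * br 0 w * E = (- q6 (- 4)) \<cdot> (P * br 0 (u @ True # False # False # v) * E)"
        unfolding eq mult.assoc[of _ "sg i" E] sgE by (rule mult_scl_right)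
      thus ?thesis using B2[of True False] V_base w v' 2 by simp
    qed
  qed
  thus ?case by (simp add: E_def)
qed (auto simp: distrib_right)

text \<open>Both sides of the braid relation vanish behind \<open>P\<close>, so the Temperley-Lieb
  relations hold on \<open>V\<close>.\<close>

lemma
  assumes "v \<in> V" "0 < i" "i + 1 < n"
  shows V_tl_up: "v * (h i * (h (i + 1) * h i)) = v * h i"
    and V_tl_down: "v * (h (i + 1) * (h i * h (i + 1))) = v * h (i + 1)"
  using V_relation[OF assms] V_relation[OF assms, unfolded braid[OF assms(2,3)]]
  by (simp_all add: right_diff_distrib mult.assoc)

text \<open>A turnback is pulled past a strand. Of the four terms of the two resolved crossings
  three are multiples of \<open>v * h i\<close> by the Temperley-Lieb relation, and their
  coefficients cancel by \<open>z\<close>.\<close>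

lemma V_slide:
  assumes "v \<in> V" "0 < i" "i + 1 < n"
  shows "v * (h i * (sg (i + 1) * sg i)) = (- q6 1) \<cdot> (v * (h i * h (i + 1)))"
    and "v * (h (i + 1) * (sg i * sg (i + 1))) = (- q6 1) \<cdot> (v * (h (i + 1) * h i))"
proof -
  have k: "q6 2 * q6 2 = q6 4" "q6 2 * q6 (- 1) = q6 1" "q6 (- 1) * q6 2 = q6 1" "q6 (- 1) * q6 (- 1) = q6 (- 2)"
    by (simp_all flip: q6_add)
  have z: "q6 4 - q6 1 * qint 2 + q6 (- 2) = 0"
    by (simp add: qint_2 algebra_simps flip: q6_add)
  have aux: "v * (a * ((q6 2 \<cdot> 1 - q6 (- 1) \<cdot> b) * (q6 2 \<cdot> 1 - q6 (- 1) \<cdot> a))) = (- q6 1) \<cdot> (v * (a * b))"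
    if a: "a * a = qint 2 \<cdot> a" and tl: "v * (a * (b * a)) = v * a" for a b
  proof -
    have "v * (a * ((q6 2 \<cdot> 1 - q6 (- 1) \<cdot> b) * (q6 2 \<cdot> 1 - q6 (- 1) \<cdot> a)))
      = q6 4 \<cdot> (v * a) - (q6 1 * qint 2) \<cdot> (v * a) + q6 (- 2) \<cdot> (v * a) - q6 1 \<cdot> (v * (a * b))"
      by (simp add: algebra_simps a tl scl_distribs) (simp add: k flip: mult.assoc)
    also have "\<dots> = (q6 4 - q6 1 * qint 2 + q6 (- 2)) \<cdot> (v * a) - q6 1 \<cdot> (v * (a * b))"
      by (simp only: scl_collect)
    finally show ?thesis by (simp add: z scl_minus_left)
  qed
  show "v * (h i * (sg (i + 1) * sg i)) = (- q6 1) \<cdot> (v * (h i * h (i + 1)))"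
    unfolding sg_def by (rule aux) (use V_tl_up[OF assms] in \<open>simp_all add: quad\<close>)
  show "v * (h (i + 1) * (sg i * sg (i + 1))) = (- q6 1) \<cdot> (v * (h (i + 1) * h i))"
    unfolding sg_def by (rule aux) (use V_tl_down[OF assms] in \<open>simp_all add: quad\<close>)
qed

text \<open>For \<open>i = 1\<close> the turnback absorbs two crossings, which gives
  \<open>q6 (- 8)\<close>. After that \<open>L_pair_rec\<close> moves the pair of loops one position
  to the left, and the two slides cost \<open>- q6 1\<close> each.\<close>

lemma V_L_pair:
  assumes "v \<in> V" "0 < i" "i < n"
  shows "v * (h i * (L i * L (i + 1))) = q6 (2 * int i - 10) \<cdot> (v * h i)"
  using assms
proof (induction i arbitrary: v)
  case (Suc i)
  show ?case
  proof (cases "i = 0")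
    case True
    thus ?thesis by (simp add: mult.assoc[symmetric] h_sg_same)
       (simp add: mult.assoc h_sg_same flip: q6_add)
  next
    case False
    hence i: "0 < i" "i + 1 < n" using Suc.prems by auto
    have v: "v * h (Suc i) \<in> V" by (rule V_h) (rule Suc)
    have "v * (h (Suc i) * (L (Suc i) * L (Suc i + 1)))
       = v * (h (i + 1) * (sg i * sg (i + 1))) * (L i * (L (i + 1) * (sg (i + 1) * sg i)))"
      using L_pair_rec[OF i] by (simp add: mult.assoc)
    also have "\<dots> = (- q6 1) \<cdot> ((v * h (Suc i)) * (h i * (L i * L (i + 1))) * (sg (i + 1) * sg i))"
      unfolding V_slide(2)[OF Suc.prems(1) i] by (simp add: mult.assoc)
    also have "\<dots> = (- q6 1 * q6 (2 * int i - 10)) \<cdot> ((v * h (Suc i)) * (h i * (sg (i + 1) * sg i)))"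
      using Suc.IH[OF v] i by (simp add: mult.assoc)
    also have "\<dots> = (- q6 1 * q6 (2 * int i - 10) * (- q6 1)) \<cdot> (v * (h (i + 1) * (h i * h (i + 1))))"
      unfolding V_slide(1)[OF v i] by (simp add: mult.assoc)
    also have "\<dots> = q6 (2 * int (Suc i) - 10) \<cdot> (v * h (Suc i))"
      unfolding V_tl_down[OF Suc.prems(1) i] by (simp flip: q6_add)
    finally show ?thesis .
  qed
qed auto

text \<open>The factors are pairwise distant and thus commute; for a suitable \<open>p\<close> they
  form one layer of the stair-step web.\<close>

definition CC :: "nat \<Rightarrow> nat \<Rightarrow> 'a" where
  "CC p l = prod_list (map (\<lambda>j. h (p + 2 * j)) [0..<l])"

lemma CC_0 [simp]: "CC p 0 = 1"
  and CC_Suc: "CC p (Suc l) = CC p l * h (p + 2 * l)"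
  by (simp_all add: CC_def)

lemma CC_Suc_left: "CC p (Suc l) = h p * CC (p + 2) l"
  by (induction l) (simp_all add: CC_Suc mult.assoc[symmetric])

lemma commute_CC:
  assumes "\<And>i. p \<le> i \<Longrightarrow> i + 1 < p + 2 * l \<Longrightarrow> x * h i = h i * x"
  shows "x * CC p l = CC p l * x"
  using assms
proof (induction l)
  case (Suc l)
  have "x * CC p l = CC p l * x" by (rule Suc.IH, rule Suc.prems) auto
  moreover have "x * h (p + 2 * l) = h (p + 2 * l) * x" by (rule Suc.prems) auto
  ultimately show ?case unfolding CC_Suc by (rule comm_mult)
qed auto

lemma V_CC: "v \<in> V \<Longrightarrow> v * CC p l \<in> V"
  unfolding CC_def by (rule V_prod) auto

text \<open>A loop behind a row of turnbacks travels along the row, two positions per turnback at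
  the price \<open>(- q6 1)^2\<close>, from strand \<open>p + 2 * l\<close> to strand
  \<open>p\<close>. The layers \<open>CC (p + 1) l * CC p l\<close> record the zigzag on which it
  went; \<open>V_CC_tl\<close> straightens the zigzag when nothing is caught in it.\<close>

lemma V_CC_L:
  assumes "v \<in> V" "0 < p" "p + 2 * l \<le> n"
  shows "v * (CC p l * L (p + 2 * l)) = q6 (2 * int l) \<cdot> (v * (CC p l * (L p * (CC (p + 1) l * CC p l))))"
  using assms
proof (induction l arbitrary: v)
  case (Suc l)
  define i where "i = p + 2 * l"
  have i: "0 < i" "i + 1 < n" and pi: "p + 2 * Suc l = Suc (Suc i)" "p + 1 + 2 * l = i + 1"
    using Suc.prems by (auto simp: i_def)
  have CCs: "CC p (Suc l) = CC p l * h i" "CC (p + 1) (Suc l) = CC (p + 1) l * h (i + 1)"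
    by (simp_all add: CC_Suc i_def)
  have hi: "h i * CC p l = CC p l * h i" and hi1: "h (i + 1) * CC p l = CC p l * h (i + 1)"
    by (rule commute_CC, rule far', simp add: i_def)+
  obtain i' where i': "i = Suc i'" using i by (cases i) auto
  have Li: "L (Suc (Suc i)) = sg (i + 1) * (sg i * (L i * (sg i * sg (i + 1))))"
    by (simp add: i' mult.assoc)
  have comm: "h (i + 1) * L i = L i * h (i + 1)" by (rule L_far) auto
  have vh: "v * h i \<in> V" by (rule V_h) (rule Suc)
  have "v * (CC p (Suc l) * L (p + 2 * Suc l))
      = (v * CC p l) * (h i * (sg (i + 1) * sg i)) * (L i * (sg i * sg (i + 1)))"
    unfolding CCs pi Li by (simp add: mult.assoc)
  also have "\<dots> = (- q6 1) \<cdot> ((v * CC p l) * (h i * (h (i + 1) * L i)) * (sg i * sg (i + 1)))"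
    unfolding V_slide(1)[OF V_CC[OF Suc.prems(1)] i] by (simp add: mult.assoc)
  also have "\<dots> = (- q6 1) \<cdot> ((v * (h i * CC p l)) * (L i * (h (i + 1) * (sg i * sg (i + 1)))))"
    unfolding comm hi by (simp add: mult.assoc)
  also have "\<dots> = (- q6 1) \<cdot> ((v * h i) * (CC p l * L i) * (h (i + 1) * (sg i * sg (i + 1))))"
    by (simp add: mult.assoc)
  also have "\<dots> = (- q6 1 * q6 (2 * int l)) \<cdot>
      ((v * h i) * (CC p l * (L p * (CC (p + 1) l * CC p l))) * (h (i + 1) * (sg i * sg (i + 1))))"
    using Suc.IH[OF vh] Suc.prems by (simp add: i_def)
  also have "(v * h i) * (CC p l * (L p * (CC (p + 1) l * CC p l))) * (h (i + 1) * (sg i * sg (i + 1)))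
     = (- q6 1) \<cdot> ((v * h i) * (CC p l * (L p * (CC (p + 1) l * CC p l))) * (h (i + 1) * h i))"
  proof (rule V_slide(2))
    have L_V: "w * L k \<in> V" if "w \<in> V" for w k
      using that by (induction k arbitrary: w rule: L.induct) (auto simp: mult.assoc[symmetric] V_sg)
    show "v * h i * (CC p l * (L p * (CC (p + 1) l * CC p l))) \<in> V"
      by (simp only: mult.assoc[symmetric]) (intro V_CC L_V vh)
  qed (use i in auto)
  also have "(v * h i) * (CC p l * (L p * (CC (p + 1) l * CC p l))) * (h (i + 1) * h i)
     = v * ((h i * CC p l) * (L p * (CC (p + 1) l * ((CC p l * h (i + 1)) * h i))))"
    by (simp add: mult.assoc)
  also have "\<dots> = v * (CC p (Suc l) * (L p * (CC (p + 1) (Suc l) * CC p (Suc l))))"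
    unfolding hi hi1[symmetric] CCs by (simp add: mult.assoc)
  finally show ?case
    by (simp add: mult.assoc algebra_simps flip: q6_add)
qed auto

lemma V_CC_tl:
  assumes "v \<in> V" "0 < p" "p + 2 * l \<le> n"
  shows "v * (CC p l * (CC (p + 1) l * CC p l)) = v * CC p l"
  using assms
proof (induction l arbitrary: v)
  case (Suc l)
  define i where "i = p + 2 * l"
  have i: "0 < i" "i + 1 < n" using Suc.prems by (auto simp: i_def)
  have CCs: "CC p (Suc l) = CC p l * h i" "CC (p + 1) (Suc l) = CC (p + 1) l * h (i + 1)"
    by (simp_all add: CC_Suc i_def)
  have hi: "h i * CC p l = CC p l * h i" and hi1: "h (i + 1) * CC p l = CC p l * h (i + 1)"
    by (rule commute_CC, rule far', simp add: i_def)+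
  have vh: "v * h i \<in> V" by (rule V_h) (rule Suc)
  have "v * (CC p (Suc l) * (CC (p + 1) (Suc l) * CC p (Suc l)))
    = v * ((CC p l * h i) * (CC (p + 1) l * ((h (i + 1) * CC p l) * h i)))"
    unfolding CCs by (simp add: mult.assoc)
  also have "\<dots> = (v * h i) * (CC p l * (CC (p + 1) l * CC p l)) * (h (i + 1) * h i)"
    unfolding hi1 hi[symmetric] by (simp add: mult.assoc)
  also have "\<dots> = v * ((h i * CC p l) * (h (i + 1) * h i))"
    using Suc.IH[OF vh] Suc.prems by (simp add: mult.assoc)
  also have "\<dots> = (v * CC p l) * (h i * (h (i + 1) * h i))"
    unfolding hi by (simp add: mult.assoc)
  also have "\<dots> = v * CC p (Suc l)"
    unfolding V_tl_up[OF V_CC[OF Suc.prems(1)] i] CCs by (simp add: mult.assoc)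
  finally show ?case .
qed auto

end

section \<open>Products of Jucys-Murphy elements and the full twist\<close>

context hecke
begin

definition LL :: "nat \<Rightarrow> nat \<Rightarrow> 'a" where
  "LL a b = prod_list (map L [Suc a..<Suc b])"

lemma LL_same [simp]: "LL a a = 1"
  by (simp add: LL_def)

lemma LL_Suc: "a \<le> b \<Longrightarrow> LL a (Suc b) = LL a b * L (Suc b)"
  by (simp add: LL_def)

lemma LL_Suc_left: "a < b \<Longrightarrow> LL a b = L (Suc a) * LL (Suc a) b"
  unfolding LL_def by (subst upt_conv_Cons) auto

lemma LL_append:
  assumes "a \<le> b" "b \<le> c"
  shows "LL a c = LL a b * LL b c"
  using assms(2)
proof (induction rule: dec_induct)
  case (step c)
  thus ?case using assms(1) by (simp add: LL_Suc mult.assoc)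
qed auto

lemma commute_prod_list: "(\<And>y. y \<in> set ys \<Longrightarrow> x * y = y * x) \<Longrightarrow> x * prod_list ys = prod_list ys * x"
  for x :: 'a
proof (induction ys)
  case (Cons y ys)
  hence "x * y = y * x" "x * prod_list ys = prod_list ys * x" by auto
  from comm_mult[OF this] show ?case by simp
qed auto

lemma commute_LL:
  "(\<And>k. a < k \<Longrightarrow> k \<le> b \<Longrightarrow> x * L k = L k * x) \<Longrightarrow> x * LL a b = LL a b * x"
  unfolding LL_def by (rule commute_prod_list) auto

lemma LL_LL_commute:
  assumes "b \<le> n" "d \<le> n"
  shows "LL a b * LL c d = LL c d * LL a b"
  by (rule commute_LL, rule commute_LL[symmetric], rule L_comm) (use assms in auto)

text \<open>Since \<open>L (j + 1)\<close> is \<open>sg j * (L j * sg j)\<close>, commutation of the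
  two loops says that their product commutes with \<open>sg j\<close>, and \<open>h j\<close> is a
  combination of 1 and \<open>sg j\<close>.\<close>

lemma h_L_pair: "h j * (L j * L (j + 1)) = L j * L (j + 1) * h j" if "j < n"
proof (cases "j = 0")
  case False
  then obtain k where k: "j = Suc k" by (cases j) auto
  have L: "L (j + 1) = sg j * (L j * sg j)" by (simp add: k)
  have "L j * L (j + 1) = L (j + 1) * L j" by (rule L_comm) (use that in auto)
  hence c: "L j * (sg j * (L j * sg j)) = sg j * (L j * (sg j * L j))" unfolding L by (simp add: mult.assoc)
  have sg: "L j * L (j + 1) * sg j = sg j * (L j * L (j + 1))"
    unfolding L by (simp add: mult.assoc c)
  have h: "h j = q6 3 \<cdot> 1 - q6 1 \<cdot> sg j"
    by (simp add: sg_def scl_diff_right flip: q6_add)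
  show ?thesis
    by (subst (1 2) h) (simp only: left_diff_distrib right_diff_distrib mult_scl_left mult_scl_right mult_1_left mult_1_right sg)
qed (simp add: h_outside)

text \<open>The generator commutes with every single loop except \<open>L j\<close> and
  \<open>L (j + 1)\<close>, and with the product of these two by \<open>h_L_pair\<close>.\<close>

lemma h_LL:
  assumes "b \<le> n" "j < b"
  shows "h j * LL 0 b = LL 0 b * h j"
  using assms
proof (induction b)
  case (Suc b)
  show ?case
  proof (cases "j < b")
    case True
    hence "h j * LL 0 b = LL 0 b * h j" using Suc by auto
    moreover have "h j * L (Suc b) = L (Suc b) * h j"
      using True Suc.prems by (cases "j = 0") (auto intro!: L_near simp: h_outside)
    ultimately show ?thesis unfolding LL_Suc[OF le0] by (rule comm_mult)
  next
    case False
    hence j: "j = b" using Suc.prems by simp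
    show ?thesis
    proof (cases b)
      case 0
      thus ?thesis by (simp add: j h_outside)
    next
      case (Suc c)
      have "h j * LL 0 c = LL 0 c * h j"
        by (rule commute_LL, rule L_far) (use j Suc in auto)
      moreover have "h j * (L j * L (j + 1)) = L j * L (j + 1) * h j"
        by (rule h_L_pair) (use j Suc.prems in simp)
      ultimately show ?thesis using comm_mult[of "h j" "LL 0 c" "L j * L (j + 1)"]
        by (simp add: j Suc LL_Suc mult.assoc)
    qed
  qed
qed auto

text \<open>The block of the first \<open>a\<close> strands passes over the next \<open>b\<close>,
  beginning at the bottom with its rightmost strand.\<close>

fun ht :: "nat \<Rightarrow> nat \<Rightarrow> 'a" where
  "ht 0 b = 1"
| "ht (Suc a) b = ht a b * tau a b"

definition ft :: "nat \<Rightarrow> nat \<Rightarrow> 'a" where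
  "ft a b = ht b a * ht a b"

lemma commute_ht:
  assumes "\<And>i. 0 < i \<Longrightarrow> i < a + b \<Longrightarrow> x * h i = h i * x"
  shows "x * ht a b = ht a b * x"
  using assms
proof (induction a)
  case (Suc a)
  have "x * ht a b = ht a b * x" by (rule Suc.IH, rule Suc.prems) auto
  moreover have "x * tau a b = tau a b * x" by (rule commute_tau, rule Suc.prems) auto
  ultimately show ?case using comm_mult by simp
qed auto

lemma ht_h_right:
  assumes "a + b \<le> n" "0 < j" "j < b"
  shows "ht a b * h (a + j) = h j * ht a b"
  using assms
proof (induction a)
  case (Suc a)
  have "tau a b * h (Suc (a + j)) = h (a + j) * tau a b" by (rule tau_h) (use Suc.prems in auto)
  thus ?case using Suc by (simp add: mult.assoc) (simp add: mult.assoc[symmetric])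
qed auto

lemma ht_h_left:
  assumes "a + b \<le> n" "0 < i" "i < a"
  shows "ht a b * h i = h (b + i) * ht a b"
  using assms
proof (induction a)
  case (Suc a)
  show ?case
  proof (cases "i < a")
    case True
    hence "h i * tau a b = tau a b * h i" by (intro tau_far) auto
    hence "ht (Suc a) b * h i = ht a b * h i * tau a b" by (simp add: mult.assoc)
    thus ?thesis using Suc True by (simp add: mult.assoc)
  next
    case False
    with Suc.prems have "i = a" by simp
    with Suc.prems obtain c where c: "a = Suc c" "i = Suc c" by (cases a) auto
    have "tau c b * (tau (Suc c) b * h (Suc c)) = h (c + b + 1) * (tau c b * tau (Suc c) b)"
      by (rule tau_tau_h) (use Suc.prems c in auto)
    moreover have "h (c + b + 1) * ht c b = ht c b * h (c + b + 1)"
      by (rule commute_ht, rule far') auto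
    ultimately have "ht (Suc a) b * h i = h (c + b + 1) * ht c b * (tau c b * tau (Suc c) b)"
      by (simp add: c mult.assoc)
    thus ?thesis by (simp add: c mult.assoc add.commute)
  qed
qed auto

text \<open>One half twist carries a generator inside a block to the other side, the next one
  carries it back. The seam \<open>a\<close> is excluded: a half twist separates the two strands
  that meet there.\<close>

lemma ft_h:
  assumes "a + b = n" "i \<noteq> a"
  shows "ft a b * h i = h i * ft a b"
proof -
  have compose: "ft a b * h i = h i * ft a b" if "ht a b * h i = h j * ht a b" "ht b a * h j = h i * ht b a" for j
    unfolding ft_def mult.assoc that(1) by (simp only: mult.assoc[symmetric] that(2))
  consider "i = 0 \<or> i \<ge> n" | "0 < i" "i < a" | "a < i" "i < n"
    using assms(2) by linarith
  thus ?thesis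
  proof cases
    case 2
    thus ?thesis using assms(1) by (intro compose[of "b + i"] ht_h_left ht_h_right) auto
  next
    case 3
    then obtain j where "0 < j" "j < b" "i = a + j"
      using assms(1) less_imp_add_positive[of a i] by auto
    thus ?thesis using assms(1) ht_h_right[of a b j] ht_h_left[of b a j] by (intro compose[of j]) auto
  qed (simp add: h_outside)
qed

fun rtau :: "nat \<Rightarrow> nat \<Rightarrow> 'a" where
  "rtau p 0 = 1"
| "rtau p (Suc a) = rtau p a * sg (p + a + 1)"

lemma L_tau: "L (Suc (p + a)) = tau p a * (L (Suc p) * rtau p a)"
  by (induction a) (auto simp: mult.assoc)

text \<open>The grid of crossings is built up here by the strands of the right block, while the
  recursion of \<open>ht\<close> uses those of the left block.\<close>

lemma ht_Suc_right:
  assumes "a + Suc b \<le> n"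
  shows "ht a (Suc b) = rtau b a * ht a b"
  using assms
proof (induction a)
  case (Suc a)
  have "sg (a + b + 1) * ht a b = ht a b * sg (a + b + 1)"
    by (rule commute_ht, rule sg_h_far) auto
  thus ?case using Suc by (simp add: mult.assoc add.commute) (simp add: mult.assoc[symmetric])
qed auto

lemma sg_intertwine: "x * h i = h j * x \<Longrightarrow> x * sg i = sg j * x"
  by (simp add: sg_def algebra_simps)

text \<open>The loop of strand \<open>a + k + 1\<close> around everything to its left is a loop
  around the first \<open>a\<close> strands followed by one around the other \<open>k\<close>. The
  latter is \<open>tau a k * rtau a k\<close>; the half twist carries it to the loop of strand
  \<open>k + 1\<close>, and \<open>L_tau\<close> then enlarges this loop by \<open>a\<close>
  strands.\<close>

lemma ft_L:
  assumes "a + Suc k \<le> n"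
  shows "ft a (Suc k) * (tau a k * rtau a k) = ft a k * L (Suc (a + k))"
proof -
  have sg: "ht a (Suc k) * sg (a + j) = sg j * ht a (Suc k)" if "0 < j" "j < Suc k" for j
    by (rule sg_intertwine, rule ht_h_right) (use that assms in auto)
  have tau: "ht a (Suc k) * tau a j = tau 0 j * ht a (Suc k)" if "j \<le> k" for j
    using that
  proof (induction j)
    case (Suc j)
    thus ?case using sg[of "Suc j"] by (simp add: mult.assoc[symmetric]) (simp add: mult.assoc)
  qed auto
  have rtau: "ht a (Suc k) * rtau a j = rtau 0 j * ht a (Suc k)" if "j \<le> k" for j
    using that
  proof (induction j)
    case (Suc j)
    thus ?case using sg[of "Suc j"] by (simp add: mult.assoc[symmetric]) (simp add: mult.assoc)
  qed auto
  have "ht a (Suc k) * (tau a k * rtau a k) = L (Suc k) * ht a (Suc k)"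
    using tau[OF order_refl] rtau[OF order_refl] L_tau[of 0 k]
    by (simp add: mult.assoc[symmetric]) (simp add: mult.assoc)
  hence "ft a (Suc k) * (tau a k * rtau a k) = ht k a * (tau k a * (L (Suc k) * rtau k a)) * ht a k"
    using ht_Suc_right[OF assms] by (simp add: ft_def mult.assoc)
  also have "\<dots> = ht k a * (L (Suc (a + k)) * ht a k)"
    unfolding L_tau[symmetric] by (simp add: mult.assoc add.commute)
  also have "L (Suc (a + k)) * ht a k = ht a k * L (Suc (a + k))"
    by (rule commute_ht, rule L_near[symmetric]) (use assms in auto)
  finally show ?thesis by (simp add: ft_def mult.assoc)
qed

lemma tau_absorb:
  "(\<And>i. p < i \<Longrightarrow> i \<le> p + a \<Longrightarrow> h i * x = 0) \<Longrightarrow> tau p a * x = q6 (2 * int a) \<cdot> x"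
  "(\<And>i. p < i \<Longrightarrow> i \<le> p + a \<Longrightarrow> h i * x = 0) \<Longrightarrow> rtau p a * x = q6 (2 * int a) \<cdot> x"
  by (induction a) (auto simp: mult.assoc sg_absorb(2) algebra_simps simp flip: q6_add)

text \<open>The product of the loops contains the full twist of the two blocks and the full twist
  inside the second block. A vector killed by the generators of that block absorbs the latter:
  \<open>k (k - 1)\<close> crossings with \<open>q6 2\<close> each.\<close>

lemma ft_absorb:
  assumes "a + k \<le> n" "\<And>i. a < i \<Longrightarrow> i < a + k \<Longrightarrow> h i * Q = 0"
  shows "LL a (a + k) * Q = q6 (2 * int k * (int k - 1)) \<cdot> (ft a k * Q)"
  using assms
proof (induction k arbitrary: Q)
  case 0
  have "ht a 0 = 1" by (induction a) auto
  thus ?case by (simp add: ft_def)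
next
  case (Suc k)
  have kill: "h i * (L (Suc (a + k)) * Q) = 0" if "a < i" "i < a + k" for i
    using L_near[of i "Suc (a + k)"] that Suc.prems by (simp add: mult.assoc[symmetric]) (simp add: mult.assoc)
  have "tau a k * (rtau a k * Q) = (q6 (2 * int k) * q6 (2 * int k)) \<cdot> Q"
    using tau_absorb[of a k Q] Suc.prems by simp
  moreover have "ft a k * (L (Suc (a + k)) * Q) = ft a (Suc k) * (tau a k * (rtau a k * Q))"
    using ft_L[of a k] Suc.prems by (simp flip: mult.assoc)
  ultimately have "ft a k * (L (Suc (a + k)) * Q) = q6 (4 * int k) \<cdot> (ft a (Suc k) * Q)"
    by (simp flip: q6_add)
  moreover have "LL a (a + k) * (L (Suc (a + k)) * Q) = q6 (2 * int k * (int k - 1)) \<cdot> (ft a k * (L (Suc (a + k)) * Q))"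
    by (rule Suc.IH) (use Suc.prems kill in auto)
  ultimately show ?case
    by (simp add: LL_Suc mult.assoc algebra_simps flip: q6_add)
qed

end

section \<open>Loops behind the stair-step web\<close>

context hecke_pair
begin

text \<open>The layer is centred at the seam of the two blocks: its generators are
  \<open>t + 1 - c, t + 3 - c, ..., t + c - 1\<close>.\<close>

definition C :: "nat \<Rightarrow> 'a" where "C c = CC (t + 1 - c) c"

definition Xs :: "nat \<Rightarrow> 'a" where "Xs l = prod_list (map C [1..<l])"
definition Ys :: "nat \<Rightarrow> 'a" where "Ys l = prod_list (map C (rev [1..<l]))"

definition g :: "nat \<Rightarrow> 'a" where "g l = prod_list (map C ([1..<l + 1] @ rev [1..<l]))"

lemma g_eq: "g l = Xs l * (C l * Ys l)"
  by (cases l) (auto simp: g_def Xs_def Ys_def C_def mult.assoc)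

text \<open>The form in which the larger web appears in \<open>Pg_L\<close>: everything outside the
  middle factor \<open>C (Suc l)\<close> is already present around a loop that has travelled through
  \<open>C l\<close>.\<close>

lemma g_Suc: "g (Suc l) = Xs l * (C l * (C (Suc l) * (C l * Ys l)))"
  by (cases l) (auto simp: g_def Xs_def Ys_def C_def mult.assoc)

lemma commute_C:
  assumes "c \<le> t" "\<And>i. t - c < i \<Longrightarrow> i < t + c \<Longrightarrow> x * h i = h i * x"
  shows "x * C c = C c * x"
  unfolding C_def by (rule commute_CC) (use assms in auto)

lemma commute_Xs_Ys:
  assumes "l \<le> t" "\<And>i. t - l + 1 < i \<Longrightarrow> i + 1 < t + l \<Longrightarrow> x * h i = h i * x"
  shows "x * Xs l = Xs l * x" "x * Ys l = Ys l * x"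
proof -
  have "x * C c = C c * x" if "c < l" for c
    by (rule commute_C, use that assms in simp, rule assms) (use that assms in auto)
  thus "x * Xs l = Xs l * x" "x * Ys l = Ys l * x"
    unfolding Xs_def Ys_def by (auto intro!: commute_prod_list)
qed

lemma commute_g:
  assumes "l \<le> t" "\<And>i. t - l < i \<Longrightarrow> i < t + l \<Longrightarrow> x * h i = h i * x"
  shows "x * g l = g l * x"
  unfolding g_eq
  by (intro comm_mult commute_Xs_Ys commute_C) (use assms in auto)

lemma V_Xs: "P * Xs l \<in> V"
proof -
  have "v * prod_list (map C xs) \<in> V" if "v \<in> V" for v xs
    using that by (induction xs arbitrary: v) (auto simp: mult.assoc[symmetric] C_def V_CC)
  thus ?thesis using P_in_V by (simp add: Xs_def)
qed

lemma Pg_kill: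
  assumes "l \<le> t" "i < t - l \<or> t + l < i"
  shows "P * g l * h i = 0"
proof -
  have "h i * g l = g l * h i" by (rule commute_g[OF assms(1)], rule far') (use assms in auto)
  hence "P * g l * h i = P * h i * g l" by (simp add: mult.assoc)
  moreover have "P * h i = 0" by (rule kill_P) (use assms in auto)
  ultimately show ?thesis by simp
qed

lemma L_absorb: "(\<And>i. 0 < i \<Longrightarrow> i < Suc k \<Longrightarrow> x * h i = 0) \<Longrightarrow> x * L (Suc k) = q6 (4 * int k) \<cdot> x"
proof (induction k)
  case (Suc k)
  have "x * sg (Suc k) = q6 2 \<cdot> x" by (rule sg_absorb, rule Suc.prems) auto
  moreover have "x * L (Suc k) = q6 (4 * int k) \<cdot> x" by (rule Suc.IH, rule Suc.prems) auto
  ultimately have "x * L (Suc (Suc k)) = (q6 2 * q6 (4 * int k) * q6 2) \<cdot> x"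
    by (simp add: mult.assoc[symmetric])
  thus ?case by (simp add: algebra_simps flip: q6_add)
qed auto

lemma LL_absorb: "(\<And>i. 0 < i \<Longrightarrow> i < k \<Longrightarrow> x * h i = 0) \<Longrightarrow> x * LL 0 k = q6 (2 * int k * (int k - 1)) \<cdot> x"
proof (induction k)
  case (Suc k)
  have "x * LL 0 k = q6 (2 * int k * (int k - 1)) \<cdot> x" by (rule Suc.IH, rule Suc.prems) auto
  moreover have "x * L (Suc k) = q6 (4 * int k) \<cdot> x" by (rule L_absorb, rule Suc.prems) auto
  ultimately show ?case by (simp add: LL_Suc mult.assoc[symmetric]) (simp add: algebra_simps flip: q6_add)
qed auto

text \<open>Each turnback takes its own pair of loops. The exponent is the sum of the values
  \<open>2 * i - 10\<close> of \<open>V_L_pair\<close> over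
  \<open>i = p + 1, p + 3, ..., p + 2 * l - 1\<close>.\<close>

lemma V_CC_LL:
  assumes "v \<in> V" "p + 2 * l \<le> n"
  shows "v * (CC (Suc p) l * LL p (p + 2 * l)) = q6 (2 * int l * (int p + int l - 5)) \<cdot> (v * CC (Suc p) l)"
  using assms
proof (induction l)
  case (Suc l)
  define i where "i = Suc (p + 2 * l)"
  have LL: "LL p (p + 2 * Suc l) = LL p (p + 2 * l) * (L i * L (i + 1))"
    by (simp add: LL_Suc i_def mult.assoc)
  have CC: "CC (Suc p) (Suc l) = CC (Suc p) l * h i"
    by (simp add: CC_Suc i_def)
  have comm: "h i * LL p (p + 2 * l) = LL p (p + 2 * l) * h i"
    by (rule commute_LL, rule L_far) (auto simp: i_def)
  have "v * (CC (Suc p) (Suc l) * LL p (p + 2 * Suc l)) =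
     v * (CC (Suc p) l * ((h i * LL p (p + 2 * l)) * (L i * L (i + 1))))"
    unfolding LL CC by (simp add: mult.assoc)
  also have "\<dots> = v * (CC (Suc p) l * LL p (p + 2 * l)) * (h i * (L i * L (i + 1)))"
    unfolding comm by (simp add: mult.assoc)
  also have "\<dots> = q6 (2 * int l * (int p + int l - 5)) \<cdot> (v * CC (Suc p) l * (h i * (L i * L (i + 1))))"
    using Suc by simp
  also have "v * CC (Suc p) l * (h i * (L i * L (i + 1))) = q6 (2 * int i - 10) \<cdot> (v * CC (Suc p) l * h i)"
    by (rule V_L_pair[OF V_CC[OF Suc.prems(1)]]) (use Suc.prems in \<open>auto simp: i_def\<close>)
  finally show ?case
    by (simp add: CC mult.assoc i_def algebra_simps flip: q6_add)
qed auto

text \<open>The product of loops commutes with the lower half \<open>Ys l\<close> and is then split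
  at \<open>t - l\<close>. The loops of the strands left of the web move up to the clasp and are
  absorbed; those of the \<open>2 * l\<close> strands of the web are taken in pairs by the layer
  \<open>C l\<close>.\<close>

lemma Pg_LL:
  assumes "l \<le> t" "l \<le> s"
  shows "P * g l * LL 0 (t + l) =
    q6 (2 * int (t - l) * (int (t - l) - 1) + 2 * int l * (int t - 5)) \<cdot> (P * g l)"
proof -
  have C: "C l = CC (Suc (t - l)) l" using assms by (simp add: C_def Suc_diff_le)
  have tl: "t - l + 2 * l = t + l" using assms by simp
  have "LL 0 (t + l) * Ys l = Ys l * LL 0 (t + l)"
    by (rule commute_Xs_Ys, fact, rule h_LL[symmetric]) (use assms n_eq in auto)
  hence "P * g l * LL 0 (t + l) = P * (Xs l * (C l * (LL 0 (t + l) * Ys l)))"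
    by (simp add: g_eq mult.assoc)
  also have "\<dots> = P * ((Xs l * (C l * LL 0 (t - l))) * (LL (t - l) (t + l) * Ys l))"
    by (subst LL_append[of 0 "t - l" "t + l"]) (use assms in \<open>auto simp: mult.assoc\<close>)
  also have "Xs l * (C l * LL 0 (t - l)) = LL 0 (t - l) * (Xs l * C l)"
  proof -
    have far: "h i * LL 0 (t - l) = LL 0 (t - l) * h i" if "t - l < i" for i
      by (rule commute_LL, rule L_far) (use that in auto)
    have "LL 0 (t - l) * (Xs l * C l) = (Xs l * C l) * LL 0 (t - l)"
      by (intro comm_mult commute_Xs_Ys commute_C far[symmetric]) (use assms in auto)
    thus ?thesis by (simp add: mult.assoc)
  qed
  also have "P * (LL 0 (t - l) * (Xs l * C l) * (LL (t - l) (t + l) * Ys l)) =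
     (P * LL 0 (t - l)) * ((Xs l * C l) * (LL (t - l) (t + l) * Ys l))"
    by (simp add: mult.assoc)
  also have "P * LL 0 (t - l) = q6 (2 * int (t - l) * (int (t - l) - 1)) \<cdot> P"
    by (rule LL_absorb, rule kill_P) (use assms in auto)
  also have "(q6 (2 * int (t - l) * (int (t - l) - 1)) \<cdot> P) * ((Xs l * C l) * (LL (t - l) (t + l) * Ys l)) =
    q6 (2 * int (t - l) * (int (t - l) - 1)) \<cdot> (P * Xs l * (C l * LL (t - l) (t + l)) * Ys l)"
    by (simp add: mult.assoc)
  also have "P * Xs l * (C l * LL (t - l) (t + l)) = q6 (2 * int l * (int (t - l) + int l - 5)) \<cdot> (P * Xs l * C l)"
    using V_CC_LL[OF V_Xs[of l], of "t - l" l] assms n_eq unfolding C tl by simp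
  finally show ?thesis
    using assms by (simp add: g_eq mult.assoc of_nat_diff algebra_simps flip: q6_add)
qed

text \<open>The second coefficient of \<open>jw_L\<close>: the weight of enlarging the web when
  \<open>a\<close> strands of the left block are still free. It vanishes when none is left.\<close>

definition \<beta> :: "nat \<Rightarrow> K" where "\<beta> a = q6 (- 3 - 2 * int a) * (1 - q6 (6 * int a))"

lemma \<beta>_0 [simp]: "\<beta> 0 = 0"
  by (simp add: \<beta>_def)

text \<open>\<open>V_CC_L\<close> carries the loop through \<open>C l\<close> to strand
  \<open>a + 1\<close>, the first behind the \<open>a = t - l\<close> free strands of the left
  block. A clasp may be inserted on the free strands because nothing separates them from
  \<open>P\<close>, and \<open>jw_L\<close> applies. Its scalar term leaves a zigzag that
  straightens; in the other term \<open>h a\<close> completes \<open>CC (a + 2) l\<close> to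
  \<open>C (Suc l)\<close>. The inserted clasp stays on the right until
  \<open>N_rec\<close>.\<close>

lemma Pg_L:
  assumes "l \<le> t" "l < s"
  shows "P * g l * L (t + l + 1) = q6 (2 * int l) \<cdot>
    (q6 (4 * int (t - l)) \<cdot> (P * g l) + \<beta> (t - l) \<cdot> (P * g (Suc l) * jw 0 (t - l)))"
proof -
  define a where "a = t - l"
  have C: "C l = CC (Suc a) l" using assms by (simp add: a_def C_def Suc_diff_le)
  define r where "r = P * Xs l * C l"
  have VX: "P * Xs l \<in> V" by (rule V_Xs)
  have idx: "Suc a + 2 * l = t + l + 1" "t + l + 1 \<le> n" "a < n" using assms n_eq by (auto simp: a_def)
  have "L (t + l + 1) * Ys l = Ys l * L (t + l + 1)"
    by (rule commute_Xs_Ys, fact, rule L_near[symmetric]) (use idx in auto)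
  hence "P * g l * L (t + l + 1) = P * Xs l * (C l * L (t + l + 1)) * Ys l"
    by (simp add: g_eq mult.assoc)
  also have "P * Xs l * (C l * L (t + l + 1)) = q6 (2 * int l) \<cdot> (r * L (Suc a) * (CC (a + 2) l * C l))"
    using V_CC_L[OF VX, of "Suc a" l] unfolding idx C r_def using idx by (simp add: mult.assoc)
  also have "r * L (Suc a) = q6 (4 * int a) \<cdot> r + \<beta> a \<cdot> (r * (h a * jw 0 a))"
  proof -
    have "r * h i = 0" if "0 < i" "i < a" for i
    proof -
      have "h i * (Xs l * C l) = (Xs l * C l) * h i"
        by (intro comm_mult commute_Xs_Ys commute_C far') (use assms that in \<open>auto simp: a_def\<close>)
      hence "r * h i = P * h i * (Xs l * C l)" by (simp add: r_def mult.assoc)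
      thus ?thesis using kill_P[of i] that by (simp add: a_def)
    qed
    hence r: "r * jw 0 a = r" by (intro absorb_jw) auto
    have "r * L (Suc a) = r * (jw 0 a * L (Suc a))" using r by (simp flip: mult.assoc)
    also have "\<dots> = q6 (4 * int a) \<cdot> (r * jw 0 a) + \<beta> a \<cdot> (r * jw 0 a * (h a * jw 0 a))"
      unfolding jw_L[OF idx(3)] \<beta>_def by (simp add: distrib_left mult.assoc)
    finally show ?thesis by (simp only: r)
  qed
  also have "(q6 (4 * int a) \<cdot> r + \<beta> a \<cdot> (r * (h a * jw 0 a))) * (CC (a + 2) l * C l)
     = q6 (4 * int a) \<cdot> (r * (CC (a + 2) l * C l)) + \<beta> a \<cdot> (r * (h a * (jw 0 a * (CC (a + 2) l * C l))))"
    by (simp add: distrib_right mult.assoc)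
  also have "r * (CC (a + 2) l * C l) = P * Xs l * C l"
    using V_CC_tl[OF VX, of "Suc a" l] idx unfolding r_def C by (simp add: mult.assoc)
  also have "jw 0 a * (CC (a + 2) l * C l) = CC (a + 2) l * C l * jw 0 a"
    unfolding C by (intro comm_mult commute_CC jw_commute[symmetric] far') auto
  finally have "P * g l * L (t + l + 1) = q6 (2 * int l) \<cdot>
     (q6 (4 * int a) \<cdot> (P * g l) + \<beta> a \<cdot> (r * (h a * (CC (a + 2) l * (C l * (jw 0 a * Ys l))))))"
    by (simp add: g_eq distrib_right mult.assoc)
  also have "jw 0 a * Ys l = Ys l * jw 0 a"
    by (intro commute_Xs_Ys jw_commute[symmetric] far') (use assms in \<open>auto simp: a_def\<close>)
  also have "\<beta> a \<cdot> (r * (h a * (CC (a + 2) l * (C l * (Ys l * jw 0 a))))) = \<beta> a \<cdot> (P * g (Suc l) * jw 0 a)"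
  proof (cases "a = 0")
    case False
    hence "C (Suc l) = h a * CC (a + 2) l"
      unfolding C_def CC_Suc_left[symmetric] using assms by (simp add: a_def)
    thus ?thesis by (simp add: g_Suc r_def mult.assoc)
  qed auto
  finally show ?thesis by (simp add: a_def)
qed

text \<open>An intermediate stage: the web has size \<open>l\<close>, and the last \<open>r\<close>
  loops are still to be moved through it.\<close>

definition N :: "nat \<Rightarrow> nat \<Rightarrow> 'a" where
  "N l r = P * g l * LL (n - r) n * P"

definition W :: "nat \<Rightarrow> 'a" where "W l = P * g l * P"

text \<open>The two loops differ by \<open>e\<close> crossings on either side. Those on the left are
  absorbed by \<open>P * g l\<close>, those on the right by \<open>Z\<close>, with
  \<open>q6 2\<close> each.\<close>

lemma Pg_L_shift:
  assumes "l \<le> t" "\<And>j. t + l < j \<Longrightarrow> j \<le> t + l + e \<Longrightarrow> h j * Z = 0"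
  shows "P * g l * (L (t + l + 1 + e) * Z) = q6 (4 * int e) \<cdot> (P * g l * (L (t + l + 1) * Z))"
  using assms(2)
proof (induction e)
  case (Suc e)
  have "P * g l * sg (t + l + 1 + e) = q6 2 \<cdot> (P * g l)"
    by (rule sg_absorb, rule Pg_kill) (use assms in auto)
  moreover have "sg (t + l + 1 + e) * Z = q6 2 \<cdot> Z"
    by (rule sg_absorb, rule Suc.prems) auto
  ultimately have "P * g l * (L (t + l + 1 + Suc e) * Z) = (q6 2 * q6 2) \<cdot> (P * g l * (L (t + l + 1 + e) * Z))"
    by (simp add: mult.assoc) (simp add: mult.assoc[symmetric])
  moreover have "P * g l * (L (t + l + 1 + e) * Z) = q6 (4 * int e) \<cdot> (P * g l * (L (t + l + 1) * Z))"
    by (rule Suc.IH, rule Suc.prems) auto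
  ultimately show ?case by (simp add: algebra_simps flip: q6_add)
qed auto

text \<open>The first of the remaining loops belongs to strand \<open>n - r\<close>, which is
  \<open>e\<close> strands away from the web. It is moved next to the web and evaluated there; the
  clasp left over by \<open>Pg_L\<close> is absorbed by the other loops and
  \<open>P\<close>.\<close>

lemma N_rec:
  assumes "l \<le> t" "l + Suc r \<le> s"
  shows "N l (Suc r) = q6 (4 * (int s - int l - int r - 1) + 2 * int l) \<cdot>
     (q6 (4 * (int t - int l)) \<cdot> N l r + \<beta> (t - l) \<cdot> N (Suc l) r)"
proof -
  define e where "e = s - l - Suc r"
  define Z where "Z = LL (n - r) n * P"
  have nr: "n - Suc r = t + l + e" "n - r = Suc (t + l + e)" "r \<le> n" "n - Suc r < n"
    using assms n_eq by (auto simp: e_def)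
  have hZ: "h j * Z = 0" if "j \<noteq> t" "j < n - r" "0 < j" for j
  proof -
    have "h j * LL (n - r) n = LL (n - r) n * h j"
      by (rule commute_LL, rule L_near) (use that in auto)
    hence "h j * Z = LL (n - r) n * (h j * P)" by (simp add: Z_def mult.assoc[symmetric])
    thus ?thesis using P_kill that by simp
  qed
  have "N l (Suc r) = P * g l * (L (t + l + 1 + e) * Z)"
    unfolding N_def LL_Suc_left[OF nr(4)] using nr by (simp add: Z_def mult.assoc)
  also have "\<dots> = q6 (4 * int e) \<cdot> (P * g l * L (t + l + 1) * Z)"
    unfolding mult.assoc[of _ "L (t + l + 1)"] by (rule Pg_L_shift) (use assms nr hZ in auto)
  also have "P * g l * L (t + l + 1) * Z = q6 (2 * int l) \<cdot>
      (q6 (4 * int (t - l)) \<cdot> (P * g l * Z) + \<beta> (t - l) \<cdot> (P * g (Suc l) * (jw 0 (t - l) * Z)))"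
    using Pg_L[of l] assms by (simp add: mult.assoc distrib_right scl_add_right)
  also have "jw 0 (t - l) * Z = Z"
    by (rule jw_absorb, rule hZ) (use nr in auto)
  finally show ?thesis
    using assms by (simp add: N_def Z_def mult.assoc e_def of_nat_diff algebra_simps flip: q6_add)
qed

text \<open>An exponent in sixths. The terms without \<open>i\<close> add up the scalars of
  \<open>r\<close> steps none of which enlarges the web; the terms with \<open>i\<close> are the
  correction when \<open>i\<close> of them do. The form is confirmed by \<open>c0\<close>,
  \<open>e1\<close> and \<open>e2\<close> in the next proof.\<close>

definition E :: "nat \<Rightarrow> nat \<Rightarrow> nat \<Rightarrow> int" where
  "E l r i = 2 * int r * (2 * (int s - int l) + int l + 2 * (int t - int l)) - 2 * int r * (int r + 1)
     - 6 * int i * int r + 6 * int i * int i - 6 * int i * (int t - int l) - 3 * int i"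

text \<open>Each of the \<open>r\<close> steps keeps the web or enlarges it. An enlargement uses up
  a free strand of the left block, whence \<open>qfall\<close>; summation over the positions of the
  enlargements among the steps follows the q-Pascal rule, whence \<open>qbin\<close>.\<close>

lemma N_expand:
  assumes "l \<le> t" "l + r \<le> s"
  shows "N l r = (\<Sum>i\<le>r. (q6 (E l r i) * qfall (t - l) i * qbin r i) \<cdot> W (l + i))"
  using assms
proof (induction r arbitrary: l)
  case 0
  show ?case by (simp add: N_def W_def E_def)
next
  case (Suc r)
  define A where "A = q6 (4 * (int s - int l - int r - 1) + 2 * int l + 4 * (int t - int l))"
  define B where "B = q6 (4 * (int s - int l - int r - 1) + 2 * int l) * \<beta> (t - l)"
  define c where "c l r i = q6 (E l r i) * qfall (t - l) i * qbin r i" for l r i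
  have c0: "c l (Suc r) 0 = A * c l r 0"
    by (simp add: c_def A_def E_def algebra_simps flip: q6_add)
  have cSuc: "c l (Suc r) (Suc i) = A * c l r (Suc i) + B * c (Suc l) r i" for i
  proof -
    define F where "F = (1 - q6 (6 * int (t - l))) * qfall (t - l - 1) i"
    define u v w x y where "u = q6 (4 * (int s - int l - int r - 1) + 2 * int l)" and "v = q6 (E l r (Suc i))"
      and "w = q6 (E (Suc l) r i)" and "x = q6 (4 * (int t - int l))" and "y = q6 (- 3 - 2 * int (t - l))"
    \<comment> \<open>The extra \<open>6 * int (Suc i)\<close> is the power of \<open>q\<close> in
      the q-Pascal rule.\<close>
    have e1: "q6 (E l (Suc r) (Suc i) + 6 * int (Suc i)) = u * x * v"
      by (simp add: E_def u_def x_def v_def algebra_simps flip: q6_add)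
    have e2: "q6 (E l (Suc r) (Suc i)) = u * y * w"
      using Suc.prems by (simp add: E_def u_def y_def w_def algebra_simps of_nat_diff flip: q6_add)
    have AB: "A = u * x" "B = u * (y * (1 - q6 (6 * int (t - l))))"
      by (simp_all only: A_def B_def u_def x_def y_def \<beta>_def q6_add mult.assoc)
    have "c l (Suc r) (Suc i) = q6 (E l (Suc r) (Suc i) + 6 * int (Suc i)) * F * qbin r (Suc i) + q6 (E l (Suc r) (Suc i)) * F * qbin r i"
      by (simp add: c_def F_def q6_add algebra_simps del: of_nat_Suc)
    also have "\<dots> = A * c l r (Suc i) + B * c (Suc l) r i"
      unfolding e1 unfolding e2 AB
      by (simp add: c_def F_def v_def[symmetric] w_def[symmetric] algebra_simps del: of_nat_Suc)
    finally show ?thesis .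
  qed
  have IH1: "N l r = (\<Sum>i\<le>r. c l r i \<cdot> W (l + i))"
    unfolding c_def by (rule Suc.IH) (use Suc.prems in auto)
  \<comment> \<open>For \<open>l = t\<close> the hypothesis says nothing about \<open>Suc l\<close>;
    there the factor \<open>\<beta> 0 = 0\<close> settles the case.\<close>
  have IH2: "\<beta> (t - l) \<cdot> N (Suc l) r = \<beta> (t - l) \<cdot> (\<Sum>i\<le>r. c (Suc l) r i \<cdot> W (Suc l + i))"
  proof (cases "l = t")
    case False
    thus ?thesis unfolding c_def by (subst Suc.IH) (use Suc.prems in auto)
  qed simp
  have "(\<Sum>i\<le>Suc r. c l (Suc r) i \<cdot> W (l + i))
    = (A * c l r 0) \<cdot> W l + (\<Sum>i\<le>r. (A * c l r (Suc i)) \<cdot> W (l + Suc i)) + (\<Sum>i\<le>r. (B * c (Suc l) r i) \<cdot> W (Suc l + i))"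
    by (simp add: sum.atMost_Suc_shift c0 cSuc scl_add_left sum.distrib del: sum.atMost_Suc)
  also have "(A * c l r 0) \<cdot> W l + (\<Sum>i\<le>r. (A * c l r (Suc i)) \<cdot> W (l + Suc i)) = (\<Sum>i\<le>Suc r. (A * c l r i) \<cdot> W (l + i))"
    by (simp add: sum.atMost_Suc_shift del: sum.atMost_Suc)
  also have "\<dots> = (\<Sum>i\<le>r. (A * c l r i) \<cdot> W (l + i))"
    by (simp add: c_def qbin_eq_0)
  also have "\<dots> = A \<cdot> N l r" by (simp add: IH1 scl_sum_right)
  also have "(\<Sum>i\<le>r. (B * c (Suc l) r i) \<cdot> W (Suc l + i)) = q6 (4 * (int s - int l - int r - 1) + 2 * int l) \<cdot> \<beta> (t - l) \<cdot> N (Suc l) r"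
    unfolding IH2 B_def by (simp add: scl_sum_right mult.assoc)
  also have "A \<cdot> N l r + q6 (4 * (int s - int l - int r - 1) + 2 * int l) \<cdot> \<beta> (t - l) \<cdot> N (Suc l) r = N l (Suc r)"
  proof -
    have "A = q6 (4 * (int s - int l - int r - 1) + 2 * int l) * q6 (4 * (int t - int l))"
      by (simp only: A_def q6_add mult.assoc)
    thus ?thesis by (subst N_rec) (use Suc.prems in \<open>auto simp: scl_add_right\<close>)
  qed
  finally show ?case by (simp add: c_def)
qed

end

subsection \<open>Iterating the full twist\<close>

text \<open>The weight with which one full twist takes \<open>W (d - k)\<close> to
  \<open>W (d - k')\<close>, up to a power of \<open>q\<close> that is the same for all
  terms.\<close>

definition step_coeff :: "nat \<Rightarrow> nat \<Rightarrow> nat \<Rightarrow> K" where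
  "step_coeff \<delta> k k' = q6 (6 * (int k' * (int k' + int \<delta>) + int k') + 3 * (int k - int k')) *
     (qpoch (k + \<delta>) / qpoch (k' + \<delta>)) * (qpoch k / (qpoch k' * qpoch (k - k')))"

lemma twist_coeff_0: "twist_coeff d \<delta> 0 [d] = 1"
  by (simp add: twist_coeff_def qmultinomial_def)

text \<open>The weights telescope: the q-factorials of \<open>k ! m\<close> and
  \<open>k ! m + \<delta>\<close> in the denominator of the shorter tuple cancel against the
  numerators of the new step.\<close>

lemma twist_coeff_Suc:
  assumes "length k = m + 1" "k ! 0 = d"
  shows "twist_coeff d \<delta> (Suc m) (k @ [k']) = twist_coeff d \<delta> m k * step_coeff \<delta> (k ! m) k'"
proof -
  have nth: "(k @ [k']) ! i = k ! i" if "i \<le> m" for i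
    using that assms by (simp add: nth_append)
  have last: "(k @ [k']) ! Suc m = k'"
    using assms by (simp add: nth_append)
  have sum: "(\<Sum>i=1..Suc m. (k @ [k']) ! i * ((k @ [k']) ! i + \<delta>) + (k @ [k']) ! i) =
    (\<Sum>i=1..m. k ! i * (k ! i + \<delta>) + k ! i) + (k' * (k' + \<delta>) + k')"
    using nth last by (simp cong: sum.cong_simp)
  have map: "map (\<lambda>i. (k @ [k']) ! i - (k @ [k']) ! (i + 1)) [0..<Suc m] = map (\<lambda>i. k ! i - k ! (i + 1)) [0..<m] @ [k ! m - k']"
    using nth last by simp
  have prod: "prod_list (map qpoch (map (\<lambda>i. (k @ [k']) ! i - (k @ [k']) ! (i + 1)) [0..<Suc m] @ [k'])) =
     prod_list (map qpoch (map (\<lambda>i. k ! i - k ! (i + 1)) [0..<m])) * qpoch (k ! m - k') * qpoch k'"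
    unfolding map by (simp add: mult.assoc)
  have nz: "prod_list (map qpoch xs) \<noteq> 0" for xs
    by (induction xs) auto
  define S where "S = (\<Sum>i=1..m. k ! i * (k ! i + \<delta>) + k ! i)"
  define R where "R = prod_list (map qpoch (map (\<lambda>i. k ! i - k ! (i + 1)) [0..<m]))"
  have R: "R \<noteq> 0" unfolding R_def by (rule nz)
  have q: "q6 (6 * int (S + (k' * (k' + \<delta>) + k'))) * q6 (3 * (int d - int k')) =
    q6 (6 * int S) * q6 (3 * (int d - int (k ! m))) * q6 (6 * (int k' * (int k' + int \<delta>) + int k') + 3 * (int (k ! m) - int k'))"
    by (simp add: algebra_simps flip: q6_add)
  show ?thesis
    unfolding twist_coeff_def qmultinomial_def sum last prod nth[OF le0] assms(2) S_def[symmetric] q step_coeff_def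
    using R by (simp add: R_def[symmetric] field_simps)
qed

lemma tuples_0: "tuples d 0 = {[d]}"
  by (auto simp: tuples_def length_Suc_conv)

lemma finite_tuples: "finite (tuples d m)"
proof -
  have "k ! i \<le> d" if "k \<in> tuples d m" "i \<le> m" for k i
    using that(2)
  proof (induction i)
    case (Suc i)
    hence "k ! (i + 1) \<le> k ! i" "k ! i \<le> d" using that by (auto simp: tuples_def)
    thus ?case by simp
  qed (use that in \<open>auto simp: tuples_def\<close>)
  hence "tuples d m \<subseteq> {k. set k \<subseteq> {..d} \<and> length k = m + 1}"
    by (auto simp: tuples_def in_set_conv_nth)
  thus ?thesis by (rule finite_subset) (rule finite_lists_length_eq, simp)
qed

lemma tuples_last_le: "k \<in> tuples d m \<Longrightarrow> k ! m \<le> d"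
proof -
  assume k: "k \<in> tuples d m"
  have "k ! i \<le> d" if "i \<le> m" for i
    using that
  proof (induction i)
    case (Suc i)
    hence "k ! (i + 1) \<le> k ! i" "k ! i \<le> d" using k by (auto simp: tuples_def)
    thus ?case by simp
  qed (use k in \<open>auto simp: tuples_def\<close>)
  thus ?thesis by blast
qed

lemma sum_tuples_Suc:
  "(\<Sum>k\<in>tuples d (Suc m). f k) = (\<Sum>k\<in>tuples d m. \<Sum>k'\<le>k ! m. f (k @ [k']))" for f :: "_ \<Rightarrow> 'b :: comm_monoid_add"
proof -
  have "(\<Sum>k\<in>tuples d m. \<Sum>k'\<le>k ! m. f (k @ [k'])) = (\<Sum>(k, k')\<in>Sigma (tuples d m) (\<lambda>k. {..k ! m}). f (k @ [k']))"
    by (subst sum.Sigma) (auto simp: finite_tuples)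
  also have "\<dots> = (\<Sum>k\<in>tuples d (Suc m). f k)"
  proof (rule sum.reindex_bij_witness[of _ "\<lambda>k. (butlast k, last k)" "\<lambda>(k, k'). k @ [k']"])
    fix k assume k: "k \<in> tuples d (Suc m)"
    hence ne: "k \<noteq> []" by (auto simp: tuples_def)
    have last: "last k = k ! Suc m" using k ne by (simp add: tuples_def last_conv_nth)
    show "(case (butlast k, last k) of (k, k') \<Rightarrow> k @ [k']) = k" using ne by simp
    show "(butlast k, last k) \<in> Sigma (tuples d m) (\<lambda>k. {..k ! m})"
      using k last by (auto simp: tuples_def nth_butlast)
  next
    fix p assume "p \<in> Sigma (tuples d m) (\<lambda>k. {..k ! m})"
    thus "(case p of (k, k') \<Rightarrow> k @ [k']) \<in> tuples d (Suc m)"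
      by (auto simp: tuples_def nth_append less_Suc_eq)
  qed auto
  finally show ?thesis by simp
qed

context hecke_pair
begin

lemma ft_P_commute: "ft t s * P = P * ft t s"
  unfolding P_def by (intro comm_mult jw_commute ft_h) (auto simp: n_eq)

text \<open>On \<open>P\<close> the twist is \<open>LL t n\<close> up to a scalar, and
  \<open>LL 0 t\<close> is a scalar. Inserting the latter completes the product to
  \<open>LL 0 n\<close>, which can be cut at \<open>t + l\<close> instead of \<open>t\<close>;
  \<open>Pg_LL\<close> evaluates the first part, and the second part gives
  \<open>N l (s - l)\<close>.\<close>

lemma g_ft:
  assumes "l \<le> t" "l \<le> s"
  shows "W l * ft t s = q6 (2 * int (t - l) * (int (t - l) - 1) + 2 * int l * (int t - 5)
     - 2 * int s * (int s - 1) - 2 * int t * (int t - 1)) \<cdot> N l (s - l)"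
proof -
  have "ht t 0 = 1" by (induction t) auto
  hence "LL 0 t * P = q6 (2 * int t * (int t - 1)) \<cdot> P"
    using ft_absorb[of 0 t P] P_kill n_eq by (simp add: ft_def)
  hence P: "P = q6 (- (2 * int t * (int t - 1))) \<cdot> (LL 0 t * P)"
    by (simp flip: q6_add)
  have "LL t n * P = q6 (2 * int s * (int s - 1)) \<cdot> (ft t s * P)"
    using ft_absorb[of t s P] P_kill n_eq by simp
  hence ft: "ft t s * P = q6 (- (2 * int s * (int s - 1))) \<cdot> (LL t n * P)"
    by (simp flip: q6_add)
  have "W l * ft t s = P * g l * (ft t s * P)"
    by (simp add: W_def mult.assoc ft_P_commute)
  also have "\<dots> = q6 (- (2 * int s * (int s - 1))) \<cdot> (P * g l * (LL t n * P))"
    by (simp add: ft)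
  also have "LL t n * P = q6 (- (2 * int t * (int t - 1))) \<cdot> (LL t n * LL 0 t * P)"
    by (subst P) (simp add: mult.assoc)
  also have "LL t n * LL 0 t = LL 0 t * LL t n"
    by (rule LL_LL_commute) (simp_all add: n_eq)
  also have "\<dots> = LL 0 (t + l) * LL (t + l) n"
    using LL_append[of 0 t n] LL_append[of 0 "t + l" n] assms n_eq by simp
  also have "P * g l * (q6 (- (2 * int t * (int t - 1))) \<cdot> (LL 0 (t + l) * LL (t + l) n * P)) =
    q6 (- (2 * int t * (int t - 1))) \<cdot> (P * g l * LL 0 (t + l) * (LL (t + l) n * P))"
    by (simp add: mult.assoc)
  also have "P * g l * LL 0 (t + l) * (LL (t + l) n * P) =
    q6 (2 * int (t - l) * (int (t - l) - 1) + 2 * int l * (int t - 5)) \<cdot> N l (s - l)"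
  proof -
    have "n - (s - l) = t + l" using assms n_eq by simp
    thus ?thesis unfolding Pg_LL[OF assms] by (simp add: N_def mult.assoc)
  qed
  finally show ?thesis
    by (simp add: algebra_simps flip: q6_add)
qed

text \<open>This is \<open>N_expand\<close> for \<open>r = s - l\<close>, rewritten in
  \<open>k = d - l\<close>, so that \<open>i\<close> enlargements lead to \<open>k' = k - i\<close>.
  The two orders of \<open>s\<close> and \<open>t\<close> are treated apart, but the result is the
  same: \<open>qfall\<close> times \<open>qbin\<close> is symmetric in \<open>t - l\<close> and
  \<open>s - l\<close>.\<close>

lemma W_ft:
  assumes "k \<le> min s t" "d = min s t" "\<delta> = max s t - min s t"
  shows "W (d - k) * ft t s = q6 (- (2 * int d * int (d + \<delta>)) - 6 * int d) \<cdot>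
     (\<Sum>k'\<le>k. step_coeff \<delta> k k' \<cdot> W (d - k'))"
proof -
  define l where "l = d - k"
  define A where "A = 2 * int (t - l) * (int (t - l) - 1) + 2 * int l * (int t - 5)
     - 2 * int s * (int s - 1) - 2 * int t * (int t - 1)"
  define B where "B = - (2 * int d * int (d + \<delta>)) - 6 * int d"
  have l: "l \<le> t" "l \<le> s" using assms by (auto simp: l_def)
  have coeff: "q6 A * (q6 (E l (s - l) i) * qfall (t - l) i * qbin (s - l) i) = q6 B * step_coeff \<delta> k (k - i)"
    if i: "i \<le> k" for i
  proof -
    have q: "q6 A * q6 (E l (s - l) i) = q6 B * q6 (6 * (int (k - i) * (int (k - i) + int \<delta>) + int (k - i)) + 3 * (int k - int (k - i)))"
    proof (cases "s \<le> t")
      case True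
      hence "int s = int l + int k" "int t = int l + int k + int \<delta>" "int d = int l + int k" "int (t - l) = int k + int \<delta>"
        using assms by (auto simp: l_def)
      thus ?thesis using i by (simp add: A_def B_def E_def of_nat_diff algebra_simps flip: q6_add)
    next
      case False
      hence "int t = int l + int k" "int s = int l + int k + int \<delta>" "int d = int l + int k" "int (t - l) = int k"
        using assms by (auto simp: l_def)
      thus ?thesis using i by (simp add: A_def B_def E_def of_nat_diff algebra_simps flip: q6_add)
    qed
    have qq: "qfall (t - l) i * qbin (s - l) i = (qpoch (k + \<delta>) / qpoch (k - i + \<delta>)) * (qpoch k / (qpoch (k - i) * qpoch i))"
    proof (cases "s \<le> t")
      case True
      hence "s - l = k" "t - l = k + \<delta>" using assms by (auto simp: l_def)
      thus ?thesis using i by (simp add: qfall_eq qbin_eq)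
    next
      case False
      hence "t - l = k" "s - l = k + \<delta>" using assms by (auto simp: l_def)
      thus ?thesis using i by (simp add: qfall_eq qbin_eq mult_ac)
    qed
    have "q6 A * (q6 (E l (s - l) i) * qfall (t - l) i * qbin (s - l) i) = (q6 A * q6 (E l (s - l) i)) * (qfall (t - l) i * qbin (s - l) i)"
      by (simp only: mult.assoc)
    moreover have "k - (k - i) = i" using i by simp
    ultimately show ?thesis unfolding q qq step_coeff_def by (simp only: mult.assoc)
  qed
  have "q6 A \<cdot> N l (s - l) = (\<Sum>i\<le>s - l. (q6 A * (q6 (E l (s - l) i) * qfall (t - l) i * qbin (s - l) i)) \<cdot> W (l + i))"
    by (subst N_expand) (use l in \<open>auto simp: scl_sum_right\<close>)
  \<comment> \<open>If \<open>t < s\<close>, the sum from \<open>N_expand\<close> goes beyond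
    \<open>k = t - l\<close>; the additional terms vanish through \<open>qfall\<close>, as the left
    block has no further strands.\<close>
  also have "\<dots> = (\<Sum>i\<le>k. (q6 A * (q6 (E l (s - l) i) * qfall (t - l) i * qbin (s - l) i)) \<cdot> W (l + i))"
  proof (cases "s \<le> t")
    case True
    hence "s - l = k" using assms by (auto simp: l_def)
    thus ?thesis by simp
  next
    case False
    hence "t - l = k" "k \<le> s - l" using assms by (auto simp: l_def)
    thus ?thesis by (intro sum.mono_neutral_right) (auto simp: qfall_eq_0)
  qed
  also have "\<dots> = (\<Sum>i\<le>k. (q6 B * step_coeff \<delta> k (k - i)) \<cdot> W (d - (k - i)))"
  proof (rule sum.cong[OF refl])
    fix i assume "i \<in> {..k}"
    hence i: "i \<le> k" by simp
    hence "l + i = d - (k - i)" using assms by (auto simp: l_def)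
    thus "(q6 A * (q6 (E l (s - l) i) * qfall (t - l) i * qbin (s - l) i)) \<cdot> W (l + i) =
      (q6 B * step_coeff \<delta> k (k - i)) \<cdot> W (d - (k - i))"
      by (simp only: coeff[OF i])
  qed
  also have "\<dots> = (\<Sum>k'\<le>k. (q6 B * step_coeff \<delta> k k') \<cdot> W (d - k'))"
    by (rule sum.reindex_bij_witness[of _ "\<lambda>i. k - i" "\<lambda>i. k - i"]) auto
  finally show ?thesis
    using g_ft[OF l] by (simp add: scl_sum_right A_def B_def l_def)
qed

text \<open>The twist commutes with \<open>P\<close>, so one more factor can be multiplied to the
  finished sum from the right, where \<open>W_ft\<close> applies to each term.\<close>

lemma clasped_twist:
  assumes "d = min s t" "\<delta> = max s t - min s t"
  shows "P * (ft t s ^ m * P) = q6 (- (2 * int m * int d * int (d + \<delta>)) - 6 * int m * int d) \<cdot>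
     (\<Sum>k\<in>tuples d m. twist_coeff d \<delta> m k \<cdot> W (d - k ! m))"
proof (induction m)
  case 0
  show ?case by (simp add: tuples_0 twist_coeff_0 W_def g_def)
next
  case (Suc m)
  define A where "A m = q6 (- (2 * int m * int d * int (d + \<delta>)) - 6 * int m * int d)" for m
  define B where "B = q6 (- (2 * int d * int (d + \<delta>)) - 6 * int d)"
  have "P * (ft t s ^ Suc m * P) = P * (ft t s ^ m * P) * ft t s"
    unfolding power_Suc2 by (simp add: mult.assoc ft_P_commute)
  also have "\<dots> = A m \<cdot> (\<Sum>k\<in>tuples d m. twist_coeff d \<delta> m k \<cdot> (W (d - k ! m) * ft t s))"
    unfolding Suc A_def by (simp add: sum_distrib_right)
  also have "\<dots> = A m \<cdot> (\<Sum>k\<in>tuples d m. twist_coeff d \<delta> m k \<cdot> B \<cdot> (\<Sum>k'\<le>k ! m. step_coeff \<delta> (k ! m) k' \<cdot> W (d - k')))"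
  proof -
    have "W (d - k ! m) * ft t s = B \<cdot> (\<Sum>k'\<le>k ! m. step_coeff \<delta> (k ! m) k' \<cdot> W (d - k'))" if "k \<in> tuples d m" for k
      unfolding B_def by (rule W_ft) (use tuples_last_le[OF that] assms in auto)
    thus ?thesis by (simp cong: sum.cong)
  qed
  also have "\<dots> = (A m * B) \<cdot> (\<Sum>k\<in>tuples d m. \<Sum>k'\<le>k ! m. (twist_coeff d \<delta> m k * step_coeff \<delta> (k ! m) k') \<cdot> W (d - k'))"
    by (simp add: scl_sum_right mult_ac)
  also have "(\<Sum>k\<in>tuples d m. \<Sum>k'\<le>k ! m. (twist_coeff d \<delta> m k * step_coeff \<delta> (k ! m) k') \<cdot> W (d - k')) =
    (\<Sum>k\<in>tuples d (Suc m). twist_coeff d \<delta> (Suc m) k \<cdot> W (d - k ! Suc m))"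
    unfolding sum_tuples_Suc
    by (intro sum.cong refl, subst twist_coeff_Suc) (auto simp: tuples_def nth_append)
  also have "A m * B = A (Suc m)"
    by (simp add: A_def B_def algebra_simps flip: q6_add)
  finally show ?case by (simp add: A_def)
qed

end

section \<open>Homeomorphisms of the plane and the square\<close>

text \<open>Continuity of the inverse follows from invariance of domain, in
  \<open>phomeo_homeomorphism\<close>; for the explicit maps below bijectivity is all that has to be
  checked.\<close>

definition phomeo :: "(complex \<Rightarrow> complex) \<Rightarrow> bool" where
  "phomeo f \<longleftrightarrow> continuous_on UNIV f \<and> bij f"

lemma phomeo_inj: "phomeo f \<Longrightarrow> inj f"
  by (simp add: phomeo_def bij_is_inj)

lemma phomeo_continuous: "phomeo f \<Longrightarrow> continuous_on A f"
  by (auto simp: phomeo_def intro: continuous_on_subset)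

lemma phomeo_comp: "phomeo f \<Longrightarrow> phomeo g \<Longrightarrow> phomeo (f \<circ> g)"
  unfolding phomeo_def by (auto intro!: bij_comp continuous_on_compose intro: continuous_on_subset simp del: comp_apply)

lemma phomeo_homeomorphism:
  assumes "phomeo f"
  shows "homeomorphism UNIV UNIV f (inv f)"
proof -
  obtain g where g: "homeomorphism UNIV (f ` UNIV) f g"
    using invariance_of_domain_homeomorphism[of UNIV f] assms by (auto simp: phomeo_def bij_is_inj)
  moreover have "f ` UNIV = UNIV" using assms by (simp add: phomeo_def bij_is_surj)
  moreover have "g = inv f"
  proof
    fix y
    obtain x where "y = f x" using assms by (metis bij_is_surj phomeo_def surj_def)
    thus "g y = inv f y" using g phomeo_inj[OF assms] by (simp add: homeomorphism_def)
  qed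
  ultimately show ?thesis by simp
qed

lemma phomeo_open: "phomeo f \<Longrightarrow> open S \<Longrightarrow> open (f ` S)"
  by (rule invariance_of_domain) (auto intro: phomeo_continuous inj_on_subset[OF phomeo_inj])

lemma phomeo_interior:
  assumes "phomeo f"
  shows "f ` interior S = interior (f ` S)"
proof
  show "f ` interior S \<subseteq> interior (f ` S)"
    using phomeo_open[OF assms] interior_subset by (intro interior_maximal) auto
  have "interior (f ` S) = f ` (f -` interior (f ` S))"
    using assms by (simp add: phomeo_def bij_is_surj)
  moreover have "open (f -` interior (f ` S))"
    using assms by (auto simp: phomeo_def intro!: open_vimage)
  moreover have "f -` interior (f ` S) \<subseteq> S"
    using interior_subset[of "f ` S"] inj_image_mem_iff[OF phomeo_inj[OF assms]] by blast
  ultimately show "interior (f ` S) \<subseteq> f ` interior S"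
    using interior_maximal by (metis image_mono)
qed

lemma phomeo_closed: "phomeo f \<Longrightarrow> closed S \<Longrightarrow> closed (f ` S)"
  using phomeo_open[of f "- S"] by (simp add: phomeo_def bij_image_Compl_eq closed_def)

lemma phomeo_frontier: "phomeo f \<Longrightarrow> closed S \<Longrightarrow> f ` frontier S = frontier (f ` S)"
  by (simp add: frontier_def phomeo_closed phomeo_inj image_set_diff phomeo_interior)

lemma square_eq: "square = cbox 0 (Complex 1 1)"
  by (auto simp: square_def in_cbox_complex_iff)

lemma interior_square: "interior square = {z. 0 < Re z \<and> Re z < 1 \<and> 0 < Im z \<and> Im z < 1}"
  by (auto simp: square_eq in_box_complex_iff)

lemma frontier_square: "frontier square = {z \<in> square. Re z = 0 \<or> Re z = 1 \<or> Im z = 0 \<or> Im z = 1}"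
  unfolding frontier_def interior_square closure_closed[OF closed_cbox, folded square_eq, of 0 "Complex 1 1"]
  using closed_cbox[of 0 "Complex 1 1"] unfolding square_eq[symmetric]
  by (auto simp: square_def)

lemma closed_square: "closed square"
  unfolding square_eq by (rule closed_cbox)

lemma compact_square: "compact square"
  unfolding square_eq by (rule compact_cbox)

subsection \<open>Arcs\<close>

lemma is_darc_compact: "is_darc e \<Longrightarrow> compact (carrier_of e)"
  unfolding is_darc_def by (metis arc_imp_path compact_path_image)

lemma is_darc_infinite: "is_darc e \<Longrightarrow> infinite (carrier_of e)"
  unfolding is_darc_def by (metis arc_image_uncountable countable_finite)

lemma is_darc_ends: "is_darc e \<Longrightarrow> ends e \<subseteq> carrier_of e"
  unfolding is_darc_def by (metis empty_subsetI insert_subset pathfinish_in_path_image pathstart_in_path_image)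

lemma is_darc_src_tgt: "is_darc e \<Longrightarrow> src e \<noteq> tgt e"
  unfolding is_darc_def by (metis arc_distinct_ends)

lemma is_darc_not_ends: "is_darc e \<Longrightarrow> \<not> carrier_of e \<subseteq> ends e"
  using is_darc_infinite finite_subset[of "carrier_of e" "ends e"] by auto

lemma map_darc_simps [simp]:
  "carrier_of (map_darc f e) = f ` carrier_of e" "src (map_darc f e) = f (src e)" "tgt (map_darc f e) = f (tgt e)"
  by (simp_all add: map_darc_def)

lemma map_darc_comp: "map_darc f (map_darc g e) = map_darc (f \<circ> g) e"
  by (simp add: map_darc_def image_comp)

lemma map_darc_id: "(\<And>z. z \<in> carrier_of e \<Longrightarrow> f z = z) \<Longrightarrow> ends e \<subseteq> carrier_of e \<Longrightarrow> map_darc f e = e"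
  by (cases e) (auto simp: map_darc_def)

lemma map_darc_cong: "(\<And>z. z \<in> carrier_of e \<Longrightarrow> f z = g z) \<Longrightarrow> ends e \<subseteq> carrier_of e \<Longrightarrow> map_darc f e = map_darc g e"
  by (cases e) (auto simp: map_darc_def)

lemma inj_map_darc: "inj f \<Longrightarrow> inj (map_darc f)"
  by (rule injI) (auto simp: map_darc_def inj_eq inj_image_eq_iff prod_eq_iff)

lemma is_darc_map: "is_darc e \<Longrightarrow> inj_on f (carrier_of e) \<Longrightarrow> continuous_on (carrier_of e) f \<Longrightarrow> is_darc (map_darc f e)"
proof -
  assume *: "is_darc e" "inj_on f (carrier_of e)" "continuous_on (carrier_of e) f"
  then obtain g where g: "arc g" "path_image g = carrier_of e" "pathstart g = src e" "pathfinish g = tgt e"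
    unfolding is_darc_def by auto
  have "arc (f \<circ> g)"
    using * g unfolding arc_def
    by (auto intro!: path_continuous_image comp_inj_on simp: path_image_def)
  thus ?thesis
    unfolding is_darc_def using g
    by (intro exI[of _ "f \<circ> g"]) (auto simp: path_image_compose pathstart_compose pathfinish_compose)
qed

lemma is_darc_phomeo: "is_darc e \<Longrightarrow> phomeo f \<Longrightarrow> is_darc (map_darc f e)"
  by (rule is_darc_map) (auto intro: phomeo_continuous inj_on_subset[OF phomeo_inj])

lemma crossing_map:
  assumes "inj f"
  shows "crossing (map_darc f ` E) q e' f' \<longleftrightarrow>
    (\<exists>p e g. q = f p \<and> e' = map_darc f e \<and> f' = map_darc f g \<and> crossing E p e g)"
proof
  assume *: "crossing (map_darc f ` E) q e' f'"
  then obtain e g where eg: "e \<in> E" "g \<in> E" "e' = map_darc f e" "f' = map_darc f g"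
    by (auto simp: crossing_def)
  with * obtain p where p: "q = f p" "p \<in> carrier_of e" by (auto simp: crossing_def)
  have "crossing E p e g" using * eg p assms by (auto simp: crossing_def inj_eq inj_image_mem_iff)
  thus "\<exists>p e g. q = f p \<and> e' = map_darc f e \<and> f' = map_darc f g \<and> crossing E p e g" using eg p by blast
next
  assume "\<exists>p e g. q = f p \<and> e' = map_darc f e \<and> f' = map_darc f g \<and> crossing E p e g"
  thus "crossing (map_darc f ` E) q e' f'"
    using assms inj_map_darc[OF assms] by (auto simp: crossing_def inj_eq)
qed

lemma transverse_at_map:
  assumes "transverse_at p A B" "phomeo f"
  shows "transverse_at (f p) (f ` A) (f ` B)"
proof -
  obtain U \<phi> \<psi> where U: "open U" "p \<in> U" "homeomorphism U (ball 0 1) \<phi> \<psi>" "\<phi> p = 0"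
    "\<phi> ` (U \<inter> A) = {z \<in> ball 0 1. Im z = 0}" "\<phi> ` (U \<inter> B) = {z \<in> ball 0 1. Re z = 0}"
    using assms unfolding transverse_at_def by blast
  have inj: "inj f" using assms phomeo_inj by auto
  have f: "homeomorphism (f ` U) U (inv f) f"
    using phomeo_homeomorphism[OF assms(2)]
    by (rule homeomorphism_symD[OF homeomorphism_of_subsets]) auto
  have im: "(\<phi> \<circ> inv f) ` (f ` U \<inter> f ` C) = \<phi> ` (U \<inter> C)" for C
    unfolding image_Int[OF inj, symmetric] image_comp[symmetric] image_inv_f_f[OF inj] ..
  show ?thesis
    unfolding transverse_at_def
    by (intro exI[of _ "f ` U"] exI[of _ "\<phi> \<circ> inv f"] exI[of _ "f \<circ> \<psi>"] conjI)
       (use U inj phomeo_open[OF assms(2)] homeomorphism_compose[OF f U(3)] im in auto)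
qed

subsection \<open>The local conditions on a web\<close>

text \<open>The conditions of \<open>is_web\<close> that refer neither to the square nor to the
  boundary points. They are invariant under homeomorphisms of the plane and compatible with
  gluing.\<close>

definition esys :: "darc set \<Rightarrow> (complex \<times> darc) set \<Rightarrow> bool" where
  "esys E R \<longleftrightarrow> finite E \<and> (\<forall>e\<in>E. is_darc e) \<and>
      (\<forall>e\<in>E. \<forall>f\<in>E. e \<noteq> f \<longrightarrow> finite (carrier_of e \<inter> carrier_of f) \<and>
         (\<forall>p \<in> carrier_of e \<inter> carrier_of f. p \<in> ends e \<inter> ends f \<or> crossing E p e f)) \<and>
      (\<forall>p e f. crossing E p e f \<longrightarrow>
         transverse_at p (carrier_of e) (carrier_of f) \<and>
         (\<forall>g\<in>E. p \<in> carrier_of g \<longrightarrow> g = e \<or> g = f) \<and>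
         ((p, e) \<in> R \<longleftrightarrow> (p, f) \<notin> R)) \<and>
      R \<subseteq> {(p, e). \<exists>f. crossing E p e f}"

lemma is_web_iff:
  "is_web w \<longleftrightarrow> esys (edges w) (over w) \<and>
      (\<forall>e\<in>edges w. carrier_of e \<subseteq> square \<and> carrier_of e \<inter> frontier square \<subseteq> boundary_points (bottom w) (topw w)) \<and>
      (\<forall>i<length (bottom w). valency (edges w) (bpt (length (bottom w)) i) = (case bottom w ! i of Up \<Rightarrow> (0, 1) | Down \<Rightarrow> (1, 0))) \<and>
      (\<forall>i<length (topw w). valency (edges w) (tpt (length (topw w)) i) = (case topw w ! i of Up \<Rightarrow> (1, 0) | Down \<Rightarrow> (0, 1))) \<and>
      (\<forall>p \<in> (\<Union>e\<in>edges w. ends e) - boundary_points (bottom w) (topw w). valency (edges w) p \<in> {(1, 1), (3, 0), (0, 3)})"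
  unfolding is_web_def esys_def Let_def
  by (simp only: ball_conj_distrib conj_assoc) (rule iffI; elim conjE; intro conjI; assumption)

lemma esysD:
  assumes "esys E R"
  shows "finite E" "e \<in> E \<Longrightarrow> is_darc e"
    "e \<in> E \<Longrightarrow> f \<in> E \<Longrightarrow> e \<noteq> f \<Longrightarrow> finite (carrier_of e \<inter> carrier_of f)"
    "e \<in> E \<Longrightarrow> f \<in> E \<Longrightarrow> e \<noteq> f \<Longrightarrow> p \<in> carrier_of e \<Longrightarrow> p \<in> carrier_of f \<Longrightarrow> p \<in> ends e \<inter> ends f \<or> crossing E p e f"
    "crossing E p e f \<Longrightarrow> transverse_at p (carrier_of e) (carrier_of f)"
    "crossing E p e f \<Longrightarrow> g \<in> E \<Longrightarrow> p \<in> carrier_of g \<Longrightarrow> g = e \<or> g = f"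
    "crossing E p e f \<Longrightarrow> (p, e) \<in> R \<longleftrightarrow> (p, f) \<notin> R"
    "(p, e) \<in> R \<Longrightarrow> \<exists>f. crossing E p e f"
proof -
  note A = assms[unfolded esys_def]
  have 1: "finite E" by (rule A[THEN conjunct1])
  have dd: "\<forall>e\<in>E. is_darc e" by (rule A[THEN conjunct2, THEN conjunct1])
  have 2: "\<forall>e\<in>E. \<forall>f\<in>E. e \<noteq> f \<longrightarrow> finite (carrier_of e \<inter> carrier_of f) \<and>
         (\<forall>p \<in> carrier_of e \<inter> carrier_of f. p \<in> ends e \<inter> ends f \<or> crossing E p e f)"
    by (rule A[THEN conjunct2, THEN conjunct2, THEN conjunct1])
  have 3: "\<forall>p e f. crossing E p e f \<longrightarrow>
         transverse_at p (carrier_of e) (carrier_of f) \<and>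
         (\<forall>g\<in>E. p \<in> carrier_of g \<longrightarrow> g = e \<or> g = f) \<and>
         ((p, e) \<in> R \<longleftrightarrow> (p, f) \<notin> R)"
    by (rule A[THEN conjunct2, THEN conjunct2, THEN conjunct2, THEN conjunct1])
  show "finite E" by (rule 1)
  show "e \<in> E \<Longrightarrow> is_darc e" using dd by blast
  show "e \<in> E \<Longrightarrow> f \<in> E \<Longrightarrow> e \<noteq> f \<Longrightarrow> finite (carrier_of e \<inter> carrier_of f)" using 2 by blast
  show "e \<in> E \<Longrightarrow> f \<in> E \<Longrightarrow> e \<noteq> f \<Longrightarrow> p \<in> carrier_of e \<Longrightarrow> p \<in> carrier_of f \<Longrightarrow> p \<in> ends e \<inter> ends f \<or> crossing E p e f"
    using 2 by blast
  assume c: "crossing E p e f"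
  note 3 = 3[rule_format, OF c]
  show "transverse_at p (carrier_of e) (carrier_of f)" using 3 by (elim conjE)
  show "(p, e) \<in> R \<longleftrightarrow> (p, f) \<notin> R" using 3 by (elim conjE)
  show "g = e \<or> g = f" if "g \<in> E" "p \<in> carrier_of g" using 3 that by blast
next
  show "(p, e) \<in> R \<Longrightarrow> \<exists>f. crossing E p e f"
    using assms[unfolded esys_def, THEN conjunct2, THEN conjunct2, THEN conjunct2, THEN conjunct2] by blast
qed

lemma esys_over:
  assumes "esys E R" "(p, e) \<in> R"
  shows "e \<in> E \<and> p \<in> carrier_of e"
  using esysD(8)[OF assms] unfolding crossing_def by (elim exE conjE) simp

definition map_overs :: "(complex \<Rightarrow> complex) \<Rightarrow> (complex \<times> darc) set \<Rightarrow> (complex \<times> darc) set" where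
  "map_overs h R = (\<lambda>(p, e). (h p, map_darc h e)) ` R"

lemma map_over_eq: "map_over h w = map_overs h (over w)" and map_edges_eq: "map_edges h w = map_darc h ` edges w"
  by (simp_all add: map_over_def map_overs_def map_edges_def)

lemma esys_map:
  assumes "esys E R" "phomeo f"
  shows "esys (map_darc f ` E) (map_overs f R)"
proof -
  note D = esysD[OF assms(1)]
  have inj: "inj f" using assms phomeo_inj by auto
  note inj' = inj_map_darc[OF inj]
  have R: "(f p, map_darc f e) \<in> map_overs f R \<longleftrightarrow> (p, e) \<in> R" for p e
    using inj inj' by (auto simp: map_overs_def inj_eq)
  show ?thesis
    unfolding esys_def
  proof (intro conjI ballI allI impI)
    fix e' g' assume "e' \<in> map_darc f ` E" "g' \<in> map_darc f ` E" "e' \<noteq> g'"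
    then obtain e g where eg: "e \<in> E" "g \<in> E" "e \<noteq> g" "e' = map_darc f e" "g' = map_darc f g" by blast
    have im: "carrier_of e' \<inter> carrier_of g' = f ` (carrier_of e \<inter> carrier_of g)"
      using inj by (simp add: eg image_Int)
    show "finite (carrier_of e' \<inter> carrier_of g')" unfolding im using D(3) eg by blast
    fix q assume "q \<in> carrier_of e' \<inter> carrier_of g'"
    then obtain p where p: "q = f p" "p \<in> carrier_of e" "p \<in> carrier_of g" unfolding im by blast
    show "q \<in> ends e' \<inter> ends g' \<or> crossing (map_darc f ` E) q e' g'"
    proof (cases "crossing E p e g")
      case True
      thus ?thesis unfolding crossing_map[OF inj] using eg p by blast
    next
      case False
      hence "p \<in> ends e \<inter> ends g" using D(4)[of e g p] eg p by blast
      thus ?thesis using eg p by auto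
    qed
  next
    fix q e' g' assume "crossing (map_darc f ` E) q e' g'"
    then obtain p e g where c: "q = f p" "e' = map_darc f e" "g' = map_darc f g" "crossing E p e g"
      unfolding crossing_map[OF inj] by blast
    show "transverse_at q (carrier_of e') (carrier_of g')"
      using transverse_at_map[OF D(5) assms(2)] c by simp
    show "(q, e') \<in> map_overs f R \<longleftrightarrow> (q, g') \<notin> map_overs f R"
      using R D(7) c by simp
    fix k assume "k \<in> map_darc f ` E" and q: "q \<in> carrier_of k"
    then obtain k' where k: "k = map_darc f k'" "k' \<in> E" by blast
    with q c inj have "p \<in> carrier_of k'" by (simp add: inj_image_mem_iff)
    thus "k = e' \<or> k = g'" using D(6)[OF c(4) k(2)] c k by blast
  next
    show "map_overs f R \<subseteq> {(p, e). \<exists>g. crossing (map_darc f ` E) p e g}"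
    proof
      fix x assume "x \<in> map_overs f R"
      then obtain p e where x: "x = (f p, map_darc f e)" "(p, e) \<in> R"
        unfolding map_overs_def by (metis (no_types, lifting) case_prod_conv imageE surj_pair)
      then obtain g where "crossing E p e g" using D(8) by blast
      hence "crossing (map_darc f ` E) (f p) (map_darc f e) (map_darc f g)"
        unfolding crossing_map[OF inj] by blast
      thus "x \<in> {(p, e). \<exists>g. crossing (map_darc f ` E) p e g}" unfolding x(1) mem_Collect_eq case_prod_conv by (rule exI)
    qed
  qed (use D assms is_darc_phomeo in auto)
qed

lemma crossing_Un:
  assumes "\<forall>e\<in>E1. \<forall>f\<in>E2. carrier_of e \<inter> carrier_of f \<subseteq> ends e \<inter> ends f"
  shows "crossing (E1 \<union> E2) p e f \<longleftrightarrow> crossing E1 p e f \<or> crossing E2 p e f"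
  using assms unfolding crossing_def by blast

text \<open>Arcs of different systems meet only in common end points, so no crossing arises. An arc
  belonging to both systems would be contained in the set of its two ends, which an infinite set
  cannot be.\<close>

lemma esys_Un:
  assumes "esys E1 R1" "esys E2 R2" and int: "\<forall>e\<in>E1. \<forall>f\<in>E2. carrier_of e \<inter> carrier_of f \<subseteq> ends e \<inter> ends f"
  shows "esys (E1 \<union> E2) (R1 \<union> R2)" "E1 \<inter> E2 = {}"
proof -
  note D1 = esysD[OF assms(1)] and D2 = esysD[OF assms(2)]
  show disj: "E1 \<inter> E2 = {}"
  proof (rule ccontr)
    assume "E1 \<inter> E2 \<noteq> {}"
    then obtain e where "e \<in> E1" "e \<in> E2" by auto
    thus False using int is_darc_not_ends[OF D1(2)] by blast
  qed
  have R1: "(p, e) \<in> R1 \<Longrightarrow> e \<in> E1" and R2: "(p, e) \<in> R2 \<Longrightarrow> e \<in> E2" for p e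
    using esys_over assms by blast+
  note crU = crossing_Un[OF int]
  have fin: "finite (carrier_of e \<inter> carrier_of f)" if "e \<in> E1" "f \<in> E2" for e f
    using int that finite_subset[of "carrier_of e \<inter> carrier_of f" "ends e \<inter> ends f"] by blast
  show "esys (E1 \<union> E2) (R1 \<union> R2)"
    unfolding esys_def
  proof (intro conjI ballI allI impI)
    fix e f assume ef: "e \<in> E1 \<union> E2" "f \<in> E1 \<union> E2" "e \<noteq> f"
    show "finite (carrier_of e \<inter> carrier_of f)"
      using ef D1(3)[of e f] D2(3)[of e f] fin[of e f] fin[of f e] by (auto simp: Int_commute)
    fix p assume p: "p \<in> carrier_of e \<inter> carrier_of f"
    show "p \<in> ends e \<inter> ends f \<or> crossing (E1 \<union> E2) p e f"
      unfolding crU using ef p D1(4)[of e f p] D2(4)[of e f p] int by blast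
  next
    fix p e f assume c: "crossing (E1 \<union> E2) p e f"
    show "transverse_at p (carrier_of e) (carrier_of f)" using c D1(5) D2(5) unfolding crU by blast
    show "(p, e) \<in> R1 \<union> R2 \<longleftrightarrow> (p, f) \<notin> R1 \<union> R2"
      using c[unfolded crU]
    proof
      assume c: "crossing E1 p e f"
      hence "e \<in> E1" "f \<in> E1" by (auto simp: crossing_def)
      thus ?thesis using D1(7)[OF c] R2 disj by blast
    next
      assume c: "crossing E2 p e f"
      hence "e \<in> E2" "f \<in> E2" by (auto simp: crossing_def)
      thus ?thesis using D2(7)[OF c] R1 disj by blast
    qed
    fix g assume g: "g \<in> E1 \<union> E2" "p \<in> carrier_of g"
    show "g = e \<or> g = f"
      using c[unfolded crU]
    proof
      assume c: "crossing E1 p e f"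
      hence "g \<in> E1" using g int unfolding crossing_def by blast
      thus ?thesis using D1(6)[OF c] g by blast
    next
      assume c: "crossing E2 p e f"
      hence "g \<in> E2" using g int unfolding crossing_def by blast
      thus ?thesis using D2(6)[OF c] g by blast
    qed
  next
    show "R1 \<union> R2 \<subseteq> {(p, e). \<exists>f. crossing (E1 \<union> E2) p e f}"
      unfolding crU using D1(8) D2(8) by blast
  qed (use D1 D2 in auto)
qed

lemma valency_map: "inj f \<Longrightarrow> valency (map_darc f ` E) (f p) = valency E p"
proof -
  assume inj: "inj f"
  have "{e \<in> map_darc f ` E. tgt e = f p} = map_darc f ` {e \<in> E. tgt e = p}"
    "{e \<in> map_darc f ` E. src e = f p} = map_darc f ` {e \<in> E. src e = p}"
    using inj by (auto simp: inj_eq)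
  thus ?thesis using inj_on_subset[OF inj_map_darc[OF inj]] by (simp add: valency_def card_image)
qed

lemma valency_Un:
  assumes "finite E1" "finite E2" "E1 \<inter> E2 = {}"
  shows "valency (E1 \<union> E2) p = (fst (valency E1 p) + fst (valency E2 p), snd (valency E1 p) + snd (valency E2 p))"
proof -
  have "{e \<in> E1 \<union> E2. Q e} = {e \<in> E1. Q e} \<union> {e \<in> E2. Q e}" for Q by auto
  moreover have "card ({e \<in> E1. Q e} \<union> {e \<in> E2. Q e}) = card {e \<in> E1. Q e} + card {e \<in> E2. Q e}" for Q
    using assms by (intro card_Un_disjoint) auto
  ultimately show ?thesis by (simp add: valency_def)
qed

lemma valency_eq_0: "p \<notin> (\<Union>e\<in>E. ends e) \<Longrightarrow> valency E p = (0, 0)"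
proof -
  assume "p \<notin> (\<Union>e\<in>E. ends e)"
  hence "{e \<in> E. tgt e = p} = {}" "{e \<in> E. src e = p} = {}" by auto
  thus ?thesis by (simp only: valency_def card.empty)
qed

subsection \<open>Isotopies of the plane\<close>

lemma ambient_isotopyI:
  assumes "continuous_on ({0..1} \<times> UNIV) (\<lambda>(t, z). k t z)" "\<And>t. t \<in> {0..1} \<Longrightarrow> bij (k t)" "\<And>z. k 0 z = z"
  shows "ambient_isotopy UNIV k"
  unfolding ambient_isotopy_def
proof (intro conjI ballI)
  fix t :: real assume t: "t \<in> {0..1}"
  have "continuous_on UNIV (\<lambda>z. (\<lambda>(t, z). k t z) (t, z))"
    by (rule continuous_on_compose2[OF assms(1)]) (use t in \<open>auto intro!: continuous_intros\<close>)
  hence "phomeo (k t)" using assms(2) t by (simp add: phomeo_def)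
  thus "\<exists>g. homeomorphism UNIV UNIV (k t) g" using phomeo_homeomorphism by blast
qed (use assms in auto)

lemma ambient_isotopy_phomeo: "ambient_isotopy UNIV k \<Longrightarrow> t \<in> {0..1} \<Longrightarrow> phomeo (k t)"
proof -
  assume "ambient_isotopy UNIV k" "t \<in> {0..1}"
  then obtain g where "homeomorphism UNIV UNIV (k t) g" unfolding ambient_isotopy_def by blast
  thus "phomeo (k t)"
    unfolding homeomorphism_def phomeo_def by (metis bij_betw_byWitness iso_tuple_UNIV_I subset_UNIV)
qed

lemma ambient_isotopy_comp:
  assumes "ambient_isotopy UNIV k" "ambient_isotopy UNIV l"
  shows "ambient_isotopy UNIV (\<lambda>t. k t \<circ> l t)"
proof (rule ambient_isotopyI)
  have k: "continuous_on ({0..1} \<times> UNIV) (\<lambda>(t, z). k t z)" and l: "continuous_on ({0..1} \<times> UNIV) (\<lambda>(t, z). l t z)"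
    using assms by (auto simp: ambient_isotopy_def)
  have "continuous_on ({0..1} \<times> UNIV) (\<lambda>p. (fst p, (\<lambda>(t, z). l t z) p))"
    by (rule continuous_on_Pair[OF continuous_on_fst[OF continuous_on_id] l])
  hence "continuous_on ({0..1} \<times> UNIV) (\<lambda>p. (\<lambda>(t, z). k t z) (fst p, (\<lambda>(t, z). l t z) p))"
    by (rule continuous_on_compose2[OF k]) auto
  thus "continuous_on ({0..1} \<times> UNIV) (\<lambda>(t, z). (k t \<circ> l t) z)"
    by (simp add: case_prod_unfold)
  show "bij (k t \<circ> l t)" if "t \<in> {0..1}" for t
    using assms that by (metis ambient_isotopy_phomeo phomeo_comp phomeo_def)
qed (use assms in \<open>auto simp: ambient_isotopy_def\<close>)

definition pisot :: "(complex \<Rightarrow> complex) \<Rightarrow> bool" where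
  "pisot h \<longleftrightarrow> (\<exists>k. ambient_isotopy UNIV k \<and> h = k 1)"

lemma pisot_comp: "pisot f \<Longrightarrow> pisot g \<Longrightarrow> pisot (f \<circ> g)"
  unfolding pisot_def using ambient_isotopy_comp by blast

lemma pisot_phomeo: "pisot h \<Longrightarrow> phomeo h"
  unfolding pisot_def using ambient_isotopy_phomeo[of _ 1] by auto

lemma disc_embedding_iff: "disc_embedding h \<longleftrightarrow> pisot h \<and> h ` square \<subseteq> square"
  by (simp add: disc_embedding_def pisot_def)

lemma surj_onI: "(\<And>y. \<exists>x. f x = y) \<Longrightarrow> surj f"
  unfolding surj_def by (intro allI) (erule meta_allE, erule exE, rule exI, erule sym)

lemma strict_mono_bij_interp:
  fixes f :: "real \<Rightarrow> real"
  assumes "continuous_on UNIV f" "strict_mono f" "surj f" "t \<in> {0..1}"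
  shows "bij (\<lambda>x. (1 - t) * x + t * f x)"
proof (rule bijI)
  have "strict_mono (\<lambda>x. (1 - t) * x + t * f x)"
  proof (rule strict_monoI)
    fix x y :: real assume xy: "x < y"
    hence "f x < f y" using assms(2) by (simp add: strict_mono_def)
    show "(1 - t) * x + t * f x < (1 - t) * y + t * f y"
    proof (cases "t = 1")
      case False
      hence "(1 - t) * x < (1 - t) * y" "t * f x \<le> t * f y" using xy \<open>f x < f y\<close> assms(4) by (auto intro: mult_left_mono)
      thus ?thesis by linarith
    qed (use \<open>f x < f y\<close> in simp)
  qed
  thus "inj (\<lambda>x. (1 - t) * x + t * f x)" by (rule strict_mono_imp_inj_on)
  have "\<exists>x. (1 - t) * x + t * f x = y" for y
  proof -
    obtain z where z: "f z = y" using surjD[OF assms(3), of y] by metis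
    define a b where "a = min y z" and "b = max y z"
    have "f a \<le> y" "f b \<ge> y" using z assms(2) by (auto simp: a_def b_def min_def max_def strict_mono_less_eq)
    hence 1: "t * f a \<le> t * y" "t * f b \<ge> t * y" using assms(4) by (auto intro: mult_left_mono)
    have "a \<le> y" "b \<ge> y" by (auto simp: a_def b_def)
    hence 2: "(1 - t) * a \<le> (1 - t) * y" "(1 - t) * b \<ge> (1 - t) * y" using assms(4) by (auto intro: mult_left_mono)
    have "(1 - t) * a + t * f a \<le> y" "(1 - t) * b + t * f b \<ge> y" using 1 2 by (simp_all add: algebra_simps)
    moreover have "a \<le> b" by (simp add: a_def b_def)
    moreover have "continuous_on {a..b} (\<lambda>x. (1 - t) * x + t * f x)"
      using continuous_on_subset[OF assms(1)] by (auto intro!: continuous_intros)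
    ultimately show ?thesis using IVT'[of "\<lambda>x. (1 - t) * x + t * f x" a y b] by auto
  qed
  thus "surj (\<lambda>x. (1 - t) * x + t * f x)" by (rule surj_onI)
qed

text \<open>Linear interpolation with the identity in each coordinate; by
  \<open>strict_mono_bij_interp\<close> all intermediate functions are again increasing and
  onto.\<close>

lemma pisot_product:
  fixes f g :: "real \<Rightarrow> real"
  assumes "continuous_on UNIV f" "strict_mono f" "surj f" "continuous_on UNIV g" "strict_mono g" "surj g"
  shows "pisot (\<lambda>z. Complex (f (Re z)) (g (Im z)))"
  unfolding pisot_def
proof (intro exI conjI)
  define k where "k t z = Complex ((1 - t) * Re z + t * f (Re z)) ((1 - t) * Im z + t * g (Im z))" for t z
  show "ambient_isotopy UNIV k"
  proof (rule ambient_isotopyI)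
    have "continuous_on ({0..1 :: real} \<times> UNIV) (\<lambda>p. f (Re (snd p)))" "continuous_on ({0..1 :: real} \<times> UNIV) (\<lambda>p. g (Im (snd p)))"
      by (auto intro!: continuous_on_compose2[OF assms(1)] continuous_on_compose2[OF assms(4)] continuous_intros)
    thus "continuous_on ({0..1} \<times> UNIV) (\<lambda>(t, z). k t z)"
      unfolding k_def case_prod_unfold by (intro continuous_intros)
    fix t :: real assume t: "t \<in> {0..1}"
    note b = strict_mono_bij_interp[OF assms(1-3) t] strict_mono_bij_interp[OF assms(4-6) t]
    show "bij (k t)"
    proof (rule bijI)
      show "inj (k t)"
        by (rule injI) (use b in \<open>auto simp: k_def complex_eq_iff dest!: bij_is_inj injD\<close>)
      have "\<exists>z. k t z = w" for w
      proof -
        obtain x where "Re w = (1 - t) * x + t * f x"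
          using surjD[OF bij_is_surj[OF b(1)], of "Re w"] by blast
        moreover obtain y where "Im w = (1 - t) * y + t * g y"
          using surjD[OF bij_is_surj[OF b(2)], of "Im w"] by blast
        ultimately
        show ?thesis by (intro exI[of _ "Complex x y"]) (simp add: k_def \<open>Re w = _\<close> \<open>Im w = _\<close> complex_eq_iff)
      qed
      thus "surj (k t)" by (rule surj_onI)
    qed
  qed (simp add: k_def)
  show "(\<lambda>z. Complex (f (Re z)) (g (Im z))) = k 1" by (simp add: k_def fun_eq_iff)
qed

lemma pisot_cis: "pisot (\<lambda>z. cis \<theta> * z)"
  unfolding pisot_def
proof (intro exI conjI)
  show "ambient_isotopy UNIV (\<lambda>t z. cis (t * \<theta>) * z)"
  proof (rule ambient_isotopyI)
    fix t show "bij ((*) (cis (t * \<theta>)))"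
      by (rule bij_betw_byWitness[of _ "\<lambda>z. z / cis (t * \<theta>)"]) auto
  qed (auto simp: case_prod_unfold intro!: continuous_intros)
qed simp

text \<open>The displacement is horizontal, so that bijectivity can be tested on each horizontal
  line, where the map is increasing and is the identity outside the unit interval.\<close>

lemma shear_bij:
  fixes u :: "complex \<Rightarrow> real"
  assumes cont: "continuous_on UNIV u" and t: "t \<in> {0..1}"
    and mono: "\<And>x x' y. x < x' \<Longrightarrow> x + u (Complex x y) < x' + u (Complex x' y)"
    and supp: "\<And>z. z \<notin> interior square \<Longrightarrow> u z = 0"
  shows "bij (\<lambda>z. z + of_real (t * u z))"
proof (rule bijI)
  have mono': "x + t * u (Complex x y) < x' + t * u (Complex x' y)" if "x < x'" for x x' y
  proof (cases "t = 1")
    case False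
    have "(1 - t) * x < (1 - t) * x'" "t * (x + u (Complex x y)) \<le> t * (x' + u (Complex x' y))"
      using that mono[OF that, of y] t False by (auto intro: mult_left_mono)
    thus ?thesis by (simp add: algebra_simps)
  qed (use mono[OF that, of y] in simp)
  show "inj (\<lambda>z. z + of_real (t * u z))"
  proof (rule injI)
    fix z w assume *: "z + of_real (t * u z) = w + of_real (t * u w)"
    hence im: "Im z = Im w" and re: "Re z + t * u z = Re w + t * u w" by (auto simp: complex_eq_iff)
    have "\<not> Re z < Re w" using mono'[of "Re z" "Re w" "Im z"] re im by (metis complex.collapse less_irrefl)
    moreover have "\<not> Re w < Re z" using mono'[of "Re w" "Re z" "Im z"] re im by (metis complex.collapse less_irrefl)
    ultimately show "z = w" using im by (simp add: complex_eq_iff)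
  qed
  have "\<exists>z. z + of_real (t * u z) = w" for w
  proof -
    define a b where "a = min 0 (Re w)" and "b = max 1 (Re w)"
    have "u (Complex a (Im w)) = 0" "u (Complex b (Im w)) = 0"
      by (rule supp, simp add: interior_square a_def b_def)+
    hence "a + t * u (Complex a (Im w)) \<le> Re w" "b + t * u (Complex b (Im w)) \<ge> Re w" "a \<le> b"
      by (auto simp: a_def b_def)
    moreover have "continuous_on {a..b} (\<lambda>x. x + t * u (Complex x (Im w)))"
      by (intro continuous_intros continuous_on_compose2[OF cont]) auto
    ultimately obtain x where "x + t * u (Complex x (Im w)) = Re w"
      using IVT'[of "\<lambda>x. x + t * u (Complex x (Im w))" a "Re w" b] by auto
    thus ?thesis by (intro exI[of _ "Complex x (Im w)"]) (auto simp: complex_eq_iff)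
  qed
  thus "surj (\<lambda>z. z + of_real (t * u z))" by (rule surj_onI)
qed

text \<open>Isotopies of the plane supported in the open square. They restrict to the
  boundary-fixing isotopies in \<open>isotopic\<close>, while their bijectivity can be checked in
  the whole plane.\<close>

definition sqisot :: "(complex \<Rightarrow> complex) \<Rightarrow> bool" where
  "sqisot h \<longleftrightarrow> (\<exists>k. ambient_isotopy UNIV k \<and> h = k 1 \<and> (\<forall>t\<in>{0..1}. \<forall>z. z \<notin> interior square \<longrightarrow> k t z = z))"

lemma sqisot_pisot: "sqisot h \<Longrightarrow> pisot h"
  unfolding sqisot_def pisot_def by blast

lemma sqisot_shear:
  assumes cont: "continuous_on UNIV u"
    and mono: "\<And>x x' y. x < x' \<Longrightarrow> x + u (Complex x y) < x' + u (Complex x' y)"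
    and supp: "\<And>z. z \<notin> interior square \<Longrightarrow> u z = 0"
  shows "sqisot (\<lambda>z. z + of_real (u z))"
  unfolding sqisot_def
proof (intro exI conjI ballI allI impI)
  have u: "continuous_on ({0..1 :: real} \<times> UNIV) (\<lambda>p. u (snd p))"
    by (intro continuous_on_compose2[OF cont] continuous_intros) auto
  show "ambient_isotopy UNIV (\<lambda>t z. z + of_real (t * u z))"
  proof (rule ambient_isotopyI)
    show "continuous_on ({0..1} \<times> UNIV) (\<lambda>(t, z). z + of_real (t * u z))"
      unfolding case_prod_unfold by (intro continuous_intros u)
  qed (use shear_bij[OF cont _ mono supp] in auto)
qed (use supp in auto)

definition swap :: "complex \<Rightarrow> complex" where "swap z = Complex (Im z) (Re z)"

lemma swap_swap [simp]: "swap (swap z) = z" and Re_swap [simp]: "Re (swap z) = Im z"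
  and Im_swap [simp]: "Im (swap z) = Re z"
  by (simp_all add: swap_def)

lemma phomeo_swap: "phomeo swap"
  unfolding phomeo_def
  by (auto simp: swap_def[abs_def] intro!: continuous_intros bij_betw_byWitness[of _ swap])

lemma swap_interior_square: "swap z \<in> interior square \<longleftrightarrow> z \<in> interior square"
  by (auto simp: interior_square)

text \<open>Conjugation by the reflection in the diagonal turns horizontal moves into vertical ones.
  The reflection reverses the orientation, but a conjugated isotopy is an isotopy.\<close>

lemma sqisot_swap:
  assumes "sqisot h"
  shows "sqisot (swap \<circ> h \<circ> swap)"
proof -
  obtain k where k: "ambient_isotopy UNIV k" "h = k 1" "\<forall>t\<in>{0..1}. \<forall>z. z \<notin> interior square \<longrightarrow> k t z = z"
    using assms unfolding sqisot_def by blast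
  have "ambient_isotopy UNIV (\<lambda>t. swap \<circ> k t \<circ> swap)"
  proof (rule ambient_isotopyI)
    have c: "continuous_on A swap" for A by (rule phomeo_continuous[OF phomeo_swap])
    have kc: "continuous_on ({0..1} \<times> UNIV) (\<lambda>(t, z). k t z)"
      using k(1) by (simp add: ambient_isotopy_def)
    have "continuous_on ({0..1 :: real} \<times> UNIV) (\<lambda>p. swap (snd p))"
      by (rule continuous_on_compose2[OF c[of UNIV]]) (auto intro!: continuous_intros)
    hence "continuous_on ({0..1 :: real} \<times> UNIV) (\<lambda>p. (fst p, swap (snd p)))"
      by (intro continuous_on_Pair continuous_on_fst continuous_on_id)
    hence "continuous_on ({0..1} \<times> UNIV) (\<lambda>p. (\<lambda>(t, z). k t z) (fst p, swap (snd p)))"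
      by (rule continuous_on_compose2[OF kc]) auto
    hence "continuous_on ({0..1} \<times> UNIV) (\<lambda>p. swap ((\<lambda>(t, z). k t z) (fst p, swap (snd p))))"
      by (rule continuous_on_compose2[OF c[of UNIV]]) auto
    thus "continuous_on ({0..1} \<times> UNIV) (\<lambda>(t, z). (swap \<circ> k t \<circ> swap) z)"
      by (simp add: case_prod_unfold)
    fix t :: real assume "t \<in> {0..1}"
    hence "phomeo (swap \<circ> k t \<circ> swap)"
      by (intro phomeo_comp phomeo_swap ambient_isotopy_phomeo[OF k(1)])
    thus "bij (swap \<circ> k t \<circ> swap)" by (simp add: phomeo_def)
  qed (use k in \<open>auto simp: ambient_isotopy_def\<close>)
  thus ?thesis
    unfolding sqisot_def using k swap_interior_square by (intro exI[of _ "\<lambda>t. swap \<circ> k t \<circ> swap"]) auto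
qed

lemma sqisot_shear_up:
  assumes cont: "continuous_on UNIV u"
    and mono: "\<And>x y y'. y < y' \<Longrightarrow> y + u (Complex x y) < y' + u (Complex x y')"
    and supp: "\<And>z. z \<notin> interior square \<Longrightarrow> u z = 0"
  shows "sqisot (\<lambda>z. z + \<i> * of_real (u z))"
proof -
  have "sqisot (\<lambda>z. z + of_real ((u \<circ> swap) z))"
  proof (rule sqisot_shear)
    show "continuous_on UNIV (u \<circ> swap)"
      by (intro continuous_on_compose phomeo_continuous phomeo_swap continuous_on_subset[OF cont]) auto
    show "x + (u \<circ> swap) (Complex x y) < x' + (u \<circ> swap) (Complex x' y)" if "x < x'" for x x' y
      using mono[OF that, of y] by (simp add: swap_def)
    show "(u \<circ> swap) z = 0" if "z \<notin> interior square" for z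
      using supp[of "swap z"] swap_interior_square[of z] that by simp
  qed
  from sqisot_swap[OF this] have "sqisot (swap \<circ> (\<lambda>z. z + of_real ((u \<circ> swap) z)) \<circ> swap)" .
  moreover have "swap \<circ> (\<lambda>z. z + of_real ((u \<circ> swap) z)) \<circ> swap = (\<lambda>z. z + \<i> * of_real (u z))"
    by (simp add: fun_eq_iff complex_eq_iff)
  ultimately show ?thesis by simp
qed

subsection \<open>Linear and bilinear extension\<close>

definition lin_ext :: "(web \<Rightarrow> web) \<Rightarrow> lweb \<Rightarrow> lweb" where
  "lin_ext F x = (\<Sum>w\<in>Poly_Mapping.keys x. smul (Poly_Mapping.lookup x w) (lw (F w)))"

lemma keys_lw [simp]: "Poly_Mapping.keys (lw w) = {w}"
  by (simp add: lw_def)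

lemma lookup_lw [simp]: "Poly_Mapping.lookup (lw w) w = 1"
  by (simp add: lw_def)

text \<open>Cancellation may remove keys from a sum of two elements. Summing over a fixed finite
  superset of the keys makes linearity a termwise statement.\<close>

lemma sum_keys_superset:
  assumes "finite S" "Poly_Mapping.keys x \<subseteq> S"
  shows "(\<Sum>w\<in>Poly_Mapping.keys x. smul (Poly_Mapping.lookup x w) (f w)) = (\<Sum>w\<in>S. smul (Poly_Mapping.lookup x w) (f w))"
  by (rule sum.mono_neutral_left[OF assms]) (auto simp: in_keys_iff)

lemma keys_smul: "Poly_Mapping.keys (smul c x) \<subseteq> Poly_Mapping.keys x"
  by (auto simp: in_keys_iff lookup_smul)

lemma lin_sum_add:
  "(\<Sum>w\<in>Poly_Mapping.keys (x + y). smul (Poly_Mapping.lookup (x + y) w) (f w)) =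
   (\<Sum>w\<in>Poly_Mapping.keys x. smul (Poly_Mapping.lookup x w) (f w)) + (\<Sum>w\<in>Poly_Mapping.keys y. smul (Poly_Mapping.lookup y w) (f w))"
proof -
  let ?S = "Poly_Mapping.keys x \<union> Poly_Mapping.keys y"
  have "Poly_Mapping.keys (x + y) \<subseteq> ?S" by (rule Poly_Mapping.keys_add)
  thus ?thesis
    using sum_keys_superset[of ?S x f] sum_keys_superset[of ?S y f] sum_keys_superset[of ?S "x + y" f]
    by (simp add: lookup_add lin.scale_left_distrib sum.distrib)
qed

lemma lin_sum_smul:
  "(\<Sum>w\<in>Poly_Mapping.keys (smul c x). smul (Poly_Mapping.lookup (smul c x) w) (f w)) =
   smul c (\<Sum>w\<in>Poly_Mapping.keys x. smul (Poly_Mapping.lookup x w) (f w))"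
  using sum_keys_superset[of "Poly_Mapping.keys x" "smul c x" f] keys_smul[of c x]
  by (simp add: lookup_smul lin.scale_sum_right)

lemma lin_ext_add: "lin_ext F (x + y) = lin_ext F x + lin_ext F y"
  and lin_ext_smul: "lin_ext F (smul c x) = smul c (lin_ext F x)"
  unfolding lin_ext_def by (rule lin_sum_add, rule lin_sum_smul)

lemma lin_ext_0 [simp]: "lin_ext F 0 = 0"
  by (simp add: lin_ext_def)

lemma lin_ext_minus: "lin_ext F (x - y) = lin_ext F x - lin_ext F y"
  using lin_ext_add[of F "x - y" y] by simp

lemma lin_ext_sum: "lin_ext F (sum f A) = (\<Sum>a\<in>A. lin_ext F (f a))"
  by (induction A rule: infinite_finite_induct) (auto simp: lin_ext_add)

lemma lin_ext_lw [simp]: "lin_ext F (lw w) = lw (F w)"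
  by (simp add: lin_ext_def)

lemma lin_ext_cong: "(\<And>w. w \<in> Poly_Mapping.keys x \<Longrightarrow> F w = G w) \<Longrightarrow> lin_ext F x = lin_ext G x"
  unfolding lin_ext_def by (intro sum.cong) auto

lemma keys_span: "x \<in> lin.span (lw ` A) \<Longrightarrow> Poly_Mapping.keys x \<subseteq> A"
proof (induction rule: lin.span_induct_alt)
  case (step c x y)
  have "Poly_Mapping.keys (smul c x + y) \<subseteq> Poly_Mapping.keys (smul c x) \<union> Poly_Mapping.keys y"
    by (rule Poly_Mapping.keys_add)
  moreover obtain w where "x = lw w" "w \<in> A" using step(1) by blast
  hence "Poly_Mapping.keys x \<subseteq> A" by simp
  hence "Poly_Mapping.keys (smul c x) \<subseteq> A" using keys_smul[of c x] by blast
  ultimately show ?case using step(2) by blast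
qed auto

lemma bilinear_ext_lin_ext: "bilinear_ext f x y = (\<Sum>v\<in>Poly_Mapping.keys x. smul (Poly_Mapping.lookup x v) (lin_ext (f v) y))"
  by (simp add: bilinear_ext_def lin_ext_def lin.scale_sum_right)

lemma bilinear_ext_add_left: "bilinear_ext f (x + x') y = bilinear_ext f x y + bilinear_ext f x' y"
  and bilinear_ext_smul_left: "bilinear_ext f (smul c x) y = smul c (bilinear_ext f x y)"
  unfolding bilinear_ext_lin_ext by (rule lin_sum_add, rule lin_sum_smul)

lemma bilinear_ext_add_right: "bilinear_ext f x (y + y') = bilinear_ext f x y + bilinear_ext f x y'"
  by (simp add: bilinear_ext_lin_ext lin_ext_add lin.scale_right_distrib sum.distrib)

lemma bilinear_ext_smul_right: "bilinear_ext f x (smul c y) = smul c (bilinear_ext f x y)"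
  by (simp add: bilinear_ext_lin_ext lin_ext_smul lin.scale_sum_right mult.commute)

lemma bilinear_ext_0 [simp]: "bilinear_ext f 0 y = 0" "bilinear_ext f x 0 = 0"
  by (simp_all add: bilinear_ext_lin_ext)

lemma bilinear_ext_minus_left: "bilinear_ext f (x - x') y = bilinear_ext f x y - bilinear_ext f x' y"
  using bilinear_ext_add_left[of f "x - x'" x' y] by simp

lemma bilinear_ext_minus_right: "bilinear_ext f x (y - y') = bilinear_ext f x y - bilinear_ext f x y'"
  using bilinear_ext_add_right[of f x "y - y'" y'] by simp

lemma bilinear_ext_lw_left: "bilinear_ext f (lw v) y = lin_ext (f v) y"
  by (simp add: bilinear_ext_lin_ext)

lemma bilinear_ext_lw_right: "bilinear_ext f x (lw w) = lin_ext (\<lambda>v. f v w) x"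
  by (simp add: bilinear_ext_lin_ext lin_ext_def)

subsection \<open>Placing a web into a larger one\<close>

text \<open>An outside \<open>(E, R, h)\<close> into which every web from \<open>\<alpha>\<close> to
  \<open>\<beta>\<close> can be plugged. Stacking and juxtaposing with one argument fixed are of
  this kind.\<close>

definition placing where
  "placing \<alpha> \<beta> \<alpha>' \<beta>' E R h \<longleftrightarrow> disc_embedding h \<and>
     (\<forall>e\<in>E. carrier_of e \<inter> h ` square \<subseteq> h ` frontier square) \<and> R \<subseteq> UNIV \<times> E \<and>
     (\<forall>w\<in>webs \<alpha> \<beta>. plug \<alpha>' \<beta>' E R h w \<in> webs \<alpha>' \<beta>')"

lemma plug_eq: "plug \<alpha> \<beta> E R h w = Web \<alpha> \<beta> (E \<union> map_darc h ` edges w) (R \<union> map_overs h (over w))"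
  by (simp add: plug_def map_edges_eq map_over_eq)

lemma websD:
  assumes "w \<in> webs \<alpha> \<beta>"
  shows "esys (edges w) (over w)" "e \<in> edges w \<Longrightarrow> carrier_of e \<subseteq> square"
    "e \<in> edges w \<Longrightarrow> carrier_of e \<inter> frontier square \<subseteq> boundary_points \<alpha> \<beta>" "bottom w = \<alpha>" "topw w = \<beta>"
proof -
  have w: "is_web w" "bottom w = \<alpha>" "topw w = \<beta>" using assms by (simp_all add: webs_def)
  note A = w(1)[unfolded is_web_iff, unfolded w(2,3)]
  show "esys (edges w) (over w)" by (rule A[THEN conjunct1])
  show "e \<in> edges w \<Longrightarrow> carrier_of e \<subseteq> square"
    "e \<in> edges w \<Longrightarrow> carrier_of e \<inter> frontier square \<subseteq> boundary_points \<alpha> \<beta>"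
    by (drule bspec[OF A[THEN conjunct2, THEN conjunct1]], elim conjE, assumption)+
  show "bottom w = \<alpha>" "topw w = \<beta>" by fact+
qed

lemma finite_boundary_points: "finite (boundary_points \<alpha> \<beta>)"
  by (simp add: boundary_points_def)

text \<open>Such an arc would meet the disc in its boundary only, and its preimage would lie in the
  finite set of boundary points. The lemma prevents a subdivision inside the disc from removing an
  outside edge.\<close>

lemma placing_disjoint:
  assumes "placing \<alpha> \<beta> \<alpha>' \<beta>' E R h" "w \<in> webs \<alpha> \<beta>" "e \<in> edges w"
  shows "map_darc h e \<notin> E"
proof
  assume "map_darc h e \<in> E"
  hence "h ` carrier_of e \<inter> h ` square \<subseteq> h ` frontier square"
    using assms(1) unfolding placing_def by (metis map_darc_simps(1))
  moreover have inj: "inj h"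
    using assms(1) by (auto simp: placing_def disc_embedding_iff intro: phomeo_inj pisot_phomeo)
  ultimately have "carrier_of e \<inter> square \<subseteq> frontier square"
    by (simp add: image_Int[symmetric] inj_image_subset_iff)
  hence "carrier_of e \<subseteq> boundary_points \<alpha> \<beta>" using websD(2,3)[OF assms(2,3)] by blast
  hence "finite (carrier_of e)" using finite_boundary_points finite_subset by blast
  thus False using is_darc_infinite[OF esysD(2)[OF websD(1)[OF assms(2)] assms(3)]] by blast
qed

lemma plug_plug:
  "plug \<alpha>' \<beta>' E R h (plug \<alpha> \<beta> E0 R0 h0 w) =
   plug \<alpha>' \<beta>' (E \<union> map_darc h ` E0) (R \<union> map_overs h R0) (h \<circ> h0) w"
  by (simp add: plug_eq image_Un Un_assoc image_image map_darc_comp map_overs_def case_prod_unfold)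

text \<open>The isotopy is transported by \<open>h\<close> into the disc and continued by the
  identity. Continuity is glued from two closed sets that overlap over the boundary of the disc,
  where nothing moves.\<close>

lemma ambient_isotopy_extend:
  assumes h: "phomeo h" "h ` square \<subseteq> square"
    and k: "ambient_isotopy square k" "\<forall>t\<in>{0..1}. \<forall>z\<in>frontier square. k t z = z"
    and k': "\<And>t z. k' t z = (if z \<in> h ` square then h (k t (inv h z)) else z)"
  shows "ambient_isotopy square k'" "\<forall>t\<in>{0..1}. \<forall>z\<in>frontier square. k' t z = z"
    "\<And>z t. z \<in> square \<Longrightarrow> k' t (h z) = h (k t z)"
    "\<And>z t. t \<in> {0..1} \<Longrightarrow> z \<notin> h ` square \<or> z \<in> h ` frontier square \<Longrightarrow> k' t z = z"
proof -
  have inj: "inj h" using h phomeo_inj by auto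
  have inv_h [simp]: "inv h (h z) = z" for z using inj by simp
  show k'_h: "k' t (h z) = h (k t z)" if "z \<in> square" for z t using that by (simp add: k')
  have fsub: "frontier square \<subseteq> square" using frontier_square by blast
  show k'_out: "k' t z = z" if "t \<in> {0..1}" "z \<notin> h ` square \<or> z \<in> h ` frontier square" for t z
    using that k(2) fsub by (auto simp: k')
  \<comment> \<open>The interior of the disc lies in the interior of the square, so a boundary point
    of the square can only be a boundary point of the disc.\<close>
  have fr: "z \<in> h ` frontier square" if zf: "z \<in> frontier square" and zs: "z \<in> h ` square" for z
  proof (rule ccontr)
    assume "z \<notin> h ` frontier square"
    then obtain y where y: "z = h y" "y \<in> square" "y \<notin> frontier square" using zs by blast
    hence "y \<in> interior square" using closed_square by (simp add: frontier_def)
    hence "z \<in> interior (h ` square)" using y phomeo_interior[OF h(1)] by blast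
    hence "z \<in> interior square" using interior_mono[OF h(2)] by blast
    thus False using zf by (simp add: frontier_def)
  qed
  show k'_fr: "\<forall>t\<in>{0..1}. \<forall>z\<in>frontier square. k' t z = z"
    using k'_out fr by blast
  have kc: "continuous_on ({0..1} \<times> square) (\<lambda>(t, z). k t z)" and k0: "\<And>z. z \<in> square \<Longrightarrow> k 0 z = z"
    using k(1) unfolding ambient_isotopy_def by blast+
  have k_hom: "\<exists>g. homeomorphism square square (k t) g" if "t \<in> {0..1}" for t
    using k(1) that unfolding ambient_isotopy_def by blast
  have k_im: "k t ` square = square" if "t \<in> {0..1}" for t
    using k_hom[OF that] unfolding homeomorphism_def by blast
  have k_inj: "inj_on (k t) square" if tt: "t \<in> {0..1}" for t
  proof -
    obtain g where "homeomorphism square square (k t) g" using k_hom[OF tt] by blast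
    thus ?thesis unfolding homeomorphism_def by (intro inj_on_inverseI[of _ g]) blast
  qed
  define A where "A = {0..1 :: real} \<times> h ` square"
  define B where "B = {0..1 :: real} \<times> (square - interior (h ` square))"
  have "closed A" "closed B" unfolding A_def B_def
    by (intro closed_Times phomeo_closed h closed_square closed_Diff open_interior closed_atLeastAtMost)+
  have cA: "continuous_on A (\<lambda>(t, z). k' t z)"
  proof -
    have "continuous_on UNIV (inv h)"
      using phomeo_homeomorphism[OF h(1)] by (simp add: homeomorphism_def)
    hence "continuous_on A (\<lambda>p. inv h (snd p))"
      by (rule continuous_on_compose2) (auto intro: continuous_intros)
    hence "continuous_on A (\<lambda>p. (fst p, inv h (snd p)))"
      by (intro continuous_on_Pair continuous_on_fst continuous_on_id)
    hence "continuous_on A (\<lambda>p. (\<lambda>(t, z). k t z) (fst p, inv h (snd p)))"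
      by (rule continuous_on_compose2[OF kc]) (auto simp: A_def)
    hence "continuous_on A (\<lambda>p. h ((\<lambda>(t, z). k t z) (fst p, inv h (snd p))))"
      by (rule continuous_on_compose2[OF phomeo_continuous[OF h(1), of UNIV]]) auto
    thus ?thesis by (rule continuous_on_eq) (auto simp: A_def k')
  qed
  have cB: "continuous_on B (\<lambda>(t, z). k' t z)"
  proof -
    have kB: "k' t z = z" if "(t, z) \<in> B" for t z
    proof (cases "z \<in> h ` square")
      case True
      hence "z \<in> frontier (h ` square)"
        using that phomeo_closed[OF h(1) closed_square] by (simp add: B_def frontier_def)
      thus ?thesis using k'_out that phomeo_frontier[OF h(1) closed_square] by (simp add: B_def)
    qed (use k'_out that in \<open>auto simp: B_def\<close>)
    have sB: "continuous_on B snd" using continuous_on_snd[OF continuous_on_id[of B]] by simp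
    show ?thesis by (rule continuous_on_eq[OF sB]) (use kB in auto)
  qed
  have AB: "{0..1} \<times> square = A \<union> B"
  proof -
    have "square = h ` square \<union> (square - interior (h ` square))" using h(2) interior_subset[of "h ` square"] by blast
    thus ?thesis unfolding A_def B_def by blast
  qed
  show "ambient_isotopy square k'"
    unfolding ambient_isotopy_def
  proof (intro conjI ballI)
    show c: "continuous_on ({0..1} \<times> square) (\<lambda>(t, z). k' t z)"
      unfolding AB by (rule continuous_on_closed_Un[OF \<open>closed A\<close> \<open>closed B\<close> cA cB])
    fix t :: real assume t: "t \<in> {0..1}"
    have "continuous_on square (\<lambda>z. (\<lambda>(t, z). k' t z) (t, z))"
    proof (rule continuous_on_compose2[OF c])
      show "continuous_on square (\<lambda>z. (t, z))" by (intro continuous_on_Pair continuous_on_const continuous_on_id)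
    qed (use t in blast)
    hence ct: "continuous_on square (k' t)" by simp
    have im: "k' t ` (h ` square) = h ` square"
    proof -
      have "k' t ` (h ` square) = (\<lambda>z. h (k t z)) ` square"
        unfolding image_image by (rule image_cong[OF refl]) (rule k'_h)
      also have "\<dots> = h ` (k t ` square)" by (simp only: image_image)
      finally show ?thesis by (simp only: k_im[OF t])
    qed
    have u: "h ` square \<union> (square - h ` square) = square" using h(2) by blast
    have "k' t ` (square - h ` square) = (\<lambda>z. z) ` (square - h ` square)"
      by (rule image_cong[OF refl]) (use k'_out[OF t] in blast)
    hence o: "k' t ` (square - h ` square) = square - h ` square" by simp
    have sq: "k' t ` square = square"
      using image_Un[of "k' t" "h ` square" "square - h ` square"] unfolding im o u .
    have ij: "inj_on (k' t) square"
    proof (rule inj_onI)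
      fix x y assume xy: "x \<in> square" "y \<in> square" "k' t x = k' t y"
      have iff: "k' t z \<in> h ` square \<longleftrightarrow> z \<in> h ` square" for z
      proof (cases "z \<in> h ` square")
        case True
        hence "k' t z \<in> k' t ` (h ` square)" by (rule imageI)
        thus ?thesis using True unfolding im by simp
      next
        case False
        thus ?thesis using k'_out[OF t, of z] by simp
      qed
      show "x = y"
      proof (cases "x \<in> h ` square")
        case True
        hence "y \<in> h ` square" using iff[of x] iff[of y] xy(3) by simp
        then obtain a b where ab: "x = h a" "y = h b" "a \<in> square" "b \<in> square" using True by blast
        hence "k t a = k t b" using xy(3) k'_h inj by (simp add: inj_eq)
        thus ?thesis using k_inj[OF t] ab by (simp add: inj_on_eq_iff)
      next
        case False
        hence "y \<notin> h ` square" using iff[of x] iff[of y] xy(3) by simp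
        hence "k' t y = y" by (intro k'_out[OF t] disjI1)
        moreover have "k' t x = x" using False by (intro k'_out[OF t] disjI1)
        ultimately show ?thesis using xy(3) by (simp only:)
      qed
    qed
    show "\<exists>g. homeomorphism square square (k' t) g"
      by (rule homeomorphism_compact[OF compact_square ct sq ij])
  next
    fix z assume "z \<in> square"
    show "k' 0 z = z"
    proof (cases "z \<in> h ` square")
      case True
      then obtain y where "z = h y" "y \<in> square" by blast
      thus ?thesis by (simp only: k'_h k0)
    next
      case False
      thus ?thesis unfolding k' by (rule if_not_P)
    qed
  qed
qed

lemma map_overs_Un: "map_overs h (R \<union> S) = map_overs h R \<union> map_overs h S"
  by (simp add: map_overs_def image_Un)

lemma map_overs_id: "(\<And>p e. (p, e) \<in> R \<Longrightarrow> h p = p \<and> map_darc h e = e) \<Longrightarrow> map_overs h R = R"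
  unfolding map_overs_def by (rule image_cong[of R R _ "\<lambda>x. x", simplified]) auto

lemma map_overs_cong: "(\<And>p e. (p, e) \<in> R \<Longrightarrow> f p = g p \<and> map_darc f e = map_darc g e) \<Longrightarrow> map_overs f R = map_overs g R"
  unfolding map_overs_def by (rule image_cong) auto

lemma map_overs_comp: "map_overs f (map_overs g R) = map_overs (f \<circ> g) R"
  by (simp add: map_overs_def image_image case_prod_unfold map_darc_comp)

lemma plug_isotopic:
  assumes pl: "placing \<alpha> \<beta> \<alpha>' \<beta>' E R h" and w: "w \<in> webs \<alpha> \<beta>" and iso: "isotopic w w'"
  shows "isotopic (plug \<alpha>' \<beta>' E R h w) (plug \<alpha>' \<beta>' E R h w')"
proof -
  have h: "phomeo h" "h ` square \<subseteq> square" and RE: "R \<subseteq> UNIV \<times> E"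
    and E: "\<And>e. e \<in> E \<Longrightarrow> carrier_of e \<inter> h ` square \<subseteq> h ` frontier square"
    and W: "plug \<alpha>' \<beta>' E R h w \<in> webs \<alpha>' \<beta>'"
    using pl w by (auto simp: placing_def disc_embedding_iff pisot_phomeo)
  obtain k where k: "ambient_isotopy square k" "\<forall>t\<in>{0..1}. \<forall>z\<in>frontier square. k t z = z"
    and w': "w' = Web (bottom w) (topw w) (map_edges (k 1) w) (map_over (k 1) w)"
    using iso unfolding isotopic_def by blast
  define k' where "k' = (\<lambda>t z. if z \<in> h ` square then h (k t (inv h z)) else z)"
  have k'_eq: "k' t z = (if z \<in> h ` square then h (k t (inv h z)) else z)" for t z
    by (simp only: k'_def)
  note ext = ambient_isotopy_extend[OF h k k'_eq]
  have es: "esys (edges (plug \<alpha>' \<beta>' E R h w)) (over (plug \<alpha>' \<beta>' E R h w))" using websD(1)[OF W] .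
  have fixE: "k' 1 z = z" if "e \<in> E" "z \<in> carrier_of e" for e z
    using ext(4)[of 1 z] E[OF that(1)] that(2) by auto
  have dE: "is_darc e" if "e \<in> E" for e using esysD(2)[OF es, of e] that by (simp add: plug_eq)
  have mE: "map_darc (k' 1) e = e" if "e \<in> E" for e
    by (rule map_darc_id) (use fixE[OF that] is_darc_ends[OF dE[OF that]] in auto)
  have mw: "map_darc (k' 1) (map_darc h e) = map_darc h (map_darc (k 1) e)" if "e \<in> edges w" for e
    unfolding map_darc_comp
  proof (rule map_darc_cong)
    show "(k' 1 \<circ> h) z = (h \<circ> k 1) z" if "z \<in> carrier_of e" for z
      using ext(3)[of z 1] websD(2)[OF w \<open>e \<in> edges w\<close>] that by auto
    show "ends e \<subseteq> carrier_of e" by (rule is_darc_ends[OF esysD(2)[OF websD(1)[OF w] that]])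
  qed
  have "map_overs (k' 1) R = R"
  proof (rule map_overs_id)
    fix p e assume pe: "(p, e) \<in> R"
    hence "e \<in> E" using RE by auto
    moreover have "p \<in> carrier_of e" using esys_over[OF es, of p e] pe by (simp add: plug_eq)
    ultimately show "k' 1 p = p \<and> map_darc (k' 1) e = e" using fixE mE by blast
  qed
  moreover have "map_overs (k' 1) (map_overs h (over w)) = map_overs h (map_overs (k 1) (over w))"
    unfolding map_overs_comp
  proof (rule map_overs_cong)
    fix p e assume "(p, e) \<in> over w"
    hence e: "e \<in> edges w" "p \<in> carrier_of e" using esys_over[OF websD(1)[OF w]] by blast+
    thus "(k' 1 \<circ> h) p = (h \<circ> k 1) p \<and> map_darc (k' 1 \<circ> h) e = map_darc (h \<circ> k 1) e"
      using mw[OF e(1)] ext(3)[of p 1] websD(2)[OF w e(1)] by (auto simp: map_darc_comp)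
  qed
  moreover have "map_darc (k' 1) ` E = E" using mE by simp
  moreover have "map_darc (k' 1) ` (map_darc h ` edges w) = map_darc h ` (map_darc (k 1) ` edges w)"
    unfolding image_image using mw by (rule image_cong[OF refl])
  ultimately have "plug \<alpha>' \<beta>' E R h w' = Web \<alpha>' \<beta>' (map_edges (k' 1) (plug \<alpha>' \<beta>' E R h w)) (map_over (k' 1) (plug \<alpha>' \<beta>' E R h w))"
    by (simp add: plug_eq w' map_edges_eq map_over_eq image_Un map_overs_Un)
  thus ?thesis unfolding isotopic_def using ext(1,2) by (auto simp: plug_eq)
qed

lemma map_overs_mem: "inj h \<Longrightarrow> (h p, map_darc h e) \<in> map_overs h R \<longleftrightarrow> (p, e) \<in> R"
  using inj_map_darc[of h] by (auto simp: map_overs_def inj_eq)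

lemma map_overs_elim: "x \<in> map_overs h R \<Longrightarrow> (\<And>p e. x = (h p, map_darc h e) \<Longrightarrow> (p, e) \<in> R \<Longrightarrow> thesis) \<Longrightarrow> thesis"
  unfolding map_overs_def by (elim imageE) (metis (no_types, lifting) case_prod_conv surj_pair)

lemma map_overs_intro: "(p, e) \<in> R \<Longrightarrow> (h p, map_darc h e) \<in> map_overs h R"
  unfolding map_overs_def by (rule image_eqI[of _ _ "(p, e)"]) auto

definition subdiv_over :: "darc \<Rightarrow> darc \<Rightarrow> darc \<Rightarrow> (complex \<times> darc) set \<Rightarrow> (complex \<times> darc) set" where
  "subdiv_over a a1 a2 R = {(x, e) \<in> R. e \<noteq> a} \<union> {(x, a1) | x. (x, a) \<in> R \<and> x \<in> carrier_of a1} \<union>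
     {(x, a2) | x. (x, a) \<in> R \<and> x \<in> carrier_of a2}"

lemma map_overs_subdiv_over:
  assumes "inj h"
  shows "map_overs h (subdiv_over a a1 a2 R) = subdiv_over (map_darc h a) (map_darc h a1) (map_darc h a2) (map_overs h R)"
proof -
  have m: "map_darc h e = map_darc h e' \<longleftrightarrow> e = e'" for e e' using inj_map_darc[OF assms] by (simp add: inj_eq)
  have 1: "map_overs h {(x, e) \<in> R. e \<noteq> a} = {(x, e) \<in> map_overs h R. e \<noteq> map_darc h a}"
    by (auto elim!: map_overs_elim intro!: map_overs_intro simp: m simp del: split_paired_All)
  have 2: "map_overs h {(x, b) | x. (x, a) \<in> R \<and> x \<in> carrier_of b} =
    {(x, map_darc h b) | x. (x, map_darc h a) \<in> map_overs h R \<and> x \<in> carrier_of (map_darc h b)}" for b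
  proof (intro subset_antisym subsetI)
    fix y assume "y \<in> map_overs h {(x, b) | x. (x, a) \<in> R \<and> x \<in> carrier_of b}"
    then obtain x where "y = (h x, map_darc h b)" "(x, a) \<in> R" "x \<in> carrier_of b"
      by (rule map_overs_elim) blast
    thus "y \<in> {(x, map_darc h b) | x. (x, map_darc h a) \<in> map_overs h R \<and> x \<in> carrier_of (map_darc h b)}"
      using map_overs_intro by auto
  next
    fix y assume "y \<in> {(x, map_darc h b) | x. (x, map_darc h a) \<in> map_overs h R \<and> x \<in> carrier_of (map_darc h b)}"
    then obtain x where x: "y = (h x, map_darc h b)" "(h x, map_darc h a) \<in> map_overs h R" "x \<in> carrier_of b"
      by auto
    hence "(x, a) \<in> R" using map_overs_mem[OF assms] by blast
    thus "y \<in> map_overs h {(x, b) | x. (x, a) \<in> R \<and> x \<in> carrier_of b}"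
      unfolding x(1) using x(3) by (intro map_overs_intro) blast
  qed
  show ?thesis unfolding subdiv_over_def map_overs_Un 1 2 ..
qed

lemma subdivision_iff:
  "subdivision w w' \<longleftrightarrow> (\<exists>a a1 a2. a \<in> edges w \<and> is_darc a1 \<and> is_darc a2 \<and> src a1 = src a \<and> tgt a2 = tgt a \<and>
     tgt a1 = src a2 \<and> carrier_of a = carrier_of a1 \<union> carrier_of a2 \<and> carrier_of a1 \<inter> carrier_of a2 = {tgt a1} \<and>
     w' = Web (bottom w) (topw w) (edges w - {a} \<union> {a1, a2}) (subdiv_over a a1 a2 (over w)))" (is "_ \<longleftrightarrow> ?R")
proof
  assume "subdivision w w'"
  then obtain A a b A1 A2 p where *: "(A, a, b) \<in> edges w" "is_darc (A1, a, p)" "is_darc (A2, p, b)"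
        "A = A1 \<union> A2" "A1 \<inter> A2 = {p}"
        "w' = Web (bottom w) (topw w)
          (edges w - {(A, a, b)} \<union> {(A1, a, p), (A2, p, b)})
          ({(x, e) \<in> over w. e \<noteq> (A, a, b)} \<union>
           {(x, (A1, a, p)) | x. (x, (A, a, b)) \<in> over w \<and> x \<in> A1} \<union>
           {(x, (A2, p, b)) | x. (x, (A, a, b)) \<in> over w \<and> x \<in> A2})"
    unfolding subdivision_def by blast
  thus ?R
    by (intro exI[of _ "(A, a, b)"] exI[of _ "(A1, a, p)"] exI[of _ "(A2, p, b)"])
       (simp add: subdiv_over_def)
next
  assume ?R
  then obtain a a1 a2 where *: "a \<in> edges w" "is_darc a1" "is_darc a2" "src a1 = src a" "tgt a2 = tgt a"
     "tgt a1 = src a2" "carrier_of a = carrier_of a1 \<union> carrier_of a2" "carrier_of a1 \<inter> carrier_of a2 = {tgt a1}"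
     "w' = Web (bottom w) (topw w) (edges w - {a} \<union> {a1, a2}) (subdiv_over a a1 a2 (over w))"
    by blast
  obtain A p q A1 p1 q1 A2 p2 q2 where e: "a = (A, p, q)" "a1 = (A1, p1, q1)" "a2 = (A2, p2, q2)"
    by (metis surj_pair)
  show "subdivision w w'"
    unfolding subdivision_def
    by (intro exI[of _ A] exI[of _ p] exI[of _ q] exI[of _ A1] exI[of _ A2] exI[of _ q1])
       (use * e in \<open>simp add: subdiv_over_def\<close>)
qed

lemma plug_subdivision:
  assumes pl: "placing \<alpha> \<beta> \<alpha>' \<beta>' E R h" and w: "w \<in> webs \<alpha> \<beta>" and sub: "subdivision w w'"
  shows "subdivision (plug \<alpha>' \<beta>' E R h w) (plug \<alpha>' \<beta>' E R h w')"
proof -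
  have h: "phomeo h" and inj: "inj h" and RE: "R \<subseteq> UNIV \<times> E"
    using pl by (auto simp: placing_def disc_embedding_iff pisot_phomeo phomeo_inj)
  obtain a a1 a2 where *: "a \<in> edges w" "is_darc a1" "is_darc a2" "src a1 = src a" "tgt a2 = tgt a"
     "tgt a1 = src a2" "carrier_of a = carrier_of a1 \<union> carrier_of a2" "carrier_of a1 \<inter> carrier_of a2 = {tgt a1}"
     "w' = Web (bottom w) (topw w) (edges w - {a} \<union> {a1, a2}) (subdiv_over a a1 a2 (over w))"
    using sub unfolding subdivision_iff by blast
  have aE: "map_darc h a \<notin> E" by (rule placing_disjoint[OF pl w *(1)])
  have edges: "E \<union> map_darc h ` (edges w - {a} \<union> {a1, a2}) = E \<union> map_darc h ` edges w - {map_darc h a} \<union> {map_darc h a1, map_darc h a2}"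
    using aE inj_map_darc[OF inj] by (auto simp: image_set_diff)
  have "(x, map_darc h a) \<notin> R" for x using RE aE by blast
  hence R: "R \<union> subdiv_over (map_darc h a) b1 b2 S = subdiv_over (map_darc h a) b1 b2 (R \<union> S)" for b1 b2 S
    unfolding subdiv_over_def by auto
  have 1: "plug \<alpha>' \<beta>' E R h w' = Web (bottom (plug \<alpha>' \<beta>' E R h w)) (topw (plug \<alpha>' \<beta>' E R h w))
       (edges (plug \<alpha>' \<beta>' E R h w) - {map_darc h a} \<union> {map_darc h a1, map_darc h a2})
       (subdiv_over (map_darc h a) (map_darc h a1) (map_darc h a2) (over (plug \<alpha>' \<beta>' E R h w)))"
    using edges by (simp add: plug_eq *(9) map_overs_subdiv_over[OF inj] R)
  have 2: "carrier_of (map_darc h a1) \<inter> carrier_of (map_darc h a2) = {tgt (map_darc h a1)}"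
    using *(8) image_Int[OF inj, of "carrier_of a1" "carrier_of a2"] by simp
  have 3: "map_darc h a \<in> edges (plug \<alpha>' \<beta>' E R h w)" using *(1) by (simp add: plug_eq)
  have 4: "carrier_of (map_darc h a) = carrier_of (map_darc h a1) \<union> carrier_of (map_darc h a2)"
    using *(7) by (simp add: image_Un)
  show ?thesis
    unfolding subdivision_iff using 1 2 3 4 is_darc_phomeo[OF *(2) h] is_darc_phomeo[OF *(3) h] *(4-6)
    by (metis map_darc_simps(2,3))
qed

lemma skein_generators_moveI:
  "w \<in> webs \<alpha> \<beta> \<Longrightarrow> w' \<in> webs \<alpha> \<beta> \<Longrightarrow> isotopic w w' \<or> subdivision w w' \<Longrightarrow> lw w - lw w' \<in> skein_generators \<alpha> \<beta>"
  unfolding skein_generators_def by blast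

lemma skein_generators_plugI:
  "r \<in> local_relations \<Longrightarrow> disc_embedding h \<Longrightarrow>
   \<forall>e\<in>E. carrier_of e \<inter> h ` square \<subseteq> h ` frontier square \<Longrightarrow> R \<subseteq> UNIV \<times> E \<Longrightarrow>
   \<forall>w\<in>Poly_Mapping.keys r. plug \<alpha> \<beta> E R h w \<in> webs \<alpha> \<beta> \<Longrightarrow>
   (\<Sum>w\<in>Poly_Mapping.keys r. smul (Poly_Mapping.lookup r w) (lw (plug \<alpha> \<beta> E R h w))) \<in> skein_generators \<alpha> \<beta>"
  unfolding skein_generators_def by blast

text \<open>An isotopy or a subdivision in the disc extends to the whole web. A local relation in a
  smaller disc \<open>h0\<close> becomes one in the disc of \<open>h \<circ> h0\<close>, where the
  images of its outside arcs join the outside \<open>E\<close>.\<close>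

lemma placing_skein_generators:
  assumes pl: "placing \<alpha> \<beta> \<alpha>' \<beta>' E R h" and x: "x \<in> skein_generators \<alpha> \<beta>"
  shows "lin_ext (plug \<alpha>' \<beta>' E R h) x \<in> skein_generators \<alpha>' \<beta>'"
proof -
  have h: "phomeo h" "pisot h" "h ` square \<subseteq> square" and RE: "R \<subseteq> UNIV \<times> E"
    and E: "\<And>e. e \<in> E \<Longrightarrow> carrier_of e \<inter> h ` square \<subseteq> h ` frontier square"
    and W: "\<And>w. w \<in> webs \<alpha> \<beta> \<Longrightarrow> plug \<alpha>' \<beta>' E R h w \<in> webs \<alpha>' \<beta>'"
    using pl by (auto simp: placing_def disc_embedding_iff pisot_phomeo)
  have inj: "inj h" using h phomeo_inj by auto
  consider w w' where "x = lw w - lw w'" "w \<in> webs \<alpha> \<beta>" "w' \<in> webs \<alpha> \<beta>" "isotopic w w' \<or> subdivision w w'"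
    | r E0 R0 h0 where "x = (\<Sum>w\<in>Poly_Mapping.keys r. smul (Poly_Mapping.lookup r w) (lw (plug \<alpha> \<beta> E0 R0 h0 w)))"
        "r \<in> local_relations" "disc_embedding h0"
        "\<forall>e\<in>E0. carrier_of e \<inter> h0 ` square \<subseteq> h0 ` frontier square" "R0 \<subseteq> UNIV \<times> E0"
        "\<forall>w\<in>Poly_Mapping.keys r. plug \<alpha> \<beta> E0 R0 h0 w \<in> webs \<alpha> \<beta>"
    using x unfolding skein_generators_def by blast
  thus ?thesis
  proof cases
    case (1 w w')
    hence "isotopic (plug \<alpha>' \<beta>' E R h w) (plug \<alpha>' \<beta>' E R h w') \<or> subdivision (plug \<alpha>' \<beta>' E R h w) (plug \<alpha>' \<beta>' E R h w')"
      using plug_isotopic[OF pl] plug_subdivision[OF pl] by blast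
    thus ?thesis
      unfolding lin_ext_minus 1(1) lin_ext_lw by (intro skein_generators_moveI W 1(2,3))
  next
    case (2 r E0 R0 h0)
    define E1 where "E1 = E \<union> map_darc h ` E0"
    define R1 where "R1 = R \<union> map_overs h R0"
    have h0: "phomeo h0" "pisot h0" "h0 ` square \<subseteq> square"
      using 2 by (auto simp: disc_embedding_iff pisot_phomeo)
    have "lin_ext (plug \<alpha>' \<beta>' E R h) x = (\<Sum>w\<in>Poly_Mapping.keys r. smul (Poly_Mapping.lookup r w) (lw (plug \<alpha>' \<beta>' E1 R1 (h \<circ> h0) w)))"
      unfolding 2(1) lin_ext_sum lin_ext_smul lin_ext_lw plug_plug E1_def R1_def ..
    moreover have "disc_embedding (h \<circ> h0)"
      using h h0 pisot_comp[OF h(2) h0(2)] unfolding disc_embedding_iff image_comp[symmetric] by blast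
    moreover have "\<forall>e\<in>E1. carrier_of e \<inter> (h \<circ> h0) ` square \<subseteq> (h \<circ> h0) ` frontier square"
    proof
      fix e assume "e \<in> E1"
      hence "e \<in> E \<or> (\<exists>e0\<in>E0. e = map_darc h e0)" unfolding E1_def by blast
      thus "carrier_of e \<inter> (h \<circ> h0) ` square \<subseteq> (h \<circ> h0) ` frontier square"
      proof
        assume e: "e \<in> E"
        show ?thesis
        proof
          fix z assume z: "z \<in> carrier_of e \<inter> (h \<circ> h0) ` square"
          then obtain y where y: "z = h (h0 y)" "y \<in> square" by auto
          hence "z \<in> h ` frontier square" using z E[OF e] h0(3) by blast
          hence "h0 y \<in> frontier square" using y inj by (simp add: inj_image_mem_iff)
          hence "h0 y \<notin> interior (h0 ` square)" using interior_mono[OF h0(3)] by (auto simp: frontier_def)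
          hence "y \<notin> interior square" using phomeo_interior[OF h0(1)] by blast
          hence "y \<in> frontier square" using y closed_square by (simp add: frontier_def)
          thus "z \<in> (h \<circ> h0) ` frontier square" using y by auto
        qed
      next
        assume "\<exists>e0\<in>E0. e = map_darc h e0"
        then obtain e0 where e0: "e0 \<in> E0" "e = map_darc h e0" by blast
        have "h ` (carrier_of e0 \<inter> h0 ` square) \<subseteq> h ` (h0 ` frontier square)"
          using 2(4) e0(1) by blast
        thus ?thesis unfolding e0(2) image_Int[OF inj] by (simp add: image_comp)
      qed
    qed
    moreover have "R1 \<subseteq> UNIV \<times> E1"
      using RE 2(5) unfolding R1_def E1_def by (auto elim!: map_overs_elim)
    moreover have "\<forall>w\<in>Poly_Mapping.keys r. plug \<alpha>' \<beta>' E1 R1 (h \<circ> h0) w \<in> webs \<alpha>' \<beta>'"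
    proof
      fix w assume "w \<in> Poly_Mapping.keys r"
      hence "plug \<alpha>' \<beta>' E R h (plug \<alpha> \<beta> E0 R0 h0 w) \<in> webs \<alpha>' \<beta>'" using 2(6) W by blast
      thus "plug \<alpha>' \<beta>' E1 R1 (h \<circ> h0) w \<in> webs \<alpha>' \<beta>'" unfolding E1_def R1_def plug_plug .
    qed
    ultimately show ?thesis using skein_generators_plugI[OF 2(2)] by simp
  qed
qed

lemma placing_skein:
  assumes pl: "placing \<alpha> \<beta> \<alpha>' \<beta>' E R h" and x: "x \<in> lin.span (skein_generators \<alpha> \<beta>)"
  shows "lin_ext (plug \<alpha>' \<beta>' E R h) x \<in> lin.span (skein_generators \<alpha>' \<beta>')"
  using x
proof (induction rule: lin.span_induct_alt)
  case (step c x y)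
  have "smul c (lin_ext (plug \<alpha>' \<beta>' E R h) x) \<in> lin.span (skein_generators \<alpha>' \<beta>')"
    by (rule lin.span_scale, rule lin.span_base, rule placing_skein_generators[OF pl step(1)])
  thus ?case unfolding lin_ext_add lin_ext_smul using step(2) by (rule lin.span_add)
qed (simp add: lin.span_zero)

lemma skein_generators_span: "skein_generators \<alpha> \<beta> \<subseteq> lin.span (lw ` webs \<alpha> \<beta>)"
proof -
  have lw: "lw w \<in> lin.span (lw ` webs \<alpha> \<beta>)" if "w \<in> webs \<alpha> \<beta>" for w
    by (rule lin.span_base) (use that in blast)
  show ?thesis
  proof
    fix x assume "x \<in> skein_generators \<alpha> \<beta>"
    then consider w w' where "x = lw w - lw w'" "w \<in> webs \<alpha> \<beta>" "w' \<in> webs \<alpha> \<beta>"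
      | r E0 R0 h0 where "x = (\<Sum>w\<in>Poly_Mapping.keys r. smul (Poly_Mapping.lookup r w) (lw (plug \<alpha> \<beta> E0 R0 h0 w)))"
        "\<forall>w\<in>Poly_Mapping.keys r. plug \<alpha> \<beta> E0 R0 h0 w \<in> webs \<alpha> \<beta>"
      unfolding skein_generators_def by blast
    thus "x \<in> lin.span (lw ` webs \<alpha> \<beta>)"
    proof cases
      case 1
      thus ?thesis by (simp only: lin.span_diff[OF lw lw])
    next
      case 2
      show ?thesis
        unfolding 2(1) by (rule lin.span_sum, rule lin.span_scale, rule lw) (use 2(2) in blast)
    qed
  qed
qed

lemma span_skein_generators: "x \<in> lin.span (skein_generators \<alpha> \<beta>) \<Longrightarrow> x \<in> lin.span (lw ` webs \<alpha> \<beta>)"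
  using lin.span_minimal[OF skein_generators_span lin.subspace_span] by blast

abbreviation uwebs :: "nat \<Rightarrow> web set" where "uwebs n \<equiv> webs (ups n) (ups n)"
abbreviation bd :: "nat \<Rightarrow> complex set" where "bd n \<equiv> boundary_points (ups n) (ups n)"

lemma bd_iff: "z \<in> bd n \<longleftrightarrow> (\<exists>i<n. z = bpt n i \<or> z = tpt n i)"
  by (auto simp: boundary_points_def)

lemma bpt_simps [simp]: "Re (bpt n i) = real (i + 1) / real (n + 1)" "Im (bpt n i) = 0"
    "Re (tpt n i) = real (i + 1) / real (n + 1)" "Im (tpt n i) = 1"
  by (simp_all add: bpt_def tpt_def)

lemma bd_square: "z \<in> bd n \<Longrightarrow> z \<in> frontier square \<and> 0 < Re z \<and> Re z < 1"
  unfolding bd_iff frontier_square by (auto simp: square_def divide_simps)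

definition ok :: "nat \<Rightarrow> darc set \<Rightarrow> (complex \<times> darc) set \<Rightarrow> bool" where
  "ok n E R \<longleftrightarrow> esys E R \<and>
      (\<forall>e\<in>E. carrier_of e \<subseteq> square \<and> carrier_of e \<inter> frontier square \<subseteq> bd n) \<and>
      (\<forall>i<n. valency E (bpt n i) = (0, 1)) \<and> (\<forall>i<n. valency E (tpt n i) = (1, 0)) \<and>
      (\<forall>p \<in> (\<Union>e\<in>E. ends e) - bd n. valency E p \<in> {(1, 1), (3, 0), (0, 3)})"

lemma uwebs_iff: "w \<in> uwebs n \<longleftrightarrow> bottom w = ups n \<and> topw w = ups n \<and> ok n (edges w) (over w)"
proof -
  have "is_web w \<longleftrightarrow> ok n (edges w) (over w)" if "bottom w = ups n" "topw w = ups n"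
    unfolding is_web_iff ok_def that by simp
  thus ?thesis unfolding webs_def mem_Collect_eq by blast
qed

lemma okD:
  assumes "ok n E R"
  shows "esys E R" "e \<in> E \<Longrightarrow> carrier_of e \<subseteq> square" "e \<in> E \<Longrightarrow> carrier_of e \<inter> frontier square \<subseteq> bd n"
    "i < n \<Longrightarrow> valency E (bpt n i) = (0, 1)" "i < n \<Longrightarrow> valency E (tpt n i) = (1, 0)"
    "p \<in> (\<Union>e\<in>E. ends e) \<Longrightarrow> p \<notin> bd n \<Longrightarrow> valency E p \<in> {(1, 1), (3, 0), (0, 3)}"
proof -
  note A = assms[unfolded ok_def]
  show "esys E R" by (rule A[THEN conjunct1])
  show "e \<in> E \<Longrightarrow> carrier_of e \<subseteq> square" "e \<in> E \<Longrightarrow> carrier_of e \<inter> frontier square \<subseteq> bd n"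
    by (drule bspec[OF A[THEN conjunct2, THEN conjunct1]], elim conjE, assumption)+
  show "i < n \<Longrightarrow> valency E (bpt n i) = (0, 1)"
    by (rule A[THEN conjunct2, THEN conjunct2, THEN conjunct1, rule_format])
  show "i < n \<Longrightarrow> valency E (tpt n i) = (1, 0)"
    by (rule A[THEN conjunct2, THEN conjunct2, THEN conjunct2, THEN conjunct1, rule_format])
  show "p \<in> (\<Union>e\<in>E. ends e) \<Longrightarrow> p \<notin> bd n \<Longrightarrow> valency E p \<in> {(1, 1), (3, 0), (0, 3)}"
    by (rule bspec[OF A[THEN conjunct2, THEN conjunct2, THEN conjunct2, THEN conjunct2]]) (rule DiffI)
qed

lemma valency_pos_end: "finite E \<Longrightarrow> valency E p \<noteq> (0, 0) \<Longrightarrow> \<exists>e\<in>E. p \<in> ends e"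
  using valency_eq_0[of p E] by blast

text \<open>By its valency a boundary point is the end of some edge. Any other edge through it must
  end there as well, since a crossing is not an end of either of its edges.\<close>

lemma ok_frontier_end:
  assumes "ok n E R" "e \<in> E" "z \<in> carrier_of e" "z \<in> frontier square"
  shows "z \<in> ends e"
proof -
  have "z \<in> bd n" using okD(3)[OF assms(1,2)] assms(3,4) by blast
  then obtain i where "i < n" "z = bpt n i \<or> z = tpt n i" unfolding bd_iff by blast
  hence "valency E z \<noteq> (0, 0)" using okD(4,5)[OF assms(1)] by fastforce
  then obtain e' where e': "e' \<in> E" "z \<in> ends e'"
    using valency_pos_end[OF esysD(1)[OF okD(1)[OF assms(1)]]] by blast
  show ?thesis
  proof (cases "e = e'")
    case False
    have "z \<in> carrier_of e'" using is_darc_ends[OF esysD(2)[OF okD(1)[OF assms(1)] e'(1)]] e'(2) by blast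
    hence "z \<in> ends e \<inter> ends e' \<or> crossing E z e e'"
      using esysD(4)[OF okD(1)[OF assms(1)] assms(2) e'(1) False] assms(3) by blast
    thus ?thesis using e'(2) unfolding crossing_def by blast
  qed (use e' in simp)
qed

subsection \<open>Gluing\<close>

text \<open>\<open>f\<close> and \<open>g\<close> embed two squares with disjoint interiors; a boundary point of the first that
  becomes an inner point is a top point and coincides with a bottom point of the second.\<close>

locale glue =
  fixes N m n :: nat and f g :: "complex \<Rightarrow> complex"
  assumes pf: "pisot f" and pg: "pisot g" and fs: "f ` square \<subseteq> square" and gs: "g ` square \<subseteq> square"
    and ff: "z \<in> square \<Longrightarrow> f z \<in> frontier square \<Longrightarrow> z \<in> frontier square"
    and gf: "z \<in> square \<Longrightarrow> g z \<in> frontier square \<Longrightarrow> z \<in> frontier square"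
    and fb: "z \<in> bd m \<Longrightarrow> f z \<in> frontier square \<Longrightarrow> f z \<in> bd N"
    and gb: "z \<in> bd n \<Longrightarrow> g z \<in> frontier square \<Longrightarrow> g z \<in> bd N"
    and If: "z \<in> square \<Longrightarrow> z' \<in> square \<Longrightarrow> f z = g z' \<Longrightarrow> z \<in> frontier square"
    and Ig: "z \<in> square \<Longrightarrow> z' \<in> square \<Longrightarrow> f z = g z' \<Longrightarrow> z' \<in> frontier square"
    and B: "i < N \<Longrightarrow> (\<exists>j<m. bpt N i = f (bpt m j) \<and> bpt N i \<notin> g ` square) \<or> (\<exists>j<n. bpt N i = g (bpt n j) \<and> bpt N i \<notin> f ` square)"
    and T: "i < N \<Longrightarrow> (\<exists>j<m. tpt N i = f (tpt m j) \<and> tpt N i \<notin> g ` square) \<or> (\<exists>j<n. tpt N i = g (tpt n j) \<and> tpt N i \<notin> f ` square)"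
    and Mf: "z \<in> bd m \<Longrightarrow> f z \<notin> bd N \<Longrightarrow> \<exists>i<m. \<exists>j<n. f z = f (tpt m i) \<and> f z = g (bpt n j)"
    and Mg: "z \<in> bd n \<Longrightarrow> g z \<notin> bd N \<Longrightarrow> \<exists>i<m. \<exists>j<n. g z = f (tpt m i) \<and> g z = g (bpt n j)"
begin

lemma f: "phomeo f" "inj f" and g: "phomeo g" "inj g"
  using pisot_phomeo[OF pf] pisot_phomeo[OF pg] by (auto intro: phomeo_inj)

lemma glue_ok:
  assumes ok1: "ok m E1 R1" and ok2: "ok n E2 R2"
  shows "ok N (map_darc f ` E1 \<union> map_darc g ` E2) (map_overs f R1 \<union> map_overs g R2)"
proof -
  note es1 = okD(1)[OF ok1] and es2 = okD(1)[OF ok2]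
  \<comment> \<open>The two squares meet along their boundaries only, and an edge can reach the
    boundary of its square only with an end.\<close>
  have int: "\<forall>e\<in>map_darc f ` E1. \<forall>e'\<in>map_darc g ` E2. carrier_of e \<inter> carrier_of e' \<subseteq> ends e \<inter> ends e'"
  proof (intro ballI subsetI)
    fix e e' p assume "e \<in> map_darc f ` E1" "e' \<in> map_darc g ` E2" and p: "p \<in> carrier_of e \<inter> carrier_of e'"
    then obtain a b where a: "a \<in> E1" "e = map_darc f a" and b: "b \<in> E2" "e' = map_darc g b" by blast
    obtain z z' where z: "z \<in> carrier_of a" "p = f z" "z' \<in> carrier_of b" "p = g z'"
      using p unfolding a b by auto
    have sq: "z \<in> square" "z' \<in> square" using z okD(2)[OF ok1 a(1)] okD(2)[OF ok2 b(1)] by blast+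
    have eq: "f z = g z'" using z by simp
    have fr: "z \<in> frontier square" "z' \<in> frontier square"
      using If[OF sq eq] Ig[OF sq eq] .
    have "z \<in> ends a" "z' \<in> ends b"
      using ok_frontier_end[OF ok1 a(1) z(1) fr(1)] ok_frontier_end[OF ok2 b(1) z(3) fr(2)] .
    thus "p \<in> ends e \<inter> ends e'" using z a b by auto
  qed
  note es = esys_Un[OF esys_map[OF es1 f(1)] esys_map[OF es2 g(1)] int]
  have val: "valency (map_darc f ` E1 \<union> map_darc g ` E2) p =
    (fst (valency (map_darc f ` E1) p) + fst (valency (map_darc g ` E2) p),
     snd (valency (map_darc f ` E1) p) + snd (valency (map_darc g ` E2) p))" for p
    by (rule valency_Un) (use es(2) esysD(1)[OF es1] esysD(1)[OF es2] in auto)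
  have v1: "valency (map_darc f ` E1) (f z) = valency E1 z" and v2: "valency (map_darc g ` E2) (g z) = valency E2 z" for z
    by (rule valency_map[OF f(2)], rule valency_map[OF g(2)])
  have end1: "\<exists>a\<in>E1. \<exists>z\<in>ends a. p = f z \<and> z \<in> carrier_of a \<and> z \<in> square" if te: "e \<in> map_darc f ` E1" "p \<in> ends e" for e p
  proof -
    obtain a where a: "a \<in> E1" "e = map_darc f a" using te(1) by blast
    obtain z where z: "z \<in> ends a" "p = f z" using te(2) unfolding a by auto
    have "z \<in> carrier_of a" using is_darc_ends[OF esysD(2)[OF es1 a(1)]] z by blast
    thus ?thesis using okD(2)[OF ok1 a(1)] a z by blast
  qed
  have end2: "\<exists>a\<in>E2. \<exists>z\<in>ends a. p = g z \<and> z \<in> carrier_of a \<and> z \<in> square" if te: "e \<in> map_darc g ` E2" "p \<in> ends e" for e p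
  proof -
    obtain a where a: "a \<in> E2" "e = map_darc g a" using te(1) by blast
    obtain z where z: "z \<in> ends a" "p = g z" using te(2) unfolding a by auto
    have "z \<in> carrier_of a" using is_darc_ends[OF esysD(2)[OF es2 a(1)]] z by blast
    thus ?thesis using okD(2)[OF ok2 a(1)] a z by blast
  qed
  have z1: "valency (map_darc f ` E1) p = (0, 0)" if "p \<notin> f ` square" for p
    by (rule valency_eq_0) (use that end1 in blast)
  have z2: "valency (map_darc g ` E2) p = (0, 0)" if "p \<notin> g ` square" for p
    by (rule valency_eq_0) (use that end2 in blast)
  show ?thesis
    unfolding ok_def
  proof (intro conjI)
    show "esys (map_darc f ` E1 \<union> map_darc g ` E2) (map_overs f R1 \<union> map_overs g R2)" by (rule es(1))
    show "\<forall>e\<in>map_darc f ` E1 \<union> map_darc g ` E2. carrier_of e \<subseteq> square \<and> carrier_of e \<inter> frontier square \<subseteq> bd N"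
    proof
      fix e assume "e \<in> map_darc f ` E1 \<union> map_darc g ` E2"
      then consider a where "a \<in> E1" "e = map_darc f a" | a where "a \<in> E2" "e = map_darc g a" by blast
      thus "carrier_of e \<subseteq> square \<and> carrier_of e \<inter> frontier square \<subseteq> bd N"
      proof cases
        case 1
        have "carrier_of e \<inter> frontier square \<subseteq> bd N"
        proof
          fix p assume p: "p \<in> carrier_of e \<inter> frontier square"
          then obtain z where z: "z \<in> carrier_of a" "p = f z" unfolding 1(2) by auto
          hence "z \<in> bd m" using p ff okD(2,3)[OF ok1 1(1)] by blast
          thus "p \<in> bd N" using fb p z by blast
        qed
        moreover have "carrier_of e \<subseteq> square" using okD(2)[OF ok1 1(1)] fs unfolding 1(2) map_darc_simps by blast
        ultimately show ?thesis by blast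
      next
        case 2
        have "carrier_of e \<inter> frontier square \<subseteq> bd N"
        proof
          fix p assume p: "p \<in> carrier_of e \<inter> frontier square"
          then obtain z where z: "z \<in> carrier_of a" "p = g z" unfolding 2(2) by auto
          hence "z \<in> bd n" using p gf okD(2,3)[OF ok2 2(1)] by blast
          thus "p \<in> bd N" using gb p z by blast
        qed
        moreover have "carrier_of e \<subseteq> square" using okD(2)[OF ok2 2(1)] gs unfolding 2(2) map_darc_simps by blast
        ultimately show ?thesis by blast
      qed
    qed
    show "\<forall>i<N. valency (map_darc f ` E1 \<union> map_darc g ` E2) (bpt N i) = (0, 1)"
    proof (intro allI impI)
      fix i assume "i < N"
      from B[OF this] consider j where "j < m" "bpt N i = f (bpt m j)" "bpt N i \<notin> g ` square"
        | j where "j < n" "bpt N i = g (bpt n j)" "bpt N i \<notin> f ` square" by blast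
      thus "valency (map_darc f ` E1 \<union> map_darc g ` E2) (bpt N i) = (0, 1)"
      proof cases
        case 1
        show ?thesis unfolding val z2[OF 1(3)] unfolding 1(2) v1 okD(4)[OF ok1 1(1)] by simp
      next
        case 2
        show ?thesis unfolding val z1[OF 2(3)] unfolding 2(2) v2 okD(4)[OF ok2 2(1)] by simp
      qed
    qed
    show "\<forall>i<N. valency (map_darc f ` E1 \<union> map_darc g ` E2) (tpt N i) = (1, 0)"
    proof (intro allI impI)
      fix i assume "i < N"
      from T[OF this] consider j where "j < m" "tpt N i = f (tpt m j)" "tpt N i \<notin> g ` square"
        | j where "j < n" "tpt N i = g (tpt n j)" "tpt N i \<notin> f ` square" by blast
      thus "valency (map_darc f ` E1 \<union> map_darc g ` E2) (tpt N i) = (1, 0)"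
      proof cases
        case 1
        show ?thesis unfolding val z2[OF 1(3)] unfolding 1(2) v1 okD(5)[OF ok1 1(1)] by simp
      next
        case 2
        show ?thesis unfolding val z1[OF 2(3)] unfolding 2(2) v2 okD(5)[OF ok2 2(1)] by simp
      qed
    qed
    show "\<forall>p\<in>(\<Union>e\<in>map_darc f ` E1 \<union> map_darc g ` E2. ends e) - bd N.
       valency (map_darc f ` E1 \<union> map_darc g ` E2) p \<in> {(1, 1), (3, 0), (0, 3)}"
    proof
      fix p assume p: "p \<in> (\<Union>e\<in>map_darc f ` E1 \<union> map_darc g ` E2. ends e) - bd N"
      \<comment> \<open>A top point of the first web has valency \<open>(1, 0)\<close> and a bottom
        point of the second has \<open>(0, 1)\<close>, so glued points become cutting
        points.\<close>
      have seam: "valency (map_darc f ` E1 \<union> map_darc g ` E2) p = (1, 1)"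
        if "i < m" "j < n" "p = f (tpt m i)" "p = g (bpt n j)" for i j
      proof -
        have "valency (map_darc f ` E1) p = (1, 0)" unfolding that(3) v1 by (rule okD(5)[OF ok1 that(1)])
        moreover have "valency (map_darc g ` E2) p = (0, 1)" unfolding that(4) v2 by (rule okD(4)[OF ok2 that(2)])
        ultimately show ?thesis unfolding val by simp
      qed
      from p obtain e where e: "e \<in> map_darc f ` E1 \<or> e \<in> map_darc g ` E2" "p \<in> ends e" by blast
      from e(1) have "(\<exists>a\<in>E1. \<exists>z\<in>ends a. p = f z \<and> z \<in> carrier_of a \<and> z \<in> square) \<or>
          (\<exists>a\<in>E2. \<exists>z\<in>ends a. p = g z \<and> z \<in> carrier_of a \<and> z \<in> square)"
        using end1[OF _ e(2)] end2[OF _ e(2)] by (elim disjE) simp_all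
      then consider a z where "a \<in> E1" "z \<in> ends a" "p = f z" "z \<in> carrier_of a" "z \<in> square"
        | a z where "a \<in> E2" "z \<in> ends a" "p = g z" "z \<in> carrier_of a" "z \<in> square"
        by (elim disjE bexE conjE) blast+
      thus "valency (map_darc f ` E1 \<union> map_darc g ` E2) p \<in> {(1, 1), (3, 0), (0, 3)}"
      proof cases
        case 1
        show ?thesis
        proof (cases "z \<in> bd m")
          case True
          have "f z \<notin> bd N" using p 1(3) by simp
          from Mf[OF True this] obtain i j where "i < m" "j < n" "f z = f (tpt m i)" "f z = g (bpt n j)"
            by (elim exE conjE)
          from seam[OF this[folded 1(3)]] show ?thesis by simp
        next
          case False
          have "p \<notin> ends e'" if "e' \<in> map_darc g ` E2" for e'
          proof
            assume "p \<in> ends e'"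
            from end2[OF that this] obtain z' where "p = g z'" "z' \<in> square" by blast
            hence "z \<in> frontier square" using If[OF 1(5)] 1(3) by metis
            thus False using okD(3)[OF ok1 1(1)] 1(4) False by blast
          qed
          hence v0: "valency (map_darc g ` E2) p = (0, 0)" by (intro valency_eq_0) blast
          have "valency E1 z \<in> {(1, 1), (3, 0), (0, 3)}" by (rule okD(6)[OF ok1]) (use 1 False in blast)+
          thus ?thesis unfolding val v0 unfolding 1(3) v1 by auto
        qed
      next
        case 2
        show ?thesis
        proof (cases "z \<in> bd n")
          case True
          have "g z \<notin> bd N" using p 2(3) by simp
          from Mg[OF True this] obtain i j where "i < m" "j < n" "g z = f (tpt m i)" "g z = g (bpt n j)"
            by (elim exE conjE)
          from seam[OF this[folded 2(3)]] show ?thesis by simp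
        next
          case False
          have "p \<notin> ends e'" if "e' \<in> map_darc f ` E1" for e'
          proof
            assume "p \<in> ends e'"
            from end1[OF that this] obtain z' where "p = f z'" "z' \<in> square" by blast
            hence "z \<in> frontier square" using Ig[of z' z] 2(3,5) by metis
            thus False using okD(3)[OF ok2 2(1)] 2(4) False by blast
          qed
          hence v0: "valency (map_darc f ` E1) p = (0, 0)" by (intro valency_eq_0) blast
          have "valency E2 z \<in> {(1, 1), (3, 0), (0, 3)}" by (rule okD(6)[OF ok2]) (use 2 False in blast)+
          thus ?thesis unfolding val v0 unfolding 2(3) v2 by auto
        qed
      qed
    qed
  qed
qed

end

definition glue_web :: "nat \<Rightarrow> (complex \<Rightarrow> complex) \<Rightarrow> (complex \<Rightarrow> complex) \<Rightarrow> web \<Rightarrow> web \<Rightarrow> web" where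
  "glue_web N f g v w = Web (ups N) (ups N) (map_darc f ` edges v \<union> map_darc g ` edges w) (map_overs f (over v) \<union> map_overs g (over w))"

lemma glue_web_webs: "glue N m n f g \<Longrightarrow> v \<in> uwebs m \<Longrightarrow> w \<in> uwebs n \<Longrightarrow> glue_web N f g v w \<in> uwebs N"
  unfolding uwebs_iff by (simp add: glue_web_def glue.glue_ok)

lemma glue_web_plug:
  "glue_web N f g v w = plug (ups N) (ups N) (map_darc g ` edges w) (map_overs g (over w)) f v"
  "glue_web N f g v w = plug (ups N) (ups N) (map_darc f ` edges v) (map_overs f (over v)) g w"
  by (simp_all add: glue_web_def plug_eq Un_commute)

lemma over_subset: "w \<in> uwebs n \<Longrightarrow> map_overs f (over w) \<subseteq> UNIV \<times> map_darc f ` edges w"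
proof
  fix x assume w: "w \<in> uwebs n" and "x \<in> map_overs f (over w)"
  then obtain p e where x: "x = (f p, map_darc f e)" "(p, e) \<in> over w" by (elim map_overs_elim) blast
  have "e \<in> edges w" using esys_over[OF websD(1)[OF w] x(2)] by blast
  thus "x \<in> UNIV \<times> map_darc f ` edges w" using x(1) by simp
qed

lemma glue_placing:
  assumes gl: "glue N m n f g"
  shows "w \<in> uwebs n \<Longrightarrow> placing (ups m) (ups m) (ups N) (ups N) (map_darc g ` edges w) (map_overs g (over w)) f"
    and "v \<in> uwebs m \<Longrightarrow> placing (ups n) (ups n) (ups N) (ups N) (map_darc f ` edges v) (map_overs f (over v)) g"
proof -
  interpret glue N m n f g by (rule gl)
  have d: "disc_embedding f" "disc_embedding g" unfolding disc_embedding_iff using pf pg fs gs by simp_all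
  show "placing (ups m) (ups m) (ups N) (ups N) (map_darc g ` edges w) (map_overs g (over w)) f" if w: "w \<in> uwebs n"
    unfolding placing_def
  proof (intro conjI ballI)
    fix e assume "e \<in> map_darc g ` edges w"
    then obtain a where a: "a \<in> edges w" "e = map_darc g a" by blast
    show "carrier_of e \<inter> f ` square \<subseteq> f ` frontier square"
    proof
      fix p assume "p \<in> carrier_of e \<inter> f ` square"
      then obtain z z' where "p = g z'" "z' \<in> carrier_of a" "p = f z" "z \<in> square"
        unfolding a(2) map_darc_simps by (elim IntE imageE) blast
      thus "p \<in> f ` frontier square" using Ig If websD(2)[OF w a(1)] by (metis imageI subsetD)
    qed
  next
    fix v assume "v \<in> uwebs m"
    thus "plug (ups N) (ups N) (map_darc g ` edges w) (map_overs g (over w)) f v \<in> uwebs N"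
      unfolding glue_web_plug(1)[symmetric] by (rule glue_web_webs[OF gl _ w])
  qed (use d over_subset[OF w] in auto)
  show "placing (ups n) (ups n) (ups N) (ups N) (map_darc f ` edges v) (map_overs f (over v)) g" if v: "v \<in> uwebs m"
    unfolding placing_def
  proof (intro conjI ballI)
    fix e assume "e \<in> map_darc f ` edges v"
    then obtain a where a: "a \<in> edges v" "e = map_darc f a" by blast
    show "carrier_of e \<inter> g ` square \<subseteq> g ` frontier square"
    proof
      fix p assume "p \<in> carrier_of e \<inter> g ` square"
      then obtain z z' where "p = f z'" "z' \<in> carrier_of a" "p = g z" "z \<in> square"
        unfolding a(2) map_darc_simps by (elim IntE imageE) blast
      thus "p \<in> g ` frontier square" using Ig If websD(2)[OF v a(1)] by (metis imageI subsetD)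
    qed
  next
    fix w assume "w \<in> uwebs n"
    thus "plug (ups N) (ups N) (map_darc f ` edges v) (map_overs f (over v)) g w \<in> uwebs N"
      unfolding glue_web_plug(2)[symmetric] by (rule glue_web_webs[OF gl v])
  qed (use d over_subset[OF v] in auto)
qed

subsection \<open>Equality in the skein module is a congruence\<close>

abbreviation Sp :: "nat \<Rightarrow> lweb set" where "Sp n \<equiv> lin.span (lw ` uwebs n)"
abbreviation heq :: "nat \<Rightarrow> lweb \<Rightarrow> lweb \<Rightarrow> bool" where "heq n \<equiv> eq_in_Hom (ups n) (ups n)"
abbreviation sk :: "nat \<Rightarrow> lweb set" where "sk n \<equiv> lin.span (skein_generators (ups n) (ups n))"

lemma heq_refl: "x \<in> Sp n \<Longrightarrow> heq n x x"
  by (simp add: eq_in_Hom_def lin.span_zero)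

lemma heq_sym: "heq n x y \<Longrightarrow> heq n y x"
  unfolding eq_in_Hom_def using lin.span_neg[of "x - y"] by simp

lemma heq_trans: "heq n x y \<Longrightarrow> heq n y z \<Longrightarrow> heq n x z"
  unfolding eq_in_Hom_def using lin.span_add[of "x - y" _ "y - z"] by simp

lemma heq_add: "heq n x y \<Longrightarrow> heq n x' y' \<Longrightarrow> heq n (x + x') (y + y')"
  unfolding eq_in_Hom_def using lin.span_add[of "x - y" _ "x' - y'"]
  by (auto simp: lin.span_add algebra_simps)

lemma heq_smul: "heq n x y \<Longrightarrow> heq n (smul c x) (smul c y)"
  unfolding eq_in_Hom_def using lin.span_scale[of "x - y" _ c]
  by (auto simp: lin.span_scale lin.scale_right_diff_distrib)

lemma heq_minus: "heq n x y \<Longrightarrow> heq n x' y' \<Longrightarrow> heq n (x - x') (y - y')"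
  using heq_add[of n x y "smul (- 1) x'" "smul (- 1) y'"] heq_smul[of n x' y' "- 1"] by simp

lemma heqD: "heq n x y \<Longrightarrow> x \<in> Sp n" "heq n x y \<Longrightarrow> y \<in> Sp n" "heq n x y \<Longrightarrow> x - y \<in> sk n"
  by (simp_all add: eq_in_Hom_def)

lemma lw_Sp: "w \<in> uwebs n \<Longrightarrow> lw w \<in> Sp n"
  by (rule lin.span_base) (rule imageI)

lemma heq_move: "w \<in> uwebs n \<Longrightarrow> w' \<in> uwebs n \<Longrightarrow> isotopic w w' \<or> subdivision w w' \<Longrightarrow> heq n (lw w) (lw w')"
  unfolding eq_in_Hom_def by (intro conjI lw_Sp lin.span_base skein_generators_moveI)

lemma span_sum_rep: "x \<in> lin.span (lw ` A) \<Longrightarrow>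
  (\<And>w. w \<in> A \<Longrightarrow> Q (lw w)) \<Longrightarrow> Q 0 \<Longrightarrow> (\<And>x y c. Q x \<Longrightarrow> Q y \<Longrightarrow> Q (smul c x + y)) \<Longrightarrow> Q x"
  by (induction rule: lin.span_induct_alt) auto

text \<open>With one argument fixed the operation is a placing of the other, so the arguments may be
  changed one at a time: the difference of the results is \<open>F\<close> of \<open>x - x'\<close>
  and \<open>y\<close> plus \<open>F\<close> of \<open>x'\<close> and \<open>y - y'\<close>.\<close>

lemma bilinear_cong:
  assumes glue1: "\<And>w. w \<in> uwebs n \<Longrightarrow> \<exists>E R f. placing (ups m) (ups m) (ups N) (ups N) E R f \<and> (\<forall>v\<in>uwebs m. F v w = plug (ups N) (ups N) E R f v)"
    and glue2: "\<And>v. v \<in> uwebs m \<Longrightarrow> \<exists>E R f. placing (ups n) (ups n) (ups N) (ups N) E R f \<and> (\<forall>w\<in>uwebs n. F v w = plug (ups N) (ups N) E R f w)"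
    and x: "heq m x x'" and y: "heq n y y'"
  shows "heq N (bilinear_ext F x y) (bilinear_ext F x' y')"
proof -
  have web: "F v w \<in> uwebs N" if "v \<in> uwebs m" "w \<in> uwebs n" for v w
    using glue1[OF that(2)] that(1) unfolding placing_def by metis
  have Sp: "bilinear_ext F a b \<in> Sp N" if a: "a \<in> Sp m" and b: "b \<in> Sp n" for a b
    unfolding bilinear_ext_def
    by (intro lin.span_sum lin.span_scale lw_Sp web) (use keys_span[OF a] keys_span[OF b] in blast)+
  have 1: "bilinear_ext F a b \<in> sk N" if a: "a \<in> sk m" and b: "b \<in> Sp n" for a b
    using b
  proof (rule span_sum_rep)
    fix w assume w: "w \<in> uwebs n"
    obtain E R f where p: "placing (ups m) (ups m) (ups N) (ups N) E R f" "\<forall>v\<in>uwebs m. F v w = plug (ups N) (ups N) E R f v"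
      using glue1[OF w] by blast
    have "bilinear_ext F a (lw w) = lin_ext (plug (ups N) (ups N) E R f) a"
      unfolding bilinear_ext_lw_right
      by (rule lin_ext_cong) (use p(2) keys_span[OF span_skein_generators[OF a]] in blast)
    thus "bilinear_ext F a (lw w) \<in> sk N" using placing_skein[OF p(1) a] by simp
  qed (auto simp: bilinear_ext_add_right bilinear_ext_smul_right lin.span_zero lin.span_add lin.span_scale)
  have 2: "bilinear_ext F a b \<in> sk N" if a: "a \<in> Sp m" and b: "b \<in> sk n" for a b
    using a
  proof (rule span_sum_rep)
    fix v assume v: "v \<in> uwebs m"
    obtain E R f where p: "placing (ups n) (ups n) (ups N) (ups N) E R f" "\<forall>w\<in>uwebs n. F v w = plug (ups N) (ups N) E R f w"
      using glue2[OF v] by blast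
    have "bilinear_ext F (lw v) b = lin_ext (plug (ups N) (ups N) E R f) b"
      unfolding bilinear_ext_lw_left
      by (rule lin_ext_cong) (use p(2) keys_span[OF span_skein_generators[OF b]] in blast)
    thus "bilinear_ext F (lw v) b \<in> sk N" using placing_skein[OF p(1) b] by simp
  qed (auto simp: bilinear_ext_add_left bilinear_ext_smul_left lin.span_zero lin.span_add lin.span_scale)
  have "bilinear_ext F x y - bilinear_ext F x' y' = bilinear_ext F (x - x') y + bilinear_ext F x' (y - y')"
    by (simp add: bilinear_ext_minus_left bilinear_ext_minus_right)
  also have "\<dots> \<in> sk N"
    by (intro lin.span_add 1 2 heqD[OF x] heqD[OF y])
  finally show ?thesis
    unfolding eq_in_Hom_def using Sp heqD[OF x] heqD[OF y] by blast
qed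

subsection \<open>Moving a web by an isotopy of the square\<close>

definition move_web :: "(complex \<Rightarrow> complex) \<Rightarrow> web \<Rightarrow> web" where
  "move_web h w = Web (bottom w) (topw w) (map_darc h ` edges w) (map_overs h (over w))"

lemma sqisot_fixes: "sqisot h \<Longrightarrow> z \<notin> interior square \<Longrightarrow> h z = z"
  unfolding sqisot_def by (elim exE conjE) simp

lemma fixing_outside:
  assumes "inj h" "\<And>z. z \<notin> interior square \<Longrightarrow> h z = z"
  shows "h z \<in> interior square \<longleftrightarrow> z \<in> interior square"
proof
  assume "h z \<in> interior square"
  thus "z \<in> interior square" using assms(2)[of z] by (cases "z \<in> interior square") auto
next
  assume z: "z \<in> interior square"
  show "h z \<in> interior square"
  proof (rule ccontr)
    assume n: "h z \<notin> interior square"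
    from assms(2)[OF this] have "h z = z" using assms(1) by (simp add: inj_eq)
    thus False using z n by simp
  qed
qed

lemma square_interior_frontier: "square = interior square \<union> frontier square" "frontier square \<inter> interior square = {}"
  using closed_square interior_subset[of square] by (auto simp: frontier_def)

lemma fixing_square:
  assumes "inj h" "\<And>z. z \<notin> interior square \<Longrightarrow> h z = z"
  shows "h z \<in> square \<longleftrightarrow> z \<in> square" "h z \<in> frontier square \<Longrightarrow> h z = z"
proof -
  have "h z = z" if "z \<notin> interior square" for z using assms(2) that .
  thus "h z \<in> square \<longleftrightarrow> z \<in> square"
    using fixing_outside[OF assms, of z] square_interior_frontier
    by (cases "z \<in> interior square") (auto dest: subsetD[OF interior_subset])
  show "h z = z" if "h z \<in> frontier square"
  proof -
    have "h z \<notin> interior square" using that square_interior_frontier(2) by blast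
    hence "h (h z) = h z" by (rule assms(2))
    thus ?thesis using assms(1) by (simp add: inj_eq)
  qed
qed

lemma ok_sqisot:
  assumes "sqisot h" "ok n E R"
  shows "ok n (map_darc h ` E) (map_overs h R)"
proof -
  have h: "phomeo h" "inj h" using sqisot_pisot[OF assms(1)] pisot_phomeo phomeo_inj by auto
  have fx: "\<And>z. z \<notin> interior square \<Longrightarrow> h z = z" by (rule sqisot_fixes[OF assms(1)])
  note F = fixing_square[OF h(2) fx]
  have bd: "h z = z" if "z \<in> bd n" for z
    using bd_square[OF that] square_interior_frontier(2) by (intro fx) blast
  note D = okD[OF assms(2)]
  have v: "valency (map_darc h ` E) (h z) = valency E z" for z by (rule valency_map[OF h(2)])
  have vb: "valency (map_darc h ` E) z = valency E z" if "z \<in> bd n" for z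
    using v[of z] unfolding bd[OF that] .
  show ?thesis
    unfolding ok_def
  proof (intro conjI allI impI ballI)
    show "esys (map_darc h ` E) (map_overs h R)" by (rule esys_map[OF D(1) h(1)])
    fix i assume i: "i < n"
    show "valency (map_darc h ` E) (bpt n i) = (0, 1)" using vb[of "bpt n i"] D(4)[OF i] i by (simp add: bd_iff) blast
    show "valency (map_darc h ` E) (tpt n i) = (1, 0)" using vb[of "tpt n i"] D(5)[OF i] i by (simp add: bd_iff) blast
  next
    fix e assume "e \<in> map_darc h ` E"
    then obtain a where a: "a \<in> E" "e = map_darc h a" by blast
    show "carrier_of e \<subseteq> square" using D(2)[OF a(1)] F(1) unfolding a(2) map_darc_simps by blast
    show "carrier_of e \<inter> frontier square \<subseteq> bd n"
    proof
      fix p assume p: "p \<in> carrier_of e \<inter> frontier square"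
      then obtain z where z: "z \<in> carrier_of a" "p = h z" unfolding a(2) map_darc_simps by blast
      have "h z = z" using F(2)[of z] p z by simp
      thus "p \<in> bd n" using D(3)[OF a(1)] p z by auto
    qed
  next
    fix p assume p: "p \<in> (\<Union>e\<in>map_darc h ` E. ends e) - bd n"
    then obtain a where a: "a \<in> E" "p \<in> ends (map_darc h a)" by blast
    then obtain z where z: "z \<in> ends a" "p = h z" by auto
    have "z \<notin> bd n" using p bd[of z] z(2) by auto
    thus "valency (map_darc h ` E) p \<in> {(1, 1), (3, 0), (0, 3)}"
      unfolding z(2) v by (intro D(6)) (use a z in blast)+
  qed
qed

lemma ambient_isotopy_square:
  assumes k: "ambient_isotopy UNIV k" and fx: "\<And>t z. t \<in> {0..1} \<Longrightarrow> z \<notin> interior square \<Longrightarrow> k t z = z"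
  shows "ambient_isotopy square k"
  unfolding ambient_isotopy_def
proof (intro conjI ballI)
  show "continuous_on ({0..1} \<times> square) (\<lambda>(t, z). k t z)"
    by (rule continuous_on_subset[OF conjunct1[OF k[unfolded ambient_isotopy_def]]]) auto
  fix t :: real assume t: "t \<in> {0..1}"
  have h: "phomeo (k t)" by (rule ambient_isotopy_phomeo[OF k t])
  note F = fixing_square[OF phomeo_inj[OF h] fx[OF t]]
  have "k t ` square = square"
  proof
    show "k t ` square \<subseteq> square" using F(1) by blast
    show "square \<subseteq> k t ` square"
    proof
      fix z assume z: "z \<in> square"
      obtain y where y: "z = k t y" using h unfolding phomeo_def by (metis bij_is_surj surjD)
      thus "z \<in> k t ` square" using z F(1)[of y] by blast
    qed
  qed
  thus "\<exists>g. homeomorphism square square (k t) g"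
    using homeomorphism_of_subsets[OF phomeo_homeomorphism[OF h], of square square] by blast
next
  show "k 0 z = z" for z using k unfolding ambient_isotopy_def by blast
qed

lemma heq_move_web:
  assumes h: "sqisot h" and w: "w \<in> uwebs n"
  shows "move_web h w \<in> uwebs n" "heq n (lw w) (lw (move_web h w))"
proof -
  have w': "bottom w = ups n" "topw w = ups n" "ok n (edges w) (over w)" using w unfolding uwebs_iff by blast+
  show mw: "move_web h w \<in> uwebs n"
    unfolding uwebs_iff move_web_def using w' ok_sqisot[OF h w'(3)] by simp
  obtain k where k: "ambient_isotopy UNIV k" "h = k 1" "\<forall>t\<in>{0..1}. \<forall>z. z \<notin> interior square \<longrightarrow> k t z = z"
    using h unfolding sqisot_def by blast
  have "ambient_isotopy square k" by (rule ambient_isotopy_square[OF k(1)]) (use k(3) in blast)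
  moreover have "\<forall>t\<in>{0..1}. \<forall>z\<in>frontier square. k t z = z" using k(3) square_interior_frontier(2) by blast
  ultimately have "isotopic w (move_web h w)"
    unfolding isotopic_def move_web_def k(2) map_edges_eq map_over_eq by (intro exI[of _ k] conjI refl)
  thus "heq n (lw w) (lw (move_web h w))" using heq_move[OF w mw] by blast
qed

subsection \<open>Stacking\<close>

definition lo :: "complex \<Rightarrow> complex" where "lo z = Complex (Re z) (Im z / 2)"
definition hi :: "complex \<Rightarrow> complex" where "hi z = Complex (Re z) ((Im z + 1) / 2)"

lemma lo_hi_simps [simp]: "Re (lo z) = Re z" "Im (lo z) = Im z / 2" "Re (hi z) = Re z" "Im (hi z) = (Im z + 1) / 2"
  by (simp_all add: lo_def hi_def)

lemma stack_web_eq: "stack_web w v = Web (bottom v) (topw w) (map_darc lo ` edges v \<union> map_darc hi ` edges w)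
   (map_overs lo (over v) \<union> map_overs hi (over w))"
  by (simp add: stack_web_def Let_def map_edges_eq map_over_eq lo_def[abs_def] hi_def[abs_def])

lemma strict_mono_linear: "(a :: real) > 0 \<Longrightarrow> strict_mono (\<lambda>x. a * x + b)"
  by (rule strict_monoI) simp

lemma surj_linear: "(a :: real) \<noteq> 0 \<Longrightarrow> surj (\<lambda>x. a * x + b)"
  by (rule surj_onI) (rule exI[of _ "(_ - b) / a"], simp)

lemma pisot_linear:
  assumes "a > 0" "c > 0"
  shows "pisot (\<lambda>z. Complex (a * Re z + b) (c * Im z + d))"
  by (rule pisot_product[of "\<lambda>x. a * x + b" "\<lambda>y. c * y + d"])
     (use assms in \<open>auto intro!: continuous_intros strict_mono_linear surj_linear\<close>)

lemma pisot_lo: "pisot lo" and pisot_hi: "pisot hi"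
proof -
  have 1: "lo = (\<lambda>z. Complex (1 * Re z + 0) ((1 / 2) * Im z + 0))" and 2: "hi = (\<lambda>z. Complex (1 * Re z + 0) ((1 / 2) * Im z + 1 / 2))"
    by (simp_all add: fun_eq_iff complex_eq_iff)
  show "pisot lo" unfolding 1 by (rule pisot_linear) simp_all
  show "pisot hi" unfolding 2 by (rule pisot_linear) simp_all
qed

text \<open>The numbered goals are the assumptions of \<open>glue\<close> in their order: 11 and 12
  locate the outer end points, 13 and 14 identify the points of the seam at height 1/2.\<close>

lemma glue_stack: "glue n n n lo hi"
proof (standard, goal_cases)
  case (11 i)
  have "bpt n i = lo (bpt n i)" "bpt n i \<notin> hi ` square"
    by (auto simp: complex_eq_iff square_def)
  thus ?case using 11 by blast
next
  case (12 i)
  have "tpt n i = hi (tpt n i)" "tpt n i \<notin> lo ` square"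
    by (auto simp: complex_eq_iff square_def)
  thus ?case using 12 by blast
next
  case (13 z)
  then obtain i where i: "i < n" "z = bpt n i \<or> z = tpt n i" unfolding bd_iff by blast
  have "lo (bpt n i) = bpt n i" by (simp add: complex_eq_iff)
  hence "z = tpt n i" using 13 i unfolding bd_iff by auto
  moreover have "lo (tpt n i) = hi (bpt n i)" by (simp add: complex_eq_iff)
  ultimately show ?case using i by blast
next
  case (14 z)
  then obtain i where i: "i < n" "z = bpt n i \<or> z = tpt n i" unfolding bd_iff by blast
  have "hi (tpt n i) = tpt n i" by (simp add: complex_eq_iff)
  hence "z = bpt n i" using 14 i unfolding bd_iff by auto
  moreover have "hi (bpt n i) = lo (tpt n i)" by (simp add: complex_eq_iff)
  ultimately show ?case using i by metis
next
  case (7 z)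
  then obtain i where i: "i < n" "z = bpt n i \<or> z = tpt n i" unfolding bd_iff by blast
  have "lo (tpt n i) \<notin> frontier square" "lo (bpt n i) = bpt n i"
    using i(1) by (auto simp: frontier_square complex_eq_iff divide_simps)
  thus ?case using 7 i unfolding bd_iff by auto
next
  case (8 z)
  then obtain i where i: "i < n" "z = bpt n i \<or> z = tpt n i" unfolding bd_iff by blast
  have "hi (bpt n i) \<notin> frontier square" "hi (tpt n i) = tpt n i"
    using i by (auto simp: frontier_square complex_eq_iff divide_simps)
  thus ?case using 8 i unfolding bd_iff by auto
qed (unfold frontier_square, auto simp: pisot_lo pisot_hi square_def complex_eq_iff)

lemma stack_web_glue: "w \<in> uwebs n \<Longrightarrow> v \<in> uwebs n \<Longrightarrow> stack_web w v = glue_web n lo hi v w"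
  by (simp add: stack_web_eq glue_web_def uwebs_iff)

lemma stack_webs: "w \<in> uwebs n \<Longrightarrow> v \<in> uwebs n \<Longrightarrow> stack_web w v \<in> uwebs n"
  using glue_web_webs[OF glue_stack] by (simp add: stack_web_glue)

lemma wcomp_cong:
  assumes "heq n x x'" "heq n y y'"
  shows "heq n (x \<odot> y) (x' \<odot> y')"
  unfolding wcomp_def
proof (rule bilinear_cong[OF _ _ assms])
  fix w assume w: "w \<in> uwebs n"
  show "\<exists>E R f. placing (ups n) (ups n) (ups n) (ups n) E R f \<and> (\<forall>v\<in>uwebs n. stack_web v w = plug (ups n) (ups n) E R f v)"
    using glue_placing(2)[OF glue_stack w] glue_web_plug(2) stack_web_glue w by metis
  show "\<exists>E R f. placing (ups n) (ups n) (ups n) (ups n) E R f \<and> (\<forall>v\<in>uwebs n. stack_web w v = plug (ups n) (ups n) E R f v)"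
    using glue_placing(1)[OF glue_stack w] glue_web_plug(1) stack_web_glue w by metis
qed

lemma wcomp_lw [simp]: "lw w \<odot> lw v = lw (stack_web w v)"
  by (simp add: wcomp_def bilinear_ext_lw_left)

lemma wcomp_Sp: "x \<in> Sp n \<Longrightarrow> y \<in> Sp n \<Longrightarrow> x \<odot> y \<in> Sp n"
  using wcomp_cong[OF heq_refl heq_refl] heqD(1) by blast

lemmas wcomp_linear = bilinear_ext_add_left[where f = stack_web, folded wcomp_def]
  bilinear_ext_add_right[where f = stack_web, folded wcomp_def]
  bilinear_ext_smul_left[where f = stack_web, folded wcomp_def]
  bilinear_ext_smul_right[where f = stack_web, folded wcomp_def]
  bilinear_ext_minus_left[where f = stack_web, folded wcomp_def]
  bilinear_ext_minus_right[where f = stack_web, folded wcomp_def]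
  bilinear_ext_0[where f = stack_web, folded wcomp_def]

lemma heq_zero: "heq n 0 0"
  by (rule heq_refl) (rule lin.span_zero)

lemma heq_comb: "heq n x y \<Longrightarrow> heq n x' y' \<Longrightarrow> heq n (smul c x + x') (smul c y + y')"
  by (intro heq_add heq_smul)

text \<open>The edges form a compact set that avoids the vertical sides of the square. The margin is
  the room in which a change of heights can fade out, as the sides must stay fixed.\<close>

lemma web_margin:
  assumes "w \<in> uwebs n"
  shows "\<exists>\<epsilon>>0. \<forall>e\<in>edges w. \<forall>z\<in>carrier_of e. \<epsilon> \<le> Re z \<and> \<epsilon> \<le> 1 - Re z"
proof -
  define K where "K = (\<Union>e\<in>edges w. carrier_of e)"
  note es = websD(1)[OF assms]
  have "compact K" unfolding K_def
    by (rule compact_UN) (use esysD(1,2)[OF es] is_darc_compact in auto)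
  have pos: "0 < min (Re z) (1 - Re z)" if "z \<in> K" for z
  proof -
    obtain e where e: "e \<in> edges w" "z \<in> carrier_of e" using \<open>z \<in> K\<close> unfolding K_def by blast
    have sq: "z \<in> square" using websD(2)[OF assms e(1)] e(2) by blast
    show ?thesis
    proof (cases "z \<in> frontier square")
      case True
      hence "z \<in> bd n" using websD(3)[OF assms e(1)] e(2) by blast
      thus ?thesis using bd_square by simp
    next
      case False
      thus ?thesis using sq unfolding frontier_square by (auto simp: square_def)
    qed
  qed
  show ?thesis
  proof (cases "K = {}")
    case True
    thus ?thesis unfolding K_def by (intro exI[of _ 1]) auto
  next
    case False
    have "continuous_on K (\<lambda>z. min (Re z) (1 - Re z))" by (intro continuous_intros)
    from continuous_attains_inf[OF \<open>compact K\<close> False this]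
    obtain z0 where z0: "z0 \<in> K" "\<forall>z\<in>K. min (Re z0) (1 - Re z0) \<le> min (Re z) (1 - Re z)" by blast
    have "\<forall>e\<in>edges w. \<forall>z\<in>carrier_of e. min (Re z0) (1 - Re z0) \<le> Re z \<and> min (Re z0) (1 - Re z0) \<le> 1 - Re z"
      using z0(2) unfolding K_def by (metis UN_I min.bounded_iff)
    thus ?thesis using pos[OF z0(1)] by blast
  qed
qed

text \<open>The vertical displacement \<open>b\<close> is damped by the cut-off \<open>c\<close>,
  which is 1 at distance at least \<open>\<epsilon>\<close> from the sides; a web with this margin
  does not feel the damping.\<close>

lemma sqisot_heights:
  fixes b :: "real \<Rightarrow> real"
  assumes b: "continuous_on UNIV b" "\<And>y y'. y < y' \<Longrightarrow> y + b y < y' + b y'" "\<And>y. y \<le> 0 \<or> y \<ge> 1 \<Longrightarrow> b y = 0"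
    and \<epsilon>: "\<epsilon> > 0"
  shows "\<exists>h. sqisot h \<and> (\<forall>z. \<epsilon> \<le> Re z \<longrightarrow> \<epsilon> \<le> 1 - Re z \<longrightarrow> h z = Complex (Re z) (Im z + b (Im z)))"
proof -
  define c where "c x = max 0 (min 1 (min (x / \<epsilon>) ((1 - x) / \<epsilon>)))" for x :: real
  define u where "u z = c (Re z) * b (Im z)" for z
  have c: "0 \<le> c x" "c x \<le> 1" for x by (simp_all add: c_def)
  have c0: "c x = 0" if "x \<le> 0 \<or> x \<ge> 1" for x
    using that \<epsilon> by (auto simp: c_def min_def max_def divide_simps)
  have c1: "c x = 1" if "\<epsilon> \<le> x" "\<epsilon> \<le> 1 - x" for x
    using that \<epsilon> by (auto simp: c_def min_def max_def divide_simps)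
  have "sqisot (\<lambda>z. z + \<i> * of_real (u z))"
  proof (rule sqisot_shear_up)
    have "continuous_on UNIV (\<lambda>z. b (Im z))"
      by (rule continuous_on_compose2[OF b(1)]) (auto intro!: continuous_intros)
    thus "continuous_on UNIV u" unfolding u_def c_def using \<epsilon> by (intro continuous_intros) simp_all
    fix x y y' :: real assume y: "y < y'"
    have "c x * (y + b y) + (1 - c x) * y < c x * (y' + b y') + (1 - c x) * y'"
    proof (cases "c x = 1")
      case False
      have "c x * (y + b y) \<le> c x * (y' + b y')" using c b(2)[OF y] by (intro mult_left_mono) auto
      moreover have "(1 - c x) * y < (1 - c x) * y'" using y False c(2)[of x] by (intro mult_strict_left_mono) auto
      ultimately show ?thesis by linarith
    qed (use b(2)[OF y] in simp)
    thus "y + u (Complex x y) < y' + u (Complex x y')" by (simp add: u_def algebra_simps)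
  next
    fix z assume "z \<notin> interior square"
    thus "u z = 0" unfolding interior_square u_def using c0[of "Re z"] b(3)[of "Im z"] by force
  qed
  moreover have "\<forall>z. \<epsilon> \<le> Re z \<longrightarrow> \<epsilon> \<le> 1 - Re z \<longrightarrow> z + \<i> * of_real (u z) = Complex (Re z) (Im z + b (Im z))"
    by (simp add: u_def c1 complex_eq_iff)
  ultimately show ?thesis by blast
qed

lemma image_map_darc_cong:
  assumes "\<And>e z. e \<in> E \<Longrightarrow> z \<in> carrier_of e \<Longrightarrow> f z = g z" "\<And>e. e \<in> E \<Longrightarrow> is_darc e"
  shows "map_darc f ` E = map_darc g ` E"
  by (rule image_cong[OF refl], rule map_darc_cong) (use assms is_darc_ends in auto)

lemma stack_assoc_web:
  assumes u: "u \<in> uwebs n" and v: "v \<in> uwebs n" and w: "w \<in> uwebs n"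
  shows "heq n (lw (stack_web (stack_web u v) w)) (lw (stack_web u (stack_web v w)))"
proof -
  obtain \<epsilon>1 \<epsilon>2 \<epsilon>3 where \<epsilon>: "\<epsilon>1 > 0" "\<epsilon>2 > 0" "\<epsilon>3 > 0"
     "\<forall>e\<in>edges u. \<forall>z\<in>carrier_of e. \<epsilon>1 \<le> Re z \<and> \<epsilon>1 \<le> 1 - Re z"
     "\<forall>e\<in>edges v. \<forall>z\<in>carrier_of e. \<epsilon>2 \<le> Re z \<and> \<epsilon>2 \<le> 1 - Re z"
     "\<forall>e\<in>edges w. \<forall>z\<in>carrier_of e. \<epsilon>3 \<le> Re z \<and> \<epsilon>3 \<le> 1 - Re z"
    using web_margin[OF u] web_margin[OF v] web_margin[OF w] by metis
  define \<epsilon> where "\<epsilon> = min \<epsilon>1 (min \<epsilon>2 \<epsilon>3)"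
  \<comment> \<open>\<open>y + b y\<close> sends the heights 0, 1/4, 1/2, 1 to 0, 1/2, 3/4, 1 and is
    linear in between: it takes the levels of one bracketing to those of the other.\<close>
  define b :: "real \<Rightarrow> real" where "b y = max 0 (min y (min (1 / 4) ((1 - y) / 2)))" for y
  have "\<exists>h. sqisot h \<and> (\<forall>z. \<epsilon> \<le> Re z \<longrightarrow> \<epsilon> \<le> 1 - Re z \<longrightarrow> h z = Complex (Re z) (Im z + b (Im z)))"
  proof (rule sqisot_heights)
    show "continuous_on UNIV b" unfolding b_def by (intro continuous_intros) simp_all
    show "y + b y < y' + b y'" if "y < y'" for y y' using that by (auto simp: b_def min_def max_def field_simps)
    show "b y = 0" if "y \<le> 0 \<or> 1 \<le> y" for y using that by (auto simp: b_def)
  qed (use \<epsilon> in \<open>simp add: \<epsilon>_def\<close>)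
  then obtain h where h: "sqisot h" "\<And>z. \<epsilon> \<le> Re z \<Longrightarrow> \<epsilon> \<le> 1 - Re z \<Longrightarrow> h z = Complex (Re z) (Im z + b (Im z))" by blast
  have m: "\<epsilon> \<le> Re z \<and> \<epsilon> \<le> 1 - Re z \<and> 0 \<le> Im z \<and> Im z \<le> 1" if "e \<in> edges x" "z \<in> carrier_of e" "x = u \<or> x = v \<or> x = w" for e z x
  proof -
    have "x \<in> uwebs n" using that(3) u v w by blast
    from websD(2)[OF this that(1)] have "z \<in> square" using that(2) by blast
    have "\<exists>\<epsilon>'\<ge>\<epsilon>. \<epsilon>' \<le> Re z \<and> \<epsilon>' \<le> 1 - Re z"
      using that(3)
    proof (elim disjE)
      assume "x = u"
      thus ?thesis using \<epsilon>(4) that(1,2) by (intro exI[of _ \<epsilon>1]) (simp add: \<epsilon>_def)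
    next
      assume "x = v"
      thus ?thesis using \<epsilon>(5) that(1,2) by (intro exI[of _ \<epsilon>2]) (simp add: \<epsilon>_def)
    next
      assume "x = w"
      thus ?thesis using \<epsilon>(6) that(1,2) by (intro exI[of _ \<epsilon>3]) (simp add: \<epsilon>_def)
    qed
    thus ?thesis using \<open>z \<in> square\<close> unfolding square_def by auto
  qed
  have d: "is_darc e" if "e \<in> edges x" "x = u \<or> x = v \<or> x = w" for e x
    using esysD(2)[OF websD(1)] that u v w by metis
  have b1: "b (y / 4) = y / 4" and b2: "b (y / 4 + 1 / 4) = 1 / 4" and b3: "b (y / 2 + 1 / 2) = (1 - y) / 4"
    if "0 \<le> y" "y \<le> 1" for y
    using that by (auto simp: b_def min_def max_def field_simps)
  have 1: "(h \<circ> (lo \<circ> lo)) z = lo z" and 2: "(h \<circ> (lo \<circ> hi)) z = (hi \<circ> lo) z" and 3: "(h \<circ> hi) z = (hi \<circ> hi) z"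
    if "\<epsilon> \<le> Re z \<and> \<epsilon> \<le> 1 - Re z \<and> 0 \<le> Im z \<and> Im z \<le> 1" for z
    using that by (simp_all add: h complex_eq_iff b1 b2 b3 add_divide_distrib diff_divide_distrib)
  have e1: "map_darc (h \<circ> (lo \<circ> lo)) ` edges w = map_darc lo ` edges w"
    by (rule image_map_darc_cong) (use 1 m d in blast)+
  have e2: "map_darc (h \<circ> (lo \<circ> hi)) ` edges v = map_darc (hi \<circ> lo) ` edges v"
    by (rule image_map_darc_cong) (use 2 m d in blast)+
  have e3: "map_darc (h \<circ> hi) ` edges u = map_darc (hi \<circ> hi) ` edges u"
    by (rule image_map_darc_cong) (use 3 m d in blast)+
  have ov: "map_overs f (over x) = map_overs g (over x)"
    if x: "x = u \<or> x = v \<or> x = w" and fg: "\<And>z. \<epsilon> \<le> Re z \<and> \<epsilon> \<le> 1 - Re z \<and> 0 \<le> Im z \<and> Im z \<le> 1 \<Longrightarrow> f z = g z" for f g x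
  proof (rule map_overs_cong)
    fix p e assume pe: "(p, e) \<in> over x"
    have "x \<in> uwebs n" using x u v w by blast
    from esys_over[OF websD(1)[OF this] pe] have e: "e \<in> edges x" "p \<in> carrier_of e" by blast+
    have "map_darc f e = map_darc g e"
      by (rule map_darc_cong[OF fg[OF m[OF e(1) _ x]] is_darc_ends[OF d[OF e(1) x]]])
    thus "f p = g p \<and> map_darc f e = map_darc g e" using fg[OF m[OF e x]] by blast
  qed
  have "move_web h (stack_web u (stack_web v w)) = stack_web (stack_web u v) w"
    by (simp add: move_web_def stack_web_eq image_Un map_overs_Un map_overs_comp image_image map_darc_comp,
        simp add: e1 e2 e3 ov[OF _ 1] ov[OF _ 2] ov[OF _ 3] Un_assoc flip: image_image, simp add: comp_def)
  thus ?thesis using heq_move_web(2)[OF h(1) stack_webs[OF u stack_webs[OF v w]]] heq_sym by metis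
qed

lemma span_heq:
  assumes "x \<in> Sp m" "\<And>w. w \<in> uwebs m \<Longrightarrow> heq n (f (lw w)) (g (lw w))"
    "f 0 = 0" "g 0 = 0" "\<And>x y c. f (smul c x + y) = smul c (f x) + f y" "\<And>x y c. g (smul c x + y) = smul c (g x) + g y"
  shows "heq n (f x) (g x)"
  using assms(1)
  by (rule span_sum_rep) (simp_all add: assms(2-6) heq_comb heq_zero)

lemma wcomp_assoc:
  assumes "x \<in> Sp n" "y \<in> Sp n" "z \<in> Sp n"
  shows "heq n ((x \<odot> y) \<odot> z) (x \<odot> (y \<odot> z))"
proof (rule span_heq[OF assms(1)])
  fix u assume u: "u \<in> uwebs n"
  show "heq n ((lw u \<odot> y) \<odot> z) (lw u \<odot> (y \<odot> z))"
  proof (rule span_heq[OF assms(2)])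
    fix v assume v: "v \<in> uwebs n"
    show "heq n ((lw u \<odot> lw v) \<odot> z) (lw u \<odot> (lw v \<odot> z))"
      by (rule span_heq[OF assms(3)]) (simp_all add: stack_assoc_web u v wcomp_linear)
  qed (simp_all add: wcomp_linear)
qed (simp_all add: wcomp_linear)


subsection \<open>Juxtaposing\<close>

definition lef :: "nat \<Rightarrow> nat \<Rightarrow> complex \<Rightarrow> complex" where "lef m n z = Complex (left_pos m n (Re z)) (Im z)"
definition rig :: "nat \<Rightarrow> nat \<Rightarrow> complex \<Rightarrow> complex" where "rig m n z = Complex (right_pos m n (Re z)) (Im z)"

lemma lef_rig_simps [simp]: "Re (lef m n z) = left_pos m n (Re z)" "Im (lef m n z) = Im z"
  "Re (rig m n z) = right_pos m n (Re z)" "Im (rig m n z) = Im z"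
  by (simp_all add: lef_def rig_def)

lemma interpolate_same: "interpolate f f z = Complex (f (Re z)) (Im z)"
  by (simp add: interpolate_def algebra_simps)

lemma juxtapose_web_glue: "v \<in> uwebs m \<Longrightarrow> w \<in> uwebs n \<Longrightarrow> juxtapose_web v w = glue_web (m + n) (lef m n) (rig m n) v w"
proof -
  have "interpolate (left_pos m n) (left_pos m n) = lef m n" "interpolate (right_pos m n) (right_pos m n) = rig m n"
    by (simp_all add: fun_eq_iff interpolate_same lef_def rig_def)
  thus "v \<in> uwebs m \<Longrightarrow> w \<in> uwebs n \<Longrightarrow> juxtapose_web v w = glue_web (m + n) (lef m n) (rig m n) v w"
    by (simp add: juxtapose_web_def Let_def map_edges_eq map_over_eq glue_web_def uwebs_iff replicate_add)
qed

lemma left_pos_eq: "left_pos m n x = min (real (m + 1) * x) ((real (m + 1) * x + real m) / 2) / real (m + n + 1)"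
  and right_pos_eq: "right_pos m n x = (real m + max (real (n + 1) * x) ((real (n + 1) * x + 1) / 2)) / real (m + n + 1)"
  by (simp_all add: left_pos_def right_pos_def Let_def)

lemma left_pos_mono: "x < y \<Longrightarrow> left_pos m n x < left_pos m n y"
  and right_pos_mono: "x < y \<Longrightarrow> right_pos m n x < right_pos m n y"
proof -
  assume xy: "x < y"
  have 1: "real (m + 1) * x < real (m + 1) * y" "real (n + 1) * x < real (n + 1) * y"
    by (rule mult_strict_left_mono[OF xy], simp)+
  have 2: "min X ((X + c) / 2) < min Y ((Y + c) / 2)" "c + max X ((X + 1) / 2) < c + max Y ((Y + 1) / 2)"
    if "X < Y" for X Y c :: real using that by (simp_all add: min_def max_def)
  show "left_pos m n x < left_pos m n y" unfolding left_pos_eq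
    by (rule divide_strict_right_mono) (rule 2(1)[OF 1(1)], simp)
  show "right_pos m n x < right_pos m n y" unfolding right_pos_eq
    by (rule divide_strict_right_mono) (rule 2(2)[OF 1(2)], simp)
qed

lemma left_pos_cont: "continuous_on UNIV (left_pos m n)" and right_pos_cont: "continuous_on UNIV (right_pos m n)"
  unfolding left_pos_eq[abs_def] right_pos_eq[abs_def] by (intro continuous_intros; simp)+

lemma left_pos_surj: "surj (left_pos m n)"
proof (rule surj_onI)
  fix y :: real
  define Y where "Y = y * real (m + n + 1)"
  have "left_pos m n (max Y (2 * Y - real m) / real (m + 1)) = y"
  proof -
    have 1: "real (m + 1) * (max Y (2 * Y - real m) / real (m + 1)) = max Y (2 * Y - real m)" by simp
    have 2: "min (max Y (2 * Y - real m)) ((max Y (2 * Y - real m) + real m) / 2) = Y" by (simp add: max_def min_def)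
    show ?thesis unfolding left_pos_eq 1 2 by (simp add: Y_def)
  qed
  thus "\<exists>x. left_pos m n x = y" by blast
qed

lemma right_pos_surj: "surj (right_pos m n)"
proof (rule surj_onI)
  fix y :: real
  define Y where "Y = y * real (m + n + 1) - real m"
  have "right_pos m n (min Y (2 * Y - 1) / real (n + 1)) = y"
  proof -
    have 1: "real (n + 1) * (min Y (2 * Y - 1) / real (n + 1)) = min Y (2 * Y - 1)" by simp
    have 2: "max (min Y (2 * Y - 1)) ((min Y (2 * Y - 1) + 1) / 2) = Y" by (simp add: max_def min_def)
    show ?thesis unfolding right_pos_eq 1 2 by (simp add: Y_def)
  qed
  thus "\<exists>x. right_pos m n x = y" by blast
qed

lemma pisot_lef: "pisot (lef m n)" and pisot_rig: "pisot (rig m n)"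
proof -
  have s: "strict_mono (left_pos m n)" "strict_mono (right_pos m n)"
    by (simp_all add: strict_mono_def left_pos_mono right_pos_mono)
  have i: "strict_mono (\<lambda>y :: real. y)" "surj (\<lambda>y :: real. y)" "continuous_on UNIV (\<lambda>y :: real. y)"
    by (simp_all add: strict_mono_def surj_def)
  show "pisot (lef m n)" unfolding lef_def[abs_def]
    by (rule pisot_product[OF left_pos_cont s(1) left_pos_surj i(3,1,2)])
  show "pisot (rig m n)" unfolding rig_def[abs_def]
    by (rule pisot_product[OF right_pos_cont s(2) right_pos_surj i(3,1,2)])
qed

lemma left_right_pos_values:
  "left_pos m n 0 = 0" "right_pos m n 1 = 1"
  "left_pos m n 1 = (real m + 1 / 2) / real (m + n + 1)" "right_pos m n 0 = (real m + 1 / 2) / real (m + n + 1)"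
  "i < m \<Longrightarrow> left_pos m n (real (i + 1) / real (m + 1)) = real (i + 1) / real (m + n + 1)"
  "i < n \<Longrightarrow> right_pos m n (real (i + 1) / real (n + 1)) = real (m + i + 1) / real (m + n + 1)"
proof -
  have c: "real (k + 1) * (real (i + 1) / real (k + 1)) = real (i + 1)" for k by simp
  show "i < m \<Longrightarrow> left_pos m n (real (i + 1) / real (m + 1)) = real (i + 1) / real (m + n + 1)"
    unfolding left_pos_eq c by (simp add: min_def)
  show "i < n \<Longrightarrow> right_pos m n (real (i + 1) / real (n + 1)) = real (m + i + 1) / real (m + n + 1)"
    unfolding right_pos_eq c by (simp add: max_def)
qed (simp_all add: left_pos_eq right_pos_eq min_def max_def field_simps)

lemma left_pos_le: "x \<le> y \<Longrightarrow> left_pos m n x \<le> left_pos m n y"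
  and right_pos_le: "x \<le> y \<Longrightarrow> right_pos m n x \<le> right_pos m n y"
  using left_pos_mono[of x y m n] right_pos_mono[of x y m n] by (cases "x = y"; simp)+

lemma left_right_pos_bounds:
  assumes "0 \<le> x" "x \<le> 1"
  shows "0 \<le> left_pos m n x" "left_pos m n x \<le> (real m + 1 / 2) / real (m + n + 1)"
    "(real m + 1 / 2) / real (m + n + 1) \<le> right_pos m n x" "right_pos m n x \<le> 1"
  using left_pos_le[OF assms(1), of m n] left_pos_le[OF assms(2), of m n]
    right_pos_le[OF assms(1), of m n] right_pos_le[OF assms(2), of m n]
  unfolding left_right_pos_values .

lemma mid_pos: "0 < (real m + 1 / 2) / real (m + n + 1)" "(real m + 1 / 2) / real (m + n + 1) < 1"
  by (simp_all add: divide_simps add_pos_nonneg)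

lemma left_eq_right:
  assumes "0 \<le> x" "x \<le> 1" "0 \<le> y" "y \<le> 1" "left_pos m n x = right_pos m n y"
  shows "x = 1" "y = 0"
  using left_pos_mono[of x 1 m n] right_pos_mono[of 0 y m n] left_right_pos_bounds[OF assms(1,2), of m n]
    left_right_pos_bounds[OF assms(3,4), of m n] assms unfolding left_right_pos_values by force+

lemma lef_bpt: "i < m \<Longrightarrow> lef m n (bpt m i) = bpt (m + n) i" "i < m \<Longrightarrow> lef m n (tpt m i) = tpt (m + n) i"
  and rig_bpt: "i < n \<Longrightarrow> rig m n (bpt n i) = bpt (m + n) (m + i)" "i < n \<Longrightarrow> rig m n (tpt n i) = tpt (m + n) (m + i)"
  using left_right_pos_values(5)[of i m n] left_right_pos_values(6)[of i n m]
  by (simp_all only: complex_eq_iff lef_rig_simps bpt_simps)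

lemma lef_rig_square:
  "z \<in> square \<Longrightarrow> lef m n z \<in> square \<and> Re (lef m n z) \<le> (real m + 1 / 2) / real (m + n + 1)"
  "z \<in> square \<Longrightarrow> rig m n z \<in> square \<and> (real m + 1 / 2) / real (m + n + 1) \<le> Re (rig m n z)"
  using left_right_pos_bounds[of "Re z" m n] mid_pos[of m n] unfolding square_def by simp_all

lemma pos_ends: "left_pos m n x = 0 \<Longrightarrow> x = 0" "right_pos m n x = 1 \<Longrightarrow> x = 1"
  using left_pos_mono[of x 0 m n] left_pos_mono[of 0 x m n] right_pos_mono[of x 1 m n] right_pos_mono[of 1 x m n]
  unfolding left_right_pos_values by (metis less_irrefl linorder_neqE)+

lemma bpt_left: "i < m \<Longrightarrow> Re (bpt (m + n) i) < (real m + 1 / 2) / real (m + n + 1)" "i < m \<Longrightarrow> Re (tpt (m + n) i) < (real m + 1 / 2) / real (m + n + 1)"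
  and bpt_right: "(real m + 1 / 2) / real (m + n + 1) < Re (bpt (m + n) (m + i))" "(real m + 1 / 2) / real (m + n + 1) < Re (tpt (m + n) (m + i))"
  by (simp_all only: bpt_simps) (rule divide_strict_right_mono; simp)+

text \<open>The images share a vertical line between the end points of the two webs, so there is no
  seam: all boundary points of the pieces become boundary points, and the last two conditions are
  vacuous.\<close>

lemma glue_juxtapose: "glue (m + n) m n (lef m n) (rig m n)"
proof -
  have 1: "lef m n z \<in> bd (m + n)" if zb: "z \<in> bd m" for z
  proof -
    obtain i where "i < m" "z = bpt m i \<or> z = tpt m i" using zb unfolding bd_iff by blast
    thus ?thesis unfolding bd_iff using lef_bpt[of i m n] by (intro exI[of _ i]) auto
  qed
  have 2: "rig m n z \<in> bd (m + n)" if zb: "z \<in> bd n" for z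
  proof -
    obtain i where "i < n" "z = bpt n i \<or> z = tpt n i" using zb unfolding bd_iff by blast
    thus ?thesis unfolding bd_iff using rig_bpt[of i n m] by (intro exI[of _ "m + i"]) auto
  qed
  have I: "Re z = 1 \<and> Re z' = 0" if z: "z \<in> square" "z' \<in> square" "lef m n z = rig m n z'" for z z'
  proof -
    have "left_pos m n (Re z) = right_pos m n (Re z')" using z(3) by (simp add: complex_eq_iff)
    thus ?thesis using left_eq_right[of "Re z" "Re z'" m n] z unfolding square_def by simp
  qed
  have nr: "z \<notin> rig m n ` square" if "Re z < (real m + 1 / 2) / real (m + n + 1)" for z
    using lef_rig_square(2)[of _ m n] that by force
  have nl: "z \<notin> lef m n ` square" if "(real m + 1 / 2) / real (m + n + 1) < Re z" for z
    using lef_rig_square(1)[of _ m n] that by force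
  show ?thesis
  proof (standard, goal_cases)
    case 1 show ?case by (rule pisot_lef)
  next
    case 2 show ?case by (rule pisot_rig)
  next
    case 3 show ?case using lef_rig_square(1) by blast
  next
    case 4 show ?case using lef_rig_square(2) by blast
  next
    case (5 z)
    have "left_pos m n (Re z) < 1" using lef_rig_square(1)[OF 5(1), of m n] mid_pos(2)[of m n] unfolding lef_rig_simps by linarith
    thus ?case using 5 pos_ends(1)[of m n "Re z"] unfolding frontier_square by auto
  next
    case (6 z)
    have "0 < right_pos m n (Re z)" using lef_rig_square(2)[OF 6(1), of m n] mid_pos(1)[of m n] unfolding lef_rig_simps by linarith
    thus ?case using 6 pos_ends(2)[of m n "Re z"] unfolding frontier_square by auto
  next
    case (7 z) thus ?case using 1 by blast
  next
    case (8 z) thus ?case using 2 by blast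
  next
    case (9 z z') thus ?case using I unfolding frontier_square by blast
  next
    case (10 z z') thus ?case using I unfolding frontier_square by blast
  next
    case (11 i)
    show ?case
    proof (cases "i < m")
      case True
      thus ?thesis using lef_bpt(1)[OF True, of n] nr bpt_left(1)[OF True, of n] by metis
    next
      case False
      hence i: "i = m + (i - m)" "i - m < n" using 11 by auto
      thus ?thesis using rig_bpt(1)[OF i(2), of m] nl bpt_right(1)[of m n "i - m"] by metis
    qed
  next
    case (12 i)
    show ?case
    proof (cases "i < m")
      case True
      thus ?thesis using lef_bpt(2)[OF True, of n] nr bpt_left(2)[OF True, of n] by metis
    next
      case False
      hence i: "i = m + (i - m)" "i - m < n" using 12 by auto
      thus ?thesis using rig_bpt(2)[OF i(2), of m] nl bpt_right(2)[of m n "i - m"] by metis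
    qed
  next
    case (13 z) thus ?case using 1 by blast
  next
    case (14 z) thus ?case using 2 by blast
  qed
qed

lemma juxtapose_webs: "v \<in> uwebs m \<Longrightarrow> w \<in> uwebs n \<Longrightarrow> juxtapose_web v w \<in> uwebs (m + n)"
  using glue_web_webs[OF glue_juxtapose] by (simp add: juxtapose_web_glue)

lemma wtens_cong:
  assumes "heq m x x'" "heq n y y'"
  shows "heq (m + n) (x \<otimes> y) (x' \<otimes> y')"
  unfolding wtens_def
proof (rule bilinear_cong[OF _ _ assms])
  fix w assume w: "w \<in> uwebs n"
  show "\<exists>E R f. placing (ups m) (ups m) (ups (m + n)) (ups (m + n)) E R f \<and> (\<forall>v\<in>uwebs m. juxtapose_web v w = plug (ups (m + n)) (ups (m + n)) E R f v)"
    using glue_placing(1)[OF glue_juxtapose w] glue_web_plug(1) juxtapose_web_glue w by metis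
next
  fix v assume v: "v \<in> uwebs m"
  show "\<exists>E R f. placing (ups n) (ups n) (ups (m + n)) (ups (m + n)) E R f \<and> (\<forall>w\<in>uwebs n. juxtapose_web v w = plug (ups (m + n)) (ups (m + n)) E R f w)"
    using glue_placing(2)[OF glue_juxtapose v] glue_web_plug(2) juxtapose_web_glue v by metis
qed

lemma wtens_lw [simp]: "lw w \<otimes> lw v = lw (juxtapose_web w v)"
  by (simp add: wtens_def bilinear_ext_lw_left)

lemma wtens_Sp: "x \<in> Sp m \<Longrightarrow> y \<in> Sp n \<Longrightarrow> x \<otimes> y \<in> Sp (m + n)"
  using wtens_cong[OF heq_refl heq_refl] heqD(1) by blast

lemmas wtens_linear = bilinear_ext_add_left[where f = juxtapose_web, folded wtens_def]
  bilinear_ext_add_right[where f = juxtapose_web, folded wtens_def]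
  bilinear_ext_smul_left[where f = juxtapose_web, folded wtens_def]
  bilinear_ext_smul_right[where f = juxtapose_web, folded wtens_def]
  bilinear_ext_minus_left[where f = juxtapose_web, folded wtens_def]
  bilinear_ext_minus_right[where f = juxtapose_web, folded wtens_def]
  bilinear_ext_0[where f = juxtapose_web, folded wtens_def]

lemma lo_hi_lef_rig: "lo \<circ> lef m n = lef m n \<circ> lo" "lo \<circ> rig m n = rig m n \<circ> lo"
  "hi \<circ> lef m n = lef m n \<circ> hi" "hi \<circ> rig m n = rig m n \<circ> hi"
  by (simp_all add: fun_eq_iff complex_eq_iff)

text \<open>An equality of webs and not only an isotopy: stacking changes heights alone and
  juxtaposing changes horizontal positions alone, so the maps commute.\<close>

lemma interchange_web:
  assumes "a \<in> uwebs m" "b \<in> uwebs n" "c \<in> uwebs m" "d \<in> uwebs n"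
  shows "stack_web (juxtapose_web a b) (juxtapose_web c d) = juxtapose_web (stack_web a c) (stack_web b d)"
  using assms stack_webs[OF assms(1,3)] stack_webs[OF assms(2,4)]
  by (simp add: juxtapose_web_glue glue_web_def stack_web_eq image_Un map_overs_Un map_overs_comp image_comp map_darc_comp lo_hi_lef_rig
      Un_ac)

lemma span_eq:
  assumes "x \<in> lin.span (lw ` A)" "\<And>w. w \<in> A \<Longrightarrow> f (lw w) = g (lw w)"
    "f 0 = 0" "g 0 = 0" "\<And>x y c. f (smul c x + y) = smul c (f x) + f y" "\<And>x y c. g (smul c x + y) = smul c (g x) + g y"
  shows "f x = g x"
  using assms(1) by (rule span_sum_rep) (simp_all add: assms(2-6))

lemma interchange:
  assumes "x \<in> Sp m" "y \<in> Sp n" "x' \<in> Sp m" "y' \<in> Sp n"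
  shows "(x \<otimes> y) \<odot> (x' \<otimes> y') = (x \<odot> x') \<otimes> (y \<odot> y')"
proof (rule span_eq[OF assms(1)])
  fix a assume a: "a \<in> uwebs m"
  show "(lw a \<otimes> y) \<odot> (x' \<otimes> y') = (lw a \<odot> x') \<otimes> (y \<odot> y')"
  proof (rule span_eq[OF assms(2)])
    fix b assume b: "b \<in> uwebs n"
    show "(lw a \<otimes> lw b) \<odot> (x' \<otimes> y') = (lw a \<odot> x') \<otimes> (lw b \<odot> y')"
    proof (rule span_eq[OF assms(3)])
      fix c assume c: "c \<in> uwebs m"
      show "(lw a \<otimes> lw b) \<odot> (lw c \<otimes> y') = (lw a \<odot> lw c) \<otimes> (lw b \<odot> y')"
        by (rule span_eq[OF assms(4)]) (simp_all add: interchange_web[OF a b c] wcomp_linear wtens_linear)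
    qed (simp_all add: wcomp_linear wtens_linear)
  qed (simp_all add: wcomp_linear wtens_linear)
qed (simp_all add: wcomp_linear wtens_linear)

subsection \<open>Piecewise linear functions\<close>

definition clamp01 :: "real \<Rightarrow> real" where "clamp01 x = max 0 (min 1 x)"

lemma clamp01_bounds: "0 \<le> clamp01 x" "clamp01 x \<le> 1" and clamp01_mono: "x \<le> y \<Longrightarrow> clamp01 x \<le> clamp01 y"
  and clamp01_low: "x \<le> 0 \<Longrightarrow> clamp01 x = 0" and clamp01_high: "1 \<le> x \<Longrightarrow> clamp01 x = 1"
  and clamp01_id: "0 \<le> x \<Longrightarrow> x \<le> 1 \<Longrightarrow> clamp01 x = x"
  by (auto simp: clamp01_def min_def max_def)

text \<open>The function with value \<open>v j\<close> at the knot \<open>a j\<close>, linear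
  between the knots and constant beyond them. Written as a sum of ramps it can be treated term by
  term, also when the knots vary with a parameter.\<close>

definition pl :: "nat \<Rightarrow> (nat \<Rightarrow> real) \<Rightarrow> (nat \<Rightarrow> real) \<Rightarrow> real \<Rightarrow> real" where
  "pl K a v x = v 0 + (\<Sum>j<K. (v (Suc j) - v j) * clamp01 ((x - a j) / (a (Suc j) - a j)))"

text \<open>Coinciding knots are allowed if the values there coincide as well.\<close>

definition knots :: "nat \<Rightarrow> (nat \<Rightarrow> real) \<Rightarrow> (nat \<Rightarrow> real) \<Rightarrow> bool" where
  "knots K a v \<longleftrightarrow> (\<forall>j<K. a j \<le> a (Suc j) \<and> (a (Suc j) = a j \<longrightarrow> v (Suc j) = v j))"

lemma pl_Suc: "pl (Suc K) a v x = pl K a v x + (v (Suc K) - v K) * clamp01 ((x - a K) / (a (Suc K) - a K))"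
  by (simp add: pl_def)

lemma knots_SucD: "knots (Suc K) a v \<Longrightarrow> knots K a v \<and> a K \<le> a (Suc K) \<and> (a (Suc K) = a K \<longrightarrow> v (Suc K) = v K)"
  by (simp add: knots_def)

lemma knots_mono: "knots K a v \<Longrightarrow> i \<le> j \<Longrightarrow> j \<le> K \<Longrightarrow> a i \<le> a j"
proof (induction j)
  case (Suc j)
  thus ?case unfolding knots_def by (metis Suc_leD Suc_le_lessD le_Suc_eq order_trans order_refl)
qed simp

lemma pl_high: "knots K a v \<Longrightarrow> a K \<le> x \<Longrightarrow> pl K a v x = v K"
proof (induction K)
  case (Suc K)
  note k = knots_SucD[OF Suc.prems(1)]
  have 1: "(v (Suc K) - v K) * clamp01 ((x - a K) / (a (Suc K) - a K)) = v (Suc K) - v K"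
  proof (cases "a (Suc K) = a K")
    case False
    thus ?thesis using k Suc.prems(2) by (simp add: clamp01_high divide_simps)
  qed (use k in simp)
  have "pl K a v x = v K" using Suc.IH Suc.prems(2) k by simp
  thus ?case unfolding pl_Suc 1 by simp
qed (simp add: pl_def)

lemma pl_low: "knots K a v \<Longrightarrow> x \<le> a 0 \<Longrightarrow> pl K a v x = v 0"
proof (induction K)
  case (Suc K)
  note k = knots_SucD[OF Suc.prems(1)]
  have "x \<le> a K" using Suc.prems(2) knots_mono[OF Suc.prems(1), of 0 K] by simp
  hence "clamp01 ((x - a K) / (a (Suc K) - a K)) = 0" using k by (intro clamp01_low divide_nonpos_nonneg) auto
  thus ?case using Suc k by (simp add: pl_Suc)
qed (simp add: pl_def)

lemma pl_at:
  "knots K a v \<Longrightarrow> j < K \<Longrightarrow> 0 \<le> t \<Longrightarrow> t \<le> 1 \<Longrightarrow> pl K a v (a j + t * (a (Suc j) - a j)) = v j + t * (v (Suc j) - v j)"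
proof (induction K)
  case (Suc K)
  note k = knots_SucD[OF Suc.prems(1)]
  define x where "x = a j + t * (a (Suc j) - a j)"
  show ?case
  proof (cases "j = K")
    case True
    have "0 \<le> t * (a (Suc j) - a j)" using k True Suc.prems by simp
    hence "a K \<le> x" using True by (simp add: x_def)
    hence 1: "pl K a v x = v K" using pl_high k by blast
    have 2: "(v (Suc K) - v K) * clamp01 ((x - a K) / (a (Suc K) - a K)) = t * (v (Suc K) - v K)"
    proof (cases "a (Suc K) = a K")
      case False
      thus ?thesis using Suc.prems True by (simp add: x_def clamp01_id)
    qed (use k in simp)
    show ?thesis using 1 2 True unfolding x_def[symmetric] by (simp add: pl_Suc)
  next
    case False
    hence j: "j < K" using Suc.prems by simp
    have jj: "a j \<le> a (Suc j)" using knots_mono[OF Suc.prems(1), of j "Suc j"] j by simp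
    have "t * (a (Suc j) - a j) \<le> 1 * (a (Suc j) - a j)" using jj Suc.prems by (intro mult_right_mono) auto
    hence "x \<le> a (Suc j)" unfolding x_def by simp
    hence "x \<le> a K" using knots_mono[OF Suc.prems(1), of "Suc j" K] j by simp
    hence "clamp01 ((x - a K) / (a (Suc K) - a K)) = 0" using k by (intro clamp01_low divide_nonpos_nonneg) auto
    thus ?thesis using Suc k j unfolding x_def[symmetric] by (simp add: pl_Suc)
  qed
qed simp

lemma pl_knot: "knots K a v \<Longrightarrow> i \<le> K \<Longrightarrow> pl K a v (a i) = v i"
  using pl_at[of K a v i 0] pl_high[of K a v "a K"] by (cases "i = K") auto

lemma pl_self: "knots K a a \<Longrightarrow> pl K a a x = max (a 0) (min x (a K))"
proof (induction K)
  case (Suc K)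
  note k = knots_SucD[OF Suc.prems]
  have m: "a 0 \<le> a K" using knots_mono[of K a a 0 K] k by simp
  have "(a (Suc K) - a K) * clamp01 ((x - a K) / (a (Suc K) - a K)) = max (a K) (min x (a (Suc K))) - a K"
    using k by (cases "a (Suc K) = a K") (auto simp: clamp01_def min_def max_def divide_simps)
  thus ?case using Suc k m by (auto simp: pl_Suc min_def max_def)
qed (simp add: pl_def)

lemma pl_mono: "knots K a v \<Longrightarrow> (\<And>j. j < K \<Longrightarrow> v j \<le> v (Suc j)) \<Longrightarrow> x \<le> y \<Longrightarrow> pl K a v x \<le> pl K a v y"
  unfolding pl_def knots_def by (intro add_left_mono sum_mono mult_left_mono clamp01_mono divide_right_mono) auto

text \<open>The interval \<open>j\<close> and the parameter \<open>t\<close> depend on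
  \<open>x\<close> and the knots only. One choice serves all sequences \<open>v\<close>, so
  positions of different strands at one height are comparable by convexity.\<close>

lemma pl_rep:
  "0 < K \<Longrightarrow> \<forall>j<K. a j < a (Suc j) \<Longrightarrow> \<exists>j<K. \<exists>t\<in>{0..1}. \<forall>v. pl K a v x = v j + t * (v (Suc j) - v j)"
proof (induction K)
  case (Suc K)
  define t where "t = clamp01 ((x - a K) / (a (Suc K) - a K))"
  have t: "t \<in> {0..1}" using clamp01_bounds by (simp add: t_def)
  show ?case
  proof (cases "x \<le> a K \<and> K > 0")
    case True
    hence "t = 0" using Suc.prems unfolding t_def by (intro clamp01_low divide_nonpos_nonneg) (auto simp: less_imp_le)
    hence "pl (Suc K) a v x = pl K a v x" for v by (simp add: pl_Suc flip: t_def)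
    thus ?thesis using Suc True by (metis less_Suc_eq)
  next
    case False
    have "pl K a v x = v K" for v
    proof (cases "K = 0")
      case False
      have "knots K a v" using Suc.prems(2) unfolding knots_def by (metis less_SucI less_imp_le order_less_irrefl)
      thus ?thesis using pl_high \<open>\<not> (x \<le> a K \<and> K > 0)\<close> False by simp
    qed (simp add: pl_def)
    hence "pl (Suc K) a v x = v K + t * (v (Suc K) - v K)" for v by (simp add: pl_Suc t_def)
    thus ?thesis using t by blast
  qed
qed simp

lemma pl_cont: "continuous_on S (pl K a v)"
proof (cases "\<forall>j<K. a (Suc j) \<noteq> a j")
  case True
  show ?thesis unfolding pl_def clamp01_def by (intro continuous_intros) (use True in auto)
next
  case False
  have "continuous_on S (\<lambda>x. clamp01 ((x - a j) / (a (Suc j) - a j)))" for j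
    by (cases "a (Suc j) = a j") (auto simp: clamp01_def intro!: continuous_intros)
  thus ?thesis unfolding pl_def by (intro continuous_intros)
qed

text \<open>The summand \<open>x - clamp01 x\<close> continues \<open>pl K a v\<close> by a translation outside the unit interval.\<close>

lemma pl_strict:
  assumes av: "knots K a v" and va: "knots K v a" and e: "a 0 = 0" "a K = 1" and xy: "x < y"
  shows "x - clamp01 x + pl K a v x < y - clamp01 y + pl K a v y"
proof (rule ccontr)
  define C where "C j x = clamp01 ((x - a j) / (a (Suc j) - a j))" for j x
  have C: "j < K \<Longrightarrow> C j x \<le> C j y" for j using xy av unfolding C_def knots_def
    by (intro clamp01_mono divide_right_mono) auto
  have vm: "j < K \<Longrightarrow> v j \<le> v (Suc j)" for j using va by (simp add: knots_def)
  have P: "pl K a w y - pl K a w x = (\<Sum>j<K. (w (Suc j) - w j) * (C j y - C j x))" for w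
    by (simp add: pl_def C_def algebra_simps sum_subtractf sum.distrib)
  have m: "pl K a v x \<le> pl K a v y" by (rule pl_mono[OF av vm]) (use xy in auto)
  have m': "x - clamp01 x \<le> y - clamp01 y" using xy by (auto simp: clamp01_def min_def max_def)
  assume "\<not> ?thesis"
  hence eq: "pl K a v y - pl K a v x = 0" "x - clamp01 x = y - clamp01 y" using m m' by linarith+
  have nn: "0 \<le> (v (Suc j) - v j) * (C j y - C j x)" if "j < K" for j using vm[OF that] C[OF that] by simp
  have z: "(v (Suc j) - v j) * (C j y - C j x) = 0" if "j < K" for j
    using eq(1) nn that unfolding P by (subst (asm) sum_nonneg_eq_0_iff) auto
  have "(a (Suc j) - a j) * (C j y - C j x) = 0" if "j < K" for j
    using z[OF that] va that unfolding knots_def by auto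
  hence "pl K a a y - pl K a a x = 0" unfolding P by (intro sum.neutral ballI) (simp only: lessThan_iff)
  moreover have "knots K a a" using av by (simp add: knots_def)
  ultimately have "clamp01 y = clamp01 x" by (simp add: pl_self e clamp01_def min.commute)
  thus False using eq(2) xy by simp
qed

subsection \<open>Moving strands\<close>

definition affine_to :: "(complex \<Rightarrow> complex) \<Rightarrow> complex \<times> complex \<Rightarrow> complex \<times> complex \<Rightarrow> bool" where
  "affine_to h s s' \<longleftrightarrow> (\<forall>t\<in>{0..1}. h (fst s + of_real t * (snd s - fst s)) = fst s' + of_real t * (snd s' - fst s'))"

lemma affine_toI:
  "(\<And>t. 0 \<le> t \<Longrightarrow> t \<le> 1 \<Longrightarrow> h (p + of_real t * (q - p)) = p' + of_real t * (q' - p')) \<Longrightarrow> affine_to h (p, q) (p', q')"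
  by (simp add: affine_to_def)

text \<open>The horizontal lines at the heights \<open>y j\<close> are cut by the strands; \<open>a i j\<close> is the position of
  strand \<open>i\<close> at height \<open>y j\<close>.  Strands \<open>0\<close> and \<open>r\<close> are the sides of the square.\<close>

definition strands :: "nat \<Rightarrow> nat \<Rightarrow> (nat \<Rightarrow> nat \<Rightarrow> real) \<Rightarrow> (nat \<Rightarrow> nat \<Rightarrow> real) \<Rightarrow> bool" where
  "strands r K a b \<longleftrightarrow> 0 < r \<and> 0 < K \<and>
     (\<forall>j\<le>K. knots r (\<lambda>i. a i j) (\<lambda>i. b i j) \<and> knots r (\<lambda>i. b i j) (\<lambda>i. a i j) \<and> a 0 j = 0 \<and> b 0 j = 0 \<and> a r j = 1 \<and> b r j = 1) \<and>
     (\<forall>i\<le>r. a i 0 = b i 0 \<and> a i K = b i K)"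

abbreviation up_seg :: "(nat \<Rightarrow> real) \<Rightarrow> (nat \<Rightarrow> nat \<Rightarrow> real) \<Rightarrow> nat \<Rightarrow> nat \<Rightarrow> complex \<times> complex" where
  "up_seg y a i j \<equiv> (Complex (a i j) (y j), Complex (a i (Suc j)) (y (Suc j)))"

abbreviation across_seg :: "(nat \<Rightarrow> real) \<Rightarrow> (nat \<Rightarrow> nat \<Rightarrow> real) \<Rightarrow> nat \<Rightarrow> nat \<Rightarrow> complex \<times> complex" where
  "across_seg y a i j \<equiv> (Complex (a i j) (y j), Complex (a (Suc i) j) (y j))"

abbreviation right_seg :: "(nat \<Rightarrow> real) \<Rightarrow> (nat \<Rightarrow> nat \<Rightarrow> real) \<Rightarrow> nat \<Rightarrow> nat \<Rightarrow> complex \<times> complex" where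
  "right_seg x a i j \<equiv> (Complex (x j) (a i j), Complex (x (Suc j)) (a i (Suc j)))"

abbreviation upright_seg :: "(nat \<Rightarrow> real) \<Rightarrow> (nat \<Rightarrow> nat \<Rightarrow> real) \<Rightarrow> nat \<Rightarrow> nat \<Rightarrow> complex \<times> complex" where
  "upright_seg x a i j \<equiv> (Complex (x j) (a i j), Complex (x j) (a (Suc i) j))"

text \<open>Where the denominator \<open>c\<close> vanishes, the coefficient \<open>d\<close> tends
  to 0 and the ramp is bounded. This happens where strands run together.\<close>

lemma continuous_pl_term:
  fixes q c d :: "'a :: t2_space \<Rightarrow> real"
  assumes q: "continuous_on UNIV q" and c: "continuous_on UNIV c" and d: "continuous_on UNIV d"
    and z: "\<And>z. c z = 0 \<Longrightarrow> d z = 0"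
  shows "continuous_on UNIV (\<lambda>z. d z * clamp01 (q z / c z))"
proof -
  have "isCont (\<lambda>z. d z * clamp01 (q z / c z)) w" for w
  proof (cases "c w = 0")
    case False
    have "isCont q w" "isCont c w" "isCont d w" using q c d by (simp_all add: continuous_on_eq_continuous_at)
    thus ?thesis unfolding clamp01_def using False by (intro continuous_intros)
  next
    case True
    hence dw: "d w = 0" by (rule z)
    have "isCont d w" using d by (simp add: continuous_on_eq_continuous_at)
    hence "(d \<longlongrightarrow> 0) (at w)" unfolding isCont_def dw .
    hence dd: "((\<lambda>z. \<bar>d z\<bar>) \<longlongrightarrow> 0) (at w)" by (rule tendsto_rabs_zero)
    have "((\<lambda>z. d z * clamp01 (q z / c z)) \<longlongrightarrow> 0) (at w)"
    proof (rule tendsto_rabs_zero_cancel, rule tendsto_sandwich[OF _ _ tendsto_const dd])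
      have "\<bar>d z * clamp01 (q z / c z)\<bar> \<le> \<bar>d z\<bar> * 1" for z
        unfolding abs_mult using clamp01_bounds[of "q z / c z"] by (intro mult_left_mono) auto
      thus "\<forall>\<^sub>F z in at w. \<bar>d z * clamp01 (q z / c z)\<bar> \<le> \<bar>d z\<bar>" by simp
    qed simp
    thus ?thesis by (simp add: isCont_def dw)
  qed
  thus ?thesis by (simp add: continuous_on_eq_continuous_at)
qed

text \<open>On every horizontal line the piecewise linear map from the positions of the strands in
  \<open>a\<close> to those in \<open>b\<close> is applied. Strands may coincide, but they do so in
  the same places in \<open>a\<close> and \<open>b\<close>; therefore the map is increasing and
  depends continuously on the height.\<close>

lemma strands_move:
  assumes s: "strands r K a b" and y: "\<forall>j<K. y j < y (Suc j)" "0 \<le> y 0" "y K \<le> 1"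
  shows "\<exists>h. sqisot h \<and>
    (\<forall>i\<le>r. \<forall>j<K. affine_to h (up_seg y a i j) (up_seg y b i j)) \<and>
    (\<forall>i<r. \<forall>j\<le>K. affine_to h (across_seg y a i j) (across_seg y b i j)) \<and>
    (\<forall>z. Im z \<le> y 0 \<or> y K \<le> Im z \<longrightarrow> h z = z)"
proof -
  have K: "0 < K" "0 < r" using s by (simp_all add: strands_def)
  have ky: "knots K y v" for v using y(1) by (force simp: knots_def)
  have kab: "knots r (\<lambda>i. a i j) (\<lambda>i. b i j)" "knots r (\<lambda>i. b i j) (\<lambda>i. a i j)" if "j \<le> K" for j
    using s that unfolding strands_def by blast+
  have e: "a 0 j = 0" "b 0 j = 0" "a r j = 1" "b r j = 1" if "j \<le> K" for j using s that unfolding strands_def by blast+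
  have se: "a i 0 = b i 0" "a i K = b i K" if "i \<le> r" for i using s that unfolding strands_def by blast+
  define A where "A i = pl K y (a i)" for i
  define B where "B i = pl K y (b i)" for i
  have rep: "\<exists>j<K. \<exists>t\<in>{0..1}. \<forall>i. A i x = a i j + t * (a i (Suc j) - a i j) \<and> B i x = b i j + t * (b i (Suc j) - b i j)" for x
    using pl_rep[OF K(1) y(1), of x] unfolding A_def B_def by metis
  have kAB: "knots r (\<lambda>i. A i x) (\<lambda>i. B i x) \<and> knots r (\<lambda>i. B i x) (\<lambda>i. A i x) \<and> A 0 x = 0 \<and> B 0 x = 0 \<and> A r x = 1 \<and> B r x = 1" for x
  proof -
    obtain j t where j: "j < K" and t: "0 \<le> t" "t \<le> 1"
      and R: "\<And>i. A i x = a i j + t * (a i (Suc j) - a i j)" "\<And>i. B i x = b i j + t * (b i (Suc j) - b i j)"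
      using rep[of x] by auto
    have jj: "j \<le> K" "Suc j \<le> K" using j by auto
    \<comment> \<open>Between two levels a gap is a convex combination of the gaps at these levels.
      These are nonnegative and vanish for \<open>a\<close> exactly when they vanish for
      \<open>b\<close>, so the same holds for the combination.\<close>
    have pat: "A (Suc i) x \<ge> A i x \<and> B (Suc i) x \<ge> B i x \<and> (A (Suc i) x = A i x \<longleftrightarrow> B (Suc i) x = B i x)" if i: "i < r" for i
    proof -
      define g0 g1 k0 k1 where "g0 = a (Suc i) j - a i j" and "g1 = a (Suc i) (Suc j) - a i (Suc j)"
        and "k0 = b (Suc i) j - b i j" and "k1 = b (Suc i) (Suc j) - b i (Suc j)"
      have g: "g0 \<ge> 0" "g1 \<ge> 0" "k0 \<ge> 0" "k1 \<ge> 0" "g0 = 0 \<longleftrightarrow> k0 = 0" "g1 = 0 \<longleftrightarrow> k1 = 0"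
        using kab[OF jj(1)] kab[OF jj(2)] i unfolding g0_def g1_def k0_def k1_def knots_def by force+
      have 1: "A (Suc i) x - A i x = (1 - t) * g0 + t * g1" "B (Suc i) x - B i x = (1 - t) * k0 + t * k1"
        unfolding R g0_def g1_def k0_def k1_def by (simp_all add: algebra_simps)
      have 2: "0 \<le> (1 - t) * g0" "0 \<le> t * g1" "0 \<le> (1 - t) * k0" "0 \<le> t * k1" using g t by simp_all
      have "(1 - t) * g0 + t * g1 = 0 \<longleftrightarrow> (1 - t) * g0 = 0 \<and> t * g1 = 0" using 2 by linarith
      also have "\<dots> \<longleftrightarrow> (1 - t) * k0 = 0 \<and> t * k1 = 0" using g by simp
      also have "\<dots> \<longleftrightarrow> (1 - t) * k0 + t * k1 = 0" using 2 by linarith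
      finally show ?thesis using 1 2 by linarith
    qed
    have "A 0 x = 0 \<and> B 0 x = 0 \<and> A r x = 1 \<and> B r x = 1" unfolding R using e jj by simp
    thus ?thesis using pat unfolding knots_def by blast
  qed
  define F where "F z = pl r (\<lambda>i. A i (Im z)) (\<lambda>i. B i (Im z)) (Re z)" for z
  define u where "u z = F z - clamp01 (Re z)" for z
  define h where "h z = z + of_real (u z)" for z
  have same: "u z = 0" if z: "Im z \<le> y 0 \<or> y K \<le> Im z" for z
  proof -
    have "A i (Im z) = B i (Im z)" if i: "i \<le> r" for i
      using z pl_low[OF ky, of "Im z"] pl_high[OF ky, of "Im z"] se[OF i] unfolding A_def B_def by metis
    hence "F z = pl r (\<lambda>i. A i (Im z)) (\<lambda>i. A i (Im z)) (Re z)" unfolding F_def pl_def by simp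
    also have "\<dots> = clamp01 (Re z)" using kAB[of "Im z"] by (subst pl_self) (auto simp: knots_def clamp01_def min.commute)
    finally show ?thesis by (simp add: u_def)
  qed
  have sq: "sqisot h"
    unfolding h_def[abs_def]
  proof (rule sqisot_shear)
    have Ac: "continuous_on UNIV (\<lambda>z. A i (Im z))" "continuous_on UNIV (\<lambda>z. B i (Im z))" for i
      unfolding A_def B_def by (rule continuous_on_compose2[OF pl_cont[of UNIV]], simp_all add: continuous_on_Im)+
    have Rc: "continuous_on UNIV Re" by (intro continuous_on_Re continuous_on_id)
    have "continuous_on UNIV (\<lambda>z. (B (Suc i) (Im z) - B i (Im z)) * clamp01 ((Re z - A i (Im z)) / (A (Suc i) (Im z) - A i (Im z))))"
      if i: "i < r" for i
    proof (rule continuous_pl_term)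
      show "A (Suc i) (Im z) - A i (Im z) = 0 \<Longrightarrow> B (Suc i) (Im z) - B i (Im z) = 0" for z
        using kAB[of "Im z"] i unfolding knots_def by simp
    qed (intro continuous_on_diff Ac Rc)+
    hence "continuous_on UNIV F" unfolding F_def pl_def by (intro continuous_on_add continuous_on_sum Ac) simp
    moreover have "continuous_on UNIV (\<lambda>z. clamp01 (Re z))" unfolding clamp01_def by (intro continuous_intros)
    ultimately show "continuous_on UNIV u" unfolding u_def by (rule continuous_on_diff)
    fix x x' w :: real assume "x < x'"
    from pl_strict[OF _ _ _ _ this, of r "\<lambda>i. A i w" "\<lambda>i. B i w"] kAB[of w]
    show "x + u (Complex x w) < x' + u (Complex x' w)" unfolding u_def F_def by simp
  next
    fix z assume z: "z \<notin> interior square"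
    show "u z = 0"
    proof (cases "Im z \<le> 0 \<or> 1 \<le> Im z")
      case True
      thus ?thesis using same[of z] y(2,3) by linarith
    next
      case False
      hence "Re z \<le> 0 \<or> 1 \<le> Re z" using z unfolding interior_square by force
      thus ?thesis using kAB[of "Im z"] pl_low[of r "\<lambda>i. A i (Im z)" "\<lambda>i. B i (Im z)" "Re z"]
          pl_high[of r "\<lambda>i. A i (Im z)" "\<lambda>i. B i (Im z)" "Re z"] unfolding u_def F_def
        by (auto simp: clamp01_low clamp01_high)
    qed
  qed
  have in01: "0 \<le> A i x \<and> A i x \<le> 1" if i: "i \<le> r" for i x
    using knots_mono[of r "\<lambda>i. A i x" "\<lambda>i. B i x" 0 i] knots_mono[of r "\<lambda>i. A i x" "\<lambda>i. B i x" i r] kAB[of x] i by auto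
  have hF: "h z = Complex (F z) (Im z)" if z: "0 \<le> Re z" "Re z \<le> 1" for z
    using clamp01_id[OF z] by (simp add: h_def u_def complex_eq_iff)
  have hA: "h (Complex (A i x) x) = Complex (B i x) x" if i: "i \<le> r" for i x
  proof -
    have "F (Complex (A i x) x) = B i x" unfolding F_def using pl_knot[OF _ i, of "\<lambda>i. A i x" "\<lambda>i. B i x"] kAB[of x] by simp
    thus ?thesis using hF[of "Complex (A i x) x"] in01[OF i, of x] by simp
  qed
  have 1: "affine_to h (up_seg y a i j) (up_seg y b i j)"
    if i: "i \<le> r" and j: "j < K" for i j
  proof (rule affine_toI)
    fix t :: real assume t: "0 \<le> t" "t \<le> 1"
    define x where "x = y j + t * (y (Suc j) - y j)"
    have AB: "A i x = a i j + t * (a i (Suc j) - a i j)" "B i x = b i j + t * (b i (Suc j) - b i j)"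
      unfolding A_def B_def x_def using t by (auto intro!: pl_at[OF ky j])
    have "Complex (a i j) (y j) + of_real t * (Complex (a i (Suc j)) (y (Suc j)) - Complex (a i j) (y j)) = Complex (A i x) x"
      "Complex (b i j) (y j) + of_real t * (Complex (b i (Suc j)) (y (Suc j)) - Complex (b i j) (y j)) = Complex (B i x) x"
      unfolding AB by (simp_all add: complex_eq_iff x_def)
    thus "h (Complex (a i j) (y j) + of_real t * (Complex (a i (Suc j)) (y (Suc j)) - Complex (a i j) (y j))) =
        Complex (b i j) (y j) + of_real t * (Complex (b i (Suc j)) (y (Suc j)) - Complex (b i j) (y j))"
      using hA[OF i, of x] by simp
  qed
  have 2: "affine_to h (across_seg y a i j) (across_seg y b i j)"
    if i: "i < r" and j: "j \<le> K" for i j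
  proof (rule affine_toI)
    fix t :: real assume t: "0 \<le> t" "t \<le> 1"
    have A: "A i (y j) = a i j" "B i (y j) = b i j" for i unfolding A_def B_def by (rule pl_knot[OF ky j])+
    define x where "x = a i j + t * (a (Suc i) j - a i j)"
    have F: "F (Complex x (y j)) = b i j + t * (b (Suc i) j - b i j)"
      unfolding F_def x_def complex.sel A using pl_at[OF kab(1)[OF j] i] t by simp
    have m: "0 \<le> a i j" "a i j \<le> a (Suc i) j" "a (Suc i) j \<le> 1"
      using in01[of i "y j"] in01[of "Suc i" "y j"] i kab(1)[OF j] unfolding A knots_def by auto
    have "t * (a (Suc i) j - a i j) \<le> 1 * (a (Suc i) j - a i j)"
      by (rule mult_right_mono) (use m t in auto)
    hence "t * (a (Suc i) j - a i j) \<le> a (Suc i) j - a i j" by (simp only: mult_1_left)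
    moreover have "0 \<le> t * (a (Suc i) j - a i j)" using m t by auto
    ultimately have "0 \<le> x" "x \<le> 1" using m unfolding x_def by linarith+
    hence "h (Complex x (y j)) = Complex (b i j + t * (b (Suc i) j - b i j)) (y j)" using hF[of "Complex x (y j)"] F by simp
    moreover have "Complex (a i j) (y j) + of_real t * (Complex (a (Suc i) j) (y j) - Complex (a i j) (y j)) = Complex x (y j)"
      "Complex (b i j) (y j) + of_real t * (Complex (b (Suc i) j) (y j) - Complex (b i j) (y j)) = Complex (b i j + t * (b (Suc i) j - b i j)) (y j)"
      by (simp_all add: complex_eq_iff x_def)
    ultimately show "h (Complex (a i j) (y j) + of_real t * (Complex (a (Suc i) j) (y j) - Complex (a i j) (y j))) =
        Complex (b i j) (y j) + of_real t * (Complex (b (Suc i) j) (y j) - Complex (b i j) (y j))"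
      by simp
  qed
  have "h z = z" if "Im z \<le> y 0 \<or> y K \<le> Im z" for z using same[OF that] by (simp add: h_def)
  thus ?thesis using sq 1 2 by blast
qed

text \<open>Here \<open>a i j\<close> is the height of row \<open>i\<close> at \<open>x j\<close>.\<close>

lemma rows_move:
  assumes s: "strands r K a b" and x: "\<forall>j<K. x j < x (Suc j)" "0 \<le> x 0" "x K \<le> 1"
  shows "\<exists>h. sqisot h \<and>
    (\<forall>i\<le>r. \<forall>j<K. affine_to h (right_seg x a i j) (right_seg x b i j)) \<and>
    (\<forall>i<r. \<forall>j\<le>K. affine_to h (upright_seg x a i j) (upright_seg x b i j)) \<and>
    (\<forall>z. Re z \<le> x 0 \<or> x K \<le> Re z \<longrightarrow> h z = z)"
proof -
  from strands_move[OF assms] obtain h where h: "sqisot h" and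
    h2: "\<forall>i\<le>r. \<forall>j<K. affine_to h (up_seg x a i j) (up_seg x b i j)" and
    h3: "\<forall>i<r. \<forall>j\<le>K. affine_to h (across_seg x a i j) (across_seg x b i j)" and
    h4: "\<forall>z. Im z \<le> x 0 \<or> x K \<le> Im z \<longrightarrow> h z = z"
    by (elim exE conjE) (rule that; assumption)
  have sw: "affine_to (swap \<circ> h \<circ> swap) (swap p, swap q) (swap p', swap q')" if "affine_to h (p, q) (p', q')" for p q p' q'
  proof (rule affine_toI)
    fix t :: real assume t: "0 \<le> t" "t \<le> 1"
    have l: "swap p + of_real t * (swap q - swap p) = swap (p + of_real t * (q - p))" for p q by (simp add: complex_eq_iff)
    have "h (p + of_real t * (q - p)) = p' + of_real t * (q' - p')" using that t by (simp add: affine_to_def)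
    thus "(swap \<circ> h \<circ> swap) (swap p + of_real t * (swap q - swap p)) = swap p' + of_real t * (swap q' - swap p')"
      unfolding l by simp
  qed
  have c: "swap (Complex u v) = Complex v u" for u v by (simp add: complex_eq_iff)
  show ?thesis
  proof (intro exI[of _ "swap \<circ> h \<circ> swap"] conjI allI impI)
    show "sqisot (swap \<circ> h \<circ> swap)" by (rule sqisot_swap[OF h])
    show "(swap \<circ> h \<circ> swap) z = z" if zz: "Re z \<le> x 0 \<or> x K \<le> Re z" for z using h4[rule_format, of "swap z"] zz by (simp only: Im_swap comp_apply swap_swap)
  next
    fix i j assume "i \<le> r" "j < K"
    from sw[OF h2[rule_format, OF this]] show "affine_to (swap \<circ> h \<circ> swap) (right_seg x a i j) (right_seg x b i j)"
      unfolding c .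
  next
    fix i j assume "i < r" "j \<le> K"
    from sw[OF h3[rule_format, OF this]] show "affine_to (swap \<circ> h \<circ> swap) (upright_seg x a i j) (upright_seg x b i j)"
      unfolding c .
  qed
qed

subsection \<open>Webs with straight edges\<close>

lemma seg_simps [simp]: "carrier_of (seg s) = closed_segment (fst s) (snd s)" "src (seg s) = fst s" "tgt (seg s) = snd s"
  by (simp_all add: seg_def case_prod_unfold)

lemma inj_seg: "inj seg"
  by (rule injI) (metis prod.collapse seg_simps(2,3))

lemma seg_image: "closed_segment a b = (\<lambda>t. a + of_real t * (b - a)) ` {0..1}" for a b :: complex
  by (simp add: closed_segment_image_interval scaleR_conv_of_real algebra_simps)

lemma segE:
  assumes "z \<in> closed_segment a (b :: complex)"
  obtains t where "0 \<le> t" "t \<le> 1" "z = a + of_real t * (b - a)"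
  using assms unfolding seg_image by auto

lemma is_darc_seg: "fst s \<noteq> snd s \<Longrightarrow> is_darc (seg s)"
  unfolding is_darc_def by (intro exI[of _ "linepath (fst s) (snd s)"]) (simp add: arc_linepath)

lemma affine_to_flip: "affine_to h (p, q) (p', q') \<Longrightarrow> affine_to h (q, p) (q', p')"
proof (rule affine_toI)
  fix t :: real assume a: "affine_to h (p, q) (p', q')" and t: "0 \<le> t" "t \<le> 1"
  have "h (p + of_real u * (q - p)) = p' + of_real u * (q' - p')" if "0 \<le> u" "u \<le> 1" for u
    using a that by (simp add: affine_to_def)
  from this[of "1 - t"] have "h (p + of_real (1 - t) * (q - p)) = p' + of_real (1 - t) * (q' - p')" using t by simp
  thus "h (q + of_real t * (p - q)) = q' + of_real t * (p' - q')" by (simp add: algebra_simps)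
qed

lemma map_darc_seg:
  assumes "affine_to h s s'"
  shows "map_darc h (seg s) = seg s'"
proof -
  have h: "h (fst s + of_real t * (snd s - fst s)) = fst s' + of_real t * (snd s' - fst s')" if "t \<in> {0..1}" for t
    using assms that unfolding affine_to_def by blast
  have "h (fst s) = fst s'" "h (snd s) = snd s'" using h[of 0] h[of 1] by simp_all
  moreover have "h ` closed_segment (fst s) (snd s) = closed_segment (fst s') (snd s')"
    unfolding seg_image image_image using h by (rule image_cong[OF refl])
  ultimately show ?thesis by (simp add: map_darc_def seg_def case_prod_unfold)
qed

definition segs :: "nat \<Rightarrow> (complex \<times> complex) set \<Rightarrow> web" where
  "segs n S = Web (ups n) (ups n) (seg ` S) {}"

definition cross :: "complex \<Rightarrow> complex \<Rightarrow> complex \<Rightarrow> real" where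
  "cross p q z = (Re q - Re p) * (Im z - Im p) - (Im q - Im p) * (Re z - Re p)"

definition dot :: "complex \<Rightarrow> complex \<Rightarrow> complex \<Rightarrow> real" where
  "dot p q z = (Re q - Re p) * (Re z - Re p) + (Im q - Im p) * (Im z - Im p)"

text \<open>The rays from \<open>p\<close> through \<open>x\<close> and through \<open>y\<close> are
  not parallel, or point to opposite sides.\<close>

definition fork :: "complex \<Rightarrow> complex \<Rightarrow> complex \<Rightarrow> bool" where
  "fork p x y \<longleftrightarrow> cross p x y \<noteq> 0 \<or> dot p x y < 0"

text \<open>A sufficient criterion for two segments to have at most end points in common.\<close>

fun sep :: "complex \<times> complex \<Rightarrow> complex \<times> complex \<Rightarrow> bool" where
  "sep (a, b) (c, d) \<longleftrightarrow>
     a = c \<and> fork a b d \<or> a = d \<and> fork a b c \<or> b = c \<and> fork b a d \<or> b = d \<and> fork b a c \<or>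
     Re a < Re c \<and> Re a < Re d \<and> Re b < Re c \<and> Re b < Re d \<or> Re c < Re a \<and> Re c < Re b \<and> Re d < Re a \<and> Re d < Re b \<or>
     Im a < Im c \<and> Im a < Im d \<and> Im b < Im c \<and> Im b < Im d \<or> Im c < Im a \<and> Im c < Im b \<and> Im d < Im a \<and> Im d < Im b \<or>
     0 < cross a b c * cross a b d \<or> 0 < cross c d a * cross c d b"

lemma cross_line: "cross a b (a + of_real t * (b - a)) = 0" and
  cross_affine: "cross a b (c + of_real u * (d - c)) = (1 - u) * cross a b c + u * cross a b d"
  by (simp_all add: cross_def algebra_simps)

lemma convex_gt:
  fixes c :: real
  assumes "c < x" "c < y" "0 \<le> u" "0 \<le> v" "u + v = 1"
  shows "c < u * x + v * y"
  using convex_bound_lt[of "- x" "- c" "- y" u v] assms by simp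

lemma cross_disjoint:
  assumes "0 < cross a b c * cross a b d"
  shows "closed_segment a b \<inter> closed_segment c d = {}"
proof (rule equals0I, elim IntE)
  fix z assume "z \<in> closed_segment a b" "z \<in> closed_segment c d"
  then obtain t u where t: "z = a + of_real t * (b - a)" and u: "0 \<le> u" "u \<le> 1" "z = c + of_real u * (d - c)"
    by (elim segE) blast
  have 0: "(1 - u) * cross a b c + u * cross a b d = 0"
    using cross_line[of a b t] cross_affine[of a b c u d] t u(3) by simp
  have "(0 < cross a b c \<and> 0 < cross a b d) \<or> (cross a b c < 0 \<and> cross a b d < 0)"
    using assms by (simp add: zero_less_mult_iff)
  thus False
  proof
    assume "0 < cross a b c \<and> 0 < cross a b d"
    thus False using convex_gt[of 0 "cross a b c" "cross a b d" "1 - u" u] u 0 by simp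
  next
    assume "cross a b c < 0 \<and> cross a b d < 0"
    thus False using convex_bound_lt[of "cross a b c" 0 "cross a b d" "1 - u" u] u 0 by simp
  qed
qed

text \<open>For rays on one line, the squared distance of a common point from \<open>p\<close>, with
  one factor taken from each parametrisation, is \<open>t * u\<close> times the negative number
  \<open>dot p x y\<close>; so it is 0.\<close>

lemma fork_disjoint:
  assumes "fork p x y"
  shows "closed_segment p x \<inter> closed_segment p y \<subseteq> {p}"
proof
  fix z assume "z \<in> closed_segment p x \<inter> closed_segment p y"
  then obtain t u where t: "0 \<le> t" "z = p + of_real t * (x - p)" and u: "0 \<le> u" "z = p + of_real u * (y - p)"
    by (elim IntE segE) blast
  show "z \<in> {p}"
  proof (cases "cross p x y = 0")
    case False
    have "u * cross p x y = cross p x (p + of_real u * (y - p))" by (simp add: cross_def algebra_simps)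
    also have "\<dots> = 0" using cross_line[of p x t] t(2) u(2) by simp
    finally show ?thesis using False u(2) by simp
  next
    case True
    hence d: "dot p x y < 0" using assms by (simp add: fork_def)
    have "(Re z - Re p)\<^sup>2 + (Im z - Im p)\<^sup>2 = (t * (Re x - Re p)) * (u * (Re y - Re p)) + (t * (Im x - Im p)) * (u * (Im y - Im p))"
    proof -
      have "Re z - Re p = t * (Re x - Re p)" "Im z - Im p = t * (Im x - Im p)" using t(2) by simp_all
      moreover have "Re z - Re p = u * (Re y - Re p)" "Im z - Im p = u * (Im y - Im p)" using u(2) by simp_all
      ultimately show ?thesis unfolding power2_eq_square by metis
    qed
    also have "\<dots> = (t * u) * dot p x y" by (simp add: dot_def algebra_simps)
    also have "\<dots> \<le> 0" using d t(1) u(1) by (intro mult_nonneg_nonpos) auto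
    finally have "(Re z - Re p)\<^sup>2 + (Im z - Im p)\<^sup>2 = 0" using sum_power2_ge_zero[of "Re z - Re p" "Im z - Im p"] by linarith
    thus ?thesis by (simp add: sum_power2_eq_zero_iff complex_eq_iff)
  qed
qed

lemma seg_convex:
  assumes "z \<in> closed_segment a b"
  shows "Re a < c \<Longrightarrow> Re b < c \<Longrightarrow> Re z < c" "c < Re a \<Longrightarrow> c < Re b \<Longrightarrow> c < Re z"
    "Im a < c \<Longrightarrow> Im b < c \<Longrightarrow> Im z < c" "c < Im a \<Longrightarrow> c < Im b \<Longrightarrow> c < Im z"
    "Im a \<le> c \<Longrightarrow> Im b \<le> c \<Longrightarrow> Im z \<le> c" "c \<le> Im a \<Longrightarrow> c \<le> Im b \<Longrightarrow> c \<le> Im z"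
    "Re a \<le> c \<Longrightarrow> Re b \<le> c \<Longrightarrow> Re z \<le> c" "c \<le> Re a \<Longrightarrow> c \<le> Re b \<Longrightarrow> c \<le> Re z"
proof -
  obtain t where t: "0 \<le> t" "t \<le> 1" "z = a + of_real t * (b - a)" using assms by (rule segE)
  have z: "Re z = (1 - t) * Re a + t * Re b" "Im z = (1 - t) * Im a + t * Im b" by (simp_all add: t(3) algebra_simps)
  show "Re a < c \<Longrightarrow> Re b < c \<Longrightarrow> Re z < c" "Im a < c \<Longrightarrow> Im b < c \<Longrightarrow> Im z < c"
    unfolding z using t by (auto intro: convex_bound_lt)
  show "c < Re a \<Longrightarrow> c < Re b \<Longrightarrow> c < Re z" "c < Im a \<Longrightarrow> c < Im b \<Longrightarrow> c < Im z"
    unfolding z using t by (auto intro: convex_gt)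
  show "Re a \<le> c \<Longrightarrow> Re b \<le> c \<Longrightarrow> Re z \<le> c" "Im a \<le> c \<Longrightarrow> Im b \<le> c \<Longrightarrow> Im z \<le> c"
    unfolding z using t by (auto intro: convex_bound_le)
  show "c \<le> Re a \<Longrightarrow> c \<le> Re b \<Longrightarrow> c \<le> Re z" "c \<le> Im a \<Longrightarrow> c \<le> Im b \<Longrightarrow> c \<le> Im z"
    unfolding z using t convex_bound_le[of "- Re a" "- c" "- Re b" "1 - t" t] convex_bound_le[of "- Im a" "- c" "- Im b" "1 - t" t] by auto
qed

lemma box_disjoint:
  assumes "Re a < Re c \<and> Re a < Re d \<and> Re b < Re c \<and> Re b < Re d \<or> Im a < Im c \<and> Im a < Im d \<and> Im b < Im c \<and> Im b < Im d"
  shows "closed_segment a b \<inter> closed_segment c d = {}"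
proof (rule equals0I, elim IntE)
  fix z assume 1: "z \<in> closed_segment a b" and 2: "z \<in> closed_segment c d"
  from assms show False
  proof
    assume A: "Re a < Re c \<and> Re a < Re d \<and> Re b < Re c \<and> Re b < Re d"
    have "Re z < Re c" "Re z < Re d" using seg_convex(1)[OF 1] A by blast+
    thus False using seg_convex(2)[OF 2, of "Re z"] by simp
  next
    assume A: "Im a < Im c \<and> Im a < Im d \<and> Im b < Im c \<and> Im b < Im d"
    have "Im z < Im c" "Im z < Im d" using seg_convex(3)[OF 1] A by blast+
    thus False using seg_convex(4)[OF 2, of "Im z"] by simp
  qed
qed

lemma sepD:
  assumes "sep (a, b) (c, d)"
  shows "closed_segment a b \<inter> closed_segment c d \<subseteq> {a, b} \<inter> {c, d}"
  using assms unfolding sep.simps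
proof (elim disjE)
  assume "a = c \<and> fork a b d" thus ?thesis using fork_disjoint[of a b d] by auto
next
  assume A: "a = d \<and> fork a b c"
  thus ?thesis using fork_disjoint[of a b c] A unfolding closed_segment_commute[of c d] by auto
next
  assume A: "b = c \<and> fork b a d"
  thus ?thesis using fork_disjoint[of b a d] A unfolding closed_segment_commute[of a b] by auto
next
  assume A: "b = d \<and> fork b a c"
  thus ?thesis using fork_disjoint[of b a c] A unfolding closed_segment_commute[of a b] closed_segment_commute[of c d] by auto
next
  assume "Re a < Re c \<and> Re a < Re d \<and> Re b < Re c \<and> Re b < Re d" thus ?thesis using box_disjoint[of a c d b] by auto
next
  assume "Re c < Re a \<and> Re c < Re b \<and> Re d < Re a \<and> Re d < Re b" thus ?thesis using box_disjoint[of c a b d] by auto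
next
  assume "Im a < Im c \<and> Im a < Im d \<and> Im b < Im c \<and> Im b < Im d" thus ?thesis using box_disjoint[of a c d b] by auto
next
  assume "Im c < Im a \<and> Im c < Im b \<and> Im d < Im a \<and> Im d < Im b" thus ?thesis using box_disjoint[of c a b d] by auto
next
  assume "0 < cross a b c * cross a b d" thus ?thesis using cross_disjoint[of a b c d] by auto
next
  assume "0 < cross c d a * cross c d b" thus ?thesis using cross_disjoint[of c d a b] by auto
qed

definition indeg :: "(complex \<times> complex) list \<Rightarrow> complex \<Rightarrow> nat" where "indeg L p = length (filter (\<lambda>s. snd s = p) L)"
definition outdeg :: "(complex \<times> complex) list \<Rightarrow> complex \<Rightarrow> nat" where "outdeg L p = length (filter (\<lambda>s. fst s = p) L)"

text \<open>A criterion for straight webs without crossings that simplification decides on explicit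
  lists: pairwise separation, degrees at the nodes, and no edge inside the bottom or top
  side.\<close>

definition seg_check :: "nat \<Rightarrow> (complex \<times> complex) list \<Rightarrow> bool" where
  "seg_check n L \<longleftrightarrow> distinct L \<and> sorted_wrt sep L \<and>
     list_all (\<lambda>(a, b). a \<noteq> b \<and> 0 < Re a \<and> Re a < 1 \<and> 0 < Re b \<and> Re b < 1 \<and> 0 \<le> Im a \<and> Im a \<le> 1 \<and> 0 \<le> Im b \<and> Im b \<le> 1 \<and>
       \<not> (Im a = 0 \<and> Im b = 0) \<and> \<not> (Im a = 1 \<and> Im b = 1)) L \<and>
     list_all (\<lambda>i. indeg L (bpt n i) = 0 \<and> outdeg L (bpt n i) = 1 \<and> indeg L (tpt n i) = 1 \<and> outdeg L (tpt n i) = 0) [0..<n] \<and>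
     list_all (\<lambda>p. if Im p = 0 then p \<in> set (map (bpt n) [0..<n]) else if Im p = 1 then p \<in> set (map (tpt n) [0..<n])
        else (indeg L p, outdeg L p) \<in> {(1, 1), (3, 0), (0, 3)}) (map fst L @ map snd L)"

lemma valency_seg: "distinct L \<Longrightarrow> valency (seg ` set L) p = (indeg L p, outdeg L p)"
proof -
  assume d: "distinct L"
  have "card {e \<in> seg ` set L. P e} = length (filter (P \<circ> seg) L)" for P
  proof -
    have "{e \<in> seg ` set L. P e} = seg ` ({s. (P \<circ> seg) s} \<inter> set L)" by auto
    also have "card \<dots> = card ({s. (P \<circ> seg) s} \<inter> set L)" by (rule card_image[OF inj_on_subset[OF inj_seg subset_UNIV]])
    finally show ?thesis by (simp add: distinct_length_filter[OF d])
  qed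
  thus ?thesis by (simp add: valency_def indeg_def outdeg_def comp_def)
qed

lemma seg_check_webs:
  assumes "seg_check n L"
  shows "segs n (set L) \<in> uwebs n"
proof -
  note A = assms[unfolded seg_check_def list_all_iff]
  have d: "distinct L" and so: "sorted_wrt sep L" using A by blast+
  have pos: "a \<noteq> b \<and> 0 < Re a \<and> Re a < 1 \<and> 0 < Re b \<and> Re b < 1 \<and> 0 \<le> Im a \<and> Im a \<le> 1 \<and> 0 \<le> Im b \<and> Im b \<le> 1 \<and>
       \<not> (Im a = 0 \<and> Im b = 0) \<and> \<not> (Im a = 1 \<and> Im b = 1)" if "(a, b) \<in> set L" for a b
    using A[THEN conjunct2, THEN conjunct2, THEN conjunct1] that by auto
  have bv: "valency (seg ` set L) (bpt n i) = (0, 1)" "valency (seg ` set L) (tpt n i) = (1, 0)" if "i < n" for i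
    using A[THEN conjunct2, THEN conjunct2, THEN conjunct2, THEN conjunct1] that valency_seg[OF d] by auto
  have nd: "(Im p = 0 \<or> Im p = 1 \<longrightarrow> p \<in> bd n) \<and> (p \<notin> bd n \<longrightarrow> valency (seg ` set L) p \<in> {(1, 1), (3, 0), (0, 3)})"
    if "p \<in> fst ` set L \<union> snd ` set L" for p
  proof -
    have "if Im p = 0 then p \<in> set (map (bpt n) [0..<n]) else if Im p = 1 then p \<in> set (map (tpt n) [0..<n])
        else (indeg L p, outdeg L p) \<in> {(1, 1), (3, 0), (0, 3)}"
      by (rule bspec[OF A[THEN conjunct2, THEN conjunct2, THEN conjunct2, THEN conjunct2]]) (use that in auto)
    thus ?thesis unfolding valency_seg[OF d] bd_iff by (auto split: if_splits)
  qed
  have disj: "carrier_of e \<inter> carrier_of f \<subseteq> ends e \<inter> ends f" if ef: "e \<in> seg ` set L" "f \<in> seg ` set L" "e \<noteq> f" for e f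
  proof -
    obtain i j where i: "i < length L" "e = seg (L ! i)" and j: "j < length L" "f = seg (L ! j)"
      using ef by (auto simp: in_set_conv_nth)
    have s: "closed_segment (fst (L ! i)) (snd (L ! i)) \<inter> closed_segment (fst (L ! j)) (snd (L ! j)) \<subseteq> {fst (L ! i), snd (L ! i)} \<inter> {fst (L ! j), snd (L ! j)}"
      if "i < j" "j < length L" for i j
      using sorted_wrt_nth_less[OF so that] by (intro sepD) simp
    have "i < j \<or> j < i" using ef i j by (metis linorder_neqE_nat)
    thus ?thesis using s[of i j] s[of j i] i j by auto
  qed
  have nc: "\<not> crossing (seg ` set L) p e f" for p e f
    using disj[of e f] unfolding crossing_def by blast
  have car: "z \<in> square \<and> (z \<in> frontier square \<longrightarrow> z \<in> {a, b})" if ab: "(a, b) \<in> set L" and z: "z \<in> closed_segment a b" for a b z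
  proof
    note p = pos[OF ab]
    have r: "0 < Re z" "Re z < 1" "0 \<le> Im z" "Im z \<le> 1" using seg_convex[OF z] p by blast+
    thus "z \<in> square" by (simp add: square_def)
    show "z \<in> frontier square \<longrightarrow> z \<in> {a, b}"
    proof
      assume "z \<in> frontier square"
      hence f: "Im z = 0 \<or> Im z = 1" using r unfolding frontier_square by auto
      obtain t where t: "0 \<le> t" "t \<le> 1" "z = a + of_real t * (b - a)" using z by (rule segE)
      have I: "Im z = (1 - t) * Im a + t * Im b" by (simp add: t(3) algebra_simps)
      have I': "1 - Im z = (1 - t) * (1 - Im a) + t * (1 - Im b)" using I by (simp add: algebra_simps)
      have zero: "t = 0 \<or> t = 1" if "(1 - t) * u + t * v = 0" "0 \<le> u" "0 \<le> v" "\<not> (u = 0 \<and> v = 0)" for u v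
      proof -
        have "0 \<le> (1 - t) * u" "0 \<le> t * v" using that t by simp_all
        hence "(1 - t) * u = 0" "t * v = 0" using that(1) by linarith+
        thus ?thesis using that(4) by auto
      qed
      have "t = 0 \<or> t = 1"
        using f
      proof
        assume "Im z = 0" thus ?thesis using zero[of "Im a" "Im b"] I p by simp
      next
        assume "Im z = 1" thus ?thesis using zero[of "1 - Im a" "1 - Im b"] I' p by simp
      qed
      thus "z \<in> {a, b}" using t(3) by auto
    qed
  qed
  have es: "esys (seg ` set L) {}"
    unfolding esys_def
  proof (intro conjI ballI allI impI)
    fix e assume "e \<in> seg ` set L"
    then obtain a b where "(a, b) \<in> set L" "e = seg (a, b)" by auto
    thus "is_darc e" using pos[of a b] is_darc_seg[of "(a, b)"] by simp
  next
    fix e f assume ef: "e \<in> seg ` set L" "f \<in> seg ` set L" "e \<noteq> f"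
    show "finite (carrier_of e \<inter> carrier_of f)" by (rule finite_subset[OF disj[OF ef]]) simp
    fix p assume "p \<in> carrier_of e \<inter> carrier_of f"
    thus "p \<in> ends e \<inter> ends f \<or> crossing (seg ` set L) p e f" using disj[OF ef] by blast
  qed (simp_all add: nc)
  have "ok n (seg ` set L) {}"
    unfolding ok_def
  proof (intro conjI ballI allI impI)
    fix e assume "e \<in> seg ` set L"
    then obtain a b where e: "(a, b) \<in> set L" "e = seg (a, b)" by auto
    show "carrier_of e \<subseteq> square" using car[OF e(1)] e(2) by auto
    show "carrier_of e \<inter> frontier square \<subseteq> bd n"
    proof
      fix z assume z: "z \<in> carrier_of e \<inter> frontier square"
      hence zz: "z \<in> closed_segment a b" using e(2) by simp
      have zab: "z \<in> {a, b}" using car[OF e(1) zz] z by blast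
      have r: "0 < Re z" "Re z < 1" using seg_convex[OF zz] pos[OF e(1)] by blast+
      have "Im z = 0 \<or> Im z = 1" using z r unfolding frontier_square by auto
      moreover have "z \<in> fst ` set L \<union> snd ` set L" using zab e(1) by force
      ultimately show "z \<in> bd n" using nd by blast
    qed
  next
    fix p assume p: "p \<in> (\<Union>e\<in>seg ` set L. ends e) - bd n"
    hence "p \<in> fst ` set L \<union> snd ` set L" by auto
    thus "valency (seg ` set L) p \<in> {(1, 1), (3, 0), (0, 3)}" using nd p by blast
  qed (use es bv in auto)
  thus ?thesis unfolding uwebs_iff segs_def by simp
qed

subsection \<open>Cutting straight edges\<close>

lemma valency_single: "valency {e} p = ((if tgt e = p then 1 else 0), (if src e = p then 1 else 0))"
proof -
  have "{f. f = e \<and> Q f} = (if Q e then {e} else {})" for Q by auto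
  thus ?thesis by (simp add: valency_def)
qed

text \<open>The point to be shown is that \<open>p\<close> lies on no other edge. A web with empty
  over-information has no crossings, so edges meet in end points only.\<close>

lemma split_seg:
  assumes w: "segs n S \<in> uwebs n" and s: "(a, b) \<in> S" and t: "0 < t" "t < 1" and p: "p = a + of_real t * (b - a)"
  shows "segs n (S - {(a, b)} \<union> {(a, p), (p, b)}) \<in> uwebs n"
    "heq n (lw (segs n S)) (lw (segs n (S - {(a, b)} \<union> {(a, p), (p, b)})))"
proof -
  have ok: "ok n (seg ` S) {}" using w unfolding uwebs_iff segs_def by simp
  note D = okD[OF ok] and E = esysD[OF okD(1)[OF ok]]
  define e where "e = seg (a, b)"
  define e1 where "e1 = seg (a, p)"
  define e2 where "e2 = seg (p, b)"
  define F where "F = seg ` (S - {(a, b)})"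
  have eE: "e \<in> seg ` S" using s by (simp add: e_def)
  have F: "F = seg ` S - {e}" unfolding F_def e_def by (simp add: image_set_diff[OF inj_seg])
  have ab: "a \<noteq> b" using is_darc_src_tgt[OF E(2)[OF eE]] by (simp add: e_def)
  have pab: "p \<noteq> a" "p \<noteq> b"
  proof -
    show "p \<noteq> a" using ab t p by simp
    have "b - p = of_real (1 - t) * (b - a)" by (simp add: p algebra_simps)
    thus "p \<noteq> b" using ab t by auto
  qed
  have pin: "p \<in> closed_segment a b" unfolding seg_image p using t by auto
  have car: "closed_segment a b = closed_segment a p \<union> closed_segment p b" by (rule Un_closed_segment[OF pin, symmetric])
  have int: "closed_segment a p \<inter> closed_segment p b = {p}" by (rule Int_closed_segment) (use pin in auto)
  have anc: "a \<notin> closed_segment p b" "b \<notin> closed_segment a p" using int pab by auto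
  have d12: "is_darc e1" "is_darc e2" unfolding e1_def e2_def using pab by (auto intro: is_darc_seg)
  have nc: "\<not> crossing (seg ` S) q f g" for q f g using E(7)[of q f g] by blast
  have pts: "q \<in> ends f \<inter> ends g" if "f \<in> seg ` S" "g \<in> seg ` S" "f \<noteq> g" "q \<in> carrier_of f" "q \<in> carrier_of g" for f g q
    using E(4)[OF that] nc by blast
  have ptF: "q \<in> {a, b} \<inter> ends f" if "f \<in> F" "q \<in> closed_segment a b" "q \<in> carrier_of f" for f q
    using pts[of e f q] that eE unfolding F by (auto simp: e_def)
  have pF: "p \<notin> carrier_of f" if "f \<in> F" for f using ptF[OF that pin] pab by blast
  have newF: "e1 \<notin> F" "e2 \<notin> F" "e1 \<noteq> e2" using pF[of e1] pF[of e2] pab by (auto simp: e1_def e2_def prod_eq_iff)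
  have finF: "finite F" using E(1) unfolding F by simp
  have S': "seg ` (S - {(a, b)} \<union> {(a, p), (p, b)}) = F \<union> {e1, e2}" by (simp add: F_def e1_def e2_def image_Un)
  have SE: "seg ` S = F \<union> {e}" using eE unfolding F by blast
  have dj: "carrier_of f \<inter> carrier_of g \<subseteq> ends f \<inter> ends g" if fg: "f \<in> F \<union> {e1, e2}" "g \<in> F \<union> {e1, e2}" "f \<noteq> g" for f g
  proof -
    have FF: "carrier_of f \<inter> carrier_of g \<subseteq> ends f \<inter> ends g" if "f \<in> F" "g \<in> F" "f \<noteq> g" for f g
      using pts[of f g] that unfolding F by blast
    have F1: "carrier_of f \<inter> carrier_of e1 \<subseteq> ends f \<inter> ends e1" if f: "f \<in> F" for f
    proof
      fix q assume q: "q \<in> carrier_of f \<inter> carrier_of e1"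
      hence q1: "q \<in> closed_segment a p" "q \<in> closed_segment a b" using car by (auto simp: e1_def)
      have "q \<in> {a, b} \<inter> ends f" using ptF[OF f q1(2)] q by blast
      thus "q \<in> ends f \<inter> ends e1" using q1(1) anc(2) by (auto simp: e1_def)
    qed
    have F2: "carrier_of f \<inter> carrier_of e2 \<subseteq> ends f \<inter> ends e2" if f: "f \<in> F" for f
    proof
      fix q assume q: "q \<in> carrier_of f \<inter> carrier_of e2"
      hence q1: "q \<in> closed_segment p b" "q \<in> closed_segment a b" using car by (auto simp: e2_def)
      have "q \<in> {a, b} \<inter> ends f" using ptF[OF f q1(2)] q by blast
      thus "q \<in> ends f \<inter> ends e2" using q1(1) anc(1) by (auto simp: e2_def)
    qed
    have 12: "carrier_of e1 \<inter> carrier_of e2 \<subseteq> ends e1 \<inter> ends e2" using int by (simp add: e1_def e2_def)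
    have F1': "carrier_of e1 \<inter> carrier_of f \<subseteq> ends e1 \<inter> ends f" if "f \<in> F" for f using F1[OF that] by blast
    have F2': "carrier_of e2 \<inter> carrier_of f \<subseteq> ends e2 \<inter> ends f" if "f \<in> F" for f using F2[OF that] by blast
    have 21: "carrier_of e2 \<inter> carrier_of e1 \<subseteq> ends e2 \<inter> ends e1" using 12 by blast
    show ?thesis using fg FF F1 F2 F1' F2' 12 21 by (elim UnE insertE emptyE) simp_all
  qed
  have nc': "\<not> crossing (F \<union> {e1, e2}) q f g" for q f g using dj[of f g] unfolding crossing_def by blast
  have es: "esys (F \<union> {e1, e2}) {}"
    unfolding esys_def
  proof (intro conjI ballI allI impI)
    fix f assume "f \<in> F \<union> {e1, e2}"
    thus "is_darc f" using d12 E(2)[of f] unfolding F by blast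
  next
    fix f g assume fg: "f \<in> F \<union> {e1, e2}" "g \<in> F \<union> {e1, e2}" "f \<noteq> g"
    show "finite (carrier_of f \<inter> carrier_of g)" by (rule finite_subset[OF dj[OF fg]]) simp
    fix q assume "q \<in> carrier_of f \<inter> carrier_of g"
    thus "q \<in> ends f \<inter> ends g \<or> crossing (F \<union> {e1, e2}) q f g" using dj[OF fg] by blast
  qed (use finF nc' in auto)
  have vF: "valency (F \<union> {e}) q = (fst (valency F q) + (if b = q then 1 else 0), snd (valency F q) + (if a = q then 1 else 0))"
    "valency (F \<union> {e1, e2}) q = (fst (valency F q) + (if p = q then 1 else 0) + (if b = q then 1 else 0), snd (valency F q) + (if a = q then 1 else 0) + (if p = q then 1 else 0))" for q
  proof -
    have "F \<inter> {e} = {}" unfolding F by simp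
    from valency_Un[OF finF _ this] show "valency (F \<union> {e}) q = (fst (valency F q) + (if b = q then 1 else 0), snd (valency F q) + (if a = q then 1 else 0))"
      by (simp add: valency_single e_def)
    have "valency {e1, e2} q = ((if p = q then 1 else 0) + (if b = q then 1 else 0), (if a = q then 1 else 0) + (if p = q then 1 else 0))"
    proof -
      have "valency ({e1} \<union> {e2}) q = (fst (valency {e1} q) + fst (valency {e2} q), snd (valency {e1} q) + snd (valency {e2} q))"
        by (rule valency_Un) (use newF(3) in auto)
      moreover have "src e1 = a" "tgt e1 = p" "src e2 = p" "tgt e2 = b" by (simp_all add: e1_def e2_def)
      moreover have "{e1, e2} = {e1} \<union> {e2}" by blast
      ultimately show ?thesis by (simp only: valency_single fst_conv snd_conv)
    qed
    thus "valency (F \<union> {e1, e2}) q = (fst (valency F q) + (if p = q then 1 else 0) + (if b = q then 1 else 0), snd (valency F q) + (if a = q then 1 else 0) + (if p = q then 1 else 0))"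
      using valency_Un[of F "{e1, e2}" q] finF newF by simp
  qed
  have vp: "valency F p = (0, 0)"
  proof (rule valency_eq_0)
    have "p \<notin> ends f" if "f \<in> F" for f
      using pF[OF that] is_darc_ends[OF E(2)[of f]] that unfolding F by blast
    thus "p \<notin> (\<Union>f\<in>F. ends f)" by blast
  qed
  have vq: "valency (F \<union> {e1, e2}) q = valency (F \<union> {e}) q" if "q \<noteq> p" for q unfolding vF using that by simp
  have pbd: "p \<notin> bd n"
  proof
    assume "p \<in> bd n"
    hence "\<exists>f\<in>seg ` S. p \<in> ends f"
      using valency_pos_end[OF E(1)] D(4,5) unfolding bd_iff by (metis Pair_inject zero_neq_one)
    then obtain f where f: "f \<in> seg ` S" "p \<in> ends f" by (rule bexE)
    show False
    proof (cases "f \<in> F")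
      case True
      have "p \<in> carrier_of f" by (rule subsetD[OF is_darc_ends[OF E(2)[OF f(1)]] f(2)])
      thus False using pF[OF True] by simp
    next
      case False
      hence "f = e" using f(1) unfolding SE by simp
      thus False using f(2) pab by (simp add: e_def)
    qed
  qed
  have ok': "ok n (F \<union> {e1, e2}) {}"
    unfolding ok_def
  proof (intro conjI ballI allI impI)
    show "esys (F \<union> {e1, e2}) {}" by (rule es)
    fix f assume f: "f \<in> F \<union> {e1, e2}"
    have "\<exists>g\<in>seg ` S. carrier_of f \<subseteq> carrier_of g"
    proof (cases "f \<in> F")
      case True thus ?thesis unfolding F by blast
    next
      case False
      hence "f = e1 \<or> f = e2" using f by simp
      hence "carrier_of f \<subseteq> carrier_of e"
        by (rule disjE) (simp_all add: e1_def e2_def e_def car)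
      thus ?thesis using eE by blast
    qed
    then obtain g where g: "g \<in> seg ` S" "carrier_of f \<subseteq> carrier_of g" by blast
    show "carrier_of f \<subseteq> square" by (rule subset_trans[OF g(2) D(2)[OF g(1)]])
    show "carrier_of f \<inter> frontier square \<subseteq> bd n" by (rule subset_trans[OF Int_mono[OF g(2) order_refl] D(3)[OF g(1)]])
  next
    fix i assume i: "i < n"
    have "bpt n i \<noteq> p" "tpt n i \<noteq> p" using pbd i unfolding bd_iff by blast+
    thus "valency (F \<union> {e1, e2}) (bpt n i) = (0, 1)" "valency (F \<union> {e1, e2}) (tpt n i) = (1, 0)"
      using vq D(4,5)[OF i] unfolding SE by simp_all
  next
    fix q assume q: "q \<in> (\<Union>f\<in>F \<union> {e1, e2}. ends f) - bd n"
    show "valency (F \<union> {e1, e2}) q \<in> {(1, 1), (3, 0), (0, 3)}"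
    proof (cases "q = p")
      case True
      thus ?thesis unfolding vF True vp using pab by simp
    next
      case False
      have u: "(\<Union>f\<in>F \<union> {e1, e2}. ends f) = (\<Union>f\<in>F. ends f) \<union> ({a, p} \<union> {p, b})"
        "(\<Union>f\<in>F \<union> {e}. ends f) = (\<Union>f\<in>F. ends f) \<union> {a, b}"
        unfolding UN_Un UN_insert UN_empty by (simp_all add: e1_def e2_def e_def)
      have "q \<in> (\<Union>f\<in>seg ` S. ends f)" using q False unfolding SE u by blast
      thus ?thesis using D(6)[of q] q vq[OF False] unfolding SE by simp
    qed
  qed
  show w': "segs n (S - {(a, b)} \<union> {(a, p), (p, b)}) \<in> uwebs n"
    unfolding uwebs_iff using ok' unfolding segs_def S' by simp
  have "subdivision (segs n S) (segs n (S - {(a, b)} \<union> {(a, p), (p, b)}))"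
    unfolding subdivision_iff
    by (intro exI[of _ e] exI[of _ e1] exI[of _ e2] conjI)
       (use eE d12 car int in \<open>simp_all add: segs_def S' F subdiv_over_def image_Un image_set_diff[OF inj_seg], simp_all add: e_def e1_def e2_def\<close>)
  thus "heq n (lw (segs n S)) (lw (segs n (S - {(a, b)} \<union> {(a, p), (p, b)})))" using heq_move[OF w w'] by blast
qed

definition cut1 :: "real \<Rightarrow> complex \<times> complex \<Rightarrow> (complex \<times> complex) list" where
  "cut1 y s = (if Im (fst s) < y \<and> y < Im (snd s) \<or> Im (snd s) < y \<and> y < Im (fst s) then
     (let p = Complex (Re (fst s) + (y - Im (fst s)) / (Im (snd s) - Im (fst s)) * (Re (snd s) - Re (fst s))) y
      in [(fst s, p), (p, snd s)]) else [s])"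

lemma cut1_split:
  assumes "Im (fst s) < y \<and> y < Im (snd s) \<or> Im (snd s) < y \<and> y < Im (fst s)"
  obtains t p where "0 < t" "t < 1" "p = fst s + of_real t * (snd s - fst s)" "Im p = y" "cut1 y s = [(fst s, p), (p, snd s)]"
proof
  define t where "t = (y - Im (fst s)) / (Im (snd s) - Im (fst s))"
  have ne: "Im (snd s) - Im (fst s) \<noteq> 0" using assms by auto
  show "0 < t" "t < 1" using assms unfolding t_def by (auto simp: divide_simps)
  show "cut1 y s = [(fst s, Complex (Re (fst s) + t * (Re (snd s) - Re (fst s))) y), (Complex (Re (fst s) + t * (Re (snd s) - Re (fst s))) y, snd s)]"
    using assms by (simp add: cut1_def t_def Let_def)
  show "Complex (Re (fst s) + t * (Re (snd s) - Re (fst s))) y = fst s + of_real t * (snd s - fst s)"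
    using ne by (simp add: complex_eq_iff t_def)
qed simp

lemma cut_height:
  assumes w: "segs n (set L) \<in> uwebs n"
  shows "segs n (set (concat (map (cut1 y) L))) \<in> uwebs n \<and> heq n (lw (segs n (set L))) (lw (segs n (set (concat (map (cut1 y) L)))))"
proof -
  define S where "S = set L"
  have main: "segs n (S - T \<union> (\<Union>s\<in>T. set (cut1 y s))) \<in> uwebs n \<and> heq n (lw (segs n S)) (lw (segs n (S - T \<union> (\<Union>s\<in>T. set (cut1 y s)))))"
    if "finite T" "T \<subseteq> S" for T
    using that
  proof (induction T)
    case empty
    thus ?case using w by (simp add: S_def heq_refl lw_Sp)
  next
    case (insert s T)
    define S' where "S' = S - T \<union> (\<Union>s\<in>T. set (cut1 y s))"
    have IH: "segs n S' \<in> uwebs n" "heq n (lw (segs n S)) (lw (segs n S'))" using insert unfolding S'_def by blast+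
    have sS: "s \<in> S'" using insert unfolding S'_def by blast
    show ?case
    proof (cases "Im (fst s) < y \<and> y < Im (snd s) \<or> Im (snd s) < y \<and> y < Im (fst s)")
      case False
      hence "S - insert s T \<union> (\<Union>s\<in>insert s T. set (cut1 y s)) = S'"
        using insert unfolding S'_def by (auto simp: cut1_def)
      thus ?thesis using IH by simp
    next
      case True
      then obtain t p where tp: "0 < t" "t < 1" "p = fst s + of_real t * (snd s - fst s)" "Im p = y" "cut1 y s = [(fst s, p), (p, snd s)]"
        by (rule cut1_split)
      \<comment> \<open>Pieces produced by a cut end at height \<open>y\<close>, while
        \<open>s\<close> crosses this height; so \<open>s\<close> is not one of them and may be
        removed alone.\<close>
      have "s \<notin> set (cut1 y s')" if s': "s' \<in> T" for s'
      proof
        assume a: "s \<in> set (cut1 y s')"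
        show False
        proof (cases "Im (fst s') < y \<and> y < Im (snd s') \<or> Im (snd s') < y \<and> y < Im (fst s')")
          case True
          then obtain q where "Im q = y" "cut1 y s' = [(fst s', q), (q, snd s')]" by (rule cut1_split)
          thus False using a \<open>Im (fst s) < y \<and> y < Im (snd s) \<or> Im (snd s) < y \<and> y < Im (fst s)\<close> by auto
        next
          case False
          thus False using a s' insert(2) by (auto simp: cut1_def)
        qed
      qed
      hence "S' - {s} = S - insert s T \<union> (\<Union>s\<in>T. set (cut1 y s))" unfolding S'_def by blast
      hence "S - insert s T \<union> (\<Union>s\<in>insert s T. set (cut1 y s)) = S' - {(fst s, snd s)} \<union> {(fst s, p), (p, snd s)}"
        using tp(5) by auto
      thus ?thesis using split_seg[OF IH(1) _ tp(1-3)] sS heq_trans[OF IH(2)] by simp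
    qed
  qed
  have "S - S \<union> (\<Union>s\<in>S. set (cut1 y s)) = set (concat (map (cut1 y) L))" by (simp add: S_def)
  thus ?thesis using main[of S] by (simp add: S_def)
qed

fun cuts :: "real list \<Rightarrow> (complex \<times> complex) list \<Rightarrow> (complex \<times> complex) list" where
  "cuts [] L = L"
| "cuts (y # ys) L = cuts ys (concat (map (cut1 y) L))"

lemma heq_cuts:
  "segs n (set L) \<in> uwebs n \<Longrightarrow> segs n (set (cuts ys L)) \<in> uwebs n \<and> heq n (lw (segs n (set L))) (lw (segs n (set (cuts ys L))))"
proof (induction ys L rule: cuts.induct)
  case (2 y ys L)
  thus ?case using cut_height[OF 2(2), of y] heq_trans by auto
qed (simp add: heq_refl lw_Sp)

subsection \<open>Moving straight edges\<close>

lemma move_segs: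
  assumes h: "sqisot h" and w: "segs n (set L) \<in> uwebs n" and L: "list_all2 (affine_to h) L L'"
  shows "segs n (set L') \<in> uwebs n" "heq n (lw (segs n (set L))) (lw (segs n (set L')))"
proof -
  have "map (map_darc h \<circ> seg) L = map seg L'"
    using L by (induction rule: list_all2_induct) (simp_all add: map_darc_seg)
  hence "set (map (map_darc h \<circ> seg) L) = set (map seg L')" by simp
  hence "map_darc h ` seg ` set L = seg ` set L'" by (simp add: image_comp)
  hence "move_web h (segs n (set L)) = segs n (set L')" by (simp add: move_web_def segs_def map_overs_def)
  thus "segs n (set L') \<in> uwebs n" "heq n (lw (segs n (set L))) (lw (segs n (set L')))"
    using heq_move_web[OF h w] by simp_all
qed

text \<open>The condition \<open>strands\<close> for explicit matrices, in a form that
  simplification evaluates; row \<open>i\<close> lists the positions of strand \<open>i\<close> at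
  the levels \<open>0, ..., K\<close>.\<close>

definition strandsl :: "nat \<Rightarrow> nat \<Rightarrow> real list list \<Rightarrow> real list list \<Rightarrow> bool" where
  "strandsl r K a b \<longleftrightarrow> 0 < r \<and> 0 < K \<and>
     list_all (\<lambda>j. list_all (\<lambda>i. a ! i ! j \<le> a ! (i + 1) ! j \<and> b ! i ! j \<le> b ! (i + 1) ! j \<and> (a ! (i + 1) ! j = a ! i ! j \<longleftrightarrow> b ! (i + 1) ! j = b ! i ! j)) [0..<r] \<and>
       a ! 0 ! j = 0 \<and> b ! 0 ! j = 0 \<and> a ! r ! j = 1 \<and> b ! r ! j = 1) [0..<K + 1] \<and>
     list_all (\<lambda>i. a ! i ! 0 = b ! i ! 0 \<and> a ! i ! K = b ! i ! K) [0..<r + 1]"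

lemma strandsl:
  assumes "strandsl r K a b"
  shows "strands r K (\<lambda>i j. a ! i ! j) (\<lambda>i j. b ! i ! j)"
proof -
  note S = assms[unfolded strandsl_def list_all_iff]
  have 1: "list_all (\<lambda>i. a ! i ! j \<le> a ! (i + 1) ! j \<and> b ! i ! j \<le> b ! (i + 1) ! j \<and> (a ! (i + 1) ! j = a ! i ! j \<longleftrightarrow> b ! (i + 1) ! j = b ! i ! j)) [0..<r] \<and>
       a ! 0 ! j = 0 \<and> b ! 0 ! j = 0 \<and> a ! r ! j = 1 \<and> b ! r ! j = 1" if "j \<le> K" for j
    unfolding list_all_iff by (rule bspec[OF S[THEN conjunct2, THEN conjunct2, THEN conjunct1]]) (use that in auto)
  have 2: "a ! i ! j \<le> a ! Suc i ! j" "b ! i ! j \<le> b ! Suc i ! j" "a ! Suc i ! j = a ! i ! j \<longleftrightarrow> b ! Suc i ! j = b ! i ! j"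
    if "j \<le> K" "i < r" for i j
    using bspec[OF 1[OF that(1), THEN conjunct1, unfolded list_all_iff], of i] that(2) by simp_all
  have 3: "a ! i ! 0 = b ! i ! 0 \<and> a ! i ! K = b ! i ! K" if "i \<le> r" for i
    by (rule bspec[OF S[THEN conjunct2, THEN conjunct2, THEN conjunct2]]) (use that in auto)
  show ?thesis unfolding strands_def knots_def
    using S[THEN conjunct1] S[THEN conjunct2, THEN conjunct1] by (intro conjI allI impI) (simp_all add: 1 2 3)
qed

definition gpt :: "real list \<Rightarrow> real list list \<Rightarrow> nat \<Rightarrow> nat \<Rightarrow> complex" where "gpt y a i j = Complex (a ! i ! j) (y ! j)"
definition rpt :: "real list \<Rightarrow> real list list \<Rightarrow> nat \<Rightarrow> nat \<Rightarrow> complex" where "rpt x a i j = Complex (x ! j) (a ! i ! j)"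

text \<open>The pair \<open>(i, j)\<close> stands for the piece of strand \<open>i\<close> between
  the levels \<open>j\<close> and \<open>j + 1\<close>; it belongs to \<open>U\<close> or
  \<open>D\<close> according to its direction.\<close>

definition glist :: "real list \<Rightarrow> real list list \<Rightarrow> (nat \<times> nat) list \<Rightarrow> (nat \<times> nat) list \<Rightarrow> (complex \<times> complex) list" where
  "glist y a U D = map (\<lambda>(i, j). (gpt y a i j, gpt y a i (j + 1))) U @ map (\<lambda>(i, j). (gpt y a i (j + 1), gpt y a i j)) D"

definition rlist :: "real list \<Rightarrow> real list list \<Rightarrow> (nat \<times> nat) list \<Rightarrow> (nat \<times> nat) list \<Rightarrow> (complex \<times> complex) list" where
  "rlist x a R L = map (\<lambda>(i, j). (rpt x a i j, rpt x a i (j + 1))) R @ map (\<lambda>(i, j). (rpt x a i (j + 1), rpt x a i j)) L"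

definition klist :: "real list \<Rightarrow> real list list \<Rightarrow> (nat \<times> nat) list \<Rightarrow> (nat \<times> nat) list \<Rightarrow> (complex \<times> complex) list" where
  "klist x a U D = map (\<lambda>(i, j). (rpt x a i j, rpt x a (i + 1) j)) U @ map (\<lambda>(i, j). (rpt x a (i + 1) j, rpt x a i j)) D"

definition incr :: "real list \<Rightarrow> nat \<Rightarrow> bool" where
  "incr y K \<longleftrightarrow> list_all (\<lambda>j. y ! j < y ! (j + 1)) [0..<K] \<and> 0 \<le> y ! 0 \<and> y ! K \<le> 1"

lemma incrD: "incr y K \<Longrightarrow> \<forall>j<K. y ! j < y ! Suc j" "incr y K \<Longrightarrow> 0 \<le> y ! 0" "incr y K \<Longrightarrow> y ! K \<le> 1"
  by (simp_all add: incr_def list_all_iff)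

lemma rows_segs:
  assumes w: "segs n (set (F @ rlist x a R L @ klist x a U D)) \<in> uwebs n"
    and s: "strandsl r K a b" and x: "incr x K"
    and F: "list_all (\<lambda>(p, q). Re p \<le> x ! 0 \<and> Re q \<le> x ! 0 \<or> x ! K \<le> Re p \<and> x ! K \<le> Re q) F"
    and RL: "list_all (\<lambda>(i, j). i \<le> r \<and> j < K) (R @ L)" and UD: "list_all (\<lambda>(i, j). i < r \<and> j \<le> K) (U @ D)"
  shows "segs n (set (F @ rlist x b R L @ klist x b U D)) \<in> uwebs n"
    "heq n (lw (segs n (set (F @ rlist x a R L @ klist x a U D)))) (lw (segs n (set (F @ rlist x b R L @ klist x b U D))))"
proof -
  from rows_move[OF strandsl[OF s] incrD[OF x], folded rpt_def] obtain h where h1: "sqisot h" and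
    h2: "\<forall>i\<le>r. \<forall>j<K. affine_to h (rpt x a i j, rpt x a i (Suc j)) (rpt x b i j, rpt x b i (Suc j))" and
    h3: "\<forall>i<r. \<forall>j\<le>K. affine_to h (rpt x a i j, rpt x a (Suc i) j) (rpt x b i j, rpt x b (Suc i) j)" and
    h4: "\<forall>z. Re z \<le> x ! 0 \<or> x ! K \<le> Re z \<longrightarrow> h z = z"
    by (elim exE conjE) (rule that; assumption)
  note h = h1 h2[rule_format] h3[rule_format] h4[rule_format]
  have FF: "affine_to h (p, q) (p, q)" if "(p, q) \<in> set F" for p q
  proof (rule affine_toI)
    fix t :: real assume t: "0 \<le> t" "t \<le> 1"
    define z where "z = p + of_real t * (q - p)"
    have z: "z \<in> closed_segment p q" unfolding seg_image z_def using t by auto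
    have "Re z \<le> x ! 0 \<or> x ! K \<le> Re z" using F that seg_convex(7,8)[OF z] unfolding list_all_iff by fastforce
    thus "h (p + of_real t * (q - p)) = p + of_real t * (q - p)"
      using h(4)[of z] unfolding z_def by simp
  qed
  have rl: "(i, j) \<in> set R \<Longrightarrow> i \<le> r \<and> j < K" "(i, j) \<in> set L \<Longrightarrow> i \<le> r \<and> j < K" for i j using RL unfolding list_all_iff by auto
  have ud: "(i, j) \<in> set U \<Longrightarrow> i < r \<and> j \<le> K" "(i, j) \<in> set D \<Longrightarrow> i < r \<and> j \<le> K" for i j using UD unfolding list_all_iff by auto
  have "list_all2 (affine_to h) (F @ rlist x a R L @ klist x a U D) (F @ rlist x b R L @ klist x b U D)"
    unfolding rlist_def klist_def
    by (intro list_all2_appendI)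
       (auto simp: list_all2_map1 list_all2_map2 intro!: list.rel_refl_strong FF h(2,3) affine_to_flip[OF h(2)] affine_to_flip[OF h(3)] dest: rl ud)
  from move_segs[OF h(1) w this]
  show "segs n (set (F @ rlist x b R L @ klist x b U D)) \<in> uwebs n"
    "heq n (lw (segs n (set (F @ rlist x a R L @ klist x a U D)))) (lw (segs n (set (F @ rlist x b R L @ klist x b U D))))"
    by simp_all
qed

text \<open>Two moves: horizontally from \<open>a\<close> to \<open>b\<close> at fixed levels, then
  a reparametrisation of the heights from \<open>y\<close> to \<open>y'\<close>.\<close>

lemma grid_segs:
  assumes w: "segs n (set (glist y a U D)) \<in> uwebs n"
    and s: "strandsl r K a b" and y: "incr y K" "y ! 0 = 0" "y ! K = 1" and y': "incr y' K" "y' ! 0 = 0" "y' ! K = 1"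
    and UD: "list_all (\<lambda>(i, j). i \<le> r \<and> j < K) (U @ D)"
  shows "segs n (set (glist y' b U D)) \<in> uwebs n" "heq n (lw (segs n (set (glist y a U D)))) (lw (segs n (set (glist y' b U D))))"
proof -
  from strands_move[OF strandsl[OF s] incrD[OF y(1)], folded gpt_def] obtain h where h1: "sqisot h" and
    h2: "\<forall>i\<le>r. \<forall>j<K. affine_to h (gpt y a i j, gpt y a i (Suc j)) (gpt y b i j, gpt y b i (Suc j))"
    by (elim exE conjE) (rule that; assumption)
  note h = h1 h2[rule_format]
  have ud: "(i, j) \<in> set U \<Longrightarrow> i \<le> r \<and> j < K" "(i, j) \<in> set D \<Longrightarrow> i \<le> r \<and> j < K" for i j using UD unfolding list_all_iff by auto
  have "list_all2 (affine_to h) (glist y a U D) (glist y b U D)"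
    unfolding glist_def
    by (intro list_all2_appendI)
       (auto simp: list_all2_map1 list_all2_map2 intro!: list.rel_refl_strong h(2) affine_to_flip[OF h(2)] dest: ud)
  note 1 = move_segs[OF h(1) w this]
  obtain \<epsilon> where \<epsilon>: "\<epsilon> > 0" "\<forall>e\<in>edges (segs n (set (glist y b U D))). \<forall>z\<in>carrier_of e. \<epsilon> \<le> Re z \<and> \<epsilon> \<le> 1 - Re z"
    using web_margin[OF 1(1)] by blast
  define Y where "Y j = y ! j" for j
  define Y' where "Y' j = y' ! j" for j
  have Yi: "\<forall>j<K. Y j < Y (Suc j)" "\<forall>j<K. Y' j < Y' (Suc j)" using incrD(1)[OF y(1)] incrD(1)[OF y'(1)] by (simp_all add: Y_def Y'_def)
  have k: "knots K Y Y'" "knots K Y' Y" "knots K Y Y" unfolding knots_def using Yi by force+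
  have e: "Y 0 = 0" "Y K = 1" "Y' 0 = 0" "Y' K = 1" using y y' by (simp_all add: Y_def Y'_def)
  define g where "g x = pl K Y Y' x - clamp01 x" for x
  have "\<exists>h. sqisot h \<and> (\<forall>z. \<epsilon> \<le> Re z \<longrightarrow> \<epsilon> \<le> 1 - Re z \<longrightarrow> h z = Complex (Re z) (Im z + g (Im z)))"
  proof (rule sqisot_heights[OF _ _ _ \<epsilon>(1)])
    show "continuous_on UNIV g" unfolding g_def by (intro continuous_on_diff pl_cont) (auto simp: clamp01_def intro!: continuous_intros)
    show "x + g x < x' + g x'" if "x < x'" for x x' using pl_strict[OF k(1,2) e(1,2) that] by (simp add: g_def)
    show "g x = 0" if "x \<le> 0 \<or> 1 \<le> x" for x
      using that pl_low[OF k(1), of x] pl_high[OF k(1), of x] clamp01_low[of x] clamp01_high[of x] unfolding g_def e by auto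
  qed
  then obtain h' where h': "sqisot h'" "\<And>z. \<epsilon> \<le> Re z \<Longrightarrow> \<epsilon> \<le> 1 - Re z \<Longrightarrow> h' z = Complex (Re z) (Im z + g (Im z))" by blast
  have aff: "affine_to h' (gpt y b i j, gpt y b i (Suc j)) (gpt y' b i j, gpt y' b i (Suc j))"
    if j: "j < K" and ed: "(gpt y b i j, gpt y b i (Suc j)) \<in> set (glist y b U D) \<or> (gpt y b i (Suc j), gpt y b i j) \<in> set (glist y b U D)" for i j
  proof (rule affine_toI)
    fix t :: real assume t: "0 \<le> t" "t \<le> 1"
    define z where "z = gpt y b i j + of_real t * (gpt y b i (Suc j) - gpt y b i j)"
    have z: "z \<in> closed_segment (gpt y b i j) (gpt y b i (Suc j))" unfolding seg_image z_def using t by auto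
    have mz: "\<epsilon> \<le> Re z" "\<epsilon> \<le> 1 - Re z"
      using ed
    proof -
      have "\<exists>e\<in>edges (segs n (set (glist y b U D))). z \<in> carrier_of e"
        using ed
      proof
        assume "(gpt y b i j, gpt y b i (Suc j)) \<in> set (glist y b U D)"
        thus ?thesis using z by (intro bexI[of _ "seg (gpt y b i j, gpt y b i (Suc j))"]) (simp_all add: segs_def)
      next
        assume "(gpt y b i (Suc j), gpt y b i j) \<in> set (glist y b U D)"
        thus ?thesis using z unfolding closed_segment_commute[of "gpt y b i j"]
          by (intro bexI[of _ "seg (gpt y b i (Suc j), gpt y b i j)"]) (simp_all add: segs_def)
      qed
      thus "\<epsilon> \<le> Re z" "\<epsilon> \<le> 1 - Re z" using \<epsilon>(2) by blast+
    qed
    have Imz: "Im z = Y j + t * (Y (Suc j) - Y j)" by (simp add: z_def gpt_def Y_def)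
    have 0: "0 \<le> Im z" "Im z \<le> 1"
    proof -
      have "Y 0 \<le> Y j" "Y (Suc j) \<le> Y K" "Y j \<le> Y (Suc j)"
        using knots_mono[OF k(1), of 0 j] knots_mono[OF k(1), of "Suc j" K] knots_mono[OF k(1), of j "Suc j"] j by auto
      moreover have "t * (Y (Suc j) - Y j) \<le> Y (Suc j) - Y j" by (rule mult_left_le_one_le) (use calculation t in auto)
      moreover have "0 \<le> t * (Y (Suc j) - Y j)" using calculation t by auto
      ultimately show "0 \<le> Im z" "Im z \<le> 1" unfolding Imz e by linarith+
    qed
    have "pl K Y Y' (Im z) = Y' j + t * (Y' (Suc j) - Y' j)" unfolding Imz using pl_at[OF k(1) j] t by simp
    hence "h' z = Complex (Re z) (Y' j + t * (Y' (Suc j) - Y' j))" using h'(2)[OF mz] clamp01_id[OF 0] by (simp add: g_def)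
    also have "\<dots> = gpt y' b i j + of_real t * (gpt y' b i (Suc j) - gpt y' b i j)"
      by (simp add: complex_eq_iff z_def gpt_def Y'_def)
    finally show "h' (gpt y b i j + of_real t * (gpt y b i (Suc j) - gpt y b i j)) = gpt y' b i j + of_real t * (gpt y' b i (Suc j) - gpt y' b i j)"
      unfolding z_def by simp
  qed
  have mem: "(i, j) \<in> set U \<Longrightarrow> (gpt y b i j, gpt y b i (Suc j)) \<in> set (glist y b U D)"
    "(i, j) \<in> set D \<Longrightarrow> (gpt y b i (Suc j), gpt y b i j) \<in> set (glist y b U D)" for i j
    unfolding glist_def by (auto intro!: image_eqI[of _ _ "(i, j)"])
  have "list_all2 (affine_to h') (glist y b U D) (glist y' b U D)"
    unfolding glist_def[of y b] glist_def[of y' b]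
    by (intro list_all2_appendI)
       (auto simp: list_all2_map1 list_all2_map2 intro!: list.rel_refl_strong aff affine_to_flip[OF aff] dest: mem ud)
  note 2 = move_segs[OF h'(1) 1(1) this]
  show "segs n (set (glist y' b U D)) \<in> uwebs n" by (rule 2)
  show "heq n (lw (segs n (set (glist y a U D)))) (lw (segs n (set (glist y' b U D))))" by (rule heq_trans[OF 1(2) 2(2)])
qed

text \<open>Edge lists are compared as sets, since cutting and stacking list the edges in different
  orders.\<close>

definition same_set :: "'a list \<Rightarrow> 'a list \<Rightarrow> bool" where
  "same_set L M \<longleftrightarrow> list_all (\<lambda>x. list_ex (\<lambda>y. x = y) M) L \<and> list_all (\<lambda>x. list_ex (\<lambda>y. x = y) L) M"

lemma same_set: "same_set L M \<Longrightarrow> set L = set M"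
  by (auto simp: same_set_def list_all_iff list_ex_iff)

definition gridlike :: "nat \<Rightarrow> nat \<Rightarrow> real list \<Rightarrow> real list list \<Rightarrow> real list \<Rightarrow> real list list \<Rightarrow> (nat \<times> nat) list \<Rightarrow> (nat \<times> nat) list \<Rightarrow> bool" where
  "gridlike r K y a y' b U D \<longleftrightarrow> strandsl r K a b \<and> incr y K \<and> y ! 0 = 0 \<and> y ! K = 1 \<and> incr y' K \<and> y' ! 0 = 0 \<and> y' ! K = 1 \<and>
     list_all (\<lambda>(i, j). i \<le> r \<and> j < K) (U @ D)"

lemmas seg_check_simps = seg_check_def indeg_def outdeg_def bpt_def tpt_def fork_def cross_def dot_def upt_rec
lemmas grid_simps = gridlike_def strandsl_def incr_def same_set_def glist_def gpt_def cut1_def Let_def upt_rec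
lemmas row_simps = strandsl_def incr_def same_set_def rlist_def klist_def rpt_def upt_rec

abbreviation edge :: "real \<Rightarrow> real \<Rightarrow> real \<Rightarrow> real \<Rightarrow> complex \<times> complex" where
  "edge a b c d \<equiv> (Complex a b, Complex c d)"

text \<open>Both webs are cut until they have the same combinatorial pieces \<open>U\<close> and
  \<open>D\<close> and differ only in positions and levels.\<close>

lemma grid_isotopic:
  assumes w: "segs n (set L) \<in> uwebs n" "segs n (set L') \<in> uwebs n" and g: "gridlike r K y a y' b U D"
    and c: "same_set (cuts c L) (glist y a U D)" "same_set (cuts c' L') (glist y' b U D)"
  shows "heq n (lw (segs n (set L))) (lw (segs n (set L')))"
proof -
  note 1 = heq_cuts[OF w(1), of c, unfolded same_set[OF c(1)]] and 2 = heq_cuts[OF w(2), of c', unfolded same_set[OF c(2)]]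
  have "heq n (lw (segs n (set (glist y a U D)))) (lw (segs n (set (glist y' b U D))))"
    using grid_segs(2)[OF 1[THEN conjunct1]] g unfolding gridlike_def by blast
  from heq_trans[OF heq_trans[OF 1[THEN conjunct2] this] heq_sym[OF 2[THEN conjunct2]]] show ?thesis .
qed

subsection \<open>Stacking and plugging webs with straight edges\<close>

definition h2 :: "(complex \<Rightarrow> complex) \<Rightarrow> complex \<times> complex \<Rightarrow> complex \<times> complex" where "h2 h s = (h (fst s), h (snd s))"

lemma h2_simp [simp]: "h2 h (a, b) = (h a, h b)" by (simp add: h2_def)

definition aff :: "(complex \<Rightarrow> complex) \<Rightarrow> bool" where
  "aff h \<longleftrightarrow> (\<forall>p q t. h (p + of_real t * (q - p)) = h p + of_real t * (h q - h p))"

lemma aff_seg: "aff h \<Longrightarrow> map_darc h (seg s) = seg (h2 h s)"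
  by (rule map_darc_seg) (simp add: affine_to_def aff_def h2_def)

lemma aff_segs: "aff h \<Longrightarrow> map_darc h ` seg ` S = seg ` h2 h ` S"
  unfolding image_image by (rule image_cong[OF refl], rule aff_seg)

lemma aff_lo: "aff lo" and aff_hi: "aff hi"
  by (simp_all add: aff_def complex_eq_iff field_simps)

lemma stack_segs: "stack_web (segs n A) (segs n B) = segs n (h2 lo ` B \<union> h2 hi ` A)"
  by (simp add: stack_web_eq segs_def aff_segs aff_lo aff_hi map_overs_def image_Un)

definition stackl :: "(complex \<times> complex) list \<Rightarrow> (complex \<times> complex) list \<Rightarrow> (complex \<times> complex) list" where
  "stackl A B = map (h2 lo) B @ map (h2 hi) A"

lemma wcomp_segs: "lw (segs n (set A)) \<odot> lw (segs n (set B)) = lw (segs n (set (stackl A B)))"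
  by (simp add: stack_segs stackl_def)

lemma plug_segs: "aff h \<Longrightarrow> plug (ups n) (ups n) (seg ` set E) {} h (Web \<alpha> \<beta> (seg ` set W) {}) = segs n (set (E @ map (h2 h) W))"
  by (simp add: plug_eq segs_def aff_segs map_overs_def image_Un)

lemma plug_skein:
  assumes "r \<in> local_relations" "disc_embedding h" "\<forall>e\<in>E. carrier_of e \<inter> h ` square \<subseteq> h ` frontier square"
    "r \<in> lin.span (lw ` A)" "\<And>w. w \<in> A \<Longrightarrow> plug (ups n) (ups n) E {} h w \<in> uwebs n"
  shows "lin_ext (plug (ups n) (ups n) E {} h) r \<in> sk n"
  unfolding lin_ext_def using keys_span[OF assms(4)]
  by (intro lin.span_base skein_generators_plugI assms(1-3)) (use assms(5) in blast)+

text \<open>The outside of a disc that is bounded by two parallel lines \<open>\<phi> = c\<close> and \<open>\<phi> = d\<close> and whose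
  other sides do not matter.\<close>

lemma avoid_disc:
  assumes phi: "\<phi> = Re \<or> \<phi> = Im"
    and E: "list_all (\<lambda>(p, q). \<phi> p \<le> c \<and> \<phi> q \<le> c \<or> d \<le> \<phi> p \<and> d \<le> \<phi> q) E"
    and h: "\<And>w. w \<in> square \<Longrightarrow> c \<le> \<phi> (h w) \<and> \<phi> (h w) \<le> d"
      "\<And>w. w \<in> square \<Longrightarrow> \<phi> (h w) = c \<or> \<phi> (h w) = d \<Longrightarrow> w \<in> frontier square"
  shows "\<forall>e\<in>seg ` set E. carrier_of e \<inter> h ` square \<subseteq> h ` frontier square"
proof (intro ballI subsetI)
  fix e z assume "e \<in> seg ` set E" and z: "z \<in> carrier_of e \<inter> h ` square"
  then obtain p q where e: "(p, q) \<in> set E" "e = seg (p, q)" by auto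
  have zs: "z \<in> closed_segment p q" using z e by simp
  obtain w where w: "w \<in> square" "z = h w" using z by blast
  have "\<phi> z \<le> c \<or> d \<le> \<phi> z"
    using phi E e(1) seg_convex(5-8)[OF zs] unfolding list_all_iff by fastforce
  hence "\<phi> (h w) = c \<or> \<phi> (h w) = d" using h(1)[OF w(1)] w(2) by auto
  thus "z \<in> h ` frontier square" using h(2)[OF w(1)] w(2) by blast
qed

definition SL :: "(complex \<times> complex) list" where
  "SL = [edge (1/3) 0 (1/3) (1/3), edge (2/3) (1/3) (2/3) 0,
         edge (2/3) 1 (2/3) (2/3), edge (1/3) (2/3) (1/3) 1,
         edge (2/3) (1/3) (1/3) (1/3), edge (2/3) (1/3) (2/3) (2/3),
         edge (1/3) (2/3) (1/3) (1/3), edge (1/3) (2/3) (2/3) (2/3)]"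

definition IL :: "(complex \<times> complex) list" where
  "IL = [edge (1/3) 0 (1/3) 1, edge (2/3) 1 (2/3) 0]"

definition TL :: "(complex \<times> complex) list" where
  "TL = [edge (1/3) 0 (1/2) (1/3), edge (1/2) (1/3) (2/3) 0,
         edge (2/3) 1 (1/2) (2/3), edge (1/2) (2/3) (1/3) 1]"

definition BL :: "(complex \<times> complex) list" where
  "BL = [edge (1/2) 0 (1/2) (1/4), edge (1/2) (3/4) (1/2) 1,
         edge (1/2) (3/4) (1/4) (1/2), edge (1/4) (1/2) (1/2) (1/4),
         edge (1/2) (3/4) (3/4) (1/2), edge (3/4) (1/2) (1/2) (1/4)]"

lemma ups_simps: "ups 1 = [Up]" "ups (Suc 0) = [Up]" "ups 2 = [Up, Up]" "ups 3 = [Up, Up, Up]"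
  by (simp_all add: numeral_2_eq_2 numeral_3_eq_3)

lemma id_web_2: "id_web [x, y] = Web [x, y] [x, y]
    (seg ` {case x of Up \<Rightarrow> (Complex (1/3) 0, Complex (1/3) 1) | Down \<Rightarrow> edge (1/3) 1 (1/3) 0,
            case y of Up \<Rightarrow> (Complex (2/3) 0, Complex (2/3) 1) | Down \<Rightarrow> (Complex (2/3) 1, Complex (2/3) 0)}) {}"
proof -
  have "{..<length [x, y]} = {0, 1}" by auto
  thus ?thesis by (cases x; cases y) (simp_all add: id_web_def Let_def bpt_def tpt_def)
qed

lemma id_web_1: "id_web [Up] = Web [Up] [Up] (seg ` set [edge (1/2) 0 (1/2) 1]) {}"
  by (simp add: id_web_def Let_def bpt_def tpt_def lessThan_Suc)

lemma local_webs: "square_web = Web [Up, Down] [Up, Down] (seg ` set SL) {}"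
  "turnback_web = Web [Up, Down] [Up, Down] (seg ` set TL) {}"
  "id_web [Up, Down] = Web [Up, Down] [Up, Down] (seg ` set IL) {}"
  "bigon_web = Web [Up] [Up] (seg ` set BL) {}"
  by (simp_all add: square_web_def turnback_web_def bigon_web_def id_web_2 SL_def TL_def IL_def BL_def pt_def)

lemma square_relation:
  assumes h: "disc_embedding h" "aff h" and E: "\<forall>e\<in>seg ` set E. carrier_of e \<inter> h ` square \<subseteq> h ` frontier square"
    and w: "segs n (set (E @ map (h2 h) SL)) \<in> uwebs n" "segs n (set (E @ map (h2 h) IL)) \<in> uwebs n" "segs n (set (E @ map (h2 h) TL)) \<in> uwebs n"
  shows "heq n (lw (segs n (set (E @ map (h2 h) SL)))) (lw (segs n (set (E @ map (h2 h) IL))) + lw (segs n (set (E @ map (h2 h) TL))))"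
proof -
  define r where "r = lw square_web - (lw (id_web [Up, Down]) + lw turnback_web)"
  have r: "r \<in> local_relations" unfolding r_def local_relations_def by blast
  have sp: "r \<in> lin.span (lw ` {square_web, id_web [Up, Down], turnback_web})"
    unfolding r_def by (intro lin.span_diff lin.span_add lin.span_base) blast+
  have "lin_ext (plug (ups n) (ups n) (seg ` set E) {} h) r \<in> sk n"
  proof (rule plug_skein[OF r h(1) E sp])
    fix v assume v: "v \<in> {square_web, id_web [Up, Down], turnback_web}"
    from v show "plug (ups n) (ups n) (seg ` set E) {} h v \<in> uwebs n"
      by (elim insertE emptyE) (simp_all only: local_webs plug_segs[OF h(2)] w)
  qed
  hence "lw (segs n (set (E @ map (h2 h) SL))) - (lw (segs n (set (E @ map (h2 h) IL))) + lw (segs n (set (E @ map (h2 h) TL)))) \<in> sk n"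
    unfolding r_def by (simp only: lin_ext_minus lin_ext_add lin_ext_lw local_webs plug_segs[OF h(2)])
  thus ?thesis unfolding eq_in_Hom_def using w by (intro conjI lin.span_add lw_Sp)
qed

lemma bigon_relation:
  assumes h: "disc_embedding h" "aff h" and E: "\<forall>e\<in>seg ` set E. carrier_of e \<inter> h ` square \<subseteq> h ` frontier square"
    and w: "segs n (set (E @ map (h2 h) BL)) \<in> uwebs n" "segs n (set (E @ map (h2 h) [edge (1/2) 0 (1/2) 1])) \<in> uwebs n"
  shows "heq n (lw (segs n (set (E @ map (h2 h) BL)))) (smul (qint 2) (lw (segs n (set (E @ map (h2 h) [edge (1/2) 0 (1/2) 1])))))"
proof -
  define r where "r = lw bigon_web - smul (qint 2) (lw (id_web [Up]))"
  have r: "r \<in> local_relations" unfolding r_def local_relations_def by blast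
  have sp: "r \<in> lin.span (lw ` {bigon_web, id_web [Up]})"
    unfolding r_def by (intro lin.span_diff lin.span_scale lin.span_base) blast+
  have "lin_ext (plug (ups n) (ups n) (seg ` set E) {} h) r \<in> sk n"
  proof (rule plug_skein[OF r h(1) E sp])
    fix v assume v: "v \<in> {bigon_web, id_web [Up]}"
    from v show "plug (ups n) (ups n) (seg ` set E) {} h v \<in> uwebs n"
      by (elim insertE emptyE) (simp_all only: local_webs id_web_1 plug_segs[OF h(2)] w)
  qed
  hence "lw (segs n (set (E @ map (h2 h) BL))) - smul (qint 2) (lw (segs n (set (E @ map (h2 h) [edge (1/2) 0 (1/2) 1])))) \<in> sk n"
    unfolding r_def by (simp only: lin_ext_minus lin_ext_smul lin_ext_lw local_webs id_web_1 plug_segs[OF h(2)])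
  thus ?thesis unfolding eq_in_Hom_def using w by (intro conjI lin.span_scale lw_Sp)
qed

lemma rows_isotopic:
  assumes w: "segs n (set L) \<in> uwebs n"
    and L: "same_set L (F @ rlist x a R R' @ klist x a U D)" and L': "same_set L' (F @ rlist x b R R' @ klist x b U D)"
    and c: "strandsl r K a b \<and> incr x K \<and> list_all (\<lambda>(p, q). Re p \<le> x ! 0 \<and> Re q \<le> x ! 0 \<or> x ! K \<le> Re p \<and> x ! K \<le> Re q) F \<and>
      list_all (\<lambda>(i, j). i \<le> r \<and> j < K) (R @ R') \<and> list_all (\<lambda>(i, j). i < r \<and> j \<le> K) (U @ D)"
  shows "segs n (set L') \<in> uwebs n \<and> heq n (lw (segs n (set L))) (lw (segs n (set L')))"
  unfolding same_set[OF L] same_set[OF L']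
proof -
  note * = rows_segs[OF w[unfolded same_set[OF L]] c[THEN conjunct1] c[THEN conjunct2, THEN conjunct1] c[THEN conjunct2, THEN conjunct2, THEN conjunct1]
      c[THEN conjunct2, THEN conjunct2, THEN conjunct2, THEN conjunct1] c[THEN conjunct2, THEN conjunct2, THEN conjunct2, THEN conjunct2]]
  show "segs n (set (F @ rlist x b R R' @ klist x b U D)) \<in> uwebs n \<and> heq n (lw (segs n (set (F @ rlist x a R R' @ klist x a U D)))) (lw (segs n (set (F @ rlist x b R R' @ klist x b U D))))"
    by (rule conjI[OF *])
qed

text \<open>Rotations are end points of isotopies of the plane, so rotated positions of a relation
  are available.\<close>

lemma pisot_quarter_turn: "a > 0 \<Longrightarrow> c > 0 \<Longrightarrow> pisot (\<lambda>z. Complex (b - a * Im z) (c * Re z + d))"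
proof -
  assume a: "a > 0" "c > 0"
  have "pisot ((\<lambda>z. Complex (a * Re z + b) (c * Im z + d)) \<circ> (\<lambda>z. cis (pi / 2) * z))"
    by (rule pisot_comp[OF pisot_linear[OF a] pisot_cis])
  moreover have "(\<lambda>z. Complex (a * Re z + b) (c * Im z + d)) \<circ> (\<lambda>z. cis (pi / 2) * z) = (\<lambda>z. Complex (b - a * Im z) (c * Re z + d))"
    by (simp add: fun_eq_iff)
  ultimately show ?thesis by simp
qed

lemma pisot_half_turn: "a > 0 \<Longrightarrow> c > 0 \<Longrightarrow> pisot (\<lambda>z. Complex (b - a * Re z) (d - c * Im z))"
proof -
  assume a: "a > 0" "c > 0"
  have "pisot ((\<lambda>z. Complex (a * Re z + b) (c * Im z + d)) \<circ> (\<lambda>z. cis pi * z))"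
    by (rule pisot_comp[OF pisot_linear[OF a] pisot_cis])
  moreover have "(\<lambda>z. Complex (a * Re z + b) (c * Im z + d)) \<circ> (\<lambda>z. cis pi * z) = (\<lambda>z. Complex (b - a * Re z) (d - c * Im z))"
    by (simp add: fun_eq_iff)
  ultimately show ?thesis by simp
qed

subsection \<open>Two strands\<close>

definition HL :: "(complex \<times> complex) list" where
  "HL = [edge (1/3) 0 (1/2) (1/3), edge (2/3) 0 (1/2) (1/3), edge (1/2) (2/3) (1/2) (1/3),
   edge (1/2) (2/3) (1/3) 1, edge (1/2) (2/3) (2/3) 1]"

lemma HL_webs: "segs 2 (set HL) \<in> uwebs 2"
  by (rule seg_check_webs) (simp add: seg_check_simps HL_def)

definition IL2 :: "(complex \<times> complex) list" where
  "IL2 = [edge (1/3) 0 (1/3) 1, edge (2/3) 0 (2/3) 1]"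

lemma IL2_webs: "segs 2 (set IL2) \<in> uwebs 2"
  by (rule seg_check_webs) (simp add: seg_check_simps IL2_def)

definition HIL :: "(complex \<times> complex) list" where "HIL = stackl HL IL2"

lemma HIL_webs: "segs 2 (set HIL) \<in> uwebs 2"
  by (rule seg_check_webs) (simp add: seg_check_simps HIL_def stackl_def HL_def IL2_def lo_def hi_def)

definition IHL :: "(complex \<times> complex) list" where "IHL = stackl IL2 HL"

lemma IHL_webs: "segs 2 (set IHL) \<in> uwebs 2"
  by (rule seg_check_webs) (simp add: seg_check_simps IHL_def stackl_def HL_def IL2_def lo_def hi_def)

definition HHL :: "(complex \<times> complex) list" where "HHL = stackl HL HL"

lemma HHL_webs: "segs 2 (set HHL) \<in> uwebs 2"
  by (rule seg_check_webs) (simp add: seg_check_simps HHL_def stackl_def HL_def IL2_def lo_def hi_def)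

text \<open>In this and the later grids the first and last rows of \<open>a\<close> and
  \<open>b\<close> are the sides of the square. Extra cuts give both webs the same number of levels,
  and the positions there are read off the straight edges: the leg from \<open>(1/3, 0)\<close> to
  \<open>(1/2, 1/3)\<close> passes 23/60 at height 1/10.\<close>

lemma HI_H:
  assumes "segs 2 (set HIL) \<in> uwebs 2" "segs 2 (set HL) \<in> uwebs 2"
  shows "heq 2 (lw (segs 2 (set HIL))) (lw (segs 2 (set HL)))"
  by (rule grid_isotopic[OF assms, where r = 3 and K = 5 and c = "[1/4]" and c' = "[1/10, 1/5]"
    and y = "[0, 1/4, 1/2, 2/3, 5/6, 1]" and y' = "[0, 1/10, 1/5, 1/3, 2/3, 1]"
    and a = "[[0, 0, 0, 0, 0, 0], [1/3, 1/3, 1/3, 1/2, 1/2, 1/3], [2/3, 2/3, 2/3, 1/2, 1/2, 2/3], [1, 1, 1, 1, 1, 1]]"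
    and b = "[[0, 0, 0, 0, 0, 0], [1/3, 23/60, 13/30, 1/2, 1/2, 1/3], [2/3, 37/60, 17/30, 1/2, 1/2, 2/3], [1, 1, 1, 1, 1, 1]]"
    and U = "[(1, 0), (1, 1), (1, 2), (1, 4), (2, 0), (2, 1), (2, 2), (2, 4)]" and D = "[(1, 3)]"])
    (simp_all add: grid_simps HIL_def stackl_def HL_def IL2_def lo_def hi_def HL_def)

lemma IH_H:
  assumes "segs 2 (set IHL) \<in> uwebs 2" "segs 2 (set HL) \<in> uwebs 2"
  shows "heq 2 (lw (segs 2 (set IHL))) (lw (segs 2 (set HL)))"
  by (rule grid_isotopic[OF assms, where r = 3 and K = 5 and c = "[3/4]" and c' = "[4/5, 9/10]"
    and y = "[0, 1/6, 1/3, 1/2, 3/4, 1]" and y' = "[0, 1/3, 2/3, 4/5, 9/10, 1]"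
    and a = "[[0, 0, 0, 0, 0, 0], [1/3, 1/2, 1/2, 1/3, 1/3, 1/3], [2/3, 1/2, 1/2, 2/3, 2/3, 2/3], [1, 1, 1, 1, 1, 1]]"
    and b = "[[0, 0, 0, 0, 0, 0], [1/3, 1/2, 1/2, 13/30, 23/60, 1/3], [2/3, 1/2, 1/2, 17/30, 37/60, 2/3], [1, 1, 1, 1, 1, 1]]"
    and U = "[(1, 0), (1, 2), (1, 3), (1, 4), (2, 0), (2, 2), (2, 3), (2, 4)]" and D = "[(1, 1)]"])
    (simp_all add: grid_simps IHL_def stackl_def HL_def IL2_def lo_def hi_def HL_def)

definition EB :: "(complex \<times> complex) list" where
  "EB = [edge (1/3) 0 (1/2) (1/6), edge (2/3) 0 (1/2) (1/6), edge (1/2) (5/6) (1/3) 1, edge (1/2) (5/6) (2/3) 1]"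

definition HBL :: "(complex \<times> complex) list" where
  "HBL = [edge (1/3) 0 (1/2) (1/6), edge (2/3) 0 (1/2) (1/6), edge (1/2) (5/6) (1/3) 1, edge (1/2) (5/6) (2/3) 1,
   edge (1/2) (5/6) (1/2) (1/6)]"

lemma HBL_webs: "segs 2 (set HBL) \<in> uwebs 2"
  by (rule seg_check_webs) (simp add: seg_check_simps HBL_def)

lemma HB_H:
  assumes "segs 2 (set HBL) \<in> uwebs 2" "segs 2 (set HL) \<in> uwebs 2"
  shows "heq 2 (lw (segs 2 (set HBL))) (lw (segs 2 (set HL)))"
  by (rule grid_isotopic[OF assms, where r = 3 and K = 3 and c = "[]" and c' = "[]"
    and y = "[0, 1/6, 5/6, 1]" and y' = "[0, 1/3, 2/3, 1]"
    and a = "[[0, 0, 0, 0], [1/3, 1/2, 1/2, 1/3], [2/3, 1/2, 1/2, 2/3], [1, 1, 1, 1]]"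
    and b = "[[0, 0, 0, 0], [1/3, 1/2, 1/2, 1/3], [2/3, 1/2, 1/2, 2/3], [1, 1, 1, 1]]"
    and U = "[(1, 0), (1, 2), (2, 0), (2, 2)]" and D = "[(1, 1)]"])
    (simp_all add: grid_simps HBL_def HL_def)


text \<open>A half turn, because the middle edge of \<open>H_web\<close> points down while the bigon
  of the relation sits in an upward edge. The heights 1/6 and 5/6 are those of the outer vertices of
  the stacked web.\<close>

definition hB :: "complex \<Rightarrow> complex" where "hB z = Complex (5/6 - 2/3 * Re z) (5/6 - 2/3 * Im z)"

lemma hB: "disc_embedding hB" "aff hB"
proof -
  have "pisot hB" unfolding hB_def[abs_def] by (rule pisot_half_turn) simp_all
  thus "disc_embedding hB" unfolding disc_embedding_iff by (auto simp: hB_def square_def)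
  show "aff hB" by (simp add: aff_def hB_def complex_eq_iff algebra_simps)
qed

lemma bigon_H: "same_set (EB @ map (h2 hB) BL) HHL" "EB @ map (h2 hB) [edge (1/2) 0 (1/2) 1] = HBL"
  by (simp_all add: same_set_def EB_def BL_def HHL_def stackl_def HL_def lo_def hi_def HBL_def hB_def)

lemma H_H: "heq 2 (lw (segs 2 (set HL)) \<odot> lw (segs 2 (set HL))) (smul (qint 2) (lw (segs 2 (set HL))))"
proof -
  have E: "\<forall>e\<in>seg ` set EB. carrier_of e \<inter> hB ` square \<subseteq> hB ` frontier square"
    by (rule avoid_disc[where \<phi> = Im and c = "1/6" and d = "5/6"])
       (auto simp: EB_def hB_def frontier_square, auto simp: square_def)
  have "heq 2 (lw (segs 2 (set (EB @ map (h2 hB) BL)))) (smul (qint 2) (lw (segs 2 (set (EB @ map (h2 hB) [edge (1/2) 0 (1/2) 1])))))"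
    by (rule bigon_relation[OF hB E]) (simp_all only: same_set[OF bigon_H(1)] bigon_H(2) HHL_webs HBL_webs)
  hence 1: "heq 2 (lw (segs 2 (set HHL))) (smul (qint 2) (lw (segs 2 (set HBL))))"
    unfolding same_set[OF bigon_H(1)] bigon_H(2) .
  show ?thesis unfolding wcomp_segs HHL_def[symmetric] using heq_trans[OF 1 heq_smul[OF HB_H[OF HBL_webs HL_webs]]] by simp
qed

lemma id_H: "heq 2 (lw (segs 2 (set IL2)) \<odot> lw (segs 2 (set HL))) (lw (segs 2 (set HL)))"
  and H_id: "heq 2 (lw (segs 2 (set HL)) \<odot> lw (segs 2 (set IL2))) (lw (segs 2 (set HL)))"
  unfolding wcomp_segs HIL_def[symmetric] IHL_def[symmetric] using IH_H[OF IHL_webs HL_webs] HI_H[OF HIL_webs HL_webs] by simp_all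

subsection \<open>Three strands\<close>

text \<open>\<open>QS\<close> and \<open>RS\<close> are isotopic to \<open>H_1 H_2 H_1\<close> and \<open>H_2 H_1 H_2\<close>; their quadrilateral is the one of the
  skein relation, turned by a right angle in \<open>QS\<close>.  The resolutions are \<open>QI\<close>, \<open>QT\<close> and \<open>RI\<close>, \<open>RT\<close>: up to
  isotopy \<open>QT\<close> is \<open>H_1\<close> and \<open>RI\<close> is \<open>H_2\<close>, and \<open>QI\<close> and \<open>RT\<close> are the web in which all three strands
  merge.\<close>

definition H1L :: "(complex \<times> complex) list" where
  "H1L = [edge (1/4) 0 (3/8) (1/3), edge (1/2) 0 (3/8) (1/3), edge (3/8) (2/3) (3/8) (1/3),
   edge (3/8) (2/3) (1/4) 1, edge (3/8) (2/3) (1/2) 1, edge (3/4) 0 (3/4) 1]"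

lemma H1L_webs: "segs 3 (set H1L) \<in> uwebs 3"
  by (rule seg_check_webs) (simp add: seg_check_simps H1L_def)

definition H2L :: "(complex \<times> complex) list" where
  "H2L = [edge (1/4) 0 (1/4) 1, edge (1/2) 0 (5/8) (1/3), edge (3/4) 0 (5/8) (1/3), edge (5/8) (2/3) (5/8) (1/3),
   edge (5/8) (2/3) (1/2) 1, edge (5/8) (2/3) (3/4) 1]"

lemma H2L_webs: "segs 3 (set H2L) \<in> uwebs 3"
  by (rule seg_check_webs) (simp add: seg_check_simps H2L_def)

definition EQ :: "(complex \<times> complex) list" where
  "EQ = [edge (1/4) 0 (1/2) (1/3), edge (1/2) 0 (1/2) (1/3), edge (1/2) (2/3) (1/4) 1, edge (1/2) (2/3) (1/2) 1,
   edge (3/4) 0 (11/16) (1/3), edge (11/16) (2/3) (3/4) 1]"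

definition ER :: "(complex \<times> complex) list" where
  "ER = [edge (1/4) 0 (3/8) (1/5), edge (1/2) 0 (1/2) (1/5), edge (3/4) 0 (1/2) (1/5), edge (1/2) (4/5) (1/2) 1,
   edge (1/2) (4/5) (3/4) 1, edge (3/8) (4/5) (1/4) 1]"

text \<open>The image is \<open>[1/2, 11/16]\<close> times \<open>[0, 1]\<close>. After the turn the
  legs of the quadrilateral leave through the vertical sides, at the points where the edges in
  \<open>EQ\<close> end.\<close>

definition hQ :: "complex \<Rightarrow> complex" where "hQ z = Complex (11/16 - 3/16 * Im z) (1 * Re z + 0)"
definition hR :: "complex \<Rightarrow> complex" where "hR z = Complex (3/8 * Re z + 1/4) (3/5 * Im z + 1/5)"

definition A121 :: "(complex \<times> complex) list" where "A121 = stackl H1L (stackl H2L H1L)"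

lemma A121_webs: "segs 3 (set A121) \<in> uwebs 3"
  by (rule seg_check_webs) (simp add: seg_check_simps A121_def stackl_def H1L_def H2L_def lo_def hi_def)

definition A212 :: "(complex \<times> complex) list" where "A212 = stackl H2L (stackl H1L H2L)"

lemma A212_webs: "segs 3 (set A212) \<in> uwebs 3"
  by (rule seg_check_webs) (simp add: seg_check_simps A212_def stackl_def H1L_def H2L_def lo_def hi_def)

definition QS :: "(complex \<times> complex) list" where "QS = EQ @ map (h2 hQ) SL"

lemma QS_webs: "segs 3 (set QS) \<in> uwebs 3"
  by (rule seg_check_webs) (simp add: seg_check_simps QS_def EQ_def SL_def hQ_def)

definition QI :: "(complex \<times> complex) list" where "QI = EQ @ map (h2 hQ) IL"

lemma QI_webs: "segs 3 (set QI) \<in> uwebs 3"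
  by (rule seg_check_webs) (simp add: seg_check_simps QI_def EQ_def IL_def hQ_def)

definition QT :: "(complex \<times> complex) list" where "QT = EQ @ map (h2 hQ) TL"

lemma QT_webs: "segs 3 (set QT) \<in> uwebs 3"
  by (rule seg_check_webs) (simp add: seg_check_simps QT_def EQ_def TL_def hQ_def)

definition RS :: "(complex \<times> complex) list" where "RS = ER @ map (h2 hR) SL"

lemma RS_webs: "segs 3 (set RS) \<in> uwebs 3"
  by (rule seg_check_webs) (simp add: seg_check_simps RS_def ER_def SL_def hR_def)

definition RI :: "(complex \<times> complex) list" where "RI = ER @ map (h2 hR) IL"

lemma RI_webs: "segs 3 (set RI) \<in> uwebs 3"
  by (rule seg_check_webs) (simp add: seg_check_simps RI_def ER_def IL_def hR_def)

definition RT :: "(complex \<times> complex) list" where "RT = ER @ map (h2 hR) TL"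

lemma RT_webs: "segs 3 (set RT) \<in> uwebs 3"
  by (rule seg_check_webs) (simp add: seg_check_simps RT_def ER_def TL_def hR_def)

definition QL :: "(complex \<times> complex) list" where
  "QL = [edge (1/4) 0 (1/2) (1/3), edge (1/2) 0 (1/2) (1/3), edge (1/2) (2/3) (1/4) 1, edge (1/2) (2/3) (1/2) 1,
   edge (3/4) 0 (11/16) (1/3), edge (11/16) (2/3) (3/4) 1, edge (9/16) (2/5) (5/8) (9/20),
   edge (5/8) (11/20) (11/16) (2/3), edge (1/2) (2/3) (9/16) (3/5), edge (11/16) (1/3) (5/8) (9/20),
   edge (9/16) (2/5) (1/2) (1/3), edge (5/8) (11/20) (9/16) (3/5), edge (9/16) (2/5) (9/16) (3/5),
   edge (5/8) (11/20) (5/8) (9/20)]"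

text \<open>The quadrilateral has horizontal edges, which fit into no grid with increasing levels.
  They are tilted by a vertical move; the same is done for the other quadrilateral in
  \<open>R_tilt\<close>.\<close>

lemma Q_tilt:
  assumes "segs 3 (set QS) \<in> uwebs 3"
  shows "segs 3 (set QL) \<in> uwebs 3" "heq 3 (lw (segs 3 (set QS))) (lw (segs 3 (set QL)))"
proof -
  have "segs 3 (set QL) \<in> uwebs 3 \<and> heq 3 (lw (segs 3 (set QS))) (lw (segs 3 (set QL)))"
    by (rule rows_isotopic[OF assms, where r = 3 and K = 3 and x = "[1/2, 9/16, 5/8, 11/16]"
    and F = "[edge (1/4) 0 (1/2) (1/3), edge (1/2) 0 (1/2) (1/3), edge (1/2) (2/3) (1/4) 1, edge (1/2) (2/3) (1/2) 1,
   edge (3/4) 0 (11/16) (1/3), edge (11/16) (2/3) (3/4) 1]"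
    and a = "[[0, 0, 0, 0], [1/3, 1/3, 1/3, 1/3], [2/3, 2/3, 2/3, 2/3], [1, 1, 1, 1]]"
    and b = "[[0, 0, 0, 0], [1/3, 2/5, 9/20, 1/3], [2/3, 3/5, 11/20, 2/3], [1, 1, 1, 1]]"
    and R = "[(1, 1), (2, 2), (2, 0)]" and R' = "[(1, 2), (1, 0), (2, 1)]" and U = "[(1, 1)]" and D = "[(1, 2)]"])
      (simp_all add: row_simps QS_def EQ_def SL_def hQ_def QL_def)
  thus "segs 3 (set QL) \<in> uwebs 3" "heq 3 (lw (segs 3 (set QS))) (lw (segs 3 (set QL)))" by blast+
qed

definition RL :: "(complex \<times> complex) list" where
  "RL = [edge (1/4) 0 (3/8) (1/5), edge (3/8) (4/5) (1/4) 1, edge (3/8) (3/5) (1/2) (13/20),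
   edge (1/2) (4/5) (3/4) 1, edge (3/4) 0 (1/2) (1/5), edge (1/2) (7/20) (3/8) (2/5),
   edge (3/8) (1/5) (3/8) (2/5), edge (3/8) (3/5) (3/8) (4/5), edge (1/2) 0 (1/2) (1/5),
   edge (1/2) (7/20) (1/2) (13/20), edge (1/2) (4/5) (1/2) 1, edge (1/2) (7/20) (1/2) (1/5),
   edge (1/2) (4/5) (1/2) (13/20), edge (3/8) (3/5) (3/8) (2/5)]"

lemma R_tilt:
  assumes "segs 3 (set RS) \<in> uwebs 3"
  shows "segs 3 (set RL) \<in> uwebs 3" "heq 3 (lw (segs 3 (set RS))) (lw (segs 3 (set RL)))"
proof -
  have "segs 3 (set RL) \<in> uwebs 3 \<and> heq 3 (lw (segs 3 (set RS))) (lw (segs 3 (set RL)))"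
    by (rule rows_isotopic[OF assms, where r = 5 and K = 2 and x = "[3/8, 1/2, 3/4]"
    and F = "[edge (1/4) 0 (3/8) (1/5), edge (3/8) (4/5) (1/4) 1]"
    and a = "[[0, 0, 0], [1/5, 1/5, 0], [2/5, 2/5, 2/5], [3/5, 3/5, 3/5], [4/5, 4/5, 1], [1, 1, 1]]"
    and b = "[[0, 0, 0], [1/5, 1/5, 0], [2/5, 7/20, 2/5], [3/5, 13/20, 3/5], [4/5, 4/5, 1], [1, 1, 1]]"
    and R = "[(3, 0), (4, 1)]" and R' = "[(1, 1), (2, 0)]" and U = "[(1, 0), (3, 0), (0, 1), (2, 1), (4, 1)]" and D = "[(1, 1), (3, 1), (2, 0)]"])
      (simp_all add: row_simps RS_def ER_def SL_def hR_def RL_def)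
  thus "segs 3 (set RL) \<in> uwebs 3" "heq 3 (lw (segs 3 (set RS))) (lw (segs 3 (set RL)))" by blast+
qed

definition EL :: "(complex \<times> complex) list" where
  "EL = [edge (1/4) 0 (1/2) (1/3), edge (1/2) 0 (1/2) (1/3), edge (1/2) (2/3) (1/4) 1, edge (1/2) (2/3) (1/2) 1,
   edge (1/2) (2/3) (11/16) (11/12), edge (11/16) (11/12) (3/4) 1, edge (3/4) 0 (11/16) (1/12),
   edge (11/16) (1/12) (1/2) (1/3)]"

lemma QI_straight:
  assumes "segs 3 (set QI) \<in> uwebs 3"
  shows "segs 3 (set EL) \<in> uwebs 3" "heq 3 (lw (segs 3 (set QI))) (lw (segs 3 (set EL)))"
proof -
  have "segs 3 (set EL) \<in> uwebs 3 \<and> heq 3 (lw (segs 3 (set QI))) (lw (segs 3 (set EL)))"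
    by (rule rows_isotopic[OF assms, where r = 3 and K = 2 and x = "[1/2, 11/16, 3/4]"
    and F = "[edge (1/4) 0 (1/2) (1/3), edge (1/2) 0 (1/2) (1/3), edge (1/2) (2/3) (1/4) 1, edge (1/2) (2/3) (1/2) 1]"
    and a = "[[0, 0, 0], [1/3, 1/3, 0], [2/3, 2/3, 1], [1, 1, 1]]"
    and b = "[[0, 0, 0], [1/3, 1/12, 0], [2/3, 11/12, 1], [1, 1, 1]]"
    and R = "[(2, 0), (2, 1)]" and R' = "[(1, 1), (1, 0)]" and U = "[]" and D = "[]"])
      (simp_all add: row_simps QI_def EQ_def IL_def hQ_def EL_def)
  thus "segs 3 (set EL) \<in> uwebs 3" "heq 3 (lw (segs 3 (set QI))) (lw (segs 3 (set EL)))" by blast+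
qed

definition FL :: "(complex \<times> complex) list" where
  "FL = [edge (1/2) 0 (1/2) (1/5), edge (3/4) 0 (1/2) (1/5), edge (1/2) (4/5) (1/2) 1, edge (1/2) (4/5) (3/4) 1,
   edge (1/4) 0 (3/8) (1/10), edge (3/8) (1/10) (7/16) (3/20), edge (7/16) (3/20) (1/2) (1/5),
   edge (1/2) (4/5) (7/16) (17/20), edge (7/16) (17/20) (3/8) (9/10), edge (3/8) (9/10) (1/4) 1]"

text \<open>The arcs of this resolution turn back in height. Moving their apexes from 2/5 and 3/5
  beyond the vertices, to 3/20 and 17/20, makes them monotone, as strands of a grid have to
  be.\<close>

lemma RT_straight:
  assumes "segs 3 (set RT) \<in> uwebs 3"
  shows "segs 3 (set FL) \<in> uwebs 3" "heq 3 (lw (segs 3 (set RT))) (lw (segs 3 (set FL)))"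
proof -
  have "segs 3 (set FL) \<in> uwebs 3 \<and> heq 3 (lw (segs 3 (set RT))) (lw (segs 3 (set FL)))"
    by (rule rows_isotopic[OF assms, where r = 3 and K = 3 and x = "[1/4, 3/8, 7/16, 1/2]"
    and F = "[edge (1/2) 0 (1/2) (1/5), edge (3/4) 0 (1/2) (1/5), edge (1/2) (4/5) (1/2) 1, edge (1/2) (4/5) (3/4) 1]"
    and a = "[[0, 0, 0, 0], [0, 1/5, 2/5, 1/5], [1, 4/5, 3/5, 4/5], [1, 1, 1, 1]]"
    and b = "[[0, 0, 0, 0], [0, 1/10, 3/20, 1/5], [1, 9/10, 17/20, 4/5], [1, 1, 1, 1]]"
    and R = "[(1, 0), (1, 1), (1, 2)]" and R' = "[(2, 2), (2, 1), (2, 0)]" and U = "[]" and D = "[]"])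
      (simp_all add: row_simps RT_def ER_def TL_def hR_def FL_def)
  thus "segs 3 (set FL) \<in> uwebs 3" "heq 3 (lw (segs 3 (set RT))) (lw (segs 3 (set FL)))" by blast+
qed

text \<open>The odd-looking entries are interpolated: the edge from \<open>(11/16, 1/3)\<close> to
  \<open>(5/8, 9/20)\<close> passes 73/112 at height 2/5.\<close>

lemma Q_grid:
  assumes "segs 3 (set QL) \<in> uwebs 3" "segs 3 (set A121) \<in> uwebs 3"
  shows "heq 3 (lw (segs 3 (set QL))) (lw (segs 3 (set A121)))"
  by (rule grid_isotopic[OF assms, where r = 4 and K = 9 and c = "[2/5, 17/40, 9/20, 11/20, 23/40, 3/5]" and c' = "[1/12, 1/6, 1/3, 5/12, 2/3, 5/6]"
    and y = "[0, 1/3, 2/5, 17/40, 9/20, 11/20, 23/40, 3/5, 2/3, 1]" and y' = "[0, 1/12, 1/6, 1/4, 1/3, 5/12, 1/2, 2/3, 5/6, 1]"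
    and a = "[[0, 0, 0, 0, 0, 0, 0, 0, 0, 0], [1/4, 1/2, 9/16, 9/16, 9/16, 9/16, 9/16, 9/16, 1/2, 1/4], [1/2, 1/2, 9/16, 19/32, 5/8, 5/8, 19/32, 9/16, 1/2, 1/2], [3/4, 11/16, 73/112, 143/224, 5/8, 5/8, 143/224, 73/112, 11/16, 3/4], [1, 1, 1, 1, 1, 1, 1, 1, 1, 1]]"
    and b = "[[0, 0, 0, 0, 0, 0, 0, 0, 0, 0], [1/4, 3/8, 3/8, 1/4, 1/4, 1/4, 1/4, 3/8, 3/8, 1/4], [1/2, 3/8, 3/8, 1/2, 5/8, 5/8, 1/2, 3/8, 3/8, 1/2], [3/4, 3/4, 3/4, 3/4, 5/8, 5/8, 3/4, 3/4, 3/4, 3/4], [1, 1, 1, 1, 1, 1, 1, 1, 1, 1]]"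
    and U = "[(1, 0), (1, 2), (1, 3), (1, 4), (1, 5), (1, 6), (1, 8), (2, 0), (2, 2), (2, 3), (2, 5), (2, 6), (2, 8), (3, 0), (3, 1), (3, 2), (3, 3), (3, 5), (3, 6), (3, 7), (3, 8)]" and D = "[(1, 1), (1, 7), (2, 4)]"])
    (simp_all add: grid_simps QL_def A121_def stackl_def H1L_def H2L_def lo_def hi_def)

lemma R_grid:
  assumes "segs 3 (set RL) \<in> uwebs 3" "segs 3 (set A212) \<in> uwebs 3"
  shows "heq 3 (lw (segs 3 (set RL))) (lw (segs 3 (set A212)))"
  by (rule grid_isotopic[OF assms, where r = 4 and K = 9 and c = "[7/20, 3/8, 2/5, 3/5, 5/8, 13/20]" and c' = "[1/12, 1/6, 1/3, 5/12, 2/3, 5/6]"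
    and y = "[0, 1/5, 7/20, 3/8, 2/5, 3/5, 5/8, 13/20, 4/5, 1]" and y' = "[0, 1/12, 1/6, 1/4, 1/3, 5/12, 1/2, 2/3, 5/6, 1]"
    and a = "[[0, 0, 0, 0, 0, 0, 0, 0, 0, 0], [1/4, 3/8, 3/8, 3/8, 3/8, 3/8, 3/8, 3/8, 3/8, 1/4], [1/2, 1/2, 1/2, 7/16, 3/8, 3/8, 7/16, 1/2, 1/2, 1/2], [3/4, 1/2, 1/2, 1/2, 1/2, 1/2, 1/2, 1/2, 1/2, 3/4], [1, 1, 1, 1, 1, 1, 1, 1, 1, 1]]"
    and b = "[[0, 0, 0, 0, 0, 0, 0, 0, 0, 0], [1/4, 1/4, 1/4, 1/4, 3/8, 3/8, 1/4, 1/4, 1/4, 1/4], [1/2, 5/8, 5/8, 1/2, 3/8, 3/8, 1/2, 5/8, 5/8, 1/2], [3/4, 5/8, 5/8, 3/4, 3/4, 3/4, 3/4, 5/8, 5/8, 3/4], [1, 1, 1, 1, 1, 1, 1, 1, 1, 1]]"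
    and U = "[(1, 0), (1, 1), (1, 2), (1, 3), (1, 5), (1, 6), (1, 7), (1, 8), (2, 0), (2, 2), (2, 3), (2, 5), (2, 6), (2, 8), (3, 0), (3, 2), (3, 3), (3, 4), (3, 5), (3, 6), (3, 8)]" and D = "[(1, 4), (2, 1), (2, 7)]"])
    (simp_all add: grid_simps RL_def A212_def stackl_def H1L_def H2L_def lo_def hi_def)

lemma QT_grid:
  assumes "segs 3 (set QT) \<in> uwebs 3" "segs 3 (set H1L) \<in> uwebs 3"
  shows "heq 3 (lw (segs 3 (set QT))) (lw (segs 3 (set H1L)))"
  by (rule grid_isotopic[OF assms, where r = 4 and K = 4 and c = "[]" and c' = "[1/3, 1/2, 2/3]"
    and y = "[0, 1/3, 1/2, 2/3, 1]" and y' = "[0, 1/3, 1/2, 2/3, 1]"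
    and a = "[[0, 0, 0, 0, 0], [1/4, 1/2, 9/16, 1/2, 1/4], [1/2, 1/2, 9/16, 1/2, 1/2], [3/4, 11/16, 5/8, 11/16, 3/4], [1, 1, 1, 1, 1]]"
    and b = "[[0, 0, 0, 0, 0], [1/4, 3/8, 3/8, 3/8, 1/4], [1/2, 3/8, 3/8, 3/8, 1/2], [3/4, 3/4, 3/4, 3/4, 3/4], [1, 1, 1, 1, 1]]"
    and U = "[(1, 0), (1, 3), (2, 0), (2, 3), (3, 0), (3, 1), (3, 2), (3, 3)]" and D = "[(1, 1), (1, 2)]"])
    (simp_all add: grid_simps QT_def EQ_def TL_def hQ_def H1L_def)

lemma RI_grid:
  assumes "segs 3 (set RI) \<in> uwebs 3" "segs 3 (set H2L) \<in> uwebs 3"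
  shows "heq 3 (lw (segs 3 (set RI))) (lw (segs 3 (set H2L)))"
  by (rule grid_isotopic[OF assms, where r = 4 and K = 3 and c = "[]" and c' = "[1/3, 2/3]"
    and y = "[0, 1/5, 4/5, 1]" and y' = "[0, 1/3, 2/3, 1]"
    and a = "[[0, 0, 0, 0], [1/4, 3/8, 3/8, 1/4], [1/2, 1/2, 1/2, 1/2], [3/4, 1/2, 1/2, 3/4], [1, 1, 1, 1]]"
    and b = "[[0, 0, 0, 0], [1/4, 1/4, 1/4, 1/4], [1/2, 5/8, 5/8, 1/2], [3/4, 5/8, 5/8, 3/4], [1, 1, 1, 1]]"
    and U = "[(1, 0), (1, 1), (1, 2), (2, 0), (2, 2), (3, 0), (3, 2)]" and D = "[(2, 1)]"])
    (simp_all add: grid_simps RI_def ER_def IL_def hR_def H2L_def)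

lemma E_grid:
  assumes "segs 3 (set EL) \<in> uwebs 3" "segs 3 (set FL) \<in> uwebs 3"
  shows "heq 3 (lw (segs 3 (set EL))) (lw (segs 3 (set FL)))"
  by (rule grid_isotopic[OF assms, where r = 4 and K = 7 and c = "[1/12, 1/6, 5/6, 11/12]" and c' = "[1/10, 3/20, 17/20, 9/10]"
    and y = "[0, 1/12, 1/6, 1/3, 2/3, 5/6, 11/12, 1]" and y' = "[0, 1/10, 3/20, 1/5, 4/5, 17/20, 9/10, 1]"
    and a = "[[0, 0, 0, 0, 0, 0, 0, 0], [1/4, 5/16, 3/8, 1/2, 1/2, 3/8, 5/16, 1/4], [1/2, 1/2, 1/2, 1/2, 1/2, 1/2, 1/2, 1/2], [3/4, 11/16, 5/8, 1/2, 1/2, 5/8, 11/16, 3/4], [1, 1, 1, 1, 1, 1, 1, 1]]"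
    and b = "[[0, 0, 0, 0, 0, 0, 0, 0], [1/4, 3/8, 7/16, 1/2, 1/2, 7/16, 3/8, 1/4], [1/2, 1/2, 1/2, 1/2, 1/2, 1/2, 1/2, 1/2], [3/4, 5/8, 9/16, 1/2, 1/2, 9/16, 5/8, 3/4], [1, 1, 1, 1, 1, 1, 1, 1]]"
    and U = "[(1, 0), (1, 1), (1, 2), (1, 4), (1, 5), (1, 6), (2, 0), (2, 1), (2, 2), (2, 4), (2, 5), (2, 6), (3, 0), (3, 1), (3, 2), (3, 4), (3, 5), (3, 6)]" and D = "[]"])
    (simp_all add: grid_simps EL_def FL_def)


lemma hQ: "disc_embedding hQ" "aff hQ"
proof -
  have "pisot hQ" unfolding hQ_def[abs_def] by (rule pisot_quarter_turn) simp_all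
  thus "disc_embedding hQ" unfolding disc_embedding_iff by (auto simp: hQ_def square_def)
  show "aff hQ" by (simp add: aff_def hQ_def complex_eq_iff algebra_simps)
qed

lemma hR: "disc_embedding hR" "aff hR"
proof -
  have "pisot hR" unfolding hR_def[abs_def] by (rule pisot_linear) simp_all
  thus "disc_embedding hR" unfolding disc_embedding_iff by (auto simp: hR_def square_def)
  show "aff hR" by (simp add: aff_def hR_def complex_eq_iff algebra_simps)
qed

lemma braid_segs:
  fixes h1 h2 :: lweb
  defines "h1 \<equiv> lw (segs 3 (set H1L))" and "h2 \<equiv> lw (segs 3 (set H2L))"
  shows "heq 3 (h1 \<odot> (h2 \<odot> h1) - h1) (h2 \<odot> (h1 \<odot> h2) - h2)"
proof -
  have EQ: "\<forall>e\<in>seg ` set EQ. carrier_of e \<inter> hQ ` square \<subseteq> hQ ` frontier square"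
    by (rule avoid_disc[where \<phi> = Re and c = "1/2" and d = "11/16"])
       (auto simp: EQ_def hQ_def frontier_square, auto simp: square_def)
  have ER: "\<forall>e\<in>seg ` set ER. carrier_of e \<inter> hR ` square \<subseteq> hR ` frontier square"
    by (rule avoid_disc[where \<phi> = Im and c = "1/5" and d = "4/5"])
       (auto simp: ER_def hR_def frontier_square, auto simp: square_def)
  have q: "heq 3 (lw (segs 3 (set QS))) (lw (segs 3 (set QI)) + lw (segs 3 (set QT)))"
    using square_relation[OF hQ EQ, of 3] unfolding QS_def[symmetric] QI_def[symmetric] QT_def[symmetric] by (simp only: QS_webs QI_webs QT_webs)
  have r: "heq 3 (lw (segs 3 (set RS))) (lw (segs 3 (set RI)) + lw (segs 3 (set RT)))"
    using square_relation[OF hR ER, of 3] unfolding RS_def[symmetric] RI_def[symmetric] RT_def[symmetric] by (simp only: RS_webs RI_webs RT_webs)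
  have s: "h1 \<odot> (h2 \<odot> h1) = lw (segs 3 (set A121))" "h2 \<odot> (h1 \<odot> h2) = lw (segs 3 (set A212))"
    unfolding h1_def h2_def wcomp_segs A121_def A212_def by (rule refl)+
  have 1: "heq 3 (lw (segs 3 (set A121))) (lw (segs 3 (set QI)) + lw (segs 3 (set QT)))"
    by (rule heq_trans[OF heq_sym[OF heq_trans[OF Q_tilt(2)[OF QS_webs] Q_grid[OF Q_tilt(1)[OF QS_webs] A121_webs]]] q])
  have 2: "heq 3 (lw (segs 3 (set A212))) (lw (segs 3 (set RI)) + lw (segs 3 (set RT)))"
    by (rule heq_trans[OF heq_sym[OF heq_trans[OF R_tilt(2)[OF RS_webs] R_grid[OF R_tilt(1)[OF RS_webs] A212_webs]]] r])
  have 3: "heq 3 (lw (segs 3 (set A121)) - h1) (lw (segs 3 (set QI)))"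
    using heq_minus[OF 1 heq_sym[OF QT_grid[OF QT_webs H1L_webs]]] unfolding h1_def by simp
  have 4: "heq 3 (lw (segs 3 (set A212)) - h2) (lw (segs 3 (set RT)))"
    using heq_minus[OF 2 heq_sym[OF RI_grid[OF RI_webs H2L_webs]]] unfolding h2_def by simp
  have 5: "heq 3 (lw (segs 3 (set QI))) (lw (segs 3 (set RT)))"
    by (rule heq_trans[OF heq_trans[OF QI_straight(2)[OF QI_webs] E_grid[OF QI_straight(1)[OF QI_webs] RT_straight(1)[OF RT_webs]]]
          heq_sym[OF RT_straight(2)[OF RT_webs]]])
  show ?thesis unfolding s by (rule heq_trans[OF 3 heq_trans[OF 5 heq_sym[OF 4]]])
qed

subsection \<open>The crossing\<close>

definition XA :: "complex \<times> complex" where "XA = (Complex (1/3) 0, Complex (2/3) 1)"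
definition XB :: "complex \<times> complex" where "XB = (Complex (2/3) 0, Complex (1/3) 1)"

text \<open>A quarter turn of the chart exchanges the coordinate axes.\<close>

lemma transverse_at_sym: "transverse_at p A B \<Longrightarrow> transverse_at p B A"
proof -
  assume "transverse_at p A B"
  then obtain U \<phi> \<psi> where U: "open U" "p \<in> U" "homeomorphism U (ball 0 1) \<phi> \<psi>" "\<phi> p = 0"
    "\<phi> ` (U \<inter> A) = {z \<in> ball 0 1. Im z = 0}" "\<phi> ` (U \<inter> B) = {z \<in> ball 0 1. Re z = 0}"
    unfolding transverse_at_def by (elim exE conjE) (rule that)
  have r: "(\<lambda>z. \<i> * z) ` {z \<in> ball 0 1. P z} = {z \<in> ball 0 1. P (- \<i> * z)}" for P
  proof (intro set_eqI iffI)
    fix z assume "z \<in> {z \<in> ball 0 1. P (- \<i> * z)}"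
    thus "z \<in> (\<lambda>z. \<i> * z) ` {z \<in> ball 0 1. P z}" by (intro image_eqI[of _ _ "- \<i> * z"]) (simp_all add: norm_mult)
  qed (auto simp: norm_mult)
  have "homeomorphism (ball 0 1) (ball 0 1) (\<lambda>z. \<i> * z) (\<lambda>z. - \<i> * z :: complex)"
    by (rule homeomorphismI) (auto intro!: continuous_intros simp: norm_mult)
  note h = homeomorphism_compose[OF U(3) this]
  show "transverse_at p B A"
    unfolding transverse_at_def
  proof (intro exI conjI)
    show "((\<lambda>z. \<i> * z) \<circ> \<phi>) ` (U \<inter> B) = {z \<in> ball 0 1. Im z = 0}"
      unfolding image_comp[symmetric] U(6) r by simp
    show "((\<lambda>z. \<i> * z) \<circ> \<phi>) ` (U \<inter> A) = {z \<in> ball 0 1. Re z = 0}"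
      unfolding image_comp[symmetric] U(5) r by simp
  qed (use U(1,2,4) h in simp_all)
qed

lemma XA_iff: "z \<in> closed_segment (fst XA) (snd XA) \<longleftrightarrow> 0 \<le> Im z \<and> Im z \<le> 1 \<and> Re z = 1/3 + Im z / 3"
  and XB_iff: "z \<in> closed_segment (fst XB) (snd XB) \<longleftrightarrow> 0 \<le> Im z \<and> Im z \<le> 1 \<and> Re z = 2/3 - Im z / 3"
proof -
  show "z \<in> closed_segment (fst XA) (snd XA) \<longleftrightarrow> 0 \<le> Im z \<and> Im z \<le> 1 \<and> Re z = 1/3 + Im z / 3"
  proof
    assume "0 \<le> Im z \<and> Im z \<le> 1 \<and> Re z = 1/3 + Im z / 3"
    thus "z \<in> closed_segment (fst XA) (snd XA)"
      unfolding seg_image by (intro image_eqI[of _ _ "Im z"]) (simp_all add: XA_def complex_eq_iff)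
  qed (auto simp: XA_def elim!: segE)
  show "z \<in> closed_segment (fst XB) (snd XB) \<longleftrightarrow> 0 \<le> Im z \<and> Im z \<le> 1 \<and> Re z = 2/3 - Im z / 3"
  proof
    assume "0 \<le> Im z \<and> Im z \<le> 1 \<and> Re z = 2/3 - Im z / 3"
    thus "z \<in> closed_segment (fst XB) (snd XB)"
      unfolding seg_image by (intro image_eqI[of _ _ "Im z"]) (simp_all add: XB_def complex_eq_iff)
  qed (auto simp: XB_def elim!: segE)
qed

lemma X_transverse: "transverse_at (Complex (1/2) (1/2)) (closed_segment (fst XA) (snd XA)) (closed_segment (fst XB) (snd XB))"
proof -
  \<comment> \<open>An affine chart around the crossing whose imaginary part vanishes on
    \<open>XA\<close> and whose real part vanishes on \<open>XB\<close>. The scale keeps the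
    preimage of the unit ball between the heights 0 and 1, so it does not reach the ends of the
    segments.\<close>
  define \<phi> where "\<phi> z = Complex (6 * (Re z - 1/2) + 2 * (Im z - 1/2)) (2 * (Im z - 1/2) - 6 * (Re z - 1/2))" for z
  define \<psi> where "\<psi> w = Complex (1/2 + (Re w - Im w) / 12) (1/2 + (Re w + Im w) / 4)" for w
  have inv: "\<phi> (\<psi> w) = w" "\<psi> (\<phi> z) = z" for w z by (simp_all add: \<phi>_def \<psi>_def complex_eq_iff field_simps)
  have cont: "continuous_on S \<phi>" "continuous_on S \<psi>" for S unfolding \<phi>_def \<psi>_def by (intro continuous_intros; simp)+
  define U where "U = \<phi> -` ball 0 1"
  have im: "\<phi> ` (U \<inter> A) = {w \<in> ball 0 1. \<psi> w \<in> A}" for A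
  proof (intro set_eqI iffI)
    fix w assume "w \<in> {w \<in> ball 0 1. \<psi> w \<in> A}"
    thus "w \<in> \<phi> ` (U \<inter> A)" by (intro image_eqI[of _ _ "\<psi> w"]) (simp_all add: U_def inv)
  qed (auto simp: U_def inv)
  have b: "\<bar>Re w\<bar> < 1 \<and> \<bar>Im w\<bar> < 1" if "w \<in> ball 0 1" for w
    using abs_Re_le_cmod[of w] abs_Im_le_cmod[of w] that by auto
  show ?thesis
    unfolding transverse_at_def
  proof (intro exI conjI)
    show "open U" unfolding U_def by (rule open_vimage[OF open_ball cont(1)])
    show "homeomorphism U (ball 0 1) \<phi> \<psi>" by (rule homeomorphismI[OF cont]) (auto simp: U_def inv)
    show "\<phi> (Complex (1/2) (1/2)) = 0" by (simp add: \<phi>_def complex_eq_iff)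
    thus "Complex (1/2) (1/2) \<in> U" by (simp add: U_def)
    show "\<phi> ` (U \<inter> closed_segment (fst XA) (snd XA)) = {z \<in> ball 0 1. Im z = 0}"
      unfolding im XA_iff using b by (force simp: \<psi>_def field_simps)
    show "\<phi> ` (U \<inter> closed_segment (fst XB) (snd XB)) = {z \<in> ball 0 1. Re z = 0}"
      unfolding im XB_iff using b by (force simp: \<psi>_def field_simps)
  qed
qed

lemma X_web_eq: "X_web True = Web (ups 2) (ups 2) (seg ` set [XA, XB]) {(Complex (1/2) (1/2), seg XA)}"
  by (simp add: X_web_def Let_def XA_def XB_def pt_def ups_simps)

text \<open>A crossing is beyond \<open>seg_check\<close>, so the conditions are verified directly
  from the equations of the two segments, which meet in the centre only.\<close>

lemma X_web_webs: "X_web True \<in> uwebs 2"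
proof -
  define e f where "e = seg XA" and "f = seg XB"
  define p where "p = Complex (1/2) (1/2)"
  have car: "carrier_of e = closed_segment (fst XA) (snd XA)" "carrier_of f = closed_segment (fst XB) (snd XB)"
    by (simp_all add: e_def f_def)
  have en: "src e = Complex (1/3) 0" "tgt e = Complex (2/3) 1" "src f = Complex (2/3) 0" "tgt f = Complex (1/3) 1"
    by (simp_all add: e_def f_def XA_def XB_def)
  have ef: "e \<noteq> f"
  proof
    assume "e = f"
    hence "src e = src f" by simp
    thus False unfolding en by simp
  qed
  have int: "z \<in> carrier_of e \<Longrightarrow> z \<in> carrier_of f \<Longrightarrow> z = p" for z
    unfolding car XA_iff XB_iff by (simp add: complex_eq_iff p_def)
  have pin: "p \<in> carrier_of e" "p \<in> carrier_of f" unfolding car XA_iff XB_iff by (simp_all add: p_def)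
  have pend: "p \<notin> ends e" "p \<notin> ends f" unfolding en by (simp_all add: p_def)
  have cr: "crossing {e, f} q x y \<longleftrightarrow> q = p \<and> (x = e \<and> y = f \<or> x = f \<and> y = e)" for q x y
  proof
    assume c: "crossing {e, f} q x y"
    hence "x = e \<and> y = f \<or> x = f \<and> y = e" "q \<in> carrier_of x" "q \<in> carrier_of y" unfolding crossing_def by blast+
    thus "q = p \<and> (x = e \<and> y = f \<or> x = f \<and> y = e)" using int by blast
  next
    assume "q = p \<and> (x = e \<and> y = f \<or> x = f \<and> y = e)"
    thus "crossing {e, f} q x y" using pin pend ef unfolding crossing_def by blast
  qed
  have tr: "transverse_at p (carrier_of e) (carrier_of f)" unfolding car p_def by (rule X_transverse)
  have d: "is_darc e" "is_darc f" unfolding e_def f_def by (rule is_darc_seg, simp add: XA_def XB_def)+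
  have fin: "carrier_of e \<inter> carrier_of f = {p}" using int pin by blast
  have es: "esys {e, f} {(p, e)}"
    unfolding esys_def
  proof (intro conjI allI impI ballI)
    fix x y assume xy: "x \<in> {e, f}" "y \<in> {e, f}" "x \<noteq> y"
    hence c: "x = e \<and> y = f \<or> x = f \<and> y = e" by blast
    hence i: "carrier_of x \<inter> carrier_of y = {p}" using fin by (metis Int_commute)
    thus "finite (carrier_of x \<inter> carrier_of y)" by simp
    fix q assume "q \<in> carrier_of x \<inter> carrier_of y"
    hence "q = p" using i by simp
    thus "q \<in> ends x \<inter> ends y \<or> crossing {e, f} q x y" unfolding cr using c by blast
  next
    fix q x y assume c: "crossing {e, f} q x y"
    thus "transverse_at q (carrier_of x) (carrier_of y)" unfolding cr using tr transverse_at_sym[OF tr] by (elim conjE disjE) simp_all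
    show "((q, x) \<in> {(p, e)}) = ((q, y) \<notin> {(p, e)})" using c ef unfolding cr by (elim conjE disjE) simp_all
    fix g assume "g \<in> {e, f}" thus "g = x \<or> g = y" using c unfolding cr by blast
  next
    have "crossing {e, f} p e f" by (simp add: cr)
    thus "{(p, e)} \<subseteq> {(q, x). \<exists>y. crossing {e, f} q x y}" by blast
  next
    fix x assume "x \<in> {e, f}"
    thus "is_darc x" using d by (elim insertE emptyE) simp_all
  qed simp
  have E: "{e, f} = seg ` set [XA, XB]" by (simp add: e_def f_def)
  have dist: "distinct [XA, XB]" by (simp add: XA_def XB_def)
  have val: "valency {e, f} q = (indeg [XA, XB] q, outdeg [XA, XB] q)" for q unfolding E by (rule valency_seg[OF dist])
  have bds: "Complex (1/3) 0 = bpt 2 0" "Complex (2/3) 0 = bpt 2 1" "Complex (1/3) 1 = tpt 2 0" "Complex (2/3) 1 = tpt 2 1"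
    by (simp_all add: bpt_def tpt_def)
  have lt2: "i < 2 \<longleftrightarrow> i = 0 \<or> i = 1" for i :: nat by auto
  have endbd: "z \<in> bd 2" if "z \<in> {Complex (1/3) 0, Complex (2/3) 0, Complex (1/3) 1, Complex (2/3) 1}" for z
    using that unfolding bds bd_iff lt2 by blast
  have sq: "z \<in> square \<and> (z \<in> frontier square \<longrightarrow> z \<in> bd 2)" if "z \<in> carrier_of e \<or> z \<in> carrier_of f" for z
  proof -
    have z: "0 \<le> Im z" "Im z \<le> 1" "Re z = 1/3 + Im z / 3 \<or> Re z = 2/3 - Im z / 3"
      using that unfolding car XA_iff XB_iff by blast+
    have r: "0 < Re z" "Re z < 1" using z by auto
    have "z \<in> bd 2" if "z \<in> frontier square"
    proof (rule endbd)
      have "Im z = 0 \<or> Im z = 1" using that r unfolding frontier_square by auto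
      thus "z \<in> {Complex (1/3) 0, Complex (2/3) 0, Complex (1/3) 1, Complex (2/3) 1}"
        using z(3) by (auto simp: complex_eq_iff)
    qed
    thus ?thesis using z r by (simp add: square_def)
  qed
  have "ok 2 {e, f} {(p, e)}"
    unfolding ok_def
  proof (intro conjI ballI allI impI)
    fix x assume "x \<in> {e, f}"
    hence x: "z \<in> carrier_of x \<Longrightarrow> z \<in> carrier_of e \<or> z \<in> carrier_of f" for z by blast
    show "carrier_of x \<subseteq> square" "carrier_of x \<inter> frontier square \<subseteq> bd 2" using x sq by blast+
  next
    fix i :: nat assume "i < 2"
    hence "i = 0 \<or> i = 1" by auto
    thus "valency {e, f} (bpt 2 i) = (0, 1)" "valency {e, f} (tpt 2 i) = (1, 0)"
      unfolding val by (auto simp: indeg_def outdeg_def XA_def XB_def bpt_def tpt_def)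
  next
    fix q assume "q \<in> (\<Union>x\<in>{e, f}. ends x) - bd 2"
    thus "valency {e, f} q \<in> {(1, 1), (3, 0), (0, 3)}" using endbd unfolding UN_insert UN_empty en by blast
  qed (rule es)
  thus ?thesis unfolding uwebs_iff X_web_eq by (simp add: e_def f_def p_def)
qed

lemma pisot_id: "pisot (\<lambda>z. z)"
  using pisot_linear[of 1 1 0 0] by simp

lemma plug_id: "bottom w = \<alpha> \<Longrightarrow> topw w = \<beta> \<Longrightarrow> plug \<alpha> \<beta> {} {} (\<lambda>z. z) w = w"
proof -
  have "map_darc (\<lambda>z. z) e = e" for e by (simp add: map_darc_def)
  thus "bottom w = \<alpha> \<Longrightarrow> topw w = \<beta> \<Longrightarrow> plug \<alpha> \<beta> {} {} (\<lambda>z. z) w = w" by (cases w) (simp add: plug_eq map_overs_def)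
qed

lemma H_web_segs: "H_web = segs 2 (set HL)"
  by (simp add: H_web_def segs_def HL_def pt_def ups_simps)

lemma id_web_segs: "id_web (ups n) = segs n ((\<lambda>i. (bpt n i, tpt n i)) ` {..<n})"
proof -
  have "(\<lambda>i. let n = length (ups n) in case ups n ! i of Up \<Rightarrow> seg (bpt n i, tpt n i) | Down \<Rightarrow> seg (tpt n i, bpt n i)) ` {..<length (ups n)}
    = (\<lambda>i. seg (bpt n i, tpt n i)) ` {..<n}"
    by (rule image_cong) (simp_all add: Let_def)
  thus ?thesis unfolding id_web_def segs_def image_image by simp
qed

lemma id_web_2_segs: "id_web (ups 2) = segs 2 (set IL2)"
  by (simp add: id_web_segs IL2_def bpt_def tpt_def lessThan_nat_numeral lessThan_Suc insert_commute)

text \<open>The local relation itself, plugged in by the identity with nothing outside.\<close>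

lemma X_skein: "heq 2 (lw (X_web True)) (smul (q6 2) (idu 2) - smul (q6 (- 1)) (lw H_web))"
proof -
  define r where "r = lw (X_web True) - (smul (q6 2) (lw (id_web [Up, Up])) - smul (q6 (- 1)) (lw H_web))"
  have r: "r \<in> local_relations" unfolding r_def local_relations_def by blast
  have sp: "r \<in> lin.span (lw ` {X_web True, id_web [Up, Up], H_web})"
    unfolding r_def by (intro lin.span_diff lin.span_scale lin.span_base) blast+
  have w: "X_web True \<in> uwebs 2" "id_web [Up, Up] \<in> uwebs 2" "H_web \<in> uwebs 2"
    using X_web_webs IL2_webs HL_webs id_web_2_segs H_web_segs by (simp_all add: ups_simps)
  have p: "plug (ups 2) (ups 2) {} {} (\<lambda>z. z) v = v" if "v \<in> {X_web True, id_web [Up, Up], H_web}" for v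
    using that w unfolding uwebs_iff by (intro plug_id) blast+
  have "lin_ext (plug (ups 2) (ups 2) {} {} (\<lambda>z. z)) r \<in> sk 2"
  proof (rule plug_skein[OF r _ _ sp])
    show "disc_embedding (\<lambda>z. z)" unfolding disc_embedding_iff using pisot_id by simp
    fix v assume v: "v \<in> {X_web True, id_web [Up, Up], H_web}"
    show "plug (ups 2) (ups 2) {} {} (\<lambda>z. z) v \<in> uwebs 2" unfolding p[OF v] using v w by blast
  qed simp
  hence c: "lw (X_web True) - (smul (q6 2) (lw (id_web [Up, Up])) - smul (q6 (- 1)) (lw H_web)) \<in> sk 2"
    unfolding r_def by (simp add: lin_ext_minus lin_ext_smul p)
  have a: "lw (X_web True) \<in> Sp 2" by (rule lw_Sp[OF w(1)])
  have b: "smul (q6 2) (lw (id_web [Up, Up])) - smul (q6 (- 1)) (lw H_web) \<in> Sp 2"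
    by (intro lin.span_diff lin.span_scale lw_Sp w)
  show ?thesis unfolding eq_in_Hom_def idu_def ups_simps(3) using a b c unfolding ups_simps(3) by (intro conjI)
qed

subsection \<open>Webs inside the strip of the end points\<close>

text \<open>There juxtaposition is a translation in units of the distance of neighbouring end points,
  so that it is strictly associative.\<close>

definition strip :: "nat \<Rightarrow> (complex \<times> complex) set \<Rightarrow> bool" where
  "strip n A \<longleftrightarrow> (\<forall>s\<in>A. \<forall>z\<in>{fst s, snd s}. 1 \<le> real (n + 1) * Re z \<and> real (n + 1) * Re z \<le> real n)"

definition shf :: "nat \<Rightarrow> nat \<Rightarrow> nat \<Rightarrow> complex \<Rightarrow> complex" where
  "shf k m N z = Complex ((real (m + 1) * Re z + real k) / real (N + 1)) (Im z)"

definition SW :: "nat \<Rightarrow> (complex \<times> complex) set \<Rightarrow> bool" where "SW n A \<longleftrightarrow> segs n A \<in> uwebs n \<and> strip n A"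

lemma aff_shf: "aff (shf k m N)"
  by (simp add: aff_def shf_def complex_eq_iff add_divide_distrib diff_divide_distrib algebra_simps)

lemma shf_shf: "shf k' N N' (shf k m N z) = shf (k' + k) m N' z"
  by (simp add: shf_def)

lemma h2_shf: "h2 (shf k' N N') ` h2 (shf k m N) ` A = h2 (shf (k' + k) m N') ` A"
  unfolding image_image by (simp add: h2_def shf_shf)

lemma shf_id: "h2 (shf 0 n n) ` A = A"
proof -
  have "real (n + 1) * Re z / real (n + 1) = Re z" for z by simp
  hence "shf 0 n n = (\<lambda>z. z)" by (simp add: fun_eq_iff shf_def del: of_nat_add of_nat_Suc)
  thus ?thesis by (simp add: h2_def)
qed

lemma strip_seg:
  assumes "strip n A" "s \<in> A" "z \<in> closed_segment (fst s) (snd s)"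
  shows "1 \<le> real (n + 1) * Re z" "real (n + 1) * Re z \<le> real n"
proof -
  have p: "0 < real (n + 1)" by simp
  have 1: "1 / real (n + 1) \<le> Re v" "Re v \<le> real n / real (n + 1)" if "v \<in> {fst s, snd s}" for v
  proof -
    have "1 \<le> real (n + 1) * Re v" "real (n + 1) * Re v \<le> real n" using assms(1,2) that unfolding strip_def by blast+
    thus "1 / real (n + 1) \<le> Re v" "Re v \<le> real n / real (n + 1)"
      unfolding pos_divide_le_eq[OF p] pos_le_divide_eq[OF p] by (simp_all only: mult.commute)
  qed
  have "1 / real (n + 1) \<le> Re z" "Re z \<le> real n / real (n + 1)"
    using seg_convex(7,8)[OF assms(3)] 1 by blast+
  thus "1 \<le> real (n + 1) * Re z" "real (n + 1) * Re z \<le> real n"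
    unfolding pos_divide_le_eq[OF p] pos_le_divide_eq[OF p] by (simp_all only: mult.commute)
qed

lemma lef_shf: "real (m + 1) * Re z \<le> real m \<Longrightarrow> lef m n z = shf 0 m (m + n) z"
proof -
  assume a: "real (m + 1) * Re z \<le> real m"
  have "min X ((X + c) / 2) = X" if "X \<le> c" for X c :: real using that by (simp add: min_def field_simps)
  from this[OF a] have "min (real (m + 1) * Re z) ((real (m + 1) * Re z + real m) / 2) = real (m + 1) * Re z" .
  thus ?thesis unfolding lef_def shf_def left_pos_eq by (simp only: of_nat_0 add_0_right)
qed

lemma rig_shf: "1 \<le> real (n + 1) * Re z \<Longrightarrow> rig m n z = shf m n (m + n) z"
proof -
  assume a: "1 \<le> real (n + 1) * Re z"
  have "max X ((X + 1) / 2) = X" if "1 \<le> X" for X :: real using that by (simp add: max_def field_simps)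
  from this[OF a] have "max (real (n + 1) * Re z) ((real (n + 1) * Re z + 1) / 2) = real (n + 1) * Re z" .
  thus ?thesis unfolding rig_def shf_def right_pos_eq by (simp only: add.commute[of "real m"])
qed

text \<open>Inside the strip the minimum and the maximum in \<open>left_pos\<close> and
  \<open>right_pos\<close> always select the same linear branch, so both maps are translations after
  scaling.\<close>

lemma juxt_segs:
  assumes A: "SW m A" and B: "SW n B"
  shows "juxtapose_web (segs m A) (segs n B) = segs (m + n) (h2 (shf 0 m (m + n)) ` A \<union> h2 (shf m n (m + n)) ` B)"
    "SW (m + n) (h2 (shf 0 m (m + n)) ` A \<union> h2 (shf m n (m + n)) ` B)"
proof -
  have w: "segs m A \<in> uwebs m" "segs n B \<in> uwebs n" using A B unfolding SW_def by blast+
  have l: "map_darc (lef m n) ` seg ` A = map_darc (shf 0 m (m + n)) ` seg ` A"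
    by (rule image_map_darc_cong)
       (use A lef_shf strip_seg(2) esysD(2)[OF websD(1)[OF w(1)]] in \<open>auto simp: SW_def segs_def\<close>)
  have r: "map_darc (rig m n) ` seg ` B = map_darc (shf m n (m + n)) ` seg ` B"
    by (rule image_map_darc_cong)
       (use B rig_shf strip_seg(1) esysD(2)[OF websD(1)[OF w(2)]] in \<open>auto simp: SW_def segs_def\<close>)
  show 1: "juxtapose_web (segs m A) (segs n B) = segs (m + n) (h2 (shf 0 m (m + n)) ` A \<union> h2 (shf m n (m + n)) ` B)"
    unfolding juxtapose_web_glue[OF w] glue_web_def
    using l r by (simp add: segs_def map_overs_def image_Un aff_segs[OF aff_shf])
  have p: "real (m + n + 1) * Re (shf k j (m + n) z) = real (j + 1) * Re z + real k" for k j z by (simp add: shf_def)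
  have "strip (m + n) (h2 (shf 0 m (m + n)) ` A \<union> h2 (shf m n (m + n)) ` B)"
    unfolding strip_def
  proof (intro ballI)
    fix s z assume "s \<in> h2 (shf 0 m (m + n)) ` A \<union> h2 (shf m n (m + n)) ` B" and z: "z \<in> {fst s, snd s}"
    then consider (a) a where "a \<in> A" "s = h2 (shf 0 m (m + n)) a" | (b) b where "b \<in> B" "s = h2 (shf m n (m + n)) b" by blast
    thus "1 \<le> real (m + n + 1) * Re z \<and> real (m + n + 1) * Re z \<le> real (m + n)"
    proof cases
      case a
      then obtain v where "v \<in> {fst a, snd a}" "z = shf 0 m (m + n) v" using z by (auto simp: h2_def)
      moreover have "1 \<le> real (m + 1) * Re v \<and> real (m + 1) * Re v \<le> real m" using A a(1) calculation(1) unfolding SW_def strip_def by blast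
      ultimately show ?thesis using p[of 0 m v] by simp
    next
      case b
      then obtain v where "v \<in> {fst b, snd b}" "z = shf m n (m + n) v" using z by (auto simp: h2_def)
      moreover have "1 \<le> real (n + 1) * Re v \<and> real (n + 1) * Re v \<le> real n" using B b(1) calculation(1) unfolding SW_def strip_def by blast
      ultimately show ?thesis using p[of m n v] by simp
    qed
  qed
  thus "SW (m + n) (h2 (shf 0 m (m + n)) ` A \<union> h2 (shf m n (m + n)) ` B)"
    unfolding SW_def using juxtapose_webs[OF w] 1 by simp
qed

lemma SW_stack:
  assumes "SW n A" "SW n B"
  shows "stack_web (segs n A) (segs n B) = segs n (h2 lo ` B \<union> h2 hi ` A)" "SW n (h2 lo ` B \<union> h2 hi ` A)"
proof -
  show 1: "stack_web (segs n A) (segs n B) = segs n (h2 lo ` B \<union> h2 hi ` A)" by (rule stack_segs)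
  have "strip n (h2 lo ` B \<union> h2 hi ` A)" using assms unfolding SW_def strip_def by (auto simp: h2_def)
  thus "SW n (h2 lo ` B \<union> h2 hi ` A)" unfolding SW_def using 1 stack_webs[of "segs n A" n "segs n B"] assms by (simp add: SW_def)
qed

definition SWs :: "nat \<Rightarrow> web set" where "SWs n = segs n ` {A. SW n A}"

abbreviation SS :: "nat \<Rightarrow> lweb set" where "SS n \<equiv> lin.span (lw ` SWs n)"

lemma SS_Sp: "x \<in> SS n \<Longrightarrow> x \<in> Sp n"
proof -
  have "lw ` SWs n \<subseteq> lw ` uwebs n" unfolding SWs_def SW_def by blast
  thus "x \<in> SS n \<Longrightarrow> x \<in> Sp n" using lin.span_mono by blast
qed

lemma SS_lw: "SW n A \<Longrightarrow> lw (segs n A) \<in> SS n"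
  by (rule lin.span_base) (simp add: SWs_def)

lemma SS_wtens: "x \<in> SS m \<Longrightarrow> y \<in> SS n \<Longrightarrow> x \<otimes> y \<in> SS (m + n)"
proof -
  assume x: "x \<in> SS m" and y: "y \<in> SS n"
  show "x \<otimes> y \<in> SS (m + n)"
    using x
  proof (rule span_sum_rep)
    fix v assume "v \<in> SWs m"
    then obtain A where A: "SW m A" "v = segs m A" unfolding SWs_def by blast
    show "lw v \<otimes> y \<in> SS (m + n)"
      using y
    proof (rule span_sum_rep)
      fix w assume "w \<in> SWs n"
      then obtain B where B: "SW n B" "w = segs n B" unfolding SWs_def by blast
      show "lw v \<otimes> lw w \<in> SS (m + n)" unfolding A(2) B(2) wtens_lw juxt_segs(1)[OF A(1) B(1)] by (rule SS_lw[OF juxt_segs(2)[OF A(1) B(1)]])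
    qed (simp_all add: wtens_linear lin.span_zero lin.span_add lin.span_scale)
  qed (simp_all add: wtens_linear lin.span_zero lin.span_add lin.span_scale)
qed

lemma SS_wcomp: "x \<in> SS n \<Longrightarrow> y \<in> SS n \<Longrightarrow> x \<odot> y \<in> SS n"
proof -
  assume x: "x \<in> SS n" and y: "y \<in> SS n"
  show "x \<odot> y \<in> SS n"
    using x
  proof (rule span_sum_rep)
    fix v assume "v \<in> SWs n"
    then obtain A where A: "SW n A" "v = segs n A" unfolding SWs_def by blast
    show "lw v \<odot> y \<in> SS n"
      using y
    proof (rule span_sum_rep)
      fix w assume "w \<in> SWs n"
      then obtain B where B: "SW n B" "w = segs n B" unfolding SWs_def by blast
      show "lw v \<odot> lw w \<in> SS n" unfolding A(2) B(2) wcomp_lw SW_stack(1)[OF A(1) B(1)] by (rule SS_lw[OF SW_stack(2)[OF A(1) B(1)]])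
    qed (simp_all add: wcomp_linear lin.span_zero lin.span_add lin.span_scale)
  qed (simp_all add: wcomp_linear lin.span_zero lin.span_add lin.span_scale)
qed

lemma wtens_assoc:
  assumes "x \<in> SS a" "y \<in> SS b" "z \<in> SS c"
  shows "(x \<otimes> y) \<otimes> z = x \<otimes> (y \<otimes> z)"
proof (rule span_eq[OF assms(1)])
  fix u assume "u \<in> SWs a"
  then obtain A where A: "SW a A" "u = segs a A" unfolding SWs_def by blast
  show "(lw u \<otimes> y) \<otimes> z = lw u \<otimes> (y \<otimes> z)"
  proof (rule span_eq[OF assms(2)])
    fix v assume "v \<in> SWs b"
    then obtain B where B: "SW b B" "v = segs b B" unfolding SWs_def by blast
    show "(lw u \<otimes> lw v) \<otimes> z = lw u \<otimes> (lw v \<otimes> z)"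
    proof (rule span_eq[OF assms(3)])
      fix w assume "w \<in> SWs c"
      then obtain C where C: "SW c C" "w = segs c C" unfolding SWs_def by blast
      note AB = juxt_segs[OF A(1) B(1)] and BC = juxt_segs[OF B(1) C(1)]
      show "(lw u \<otimes> lw v) \<otimes> lw w = lw u \<otimes> (lw v \<otimes> lw w)"
        unfolding A(2) B(2) C(2) wtens_lw AB(1) BC(1) juxt_segs(1)[OF AB(2) C(1)] juxt_segs(1)[OF A(1) BC(2)]
        by (simp add: image_Un h2_shf Un_assoc add.assoc)
    qed (simp_all add: wtens_linear)
  qed (simp_all add: wtens_linear)
qed (simp_all add: wtens_linear)

definition idset :: "nat \<Rightarrow> (complex \<times> complex) set" where "idset n = (\<lambda>i. (bpt n i, tpt n i)) ` {..<n}"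

lemma idu_segs: "idu n = lw (segs n (idset n))"
  by (simp add: idu_def id_web_segs idset_def)

lemma shf_bpt: "shf 0 m (m + n) (bpt m i) = bpt (m + n) i" "shf 0 m (m + n) (tpt m i) = tpt (m + n) i"
  "shf m n (m + n) (bpt n i) = bpt (m + n) (m + i)" "shf m n (m + n) (tpt n i) = tpt (m + n) (m + i)"
  by (simp_all add: shf_def complex_eq_iff add.commute)

lemma idset_add: "h2 (shf 0 m (m + n)) ` idset m \<union> h2 (shf m n (m + n)) ` idset n = idset (m + n)"
proof -
  have "{..<m + n} = {..<m} \<union> (\<lambda>i. m + i) ` {..<n}"
  proof (intro set_eqI iffI)
    fix i assume "i \<in> {..<m + n}"
    thus "i \<in> {..<m} \<union> (\<lambda>i. m + i) ` {..<n}" by (cases "i < m") (auto intro!: image_eqI[of _ _ "i - m"])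
  qed auto
  thus ?thesis unfolding idset_def image_image by (simp only: h2_simp shf_bpt image_Un image_image)
qed

lemma SW_0: "SW 0 {}"
  using seg_check_webs[of 0 "[]"] by (simp add: SW_def strip_def seg_check_def)

lemma SW_1: "SW 1 (idset 1)"
proof -
  have e: "idset 1 = set [(Complex (1/2) 0, Complex (1/2) 1)]" by (simp add: idset_def bpt_def tpt_def lessThan_Suc)
  have "segs 1 (idset 1) \<in> uwebs 1" unfolding e
    by (rule seg_check_webs) (simp add: seg_check_def indeg_def outdeg_def bpt_def tpt_def upt_rec)
  thus ?thesis unfolding SW_def e by (simp add: strip_def)
qed

lemma SW_id: "SW n (idset n)"
proof (induction n)
  case 0
  thus ?case using SW_0 by (simp add: idset_def)
next
  case (Suc n)
  thus ?case using juxt_segs(2)[OF Suc SW_1] unfolding idset_add by simp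
qed

lemma idu_SS: "idu n \<in> SS n"
  unfolding idu_segs by (rule SS_lw[OF SW_id])

lemma idu_add: "idu m \<otimes> idu n = idu (m + n)"
  unfolding idu_segs wtens_lw juxt_segs(1)[OF SW_id SW_id] idset_add ..

lemma idu_0_wtens:
  assumes "x \<in> SS n"
  shows "idu 0 \<otimes> x = x" "x \<otimes> idu 0 = x"
proof -
  have i: "idset 0 = {}" by (simp add: idset_def)
  have "idu 0 \<otimes> x = x \<and> x \<otimes> idu 0 = x"
    using assms
  proof (rule span_sum_rep)
    fix w assume "w \<in> SWs n"
    then obtain A where A: "SW n A" "w = segs n A" unfolding SWs_def by blast
    show "idu 0 \<otimes> lw w = lw w \<and> lw w \<otimes> idu 0 = lw w"
      using juxt_segs(1)[OF SW_0 A(1)] juxt_segs(1)[OF A(1) SW_0] unfolding idu_segs i A(2) by (simp add: shf_id)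
  qed (simp_all add: wtens_linear)
  thus "idu 0 \<otimes> x = x" "x \<otimes> idu 0 = x" by blast+
qed

lemma SW_H: "SW 2 (set HL)"
  unfolding SW_def using HL_webs by (simp add: strip_def HL_def)

lemma H_SS: "lw H_web \<in> SS 2"
  unfolding H_web_segs by (rule SS_lw[OF SW_H])

text \<open>One strand stacked on itself is an edge cut at height 1/2; the interchange law extends
  this to \<open>n\<close> strands.\<close>

lemma id_id: "heq n (idu n \<odot> idu n) (idu n)"
proof (induction n)
  case 0
  have e: "idu 0 \<odot> idu 0 = idu 0" by (simp add: idu_segs idset_def stack_segs)
  show ?case unfolding e by (rule heq_refl[OF SS_Sp[OF idu_SS]])
next
  case (Suc n)
  have e: "idset 1 = set [(Complex (1/2) 0, Complex (1/2) 1)]" by (simp add: idset_def bpt_def tpt_def lessThan_Suc)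
  have w: "segs 1 (set [(Complex (1/2) 0, Complex (1/2) 1)]) \<in> uwebs 1" using SW_1 unfolding SW_def e by blast
  have "cuts [1/2] [(Complex (1/2) 0, Complex (1/2) 1)] = stackl [(Complex (1/2) 0, Complex (1/2) 1)] [(Complex (1/2) 0, Complex (1/2) 1)]"
    by (simp add: cut1_def stackl_def lo_def hi_def Let_def)
  hence 1: "heq 1 (idu 1 \<odot> idu 1) (idu 1)"
    using heq_sym[OF heq_cuts[OF w, of "[1/2]", THEN conjunct2]] unfolding idu_segs e wcomp_segs by simp
  have "idu (n + 1) \<odot> idu (n + 1) = (idu n \<odot> idu n) \<otimes> (idu 1 \<odot> idu 1)"
    unfolding idu_add[symmetric] by (rule interchange) (rule SS_Sp[OF idu_SS])+
  thus ?case using wtens_cong[OF Suc 1] unfolding idu_add by simp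
qed

subsection \<open>Elements on which the identity acts as a unit\<close>

text \<open>For an arbitrary web the unit law would require an isotopy that straightens its ends.
  Taken as a defining property it is checked only for \<open>H_web\<close> and the identity, and all
  operations inherit it.\<close>

definition unital :: "nat \<Rightarrow> lweb set" where
  "unital n = {x \<in> SS n. heq n (idu n \<odot> x) x \<and> heq n (x \<odot> idu n) x}"

lemma unitalD: "x \<in> unital n \<Longrightarrow> x \<in> SS n" "x \<in> unital n \<Longrightarrow> x \<in> Sp n" "x \<in> unital n \<Longrightarrow> heq n (idu n \<odot> x) x" "x \<in> unital n \<Longrightarrow> heq n (x \<odot> idu n) x"
  by (auto simp: unital_def SS_Sp)

lemma idu_Sp: "idu n \<in> Sp n" by (rule SS_Sp[OF idu_SS])

lemma unital_0: "0 \<in> unital n"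
  by (simp add: unital_def lin.span_zero wcomp_linear heq_zero)

lemma unital_idu: "idu n \<in> unital n"
  by (simp add: unital_def idu_SS id_id)

lemma unital_add: "x \<in> unital n \<Longrightarrow> y \<in> unital n \<Longrightarrow> x + y \<in> unital n"
  by (simp add: unital_def lin.span_add wcomp_linear heq_add)

lemma unital_smul: "x \<in> unital n \<Longrightarrow> smul c x \<in> unital n"
  by (simp add: unital_def lin.span_scale wcomp_linear heq_smul)

lemma unital_minus: "x \<in> unital n \<Longrightarrow> y \<in> unital n \<Longrightarrow> x - y \<in> unital n"
  by (simp add: unital_def lin.span_diff wcomp_linear heq_minus)

lemma unital_wcomp:
  assumes x: "x \<in> unital n" and y: "y \<in> unital n"
  shows "x \<odot> y \<in> unital n"
proof -
  note X = unitalD[OF x] and Y = unitalD[OF y]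
  have "heq n (idu n \<odot> (x \<odot> y)) (x \<odot> y)"
    by (rule heq_trans[OF heq_sym[OF wcomp_assoc[OF idu_Sp X(2) Y(2)]] wcomp_cong[OF X(3) heq_refl[OF Y(2)]]])
  moreover have "heq n ((x \<odot> y) \<odot> idu n) (x \<odot> y)"
    by (rule heq_trans[OF wcomp_assoc[OF X(2) Y(2) idu_Sp] wcomp_cong[OF heq_refl[OF X(2)] Y(4)]])
  ultimately show ?thesis unfolding unital_def using SS_wcomp[OF X(1) Y(1)] by blast
qed

lemma unital_wtens:
  assumes x: "x \<in> unital m" and y: "y \<in> unital n"
  shows "x \<otimes> y \<in> unital (m + n)"
proof -
  note X = unitalD[OF x] and Y = unitalD[OF y]
  have "heq (m + n) (idu (m + n) \<odot> (x \<otimes> y)) (x \<otimes> y)" "heq (m + n) ((x \<otimes> y) \<odot> idu (m + n)) (x \<otimes> y)"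
    unfolding idu_add[symmetric] interchange[OF idu_Sp idu_Sp X(2) Y(2)] interchange[OF X(2) Y(2) idu_Sp idu_Sp]
    by (rule wtens_cong[OF X(3) Y(3)], rule wtens_cong[OF X(4) Y(4)])
  thus ?thesis unfolding unital_def using SS_wtens[OF X(1) Y(1)] by blast
qed

lemma idu_2_segs: "idu 2 = lw (segs 2 (set IL2))"
  by (simp add: idu_def id_web_2_segs)

lemma H_unital: "lw H_web \<in> unital 2"
  unfolding unital_def using id_H H_id H_SS unfolding idu_2_segs H_web_segs by blast

subsection \<open>Relations of the generators\<close>

lemma wtens_interchange:
  assumes "a \<in> unital m" "b \<in> unital n"
  shows "heq (m + n) ((a \<otimes> idu n) \<odot> (idu m \<otimes> b)) (a \<otimes> b)" "heq (m + n) ((idu m \<otimes> b) \<odot> (a \<otimes> idu n)) (a \<otimes> b)"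
  unfolding interchange[OF unitalD(2)[OF assms(1)] idu_Sp idu_Sp unitalD(2)[OF assms(2)]] interchange[OF idu_Sp unitalD(2)[OF assms(2)] unitalD(2)[OF assms(1)] idu_Sp]
  by (rule wtens_cong[OF unitalD(4)[OF assms(1)] unitalD(3)[OF assms(2)]], rule wtens_cong[OF unitalD(3)[OF assms(1)] unitalD(4)[OF assms(2)]])

lemma pad_wcomp:
  assumes "x \<in> Sp m" "y \<in> Sp m"
  shows "heq (p + (m + r)) ((idu p \<otimes> (x \<otimes> idu r)) \<odot> (idu p \<otimes> (y \<otimes> idu r))) (idu p \<otimes> ((x \<odot> y) \<otimes> idu r))"
  unfolding interchange[OF idu_Sp wtens_Sp[OF assms(1) idu_Sp] idu_Sp wtens_Sp[OF assms(2) idu_Sp]] interchange[OF assms(1) idu_Sp assms(2) idu_Sp]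
  by (intro wtens_cong id_id heq_refl wcomp_Sp assms)

lemma pad_cong: "heq m x y \<Longrightarrow> heq (p + (m + r)) (idu p \<otimes> (x \<otimes> idu r)) (idu p \<otimes> (y \<otimes> idu r))"
  by (intro wtens_cong heq_refl idu_Sp)

lemma pad_Sp: "x \<in> Sp m \<Longrightarrow> idu p \<otimes> (x \<otimes> idu r) \<in> Sp (p + (m + r))"
  by (intro wtens_Sp idu_Sp)

lemma Hgen_unital: "0 < i \<Longrightarrow> i < n \<Longrightarrow> Hgen n i \<in> unital n"
proof -
  assume i: "0 < i" "i < n"
  have n: "i - 1 + (2 + (n - i - 1)) = n" using i by simp
  show ?thesis
    using unital_wtens[OF unital_idu[of "i - 1"] unital_wtens[OF H_unital unital_idu[of "n - i - 1"]]] unfolding n Hgen_def .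
qed

lemma Hgen_left: "0 < i \<Longrightarrow> idu k \<otimes> Hgen m i = Hgen (k + m) (k + i)"
  unfolding Hgen_def wtens_assoc[OF idu_SS idu_SS SS_wtens[OF H_SS idu_SS], symmetric] idu_add by simp

lemma Hgen_right: "i < m \<Longrightarrow> Hgen m i \<otimes> idu k = Hgen (m + k) i"
  unfolding Hgen_def wtens_assoc[OF idu_SS SS_wtens[OF H_SS idu_SS] idu_SS] wtens_assoc[OF H_SS idu_SS idu_SS] idu_add
  by (simp add: add.commute)

lemma Hgen_H: "Hgen 2 1 = lw H_web"
  unfolding Hgen_def by (simp add: idu_0_wtens[OF H_SS])

lemma Hgen_quad: "0 < i \<Longrightarrow> i < n \<Longrightarrow> heq n (Hgen n i \<odot> Hgen n i) (smul (qint 2) (Hgen n i))"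
proof -
  assume i: "0 < i" "i < n"
  have n: "i - 1 + (2 + (n - i - 1)) = n" using i by simp
  have HH: "heq 2 (lw H_web \<odot> lw H_web) (smul (qint 2) (lw H_web))" unfolding H_web_segs by (rule H_H)
  have "heq n (Hgen n i \<odot> Hgen n i) (idu (i - 1) \<otimes> (smul (qint 2) (lw H_web) \<otimes> idu (n - i - 1)))"
    using heq_trans[OF pad_wcomp[OF SS_Sp[OF H_SS] SS_Sp[OF H_SS]] pad_cong[OF HH], of "i - 1" "n - i - 1"] unfolding n Hgen_def .
  thus ?thesis by (simp add: Hgen_def wtens_linear)
qed

text \<open>The strands are split behind strand \<open>i + 1\<close>. The generators become
  \<open>a \<otimes> idu\<close> and \<open>idu \<otimes> b\<close>, and both orders are equal to
  \<open>a \<otimes> b\<close>.\<close>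

lemma Hgen_far: "0 < i \<Longrightarrow> i + 1 < j \<Longrightarrow> j < n \<Longrightarrow> heq n (Hgen n i \<odot> Hgen n j) (Hgen n j \<odot> Hgen n i)"
proof -
  assume i: "0 < i" "i + 1 < j" "j < n"
  have 1: "Hgen n i = Hgen (i + 1) i \<otimes> idu (n - i - 1)" using Hgen_right[of i "i + 1" "n - i - 1"] i by simp
  have 2: "Hgen n j = idu (i + 1) \<otimes> Hgen (n - i - 1) (j - i - 1)" using Hgen_left[of "j - i - 1" "i + 1" "n - i - 1"] i by simp
  have a: "Hgen (i + 1) i \<in> unital (i + 1)" "Hgen (n - i - 1) (j - i - 1) \<in> unital (n - i - 1)" using i by (auto intro!: Hgen_unital)
  have n: "i + 1 + (n - i - 1) = n" using i by simp
  show ?thesis using heq_trans[OF wtens_interchange(1)[OF a] heq_sym[OF wtens_interchange(2)[OF a]]] unfolding n 1 2 .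
qed

lemma Hgen_3: "Hgen 3 1 = lw (segs 3 (set H1L))" "Hgen 3 2 = lw (segs 3 (set H2L))"
proof -
  have 1: "Hgen 3 1 = lw H_web \<otimes> idu 1" "Hgen 3 2 = idu 1 \<otimes> lw H_web"
    unfolding Hgen_def by (simp_all add: idu_0_wtens[OF SS_wtens[OF H_SS idu_SS]] idu_0_wtens[OF H_SS])
  have e: "idset 1 = set [(Complex (1/2) 0, Complex (1/2) 1)]" by (simp add: idset_def bpt_def tpt_def lessThan_Suc)
  have "h2 (shf 0 2 3) ` set HL \<union> h2 (shf 2 1 3) ` idset 1 = set H1L" "h2 (shf 0 1 3) ` idset 1 \<union> h2 (shf 1 2 3) ` set HL = set H2L"
    unfolding e by (simp_all add: HL_def H1L_def H2L_def shf_def insert_commute)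
  moreover have n: "2 + 1 = (3 :: nat)" "1 + 2 = (3 :: nat)" by simp_all
  ultimately show "Hgen 3 1 = lw (segs 3 (set H1L))" "Hgen 3 2 = lw (segs 3 (set H2L))"
    using juxt_segs(1)[OF SW_H SW_1, unfolded n] juxt_segs(1)[OF SW_1 SW_H, unfolded n]
    unfolding 1 H_web_segs idu_segs wtens_lw by (simp_all only:)
qed

lemma Hgen_braid:
  assumes i: "0 < i" "i + 1 < n"
  shows "heq n (Hgen n i \<odot> (Hgen n (i + 1) \<odot> Hgen n i) - Hgen n i) (Hgen n (i + 1) \<odot> (Hgen n i \<odot> Hgen n (i + 1)) - Hgen n (i + 1))"
proof -
  define p r where "p = i - 1" and "r = n - i - 2"
  have n: "p + (3 + r) = n" using i by (simp add: p_def r_def)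
  define pad where "pad x = idu p \<otimes> (x \<otimes> idu r)" for x
  have H: "Hgen n i = pad (Hgen 3 1)" "Hgen n (i + 1) = pad (Hgen 3 2)"
    unfolding pad_def using i by (simp_all add: Hgen_right Hgen_left p_def r_def)
  have S: "Hgen 3 1 \<in> Sp 3" "Hgen 3 2 \<in> Sp 3" by (rule unitalD(2), rule Hgen_unital, simp_all)+
  have c: "heq n (pad x \<odot> pad y) (pad (x \<odot> y))" if "x \<in> Sp 3" "y \<in> Sp 3" for x y
    using pad_wcomp[OF that, of p r] unfolding n pad_def .
  have pS: "pad x \<in> Sp n" if "x \<in> Sp 3" for x using pad_Sp[OF that, of p r] unfolding n pad_def .
  have m: "pad (x - y) = pad x - pad y" for x y by (simp add: pad_def wtens_linear)
  have t: "heq n (pad x \<odot> (pad y \<odot> pad x) - pad x) (pad (x \<odot> (y \<odot> x) - x))" if x: "x \<in> Sp 3" and y: "y \<in> Sp 3" for x y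
    unfolding m by (rule heq_minus[OF heq_trans[OF wcomp_cong[OF heq_refl[OF pS[OF x]] c[OF y x]] c[OF x wcomp_Sp[OF y x]]] heq_refl[OF pS[OF x]]])
  have b: "heq n (pad (Hgen 3 1 \<odot> (Hgen 3 2 \<odot> Hgen 3 1) - Hgen 3 1)) (pad (Hgen 3 2 \<odot> (Hgen 3 1 \<odot> Hgen 3 2) - Hgen 3 2))"
    using pad_cong[OF braid_segs, of p r] unfolding n pad_def Hgen_3 .
  show ?thesis unfolding H by (rule heq_trans[OF t[OF S] heq_trans[OF b heq_sym[OF t[OF S(2,1)]]]])
qed

subsection \<open>The ring of the skein modules\<close>

text \<open>All \<open>Hom(+^n, +^n)\<close> are collected into one ring.  The additional component in the ground
  field only serves to make \<open>0 \<noteq> 1\<close> obvious, as the type class requires.\<close>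

definition hrel :: "(nat \<Rightarrow> lweb) \<times> K \<Rightarrow> (nat \<Rightarrow> lweb) \<times> K \<Rightarrow> bool" where
  "hrel x y \<longleftrightarrow> (\<forall>n. fst x n \<in> unital n \<and> fst y n \<in> unital n \<and> heq n (fst x n) (fst y n)) \<and> snd x = snd y"

quotient_type hring = "(nat \<Rightarrow> lweb) \<times> K" / partial: hrel
proof (rule part_equivpI)
  show "\<exists>x. hrel x x" by (rule exI[of _ "(\<lambda>_. 0, 0)"]) (simp add: hrel_def unital_0 heq_zero)
  show "symp hrel" by (rule sympI) (simp add: hrel_def heq_sym)
  show "transp hrel" by (rule transpI) (auto simp: hrel_def intro: heq_trans)
qed

lemma hrel_refl: "(\<And>n. f n \<in> unital n) \<Longrightarrow> hrel (f, c) (f, c)"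
  by (simp add: hrel_def heq_refl unitalD(2))

definition hcl :: "(nat \<Rightarrow> lweb) \<Rightarrow> K \<Rightarrow> hring" where "hcl f c = abs_hring (f, c)"

lemma hcl_eqI:
  assumes "\<And>n. f n \<in> unital n" "\<And>n. g n \<in> unital n" "\<And>n. heq n (f n) (g n)" "c = d"
  shows "hcl f c = hcl g d"
  unfolding hcl_def by (rule Quotient_rel_abs[OF Quotient_hring]) (simp add: hrel_def assms)

lemma hcl_eqD:
  assumes "hcl f c = hcl g d" "\<And>n. f n \<in> unital n" "\<And>n. g n \<in> unital n"
  shows "heq n (f n) (g n)"
proof -
  have "hrel (f, c) (g, d)"
    using assms Quotient_rel[OF Quotient_hring, of "(f, c)" "(g, d)"] by (simp add: hcl_def hrel_refl)
  thus ?thesis by (simp add: hrel_def)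
qed

lemma hcl_cases:
  obtains f c where "x = hcl f c" "\<And>n. f n \<in> unital n"
proof -
  have "\<exists>f c. x = hcl f c \<and> (\<forall>n. f n \<in> unital n)"
  proof (induction x rule: hring.abs_induct)
    case (1 y)
    thus ?case unfolding hcl_def by (intro exI[of _ "fst y"] exI[of _ "snd y"]) (simp add: hrel_def)
  qed
  thus ?thesis using that by blast
qed

instantiation hring :: ring_1
begin

lift_definition zero_hring :: hring is "(\<lambda>_. 0, 0)" by (simp add: hrel_def unital_0 heq_zero)
lift_definition one_hring :: hring is "(idu, 1)" by (simp add: hrel_def unital_idu heq_refl idu_Sp)
lift_definition plus_hring :: "hring \<Rightarrow> hring \<Rightarrow> hring" is "\<lambda>x y. (\<lambda>n. fst x n + fst y n, snd x + snd y)"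
  by (simp add: hrel_def unital_add heq_add)
lift_definition minus_hring :: "hring \<Rightarrow> hring \<Rightarrow> hring" is "\<lambda>x y. (\<lambda>n. fst x n - fst y n, snd x - snd y)"
  by (simp add: hrel_def unital_minus heq_minus)
lift_definition uminus_hring :: "hring \<Rightarrow> hring" is "\<lambda>x. (\<lambda>n. smul (- 1) (fst x n), - snd x)"
  by (simp only: hrel_def fst_conv snd_conv unital_smul heq_smul simp_thms)
lift_definition times_hring :: "hring \<Rightarrow> hring \<Rightarrow> hring" is "\<lambda>x y. (\<lambda>n. fst x n \<odot> fst y n, snd x * snd y)"
  by (simp add: hrel_def unital_wcomp wcomp_cong)

lemma hcl_ops:
  "0 = hcl (\<lambda>_. 0) 0" "1 = hcl idu 1"
  "(\<And>n. f n \<in> unital n) \<Longrightarrow> (\<And>n. g n \<in> unital n) \<Longrightarrow> hcl f c + hcl g d = hcl (\<lambda>n. f n + g n) (c + d)"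
  "(\<And>n. f n \<in> unital n) \<Longrightarrow> (\<And>n. g n \<in> unital n) \<Longrightarrow> hcl f c - hcl g d = hcl (\<lambda>n. f n - g n) (c - d)"
  "(\<And>n. f n \<in> unital n) \<Longrightarrow> - hcl f c = hcl (\<lambda>n. smul (- 1) (f n)) (- c)"
  "(\<And>n. f n \<in> unital n) \<Longrightarrow> (\<And>n. g n \<in> unital n) \<Longrightarrow> hcl f c * hcl g d = hcl (\<lambda>n. f n \<odot> g n) (c * d)"
  unfolding hcl_def
  by (simp_all add: zero_hring.abs_eq one_hring.abs_eq plus_hring.abs_eq minus_hring.abs_eq uminus_hring.abs_eq times_hring.abs_eq hrel_refl)

instance
proof
  fix x y z :: hring
  obtain f c where x: "x = hcl f c" and f: "\<And>n. f n \<in> unital n" by (rule hcl_cases[of x]) blast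
  obtain g d where y: "y = hcl g d" and g: "\<And>n. g n \<in> unital n" by (rule hcl_cases[of y]) blast
  obtain k e where z: "z = hcl k e" and k: "\<And>n. k n \<in> unital n" by (rule hcl_cases[of z]) blast
  have mf: "- f n \<in> unital n" "- g n \<in> unital n" for n using unital_smul[OF f, of "- 1" n] unital_smul[OF g, of "- 1" n] by simp_all
  note u = f g k mf unital_add unital_minus unital_smul unital_wcomp unital_0 unital_idu
  have fgk: "f n \<in> Sp n" "g n \<in> Sp n" "k n \<in> Sp n" for n using f g k unitalD(2) by blast+
  show "x + y + z = x + (y + z)" by (simp add: x y z hcl_ops u add.assoc)
  show "x + y = y + x" by (simp add: x y hcl_ops u add.commute)
  show "0 + x = x" by (simp add: x hcl_ops u)
  show "- x + x = 0" by (simp add: x hcl_ops u)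
  show "x - y = x + - y" by (simp add: x y hcl_ops u)
  show "x * y * z = x * (y * z)"
    unfolding x y z by (simp add: hcl_ops u) (rule hcl_eqI; simp add: u wcomp_assoc fgk mult.assoc)
  show "1 * x = x" unfolding x by (simp add: hcl_ops u) (rule hcl_eqI; simp add: u unitalD(3)[OF f])
  show "x * 1 = x" unfolding x by (simp add: hcl_ops u) (rule hcl_eqI; simp add: u unitalD(4)[OF f])
  show "(x + y) * z = x * z + y * z" by (simp add: x y z hcl_ops u wcomp_linear distrib_right)
  show "x * (y + z) = x * y + x * z" by (simp add: x y z hcl_ops u wcomp_linear distrib_left)
  show "(0 :: hring) \<noteq> 1"
  proof
    assume "(0 :: hring) = 1"
    hence "hrel (\<lambda>_. 0, 0) (idu, 1)"
      using Quotient_rel[OF Quotient_hring, of "(\<lambda>_. 0, 0)" "(idu, 1)"] by (simp add: hcl_ops hcl_def hrel_refl unital_0 unital_idu)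
    thus False by (simp add: hrel_def)
  qed
qed

end

lift_definition hscl :: "K \<Rightarrow> hring \<Rightarrow> hring" is "\<lambda>c x. (\<lambda>n. smul c (fst x n), c * snd x)"
  by (simp add: hrel_def unital_smul heq_smul)

lemma hcl_scl: "(\<And>n. f n \<in> unital n) \<Longrightarrow> hscl a (hcl f c) = hcl (\<lambda>n. smul a (f n)) (a * c)"
  unfolding hcl_def by (simp add: hscl.abs_eq hrel_refl)

text \<open>The only component that can be nonzero is the one in degree \<open>n\<close>; in all
  other degrees the Hecke relations read \<open>0 = 0\<close>.\<close>

definition hgen :: "nat \<Rightarrow> nat \<Rightarrow> hring" where
  "hgen n i = hcl (\<lambda>m. if m = n \<and> 0 < i \<and> i < n then Hgen n i else 0) 0"

lemma hgen_unital: "(if m = n \<and> 0 < i \<and> i < n then Hgen n i else 0) \<in> unital m"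
  by (simp add: Hgen_unital unital_0)

lemma hecke_hgen: "hecke hscl (hgen n) n"
proof
  fix x y :: hring and c d :: K
  obtain f a where x: "x = hcl f a" and f: "\<And>n. f n \<in> unital n" by (rule hcl_cases[of x]) blast
  obtain g b where y: "y = hcl g b" and g: "\<And>n. g n \<in> unital n" by (rule hcl_cases[of y]) blast
  note u = f g unital_add unital_smul unital_wcomp
  show "hscl c (x + y) = hscl c x + hscl c y" by (simp add: x y hcl_ops hcl_scl u lin.scale_right_distrib distrib_left)
  show "hscl (c + d) x = hscl c x + hscl d x" by (simp add: x hcl_ops hcl_scl u lin.scale_left_distrib distrib_right)
  show "hscl c (hscl d x) = hscl (c * d) x" by (simp add: x hcl_scl u mult.assoc)
  show "hscl 1 x = x" by (simp add: x hcl_scl u)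
  show "hscl c x * y = hscl c (x * y)" by (simp add: x y hcl_ops hcl_scl u wcomp_linear mult.assoc)
  show "x * hscl c y = hscl c (x * y)" by (simp add: x y hcl_ops hcl_scl u wcomp_linear mult.left_commute)
next
  fix i
  show "hgen n i * hgen n i = hscl (qint 2) (hgen n i)"
    unfolding hgen_def hcl_ops(6)[OF hgen_unital hgen_unital] hcl_scl[OF hgen_unital]
    by (rule hcl_eqI) (auto simp: Hgen_unital unital_wcomp unital_smul unital_0 Hgen_quad wcomp_linear heq_zero)
  show "i = 0 \<or> n \<le> i \<Longrightarrow> hgen n i = 0"
    unfolding hgen_def hcl_ops by (rule hcl_eqI) (auto simp: unital_0 heq_zero)
  fix j
  show "i + 1 < j \<Longrightarrow> hgen n i * hgen n j = hgen n j * hgen n i"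
    unfolding hgen_def hcl_ops(6)[OF hgen_unital hgen_unital]
    by (rule hcl_eqI) (auto simp: Hgen_unital unital_wcomp unital_0 Hgen_far wcomp_linear heq_zero)
next
  fix i assume i: "0 < i" "i + 1 < n"
  note u = hgen_unital unital_wcomp[OF hgen_unital hgen_unital] unital_wcomp[OF unital_wcomp[OF hgen_unital hgen_unital] hgen_unital]
    unital_wcomp[OF hgen_unital unital_wcomp[OF hgen_unital hgen_unital]]
  have "hgen n i * (hgen n (i + 1) * hgen n i) - hgen n i = hgen n (i + 1) * (hgen n i * hgen n (i + 1)) - hgen n (i + 1)"
    unfolding hgen_def hcl_ops(6)[OF u(1) u(1)] hcl_ops(6)[OF u(1) u(2)] hcl_ops(4)[OF u(4) u(1)]
    by (rule hcl_eqI) (use i Hgen_braid[OF i] in \<open>auto simp: Hgen_unital unital_wcomp unital_minus unital_0 wcomp_linear heq_zero\<close>)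
  thus "hgen n i * hgen n (i + 1) * hgen n i - hgen n i = hgen n (i + 1) * hgen n i * hgen n (i + 1) - hgen n (i + 1)"
    by (simp only: mult.assoc)
qed

subsection \<open>Representatives\<close>

text \<open>The transfer relation between linear combinations of webs with \<open>n\<close> strands
  and the ring: only the component in degree \<open>n\<close> is compared.\<close>

definition rep :: "nat \<Rightarrow> lweb \<Rightarrow> hring \<Rightarrow> bool" where
  "rep n x a \<longleftrightarrow> (\<exists>f c. a = hcl f c \<and> (\<forall>m. f m \<in> unital m) \<and> heq n (f n) x)"

lemma repI: "(\<And>m. f m \<in> unital m) \<Longrightarrow> heq n (f n) x \<Longrightarrow> rep n x (hcl f c)"
  unfolding rep_def by blast

text \<open>The way back from an equation in the ring to one between webs: both sides of the theorem
  will represent the same element.\<close>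

lemma rep_unique: "rep n x a \<Longrightarrow> rep n y a \<Longrightarrow> heq n x y"
proof -
  assume "rep n x a" "rep n y a"
  then obtain f c g d where *: "a = hcl f c" "\<forall>m. f m \<in> unital m" "heq n (f n) x" "a = hcl g d" "\<forall>m. g m \<in> unital m" "heq n (g n) y"
    unfolding rep_def by blast
  have "heq n (f n) (g n)" by (rule hcl_eqD[of f c g d]) (use * in auto)
  from heq_trans[OF heq_sym[OF *(3)] heq_trans[OF this *(6)]] show ?thesis .
qed

lemma rep_cong: "rep n x a \<Longrightarrow> heq n x y \<Longrightarrow> rep n y a"
  unfolding rep_def using heq_trans by blast

lemma rep_0: "rep n 0 0"
  unfolding rep_def hcl_ops using unital_0 heq_zero by blast

lemma rep_1: "rep n (idu n) 1"
  unfolding rep_def hcl_ops using unital_idu heq_refl[OF idu_Sp] by blast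

lemma rep_mult: "rep n x a \<Longrightarrow> rep n y b \<Longrightarrow> rep n (x \<odot> y) (a * b)"
  and rep_add: "rep n x a \<Longrightarrow> rep n y b \<Longrightarrow> rep n (x + y) (a + b)"
  and rep_minus: "rep n x a \<Longrightarrow> rep n y b \<Longrightarrow> rep n (x - y) (a - b)"
proof -
  assume "rep n x a" "rep n y b"
  then obtain f c g d where *: "a = hcl f c" "\<And>m. f m \<in> unital m" "heq n (f n) x" "b = hcl g d" "\<And>m. g m \<in> unital m" "heq n (g n) y"
    unfolding rep_def by blast
  show "rep n (x \<odot> y) (a * b)" unfolding *(1,4) hcl_ops(6)[OF *(2,5)]
    by (rule repI[OF unital_wcomp[OF *(2,5)] wcomp_cong[OF *(3,6)]])
  show "rep n (x + y) (a + b)" unfolding *(1,4) hcl_ops(3)[OF *(2,5)]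
    by (rule repI[OF unital_add[OF *(2,5)] heq_add[OF *(3,6)]])
  show "rep n (x - y) (a - b)" unfolding *(1,4) hcl_ops(4)[OF *(2,5)]
    by (rule repI[OF unital_minus[OF *(2,5)] heq_minus[OF *(3,6)]])
qed

lemma rep_smul: "rep n x a \<Longrightarrow> rep n (smul c x) (hscl c a)"
proof -
  assume "rep n x a"
  then obtain f d where *: "a = hcl f d" "\<And>m. f m \<in> unital m" "heq n (f n) x" unfolding rep_def by blast
  show ?thesis unfolding *(1) hcl_scl[OF *(2)]
    by (rule repI[OF unital_smul[OF *(2)] heq_smul[OF *(3)]])
qed

lemma rep_sum: "finite A \<Longrightarrow> (\<And>k. k \<in> A \<Longrightarrow> rep n (F k) (G k)) \<Longrightarrow> rep n (sum F A) (sum G A)"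
  by (induction A rule: finite_induct) (simp_all add: rep_0 rep_add)

lemma rep_gen: "0 < i \<Longrightarrow> i < n \<Longrightarrow> rep n (Hgen n i) (hgen n i)"
proof -
  assume i: "0 < i" "i < n"
  show ?thesis unfolding hgen_def
    by (rule repI[OF hgen_unital]) (use i in \<open>simp add: heq_refl unitalD(2)[OF Hgen_unital]\<close>)
qed

lemma rep_comp_list: "list_all2 (rep n) xs as \<Longrightarrow> rep n (comp_list n xs) (prod_list as)"
  unfolding comp_list_def by (induction rule: list_all2_induct) (simp_all add: rep_1 rep_mult)

definition pad :: "nat \<Rightarrow> nat \<Rightarrow> lweb \<Rightarrow> lweb" where "pad p r x = idu p \<otimes> (x \<otimes> idu r)"

lemma pad_linear: "pad p r (x + y) = pad p r x + pad p r y" "pad p r (x - y) = pad p r x - pad p r y" "pad p r (smul c x) = smul c (pad p r x)"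
  by (simp_all add: pad_def wtens_linear)

lemma pad_idu: "pad p r (idu m) = idu (p + (m + r))"
  by (simp add: pad_def idu_add)

lemma pad_mult:
  assumes "p + (m + r) = n" "x \<in> Sp m" "y \<in> Sp m" "rep n (pad p r x) a" "rep n (pad p r y) b"
  shows "rep n (pad p r (x \<odot> y)) (a * b)"
  using rep_cong[OF rep_mult[OF assms(4,5)]] pad_wcomp[OF assms(2,3), of p r] unfolding pad_def assms(1) by blast

lemma pad_Hgen: "0 < i \<Longrightarrow> i < m \<Longrightarrow> pad p r (Hgen m i) = Hgen (p + (m + r)) (p + i)"
  by (simp add: pad_def Hgen_right Hgen_left)

lemma pad_wtens_idu: "x \<in> SS m \<Longrightarrow> pad p r (x \<otimes> idu k) = pad p (k + r) x"
  unfolding pad_def by (simp add: wtens_assoc[OF _ idu_SS idu_SS] idu_add)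

lemma pad_idu_wtens: "x \<in> SS m \<Longrightarrow> pad p r (idu k \<otimes> x) = pad (p + k) r x"
  unfolding pad_def by (simp add: wtens_assoc[OF idu_SS _ idu_SS] wtens_assoc[OF idu_SS idu_SS SS_wtens[OF _ idu_SS], symmetric] idu_add)

lemma pad_0: "x \<in> SS m \<Longrightarrow> pad 0 r x = x \<otimes> idu r" "x \<in> SS m \<Longrightarrow> pad p 0 x = idu p \<otimes> x"
  unfolding pad_def by (simp_all add: idu_0_wtens idu_0_wtens[OF SS_wtens[OF _ idu_SS]])

lemma pad_comp_list:
  assumes n: "p + (m + r) = n" and l: "list_all2 (\<lambda>x a. x \<in> Sp m \<and> rep n (pad p r x) a) xs as"
  shows "comp_list m xs \<in> Sp m \<and> rep n (pad p r (comp_list m xs)) (prod_list as)"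
  using l
proof (induction rule: list_all2_induct)
  case Nil
  show ?case using rep_1[of n] by (simp add: comp_list_def pad_idu n idu_Sp)
next
  case (Cons x xs a as)
  have e: "comp_list m (x # xs) = x \<odot> comp_list m xs" by (simp add: comp_list_def)
  show ?case unfolding e prod_list.Cons
    using Cons pad_mult[OF n, of x "comp_list m xs" a "prod_list as"] wcomp_Sp[of x m] by blast
qed

lemma JW_unital: "JW m \<in> unital m"
proof (induction m rule: JW.induct)
  case (3 k)
  have J: "JW (Suc k) \<otimes> idu 1 \<in> unital (Suc (Suc k))" using unital_wtens[OF 3 unital_idu[of 1]] by simp
  have e: "idu k \<otimes> lw H_web \<in> unital (Suc (Suc k))" using unital_wtens[OF unital_idu[of k] H_unital] by simp
  show ?case unfolding JW.simps(3) Let_def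
    using unital_minus[OF J unital_smul[OF unital_wcomp[OF J unital_wcomp[OF e J]]]] by simp
qed (simp_all add: unital_idu)

definition XL :: lweb where "XL = smul (q6 2) (idu 2) - smul (q6 (- 1)) (lw H_web)"

lemma XL_unital: "XL \<in> unital 2"
  unfolding XL_def by (intro unital_minus unital_smul unital_idu H_unital)

text \<open>The crossing is resolved from the outset, because \<open>unital\<close> is spanned by
  straight webs without crossings.\<close>

fun twist_one' :: "nat \<Rightarrow> lweb" where
  "twist_one' 0 = idu 1"
| "twist_one' (Suc b) = (idu b \<otimes> XL) \<odot> (twist_one' b \<otimes> idu 1)"

fun half_twist' :: "nat \<Rightarrow> nat \<Rightarrow> lweb" where
  "half_twist' 0 b = idu b"
| "half_twist' (Suc a) b = (half_twist' a b \<otimes> idu 1) \<odot> (idu a \<otimes> twist_one' b)"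

lemma twist_one': "twist_one' b \<in> unital (b + 1)" "heq (b + 1) (twist_one b) (twist_one' b)"
proof (induction b)
  case 0
  show "twist_one' 0 \<in> unital (0 + 1)" "heq (0 + 1) (twist_one 0) (twist_one' 0)"
    using unital_idu[of 1] heq_refl[OF idu_Sp[of 1]] by (simp_all only: twist_one'.simps twist_one.simps add_0_left)
next
  case (Suc b)
  have n: "b + 2 = Suc b + 1" "b + 1 + 1 = Suc b + 1" by simp_all
  show "twist_one' (Suc b) \<in> unital (Suc b + 1)" unfolding twist_one'.simps
    using unital_wtens[OF unital_idu[of b] XL_unital] unital_wtens[OF Suc(1) unital_idu[of 1]] unfolding n by (rule unital_wcomp)
  show "heq (Suc b + 1) (twist_one (Suc b)) (twist_one' (Suc b))" unfolding twist_one'.simps twist_one.simps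
    using wtens_cong[OF heq_refl[OF idu_Sp[of b]] X_skein] wtens_cong[OF Suc(2) heq_refl[OF idu_Sp[of 1]]]
    unfolding n XL_def by (rule wcomp_cong)
qed

lemma half_twist': "half_twist' a b \<in> unital (a + b)" "heq (a + b) (half_twist a b) (half_twist' a b)"
proof (induction a)
  case 0
  show "half_twist' 0 b \<in> unital (0 + b)" "heq (0 + b) (half_twist 0 b) (half_twist' 0 b)"
    using unital_idu[of b] heq_refl[OF idu_Sp[of b]] by (simp_all only: half_twist'.simps half_twist.simps add_0_left)
next
  case (Suc a)
  have n: "a + b + 1 = Suc a + b" "a + (b + 1) = Suc a + b" by simp_all
  show "half_twist' (Suc a) b \<in> unital (Suc a + b)" unfolding half_twist'.simps
    using unital_wtens[OF Suc(1) unital_idu[of 1]] unital_wtens[OF unital_idu[of a] twist_one'(1)[of b]] unfolding n by (rule unital_wcomp)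
  show "heq (Suc a + b) (half_twist (Suc a) b) (half_twist' (Suc a) b)" unfolding half_twist'.simps half_twist.simps
    using wtens_cong[OF Suc(2) heq_refl[OF idu_Sp[of 1]]] wtens_cong[OF heq_refl[OF idu_Sp[of a]] twist_one'(2)[of b]]
    unfolding n by (rule wcomp_cong)
qed

context
  fixes t s :: nat
begin

interpretation hecke_pair hscl "hgen (t + s)" "t + s" t s
  by (intro hecke_pair.intro hecke_hgen) (simp add: hecke_pair_axioms_def)

lemma rep_pad_Hgen: "p + (m + r) = t + s \<Longrightarrow> 0 < i \<Longrightarrow> i < m \<Longrightarrow> rep (t + s) (pad p r (Hgen m i)) (hgen (t + s) (p + i))"
  using rep_gen[of "p + i" "t + s"] by (simp add: pad_Hgen)

lemma rep_pad_idu: "p + (m + r) = t + s \<Longrightarrow> rep (t + s) (pad p r (idu m)) 1"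
  by (simp add: pad_idu rep_1)

lemma rep_pad_H: "p + k + 2 + r = t + s \<Longrightarrow> rep (t + s) (pad p r (idu k \<otimes> lw H_web)) (hgen (t + s) (p + k + 1))"
  using rep_pad_Hgen[of "p + k" 2 r 1] by (simp add: pad_idu_wtens[OF H_SS] Hgen_H[unfolded One_nat_def])

text \<open>Padding by \<open>p\<close> strands corresponds to the offset \<open>p\<close> of
  \<open>jw\<close>; the clasps of the two blocks are the cases \<open>p = 0\<close> and
  \<open>p = t\<close>.\<close>

lemma rep_JW: "p + (m + r) = t + s \<Longrightarrow> rep (t + s) (pad p r (JW m)) (jw p m)"
proof (induction m arbitrary: r rule: JW.induct)
  case (3 k)
  define J where "J = JW (Suc k) \<otimes> idu 1"
  define e where "e = idu k \<otimes> lw H_web"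
  have n: "p + (Suc (Suc k) + r) = t + s" by (rule 3(2))
  have J: "J \<in> Sp (Suc (Suc k))" "e \<in> Sp (Suc (Suc k))"
    using wtens_Sp[OF unitalD(2)[OF JW_unital[of "Suc k"]] idu_Sp[of 1]] wtens_Sp[OF idu_Sp[of k] SS_Sp[OF H_SS]] by (simp_all add: J_def e_def)
  have rJ: "rep (t + s) (pad p r J) (jw p (Suc k))"
    unfolding J_def pad_wtens_idu[OF unitalD(1)[OF JW_unital]] using 3(1)[of "1 + r"] n by simp
  have re: "rep (t + s) (pad p r e) (hgen (t + s) (p + Suc k))"
    using rep_pad_H[of p k r] n unfolding e_def by simp
  have "rep (t + s) (pad p r (J \<odot> (e \<odot> J))) (jw p (Suc k) * (hgen (t + s) (p + Suc k) * jw p (Suc k)))"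
    by (intro pad_mult[OF n] J rJ re wcomp_Sp)
  hence "rep (t + s) (pad p r (J - smul (qint (Suc k) / qint (Suc (Suc k))) (J \<odot> (e \<odot> J)))) (jw p (Suc (Suc k)))"
    unfolding pad_linear jw.simps(3) by (intro rep_minus rep_smul rJ)
  moreover have "JW (Suc (Suc k)) = J - smul (qint (Suc k) / qint (Suc (Suc k))) (J \<odot> (e \<odot> J))"
    by (simp add: J_def e_def Let_def)
  ultimately show ?case by simp
qed (simp_all add: rep_pad_idu)

lemma rep_clasp_pair: "rep (t + s) (clasp_pair t s) P"
proof -
  have "rep (t + s) (JW t \<otimes> idu s) (jw 0 t)" using rep_JW[of 0 t s] by (simp add: pad_0(1)[OF unitalD(1)[OF JW_unital]])
  moreover have "rep (t + s) (idu t \<otimes> JW s) (jw t s)" using rep_JW[of t s 0] by (simp add: pad_0(2)[OF unitalD(1)[OF JW_unital]])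
  ultimately have "rep (t + s) ((JW t \<otimes> idu s) \<odot> (idu t \<otimes> JW s)) P" unfolding P_def by (rule rep_mult)
  thus ?thesis unfolding clasp_pair_def using rep_cong wtens_interchange(1)[OF JW_unital JW_unital] by blast
qed

lemma rep_XL: "p + k + 2 + r = t + s \<Longrightarrow> rep (t + s) (pad p r (idu k \<otimes> XL)) (sg (p + k + 1))"
proof -
  assume n: "p + k + 2 + r = t + s"
  have i: "rep (t + s) (pad p r (idu k \<otimes> idu 2)) 1" unfolding idu_add using n by (intro rep_pad_idu) simp
  show ?thesis unfolding XL_def wtens_linear pad_linear sg_def
    by (intro rep_minus rep_smul i rep_pad_H n)
qed

lemma rep_twist_one: "p + (b + 1 + r) = t + s \<Longrightarrow> rep (t + s) (pad p r (twist_one' b)) (tau p b)"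
proof (induction b arbitrary: r)
  case 0
  thus ?case using rep_pad_idu[of p 1 r] by simp
next
  case (Suc b)
  have n: "p + (Suc b + 1 + r) = t + s" by (rule Suc(2))
  have S: "idu b \<otimes> XL \<in> Sp (Suc b + 1)" "twist_one' b \<otimes> idu 1 \<in> Sp (Suc b + 1)"
    using wtens_Sp[OF idu_Sp[of b] unitalD(2)[OF XL_unital]] wtens_Sp[OF unitalD(2)[OF twist_one'(1)[of b]] idu_Sp[of 1]] by simp_all
  have 1: "rep (t + s) (pad p r (idu b \<otimes> XL)) (sg (p + b + 1))" using n by (intro rep_XL) simp
  have 2: "rep (t + s) (pad p r (twist_one' b \<otimes> idu 1)) (tau p b)"
    unfolding pad_wtens_idu[OF unitalD(1)[OF twist_one'(1)]] using Suc(1)[of "1 + r"] n by simp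
  show ?case unfolding twist_one'.simps tau.simps by (rule pad_mult[OF n S 1 2])
qed

lemma rep_half_twist: "a + b + r = t + s \<Longrightarrow> rep (t + s) (pad 0 r (half_twist' a b)) (ht a b)"
proof (induction a arbitrary: r)
  case 0
  thus ?case using rep_pad_idu[of 0 b r] by simp
next
  case (Suc a)
  have n: "0 + (Suc a + b + r) = t + s" using Suc(2) by simp
  have S: "half_twist' a b \<otimes> idu 1 \<in> Sp (Suc a + b)" "idu a \<otimes> twist_one' b \<in> Sp (Suc a + b)"
    using wtens_Sp[OF unitalD(2)[OF half_twist'(1)[of a b]] idu_Sp[of 1]] wtens_Sp[OF idu_Sp[of a] unitalD(2)[OF twist_one'(1)[of b]]] by simp_all
  have 1: "rep (t + s) (pad 0 r (half_twist' a b \<otimes> idu 1)) (ht a b)"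
    unfolding pad_wtens_idu[OF unitalD(1)[OF half_twist'(1)]] using Suc(1)[of "1 + r"] n by simp
  have 2: "rep (t + s) (pad 0 r (idu a \<otimes> twist_one' b)) (tau a b)"
    unfolding pad_idu_wtens[OF unitalD(1)[OF twist_one'(1)]] using rep_twist_one[of a b r] n by simp
  show ?case unfolding half_twist'.simps ht.simps by (rule pad_mult[OF n S 1 2])
qed

lemma rep_half_twist_0: "a + b = t + s \<Longrightarrow> rep (t + s) (half_twist a b) (ht a b)"
proof -
  assume n: "a + b = t + s"
  have "rep (t + s) (half_twist' a b) (ht a b)"
    using rep_half_twist[of a b 0] n idu_0_wtens[OF unitalD(1)[OF half_twist'(1)[of a b]]]
    by (simp add: pad_0(1)[OF unitalD(1)[OF half_twist'(1)]])
  thus ?thesis using rep_cong heq_sym[OF half_twist'(2)[of a b]] unfolding n by blast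
qed

lemma rep_full_twist: "rep (t + s) (full_twist t s) (ft t s)"
  unfolding full_twist_def ft_def by (intro rep_mult rep_half_twist_0) simp_all

lemma rep_stair:
  assumes l: "l \<le> t" "l \<le> s"
  shows "rep (t + s) (pad (t - l) (s - l) (stair l)) (g l)"
proof -
  have n: "t - l + (2 * l + (s - l)) = t + s" using l by simp
  have layer: "stair_layer l c \<in> Sp (2 * l) \<and> rep (t + s) (pad (t - l) (s - l) (stair_layer l c)) (C c)" if c: "0 < c" "c \<le> l" for c
    unfolding stair_layer_def C_def CC_def
  proof (rule pad_comp_list[OF n], unfold list_all2_map1 list_all2_map2, rule list.rel_refl_strong)
    fix j assume "j \<in> set [0..<c]"
    hence j: "j < c" by simp
    have i: "0 < l - c + 1 + 2 * j" "l - c + 1 + 2 * j < 2 * l" using j c by auto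
    \<comment> \<open>Padding by \<open>t - l\<close> strands moves the centre of the layer from
      strand \<open>l\<close> to strand \<open>t\<close>, the last one of the left block.\<close>
    have e: "t - l + (l - c + 1 + 2 * j) = t + 1 - c + 2 * j" using l c by simp
    show "Hgen (2 * l) (l - c + 1 + 2 * j) \<in> Sp (2 * l) \<and> rep (t + s) (pad (t - l) (s - l) (Hgen (2 * l) (l - c + 1 + 2 * j))) (hgen (t + s) (t + 1 - c + 2 * j))"
      using rep_pad_Hgen[OF n i] unitalD(2)[OF Hgen_unital[OF i]] unfolding e by blast
  qed
  have "comp_list (2 * l) (map (stair_layer l) ([1..<l + 1] @ rev [1..<l])) \<in> Sp (2 * l) \<and>
    rep (t + s) (pad (t - l) (s - l) (comp_list (2 * l) (map (stair_layer l) ([1..<l + 1] @ rev [1..<l])))) (g l)"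
    unfolding g_def
    by (rule pad_comp_list[OF n], unfold list_all2_map1 list_all2_map2, rule list.rel_refl_strong) (auto intro!: layer simp del: upt_Suc)
  thus ?thesis unfolding stair_def by blast
qed

lemma rep_clasped_stair: "l \<le> t \<Longrightarrow> l \<le> s \<Longrightarrow> rep (t + s) (clasped_stair t s l) (W l)"
  unfolding clasped_stair_def W_def mult.assoc pad_def[symmetric] by (intro rep_mult rep_clasp_pair rep_stair)

lemma clasped_twist_heq:
  assumes "d = min s t" "\<delta> = max s t - min s t"
  shows "heq (t + s) (clasp_pair t s \<odot> comp_list (t + s) (replicate m (full_twist t s)) \<odot> clasp_pair t s)
    (smul (q6 (- (2 * int m * int d * int (d + \<delta>)) - 6 * int m * int d))
       (\<Sum>k\<in>tuples d m. smul (twist_coeff d \<delta> m k) (clasped_stair t s (d - k ! m))))"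
proof (rule rep_unique)
  have "rep (t + s) (comp_list (t + s) (replicate m (full_twist t s))) (prod_list (replicate m (ft t s)))"
    by (rule rep_comp_list) (simp add: list_all2_conv_all_nth rep_full_twist)
  thus "rep (t + s) (clasp_pair t s \<odot> comp_list (t + s) (replicate m (full_twist t s)) \<odot> clasp_pair t s) (P * (ft t s ^ m * P))"
    unfolding prod_list_replicate by (intro rep_mult rep_clasp_pair)
  show "rep (t + s) (smul (q6 (- (2 * int m * int d * int (d + \<delta>)) - 6 * int m * int d))
       (\<Sum>k\<in>tuples d m. smul (twist_coeff d \<delta> m k) (clasped_stair t s (d - k ! m)))) (P * (ft t s ^ m * P))"
    unfolding clasped_twist[OF assms]
    by (intro rep_smul rep_sum finite_tuples rep_clasped_stair) (simp_all add: assms)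
qed

end

theorem theorem3p7:
  fixes s t m d \<delta> :: nat and P :: lweb
  assumes "s > 0" and "t > 0" and "m > 0"
    and "d = min s t"
    and "\<delta> = max s t - min s t"
    and "P = clasp_pair t s"
  shows "eq_in_Hom (ups (t + s)) (ups (t + s))
    (P \<odot> comp_list (t + s) (replicate m (full_twist t s)) \<odot> P)
    (smul (q6 (- (2 * int m * int d * int (d + \<delta>)) - 6 * int m * int d))
       (\<Sum>k\<in>tuples d m. smul (twist_coeff d \<delta> m k) (clasped_stair t s (d - k ! m))))"
  unfolding assms(6) by (rule clasped_twist_heq[OF assms(4,5)])

end
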